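(* Assume the following hypothesis (H): for every Э-function $\mathfrak f(z)$ and every $\theta\in(-\pi/2,\pi/2)$ which is not anti-Stokes for $\mathfrak f$ and such that $\mathfrak f_\theta(1)=0$, the series $\frac{\mathfrak f(z)}{z-1}$ is an Э-function. Let $\underline{\mathfrak f}(z)={}^t(\mathfrak f_1(z),\dots,\mathfrak f_n(z))$ be a vector of Э-functions satisfying $\underline{\mathfrak f}'(z)=A(z)\underline{\mathfrak f}(z)$ for some matrix $A(z)\in M_n(\overline{\mathbb Q}(z))$. Let $\xi\in\overline{\mathbb Q}^*$ and $\theta\in(\arg(\xi)-\pi/2,\arg(\xi)+\pi/2)$. Assume that $\xi$ is not a pole of any coefficient of $A$, and that $\theta$ is anti-Stokes for none of the $\mathfrak f_j$. Let $P\in\overline{\mathbb Q}[X_1,\dots,X_n]$ be a homogeneous polynomial such that $P(\mathfrak f_{1,\theta}(1/\xi),\dots,\mathfrak f_{n,\theta}(1/\xi))=0$. Then there exists $Q\in\overline{\mathbb Q}[Z,X_1,\dots,X_n]$, homogeneous in the $X_i$, such that: - $Q(z,\mathfrak f_1(z),\dots,\mathfrak f_n(z))=0$ identically; - $P(X_1,\dots,X_n)=Q(1/\xi,X_1,\dots,X_n)$. In particular, $$\mathrm{trdeg}_{\overline{\mathbb Q}}(\mathfrak f_{1,\theta}(1/\xi),\dots,\mathfrak f_{n,\theta}(1/\xi))=\mathrm{trdeg}_{\overline{\mathbb Q}(z)}(\mathfrak f_1(z),\dots,\mathfrak f_n(z)).$$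
   Context: Throughout, $\overline{\mathbb Q}$ is the field of algebraic numbers, seen as a subfield of $\mathbb C$. An $E$-function is a power series $F(x)=\sum_{n\ge0}\frac{a_n}{n!}x^n$ with all $a_n\in\overline{\mathbb Q}$ such that: - $F$ satisfies a nonzero linear differential equation over $\overline{\mathbb Q}(x)$; - there is $C>0$ with $|\sigma(a_n)|\le C^{n+1}$ for all $n$ and all $\sigma\in\mathrm{Gal}(\overline{\mathbb Q}/\mathbb Q)$; - the least common denominator of $a_0,\dots,a_n$ is at most $C^{n+1}$. A $G$-function is a power series $\sum a_nx^n\in\overline{\mathbb Q}[[x]]$ such that $\sum\frac{a_n}{n!}x^n$ is an $E$-function. In that case the (generally divergent) series $\mathfrak f(z)=\sum n!a_nz^n$ is an Э-function. For an Э-function $\mathfrak f$ and a direction $\theta$ which is not one of its finitely many (mod $2\pi$) anti-Stokes directions, $\mathfrak f_\theta(1/z)$ (also written $\mathfrak f_{j,\theta}$ for $\mathfrak f=\mathfrak f_j$) denotes the Ramis 1-sum (= Borel–Laplace sum) of $\mathfrak f(1/z)$ in the direction $\theta$. It is holomorphic on a large sector $\theta-\frac\pi2-\varepsilon<\arg z<\theta+\frac\pi2+\varepsilon$ and has asymptotic expansion $\mathfrak f(1/z)$ there. For example, if $g(x)=\sum a_nx^n$, $\theta=0$ is not anti-Stokes and $z>0$, then $\mathfrak f_0(1/z)=\int_0^\infty g(t/z)e^{-t}dt$.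
   Formalization: The assumption that ξ is not a pole of any coefficient of A is replaced by: 1/ξ is not a pole. As printed the claim fails under (H): n=1, f(z)=1−2z, A=−2/(1−2z), ξ=2, θ=0, P=X. *)

theory Defs
  imports
    "HOL-Analysis.Analysis"
    "HOL-Computational_Algebra.Computational_Algebra"
    "HOL-Library.Poly_Mapping"
    "HOL-Library.Extended_Nat"
begin

section \<open>Algebraic numbers and rational functions\<close>

definition Qbar :: "complex set" where
  "Qbar = {x. algebraic x}"

text \<open>
  Elements of the absolute Galois group, as functions on the complex numbers of which only the
  restriction to \<^const>\<open>Qbar\<close> matters. Ring automorphisms fix the rationals.
\<close>

definition Qbar_automorphism :: "(complex \<Rightarrow> complex) \<Rightarrow> bool" where
  "Qbar_automorphism \<sigma> \<longleftrightarrow>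
     bij_betw \<sigma> Qbar Qbar \<and>
     (\<forall>x\<in>Qbar. \<forall>y\<in>Qbar. \<sigma> (x + y) = \<sigma> x + \<sigma> y \<and> \<sigma> (x * y) = \<sigma> x * \<sigma> y)"

definition polys_over :: "'a::zero set \<Rightarrow> 'a poly set" where
  "polys_over K = {p. \<forall>i. coeff p i \<in> K}"

text \<open>
  Power series and rational functions in \<open>z\<close> all live in the field of formal Laurent series at
  \<open>z = 0\<close>, in which a rational function is identified with its expansion.
\<close>

abbreviation fls_of_poly :: "complex poly \<Rightarrow> complex fls" where
  "fls_of_poly p \<equiv> fps_to_fls (fps_of_poly p)"

definition Qbar_ratfuns :: "complex fls set" where
  "Qbar_ratfuns =
     {fls_of_poly p / fls_of_poly q | p q. p \<in> polys_over Qbar \<and> q \<in> polys_over Qbar \<and> q \<noteq> 0}"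

text \<open>
  Values such as \<open>f\<^sub>\<theta>(1/\<xi>)\<close> are taken at the point \<open>z = 1/\<xi>\<close>, so this is where a system
  \<open>f'(z) = A(z) f(z)\<close> has to be regular, and not at \<open>z = \<xi>\<close>. For instance \<open>f(z) = 1 - 2 z\<close>
  vanishes at \<open>z = 1/2\<close>, the only pole of \<open>A(z) = - 2 / (1 - 2 z)\<close>, and for \<open>\<xi> = 2\<close> the relation
  \<open>X = 0\<close> between its values is not the specialisation of a functional relation.
\<close>

definition ratfun_pole :: "complex fls \<Rightarrow> complex \<Rightarrow> bool" where
  "ratfun_pole r c \<longleftrightarrow> \<not> (\<exists>p q. poly q c \<noteq> 0 \<and> r = fls_of_poly p / fls_of_poly q)"


section \<open>E-functions, G-functions and the divergent series attached to them\<close>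

definition common_denom :: "(nat \<Rightarrow> complex) \<Rightarrow> nat \<Rightarrow> nat" where
  "common_denom a n = (LEAST d. d > 0 \<and> (\<forall>i\<le>n. algebraic_int (of_nat d * a i)))"

definition linear_ODE_over_Qbar_ratfuns :: "complex fps \<Rightarrow> bool" where
  "linear_ODE_over_Qbar_ratfuns F \<longleftrightarrow>
     (\<exists>m c. (\<forall>i\<le>m. c i \<in> Qbar_ratfuns) \<and> (\<exists>i\<le>m. c i \<noteq> 0) \<and>
            (\<Sum>i\<le>m. c i * fps_to_fls ((fps_deriv ^^ i) F)) = 0)"

definition E_function :: "complex fps \<Rightarrow> bool" where
  "E_function F \<longleftrightarrow>
     (let a = (\<lambda>n. fact n * fps_nth F n) in
        (\<forall>n. a n \<in> Qbar) \<and>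
        linear_ODE_over_Qbar_ratfuns F \<and>
        (\<exists>C::real. C > 0 \<and>
           (\<forall>n \<sigma>. Qbar_automorphism \<sigma> \<longrightarrow> cmod (\<sigma> (a n)) \<le> C ^ (n + 1)) \<and>
           (\<forall>n. real (common_denom a n) \<le> C ^ (n + 1))))"

definition G_function :: "complex fps \<Rightarrow> bool" where
  "G_function g \<longleftrightarrow> E_function (Abs_fps (\<lambda>n. fps_nth g n / fact n))"

text \<open>\<open>Eh\<close> stands for the reversed letter E of the Cyrillic alphabet.\<close>

definition Eh_function :: "complex fps \<Rightarrow> bool" where
  "Eh_function f \<longleftrightarrow> G_function (Abs_fps (\<lambda>n. fps_nth f n / fact n))"


section \<open>Ramis 1-summation\<close>

definition large_sector :: "real \<Rightarrow> real \<Rightarrow> complex set" where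
  "large_sector \<theta> \<epsilon> = {z. z \<noteq> 0 \<and> \<bar>Arg (z * cis (- \<theta>))\<bar> < pi / 2 + \<epsilon>}"

text \<open>
  \<open>F\<close> is a 1-sum of \<open>f(1/z)\<close> in the direction \<open>\<theta>\<close>: the function \<open>z \<mapsto> F(1/z)\<close> is holomorphic on a
  sector bisected by \<open>\<theta>\<close> of opening greater than \<open>pi\<close> and is asymptotic there to \<open>f(1/z)\<close>, of
  Gevrey order 1, as \<open>z\<close> tends to infinity. By Watson's lemma the values \<open>F(1/z)\<close> for \<open>z\<close> in
  the half-plane bisected by \<open>\<theta>\<close> do not depend on the choice of \<open>F\<close>, so that \<open>SOME\<close> is harmless
  below. If \<open>f\<close> has coefficients \<open>n! a\<^sub>n\<close> and \<open>g\<close> is the analytic continuation of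
  \<open>\<Sum> a\<^sub>n x\<^sup>n\<close> along the ray of argument \<open>- \<theta>\<close>, then \<open>F(1/z)\<close> is the Laplace integral of
  \<open>z g(u) exp(- z u)\<close> along that ray; the integral of \<open>g(t/z) exp(- t)\<close> over \<open>t > 0\<close> is the
  case \<open>arg z = \<theta>\<close>.
\<close>

definition is_Ramis_sum :: "complex fps \<Rightarrow> real \<Rightarrow> (complex \<Rightarrow> complex) \<Rightarrow> bool" where
  "is_Ramis_sum f \<theta> F \<longleftrightarrow>
     (\<exists>\<epsilon>>0. (\<lambda>z. F (1 / z)) holomorphic_on large_sector \<theta> \<epsilon> \<and>
        (\<exists>R>0. \<exists>C>0. \<exists>B>0. \<forall>z\<in>large_sector \<theta> \<epsilon>. cmod z > R \<longrightarrow>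
           (\<forall>N. cmod (F (1 / z) - (\<Sum>k<N. fps_nth f k / z ^ k))
                  \<le> C * B ^ N * fact N / cmod z ^ N)))"

text \<open>The anti-Stokes (or singular) directions are those in which there is no 1-sum.\<close>

definition anti_Stokes :: "complex fps \<Rightarrow> real \<Rightarrow> bool" where
  "anti_Stokes f \<theta> \<longleftrightarrow> \<not> (\<exists>F. is_Ramis_sum f \<theta> F)"

definition Ramis_sum :: "complex fps \<Rightarrow> real \<Rightarrow> complex \<Rightarrow> complex" where
  "Ramis_sum f \<theta> = (SOME F. is_Ramis_sum f \<theta> F)"


section \<open>Polynomials in several variables\<close>

text \<open>
  A polynomial with variables indexed by \<open>'v\<close> is a finitely supported family of coefficients
  indexed by monomials, and a monomial is a finitely supported family of exponents.
\<close>

type_synonym ('v, 'a) mpoly = "('v \<Rightarrow>\<^sub>0 nat) \<Rightarrow>\<^sub>0 'a"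

definition mpolys :: "'a::zero set \<Rightarrow> 'v set \<Rightarrow> ('v, 'a) mpoly set" where
  "mpolys K V =
     {P. (\<forall>m. Poly_Mapping.lookup P m \<in> K) \<and>
         (\<forall>m\<in>Poly_Mapping.keys P. Poly_Mapping.keys m \<subseteq> V)}"

definition homogeneous :: "('v, 'a::zero) mpoly \<Rightarrow> bool" where
  "homogeneous P \<longleftrightarrow>
     (\<exists>d. \<forall>m\<in>Poly_Mapping.keys P. (\<Sum>v\<in>Poly_Mapping.keys m. Poly_Mapping.lookup m v) = d)"

definition mpoly_eval ::
  "('a::zero \<Rightarrow> 'b::comm_semiring_1) \<Rightarrow> ('v \<Rightarrow> 'b) \<Rightarrow> ('v, 'a) mpoly \<Rightarrow> 'b" where
  "mpoly_eval \<iota> x P =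
     (\<Sum>m\<in>Poly_Mapping.keys P. \<iota> (Poly_Mapping.lookup P m) *
        (\<Prod>v\<in>Poly_Mapping.keys m. x v ^ Poly_Mapping.lookup m v))"


section \<open>Transcendence degree\<close>

text \<open>
  \<open>trdeg K V\<close> is the transcendence degree over \<open>K\<close> of the field generated by \<open>K\<close> and \<open>V\<close>.
  In \<open>alg_indep K S\<close> the elements of \<open>S\<close> themselves serve as names of the
  variables.
\<close>

definition alg_indep :: "'a::field set \<Rightarrow> 'a set \<Rightarrow> bool" where
  "alg_indep K S \<longleftrightarrow> (\<forall>P\<in>mpolys K S. mpoly_eval id id P = 0 \<longrightarrow> P = 0)"

definition subfield_of_type :: "'a::field set \<Rightarrow> bool" where
  "subfield_of_type F \<longleftrightarrow>
     0 \<in> F \<and> 1 \<in> F \<and>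
     (\<forall>x\<in>F. \<forall>y\<in>F. x - y \<in> F \<and> x * y \<in> F) \<and> (\<forall>x\<in>F. inverse x \<in> F)"

definition adjoin :: "'a::field set \<Rightarrow> 'a set \<Rightarrow> 'a set" where
  "adjoin K V = \<Inter> {F. subfield_of_type F \<and> K \<subseteq> F \<and> V \<subseteq> F}"

definition trdeg :: "'a::field set \<Rightarrow> 'a set \<Rightarrow> enat" where
  "trdeg K V =
     (SUP S \<in> {S. finite S \<and> S \<subseteq> adjoin K V \<and> alg_indep K S}. enat (card S))"

end

theory Submission
  imports Defs "Jordan_Normal_Form.Char_Poly" "HOL-Complex_Analysis.Complex_Analysis"
begin

text \<open>
  The substitution \<open>z \<mapsto> z/\<xi>\<close> moves the point to 1. A relation of degree \<open>d\<close> between the values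
  says that \<open>h = \<Sum> \<lambda>\<^sub>m f\<^sup>m\<close> has 1-sum 0 at 1, where the monomials \<open>f\<^sup>m\<close> of degree \<open>d\<close> again satisfy a
  linear system regular at 1. By the hypothesis, \<open>h/(z - 1)\<close> then has the arithmetic of the series
  considered, so that \<open>h\<close> vanishes at 1 also \<open>p\<close>-adically for all \<open>p\<close>. Siegel's lemma provides a row
  \<open>b\<close> of polynomials whose derivatives along the system are, at 1 and up to order \<open>k\<close>, proportional to
  \<open>\<lambda>\<close>. The \<open>k\<close>-fold \<open>p\<close>-adic zero makes the lowest coefficient of \<open>b \<cdot> f\<close> divisible by \<open>(n + k)!\<close> instead
  of \<open>n!\<close>, which is more than its conjugates allow; hence \<open>b \<cdot> f = 0\<close>. This gives a relation between the
  functions, and induction on their number yields one which specialises to \<open>\<lambda>\<close> at 1.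

  For the transcendence degrees, linear relations between the monomials of degree at most \<open>d\<close> specialise
  to the values and lift back to the functions. So both families of monomials have the same rank, and
  its growth in \<open>d\<close> determines the transcendence degree.
\<close>

section \<open>Algebraic integers and automorphisms\<close>

text \<open>Analysis enters only through sums, products and uniqueness of 1-sums. Once the
  hypothesis has been applied, all that is kept of the vanishing at 1 is a series y with (X - 1) y =
  h whose coefficients y_n, like those of the functions, are n! times numbers with geometrically
  bounded conjugates and denominators. The partial sum of h at 1 up to degree n is - y_n, so it is
  divisible by n! up to a geometric factor; this finite statement is what a p-adic zero means here.
  The numerical obstacle: with factorial weights, Siegel's lemma has solutions of factorial size.
  For m functions, q k coefficients per component and k (m - 1) conditions, the size is about k^((q
  + 1) (m - 1) k / P) with P = m q - (m - 1). It stays below k! when (q + 1) (m - 1) < P, that is q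
  > 2 m - 2. The choice q = 2 m gives P = 2 m^2 - m + 1 and (q + 1) (m - 1) = P - 2, and the margin
  k^(2 k / P) absorbs every geometric factor. The other obstacle is that each reduction must stay
  regular at 1; therefore relations and submodules are divided by powers of z - 1 before they are
  used.\<close>

lemma algebraic_int_of_finite_module:
  fixes x :: complex and e :: "nat \<Rightarrow> complex" and A :: "nat \<Rightarrow> nat \<Rightarrow> int"
  assumes nz: "i0 < n" "e i0 \<noteq> 0"
    and eq: "\<And>i. i < n \<Longrightarrow> x * e i = (\<Sum>j<n. of_int (A i j) * e j)"
  shows "algebraic_int x"
proof -
  define M where "M = mat n n (\<lambda>(i,j). A i j)"
  define Mc where "Mc = (map_mat of_int M :: complex mat)"
  define v where "v = vec n e"
  have M: "M \<in> carrier_mat n n" by (simp add: M_def)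
  hence Mc: "Mc \<in> carrier_mat n n" by (simp add: Mc_def)
  have v: "v \<in> carrier_vec n" by (simp add: v_def)
  have "v \<noteq> 0\<^sub>v n"
  proof
    assume "v = 0\<^sub>v n"
    hence "vec_index v i0 = 0" using nz by simp
    thus False using nz by (simp add: v_def)
  qed
  moreover have "Mc *\<^sub>v v = x \<cdot>\<^sub>v v"
  proof (rule eq_vecI)
    show "dim_vec (Mc *\<^sub>v v) = dim_vec (x \<cdot>\<^sub>v v)" using Mc v by auto
    fix i assume "i < dim_vec (x \<cdot>\<^sub>v v)"
    hence i: "i < n" using v by simp
    have "vec_index (Mc *\<^sub>v v) i = (\<Sum>j<n. of_int (A i j) * e j)"
      using i M by (simp add: Mc_def scalar_prod_def v_def M_def atLeast0LessThan)
    thus "vec_index (Mc *\<^sub>v v) i = vec_index (x \<cdot>\<^sub>v v) i" using i eq[OF i] by (simp add: v_def)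
  qed
  \<comment> \<open>The number x is an eigenvalue of an integer matrix, hence a root of its
    characteristic polynomial, which is monic with integer coefficients.\<close>
  ultimately have "eigenvector Mc v x" using Mc v by (auto simp: eigenvector_def)
  hence "eigenvalue Mc x" by (auto simp: eigenvalue_def)
  hence "poly (char_poly Mc) x = 0" using eigenvalue_root_char_poly[OF Mc] by blast
  moreover have "char_poly Mc = map_poly of_int (char_poly M)"
    unfolding Mc_def using of_int_hom.char_poly_hom[OF M] by simp
  moreover have "lead_coeff (char_poly M) = 1" using degree_monic_char_poly[OF M] by simp
  ultimately show ?thesis unfolding algebraic_int_altdef_ipoly by auto
qed

lemma algebraic_int_of_finite_module':
  fixes x :: complex and e :: "'i \<Rightarrow> complex" and A :: "'i \<Rightarrow> 'i \<Rightarrow> int"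
  assumes fin: "finite I" and nz: "i0 \<in> I" "e i0 \<noteq> 0"
    and eq: "\<And>i. i \<in> I \<Longrightarrow> x * e i = (\<Sum>j\<in>I. of_int (A i j) * e j)"
  shows "algebraic_int x"
proof -
  obtain h where h: "bij_betw h {0..<card I} I" using ex_bij_betw_nat_finite[OF fin] by blast
  from h nz obtain n0 where n0: "n0 < card I" "h n0 = i0"
    unfolding bij_betw_def by (metis atLeastLessThan_iff imageE)
  show ?thesis
  proof (rule algebraic_int_of_finite_module[of n0 "card I" "e \<circ> h" x "\<lambda>i j. A (h i) (h j)"])
    fix i assume "i < card I"
    hence "h i \<in> I" using h by (auto simp: bij_betw_def)
    from eq[OF this] show "x * (e \<circ> h) i = (\<Sum>j<card I. of_int (A (h i) (h j)) * (e \<circ> h) j)"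
      using sum.reindex_bij_betw[OF h, of "\<lambda>j. of_int (A (h i) j) * e j"]
      by (simp add: atLeast0LessThan)
  qed (use n0 nz in auto)
qed

lemma algebraic_int_reduce:
  fixes x :: complex
  assumes "algebraic_int x"
  obtains n :: nat and c where "n > 0" "x ^ n = (\<Sum>i<n. of_int (c i) * x ^ i)"
proof -
  from assms obtain p :: "int poly" where p: "poly (map_poly of_int p) x = 0" "lead_coeff p = 1"
    unfolding algebraic_int_altdef_ipoly by auto
  have "degree p \<noteq> 0"
  proof
    assume d: "degree p = 0"
    then obtain a where "p = [:a:]" by (rule degree_eq_zeroE)
    hence "p = 1" using p(2) by (simp add: one_pCons)
    thus False using p(1) by simp
  qed
  moreover have "(\<Sum>i\<le>degree p. of_int (coeff p i) * x ^ i) = 0"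
    using p(1) by (simp add: poly_altdef degree_map_poly coeff_map_poly)
  hence "x ^ degree p = (\<Sum>i<degree p. of_int (- coeff p i) * x ^ i)"
    using p(2) by (simp add: lessThan_Suc_atMost[symmetric] sum_negf eq_neg_iff_add_eq_0 add.commute)
  ultimately show ?thesis using that[of "degree p" "\<lambda>i. - coeff p i"] by blast
qed

text \<open>The products x^i y^j with i < m and j < n generate a module stable under x and y. The
  matrices \<open>\<alpha>\<close> and \<open>\<beta>\<close> are the companion matrices of the two
  equations; x + y and x y act by integer matrices built from them.\<close>

lemma algebraic_int_add_mult:
  fixes x y :: complex
  assumes "algebraic_int x" "algebraic_int y"
  shows "algebraic_int (x + y)" "algebraic_int (x * y)"
proof -
  obtain m c where m: "m > 0" "x ^ m = (\<Sum>i<m. of_int (c i) * x ^ i)"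
    using algebraic_int_reduce[OF assms(1)] by metis
  obtain n d where n: "n > 0" "y ^ n = (\<Sum>i<n. of_int (d i) * y ^ i)"
    using algebraic_int_reduce[OF assms(2)] by metis
  define I where "I = {..<m} \<times> {..<n}"
  define e where "e = (\<lambda>(i,j). x ^ i * y ^ j)"
  define \<alpha> :: "nat \<Rightarrow> nat \<Rightarrow> int" where "\<alpha> i i' = (if Suc i < m then (if i' = Suc i then 1 else 0) else c i')" for i i'
  define \<beta> :: "nat \<Rightarrow> nat \<Rightarrow> int" where "\<beta> i i' = (if Suc i < n then (if i' = Suc i then 1 else 0) else d i')" for i i'
  have X: "x * x ^ i = (\<Sum>i'<m. of_int (\<alpha> i i') * x ^ i')" if "i < m" for i
  proof (cases "Suc i < m")
    case True
    have "(\<Sum>i'<m. of_int (\<alpha> i i') * x ^ i') = (\<Sum>i'<m. if i' = Suc i then x ^ i' else 0)"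
      by (rule sum.cong) (simp_all add: \<alpha>_def True)
    also have "\<dots> = x ^ Suc i" using True by (simp add: sum.delta)
    finally show ?thesis by simp
  next
    case False
    hence "m = Suc i" using that by simp
    thus ?thesis using m(2) by (simp add: \<alpha>_def)
  qed
  have Y: "y * y ^ i = (\<Sum>i'<n. of_int (\<beta> i i') * y ^ i')" if "i < n" for i
  proof (cases "Suc i < n")
    case True
    have "(\<Sum>i'<n. of_int (\<beta> i i') * y ^ i') = (\<Sum>i'<n. if i' = Suc i then y ^ i' else 0)"
      by (rule sum.cong) (simp_all add: \<beta>_def True)
    also have "\<dots> = y ^ Suc i" using True by (simp add: sum.delta)
    finally show ?thesis by simp
  next
    case False
    hence "n = Suc i" using that by simp
    thus ?thesis using n(2) by (simp add: \<beta>_def)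
  qed
  define AX :: "nat \<times> nat \<Rightarrow> nat \<times> nat \<Rightarrow> int" where "AX = (\<lambda>(i,j) (i',j'). if j' = j then \<alpha> i i' else 0)"
  define AY :: "nat \<times> nat \<Rightarrow> nat \<times> nat \<Rightarrow> int" where "AY = (\<lambda>(i,j) (i',j'). if i' = i then \<beta> j j' else 0)"
  define AP :: "nat \<times> nat \<Rightarrow> nat \<times> nat \<Rightarrow> int" where "AP = (\<lambda>(i,j) (i',j'). \<alpha> i i' * \<beta> j j')"
  have EX: "x * e a = (\<Sum>b\<in>I. of_int (AX a b) * e b)" if "a \<in> I" for a
  proof -
    obtain i j where a: "a = (i,j)" "i < m" "j < n" using \<open>a \<in> I\<close> by (cases a) (auto simp: I_def)
    have "(\<Sum>b\<in>I. of_int (AX a b) * e b) = (\<Sum>i'<m. \<Sum>j'<n. if j' = j then of_int (\<alpha> i i') * (x ^ i' * y ^ j') else 0)"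
      unfolding I_def sum.cartesian_product a(1) by (intro sum.cong) (auto simp: AX_def e_def)
    also have "\<dots> = (\<Sum>i'<m. of_int (\<alpha> i i') * x ^ i') * y ^ j"
      using a by (simp add: sum.delta sum_distrib_right mult.assoc)
    finally show ?thesis using X[OF a(2)] a by (simp add: e_def mult.assoc[symmetric])
  qed
  have EY: "y * e a = (\<Sum>b\<in>I. of_int (AY a b) * e b)" if "a \<in> I" for a
  proof -
    obtain i j where a: "a = (i,j)" "i < m" "j < n" using \<open>a \<in> I\<close> by (cases a) (auto simp: I_def)
    have "(\<Sum>b\<in>I. of_int (AY a b) * e b) = (\<Sum>i'<m. \<Sum>j'<n. if i' = i then of_int (\<beta> j j') * (x ^ i' * y ^ j') else 0)"
      unfolding I_def sum.cartesian_product a(1) by (intro sum.cong) (auto simp: AY_def e_def)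
    also have "\<dots> = (\<Sum>i'<m. if i' = i then (\<Sum>j'<n. of_int (\<beta> j j') * (x ^ i' * y ^ j')) else 0)"
      by (intro sum.cong) auto
    also have "\<dots> = (\<Sum>j'<n. of_int (\<beta> j j') * y ^ j') * x ^ i"
      using a by (simp add: sum.delta sum_distrib_left mult_ac)
    finally show ?thesis using Y[OF a(3)] a by (simp add: e_def algebra_simps)
  qed
  have EP: "(x * y) * e a = (\<Sum>b\<in>I. of_int (AP a b) * e b)" if "a \<in> I" for a
  proof -
    obtain i j where a: "a = (i,j)" "i < m" "j < n" using \<open>a \<in> I\<close> by (cases a) (auto simp: I_def)
    have "(\<Sum>b\<in>I. of_int (AP a b) * e b) = (\<Sum>i'<m. \<Sum>j'<n. (of_int (\<alpha> i i') * x ^ i') * (of_int (\<beta> j j') * y ^ j'))"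
      unfolding I_def sum.cartesian_product a(1) by (intro sum.cong) (auto simp: AP_def e_def)
    also have "\<dots> = (x * x ^ i) * (y * y ^ j)"
      unfolding X[OF a(2)] Y[OF a(3)] by (simp add: sum_product)
    finally show ?thesis using a by (simp add: e_def algebra_simps)
  qed
  have nz: "(0,0) \<in> I" "e (0,0) \<noteq> 0" using m n by (auto simp: I_def e_def)
  have fin: "finite I" by (simp add: I_def)
  have "(x + y) * e a = (\<Sum>b\<in>I. of_int (AX a b + AY a b) * e b)" if "a \<in> I" for a
    using EX[OF that] EY[OF that] by (simp add: sum.distrib algebra_simps)
  from algebraic_int_of_finite_module'[OF fin nz this] show "algebraic_int (x + y)" .
  from algebraic_int_of_finite_module'[OF fin nz EP] show "algebraic_int (x * y)" .
qed

lemma algebraic_int_power: "algebraic_int (x::complex) \<Longrightarrow> algebraic_int (x ^ n)"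
  by (induction n) (auto intro: algebraic_int_add_mult)

lemma algebraic_int_sum:
  "(\<And>i. i \<in> A \<Longrightarrow> algebraic_int (f i :: complex)) \<Longrightarrow> algebraic_int (\<Sum>i\<in>A. f i)"
  by (induction A rule: infinite_finite_induct) (auto intro: algebraic_int_add_mult)

lemma algebraic_int_diff:
  "algebraic_int x \<Longrightarrow> algebraic_int y \<Longrightarrow> algebraic_int (x - y :: complex)"
  using algebraic_int_add_mult(1)[of x "- y"] by auto

lemma algebraic_int_of_nat: "algebraic_int (of_nat n :: complex)"
  by (metis Ints_of_nat int_imp_algebraic_int)

lemma algebraic_int_of_int: "algebraic_int (of_int n :: complex)"
  by (metis Ints_of_int int_imp_algebraic_int)

text \<open>With leading coefficient a and degree n, the equation of x multiplied by a^(n - 1)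
  becomes a monic equation for a x with the integer coefficients \<open>c i\<close>; d is the
  absolute value of a.\<close>

lemma algebraic_obtain_int_multiple:
  assumes "algebraic (x::complex)"
  obtains d :: nat where "d > 0" "algebraic_int (of_nat d * x)"
proof -
  from assms obtain p :: "int poly" where p: "p \<noteq> 0" "poly (map_poly of_int p) x = 0"
    by (rule algebraicE')
  define a where "a = lead_coeff p"
  have a: "a \<noteq> 0" using p by (simp add: a_def)
  define n where "n = degree p"
  have sum0: "(\<Sum>i\<le>n. of_int (coeff p i) * x ^ i) = 0"
    using p(2) by (simp add: poly_altdef degree_map_poly coeff_map_poly n_def)
  have "n \<noteq> 0"
  proof
    assume "n = 0"
    thus False using sum0 a by (simp add: a_def n_def)
  qed
  define y where "y = of_int a * x"
  define c :: "nat \<Rightarrow> int" where "c i = - coeff p i * a ^ (n - 1 - i)" for i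
  have yn: "y ^ n = (\<Sum>i<n. of_int (c i) * y ^ i)"
  proof -
    have "(\<Sum>i<n. of_int (coeff p i) * x ^ i) + of_int a * x ^ n = 0"
      using sum0 by (simp add: lessThan_Suc_atMost[symmetric] a_def n_def)
    hence e: "of_int a * x ^ n = - (\<Sum>i<n. of_int (coeff p i) * x ^ i)"
      by (simp add: eq_neg_iff_add_eq_0 add.commute)
    have "y ^ n = of_int (a ^ (n - 1)) * (of_int a * x ^ n)"
      using \<open>n \<noteq> 0\<close> by (simp add: y_def power_mult_distrib mult.assoc[symmetric] power_Suc2[symmetric] del: power_Suc)
    also have "\<dots> = (\<Sum>i<n. - of_int (coeff p i) * of_int (a ^ (n - 1)) * x ^ i)"
      unfolding e by (simp add: sum_distrib_left sum_negf algebra_simps)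
    also have "\<dots> = (\<Sum>i<n. of_int (c i) * y ^ i)"
    proof (rule sum.cong)
      fix i assume "i \<in> {..<n}"
      hence "a ^ (n - 1) = a ^ (n - 1 - i) * a ^ i" by (simp add: power_add[symmetric])
      thus "- of_int (coeff p i) * of_int (a ^ (n - 1)) * x ^ i = of_int (c i) * y ^ i"
        by (simp add: c_def y_def power_mult_distrib)
    qed simp
    finally show ?thesis .
  qed
  have "algebraic_int y"
  proof (rule algebraic_int_of_finite_module[of 0 n "\<lambda>i. y ^ i" y "\<lambda>i j. if Suc i < n then (if j = Suc i then 1 else 0) else c j"])
    fix i assume i: "i < n"
    show "y * y ^ i = (\<Sum>j<n. of_int (if Suc i < n then if j = Suc i then 1 else 0 else c j) * y ^ j)"
    proof (cases "Suc i < n")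
      case True
      have "(\<Sum>j<n. of_int (if Suc i < n then if j = Suc i then 1 else 0 else c j) * y ^ j) =
         (\<Sum>j<n. if j = Suc i then y ^ j else 0)"
        by (rule sum.cong) (simp_all add: True)
      also have "\<dots> = y ^ Suc i" using True by (simp add: sum.delta)
      finally show ?thesis by simp
    next
      case False
      hence "n = Suc i" using i by simp
      thus ?thesis using yn by simp
    qed
  qed (use \<open>n \<noteq> 0\<close> in auto)
  moreover have "of_nat (nat \<bar>a\<bar>) * x = y \<or> of_nat (nat \<bar>a\<bar>) * x = - y"
    by (cases "a \<ge> 0") (auto simp: y_def abs_if)
  ultimately have "algebraic_int (of_nat (nat \<bar>a\<bar>) * x)" by auto
  thus ?thesis using that[of "nat \<bar>a\<bar>"] a by simp
qed

lemma algebraic_of_int_multiple: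
  assumes "algebraic_int (of_nat d * x :: complex)" "d > 0"
  shows "algebraic x"
proof -
  from assms(1) obtain p :: "complex poly" where p: "lead_coeff p = 1" "\<forall>i. coeff p i \<in> \<int>" "poly p (of_nat d * x) = 0"
    by (auto elim: algebraic_int.cases)
  define q where "q = pcompose p [:0, of_nat d:]"
  show ?thesis
  proof (rule algebraicI')
    show "coeff q i \<in> \<rat>" for i
    proof -
      have "\<forall>i. coeff (pcompose p [:0, of_nat d:]) i \<in> \<rat>" using p(2)
      proof (induction p)
        case 0 thus ?case by simp
      next
        case (pCons a p)
        have "\<forall>i. coeff p i \<in> \<int>"
        proof
          fix i show "coeff p i \<in> \<int>" using pCons.prems[rule_format, of "Suc i"] by simp
        qed
        with pCons.IH have IH: "\<forall>i. coeff (pcompose p [:0, of_nat d:]) i \<in> \<rat>" by blast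
        have a: "a \<in> \<rat>" using pCons.prems[rule_format, of 0] Ints_subset_Rats by auto
        show ?case
        proof
          fix i show "coeff (pCons a p \<circ>\<^sub>p [:0, of_nat d:]) i \<in> \<rat>"
            using IH a by (cases i) (auto simp: pcompose_pCons)
        qed
      qed
      thus ?thesis by (simp add: q_def)
    qed
    show "q \<noteq> 0" using p(1) assms(2) by (auto simp: q_def pcompose_eq_0_iff)
    show "poly q x = 0" using p(3) by (simp add: q_def poly_pcompose mult.commute)
  qed
qed

section \<open>The field of algebraic numbers\<close>

lemma Qbar_iff: "x \<in> Qbar \<longleftrightarrow> (\<exists>d::nat. d > 0 \<and> algebraic_int (of_nat d * x))"
  unfolding Qbar_def mem_Collect_eq
  by (meson algebraic_obtain_int_multiple algebraic_of_int_multiple)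

lemma algebraic_int_imp_Qbar: "algebraic_int x \<Longrightarrow> x \<in> Qbar"
  unfolding Qbar_def by auto

lemma Qbar_add [intro]:
  assumes "x \<in> Qbar" "y \<in> Qbar" shows "x + y \<in> Qbar"
proof -
  from assms obtain d e :: nat where "d > 0" "e > 0" and de: "algebraic_int (of_nat d * x)" "algebraic_int (of_nat e * y)"
    by (auto simp: Qbar_iff)
  have "algebraic_int (of_nat e * (of_nat d * x) + of_nat d * (of_nat e * y))"
    by (intro algebraic_int_add_mult(1) algebraic_int_add_mult(2)[OF algebraic_int_of_nat] de)
  hence "algebraic_int (of_nat (d * e) * (x + y))" by (simp add: algebra_simps)
  thus ?thesis using \<open>d > 0\<close> \<open>e > 0\<close> unfolding Qbar_iff by (meson nat_0_less_mult_iff)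
qed

lemma Qbar_mult [intro]:
  assumes "x \<in> Qbar" "y \<in> Qbar" shows "x * y \<in> Qbar"
proof -
  from assms obtain d e :: nat where "d > 0" "e > 0" and de: "algebraic_int (of_nat d * x)" "algebraic_int (of_nat e * y)"
    by (auto simp: Qbar_iff)
  have "algebraic_int ((of_nat d * x) * (of_nat e * y))"
    by (rule algebraic_int_add_mult(2)[OF de])
  hence "algebraic_int (of_nat (d * e) * (x * y))" by (simp add: algebra_simps)
  thus ?thesis using \<open>d > 0\<close> \<open>e > 0\<close> unfolding Qbar_iff by (meson nat_0_less_mult_iff)
qed

lemma Qbar_0 [simp, intro]: "0 \<in> Qbar" and Qbar_1 [simp, intro]: "1 \<in> Qbar"
  by (auto intro!: algebraic_int_imp_Qbar)

lemma Qbar_of_nat [simp, intro]: "of_nat n \<in> Qbar"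
  by (intro algebraic_int_imp_Qbar algebraic_int_of_nat)

lemma Qbar_of_int [simp, intro]: "of_int n \<in> Qbar"
  by (intro algebraic_int_imp_Qbar algebraic_int_of_int)

lemma Qbar_minus [intro]: "x \<in> Qbar \<Longrightarrow> - x \<in> Qbar"
  by (simp add: Qbar_def)

lemma Qbar_diff [intro]: "x \<in> Qbar \<Longrightarrow> y \<in> Qbar \<Longrightarrow> x - y \<in> Qbar"
  using Qbar_add[of x "- y"] Qbar_minus[of y] by simp

lemma Qbar_inverse [intro]: "x \<in> Qbar \<Longrightarrow> inverse x \<in> Qbar"
  by (auto simp: Qbar_def)

lemma Qbar_divide [intro]: "x \<in> Qbar \<Longrightarrow> y \<in> Qbar \<Longrightarrow> x / y \<in> Qbar"
  by (simp add: divide_inverse Qbar_inverse Qbar_mult)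

lemma Qbar_power [intro]: "x \<in> Qbar \<Longrightarrow> x ^ n \<in> Qbar"
  by (induction n) auto

lemma Qbar_sum [intro]: "(\<And>i. i \<in> A \<Longrightarrow> f i \<in> Qbar) \<Longrightarrow> (\<Sum>i\<in>A. f i) \<in> Qbar"
  by (induction A rule: infinite_finite_induct) auto

text \<open>Field isomorphisms between subfields of \<^const>\<open>Qbar\<close> are represented by their graphs.\<close>

definition pair_subring :: "(complex \<times> complex) set \<Rightarrow> bool" where
  "pair_subring S \<longleftrightarrow> (1, 1) \<in> S \<and>
     (\<forall>a b c d. (a, b) \<in> S \<longrightarrow> (c, d) \<in> S \<longrightarrow> (a - c, b - d) \<in> S \<and> (a * c, b * d) \<in> S)"

definition iso_graph :: "(complex \<times> complex) set \<Rightarrow> bool" where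
  "iso_graph S \<longleftrightarrow> pair_subring S \<and> (\<forall>a b. (a, b) \<in> S \<longrightarrow> (inverse a, inverse b) \<in> S) \<and>
     (\<forall>b. (0, b) \<in> S \<longrightarrow> b = 0) \<and> fst ` S \<subseteq> Qbar"

lemma pair_subringD:
  assumes "pair_subring S"
  shows "(1, 1) \<in> S" "(0, 0) \<in> S"
    "(a, b) \<in> S \<Longrightarrow> (c, d) \<in> S \<Longrightarrow> (a - c, b - d) \<in> S"
    "(a, b) \<in> S \<Longrightarrow> (c, d) \<in> S \<Longrightarrow> (a + c, b + d) \<in> S"
    "(a, b) \<in> S \<Longrightarrow> (c, d) \<in> S \<Longrightarrow> (a * c, b * d) \<in> S"
proof -
  show one: "(1, 1) \<in> S" using assms by (auto simp: pair_subring_def)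
  show diff: "(a, b) \<in> S \<Longrightarrow> (c, d) \<in> S \<Longrightarrow> (a - c, b - d) \<in> S" for a b c d
    using assms by (auto simp: pair_subring_def)
  show zero: "(0, 0) \<in> S" using diff[OF one one] by simp
  show "(a, b) \<in> S \<Longrightarrow> (c, d) \<in> S \<Longrightarrow> (a + c, b + d) \<in> S"
    using diff[of a b "0 - c" "0 - d"] diff[OF zero, of c d] by simp
  show "(a, b) \<in> S \<Longrightarrow> (c, d) \<in> S \<Longrightarrow> (a * c, b * d) \<in> S"
    using assms by (auto simp: pair_subring_def)
qed

lemma pair_subring_sum:
  assumes "pair_subring S" "\<And>i. i \<in> A \<Longrightarrow> (f i, g i) \<in> S"
  shows "((\<Sum>i\<in>A. f i), (\<Sum>i\<in>A. g i)) \<in> S"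
  using assms(2) by (induction A rule: infinite_finite_induct) (auto intro: pair_subringD[OF assms(1)])

lemma pair_subring_of_int:
  assumes "pair_subring S"
  shows "(of_int n, of_int n) \<in> S"
proof (induction n rule: int_induct[where k = 0])
  case base
  then show ?case using pair_subringD(2)[OF assms] by simp
next
  case (step1 i)
  then show ?case using pair_subringD(4)[OF assms _ pair_subringD(1)[OF assms]] by simp
next
  case (step2 i)
  then show ?case using pair_subringD(3)[OF assms _ pair_subringD(1)[OF assms]] by simp
qed

lemma iso_graph_Rats:
  assumes "iso_graph S" "r \<in> \<rat>"
  shows "(r, r) \<in> S"
proof -
  obtain a b where r: "r = of_int a / of_int b" using assms(2) by (elim Rats_cases')
  have S: "pair_subring S" using assms(1) by (simp add: iso_graph_def)
  have "(inverse (of_int b), inverse (of_int b)) \<in> S"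
    using pair_subring_of_int[OF S] assms(1) by (auto simp: iso_graph_def)
  from pair_subringD(5)[OF S pair_subring_of_int[OF S, of a] this] show ?thesis
    by (simp add: r divide_inverse)
qed

lemma pair_subring_poly:
  assumes "pair_subring S" "\<And>i. (coeff p i, coeff q i) \<in> S" "(a, b) \<in> S"
  shows "(poly p a, poly q b) \<in> S"
proof -
  have pw: "(a ^ i, b ^ i) \<in> S" for i
    by (induction i) (auto intro: pair_subringD[OF assms(1)] assms(3))
  define N where "N = max (degree p) (degree q)"
  have "poly p a = (\<Sum>i\<le>N. coeff p i * a ^ i)" "poly q b = (\<Sum>i\<le>N. coeff q i * b ^ i)"
    by (auto simp: poly_altdef N_def intro!: sum.mono_neutral_left le_degree)
  thus ?thesis using pair_subring_sum[OF assms(1), of "{..N}" "\<lambda>i. coeff p i * a ^ i" "\<lambda>i. coeff q i * b ^ i"]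
      pair_subringD(5)[OF assms(1) assms(2) pw] by simp
qed

text \<open>Over algebraic numbers, closure under inverses is automatic: 1/a is a polynomial in a
  with rational coefficients, obtained from an equation with constant term r \<noteq> 0, and its
  partner must be inverse to b because only 0 is paired with 0.\<close>

lemma iso_graphI:
  assumes S: "pair_subring S" and rat: "\<And>r. r \<in> \<rat> \<Longrightarrow> (r, r) \<in> S"
    and sv: "\<And>b. (0, b) \<in> S \<Longrightarrow> b = 0" and alg: "fst ` S \<subseteq> Qbar"
  shows "iso_graph S"
  unfolding iso_graph_def
proof (intro conjI allI impI S sv alg)
  fix a b assume ab: "(a, b) \<in> S"
  show "(inverse a, inverse b) \<in> S"
  proof (cases "a = 0")
    case True
    with sv ab have "b = 0" by blast
    thus ?thesis using True pair_subringD(2)[OF S] by simp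
  next
    case False
    have "algebraic a" using ab alg by (force simp: Qbar_def)
    from algebraicE'_nonzero[OF this False] obtain p0 :: "int poly" where
      p0: "coeff p0 0 \<noteq> 0" "poly (map_poly of_int p0) a = 0" by metis
    define p where "p = (map_poly of_int p0 :: complex poly)"
    obtain r p' where p: "p = pCons r p'" by (cases p)
    have r: "r = of_int (coeff p0 0)" "r \<noteq> 0"
      using p p0(1) by (metis p_def coeff_map_poly coeff_pCons_0 of_int_0 of_int_0_eq_iff)+
    have cf: "coeff p' i \<in> \<rat>" for i
    proof -
      have "coeff p' i = coeff p (Suc i)" by (simp add: p)
      thus ?thesis by (simp add: p_def coeff_map_poly)
    qed
    have "(poly p' a, poly p' b) \<in> S"
      using pair_subring_poly[OF S _ ab, of p' p'] rat cf by blast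
    moreover have "(- (1/r), - (1/r)) \<in> S" by (rule rat) (simp add: r(1))
    ultimately have v: "(- (1/r) * poly p' a, - (1/r) * poly p' b) \<in> S"
      by (rule pair_subringD(5)[OF S, rotated])
    have "a * poly p' a + r = 0" using p0(2) by (simp add: p_def[symmetric] p add.commute)
    hence "a * poly p' a = - r" by (simp add: eq_neg_iff_add_eq_0)
    hence v1: "- (1/r) * poly p' a = inverse a"
      using r(2) False by (simp add: field_simps)
    define w where "w = - (1/r) * poly p' b"
    have vw: "(inverse a, w) \<in> S" using v by (simp only: v1 w_def)
    have "(inverse a * a - 1, w * b - 1) \<in> S"
      by (intro pair_subringD[OF S] vw ab)
    hence "w * b - 1 = 0" using False sv[of "w * b - 1"] by simp
    hence "w = inverse b" by (metis eq_iff_diff_eq_0 inverse_unique mult.commute)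
    thus ?thesis using vw by simp
  qed
qed

text \<open>Extension of an isomorphism to a simple extension: \<open>S\<close> evaluates
  corresponding polynomials at a and a'. The work lies in well-definedness, where \<open>p0\<close>
  acts as the minimal polynomial of a over the first field and \<open>q0\<close> as its image over
  the second.\<close>

lemma iso_graph_extend:
  assumes G: "iso_graph G" and a: "a \<in> Qbar"
    and p0: "\<And>i. (coeff p0 i, coeff q0 i) \<in> G" "lead_coeff p0 = 1" "poly p0 a = 0" "poly q0 a' = 0"
    and min: "\<And>p q. (\<And>i. (coeff p i, coeff q i) \<in> G) \<Longrightarrow> p \<noteq> 0 \<Longrightarrow> poly p a = 0 \<Longrightarrow> degree p0 \<le> degree p"
  shows "\<exists>S. iso_graph S \<and> G \<subseteq> S \<and> (a, a') \<in> S"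
proof -
  have R: "pair_subring G" and sv: "\<And>b. (0, b) \<in> G \<Longrightarrow> b = 0" and alg: "fst ` G \<subseteq> Qbar"
    using G by (auto simp: iso_graph_def)
  note RD = pair_subringD[OF R]
  define S where "S = {(poly p a, poly q a') | p q. \<forall>i. (coeff p i, coeff q i) \<in> G}"
  have monomG: "(coeff (monom c n) i, coeff (monom d n) i) \<in> G" if "(c, d) \<in> G" for c d n i
    using that RD by simp
  have sub: "G \<subseteq> S"
  proof
    fix x assume "x \<in> G"
    obtain c d where x: "x = (c, d)" by (cases x)
    have "\<forall>i. (coeff [:c:] i, coeff [:d:] i) \<in> G"
      using \<open>x \<in> G\<close> RD by (auto simp: x coeff_pCons split: nat.splits)
    moreover have "x = (poly [:c:] a, poly [:d:] a')" by (simp add: x)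
    ultimately show "x \<in> S" unfolding S_def by blast
  qed
  have aS: "(a, a') \<in> S"
  proof -
    have "\<forall>i. (coeff [:0,1:] i, coeff [:0,1:] i) \<in> G"
      using RD by (auto simp: coeff_pCons split: nat.splits)
    moreover have "(a, a') = (poly [:0,1:] a, poly [:0,1:] a')" by simp
    ultimately show ?thesis unfolding S_def by blast
  qed
  have S: "pair_subring S"
    unfolding pair_subring_def
  proof (intro conjI allI impI)
    show "(1, 1) \<in> S" using sub RD by blast
    fix u v w z assume "(u, v) \<in> S" "(w, z) \<in> S"
    then obtain p q r s where pq: "\<forall>i. (coeff p i, coeff q i) \<in> G" "u = poly p a" "v = poly q a'"
      and rs: "\<forall>i. (coeff r i, coeff s i) \<in> G" "w = poly r a" "z = poly s a'"
      unfolding S_def by blast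
    have "\<forall>i. (coeff (p - r) i, coeff (q - s) i) \<in> G"
      using pq(1) rs(1) RD(3) by simp
    moreover have "(u - w, v - z) = (poly (p - r) a, poly (q - s) a')" by (simp add: pq rs)
    ultimately show "(u - w, v - z) \<in> S" unfolding S_def by blast
    have "\<forall>i. (coeff (p * r) i, coeff (q * s) i) \<in> G"
      using pq(1) rs(1) by (auto simp: coeff_mult intro!: pair_subring_sum[OF R] RD)
    moreover have "(u * w, v * z) = (poly (p * r) a, poly (q * s) a')" by (simp add: pq rs)
    ultimately show "(u * w, v * z) \<in> S" unfolding S_def by blast
  qed
  \<comment> \<open>Division by \<open>p0\<close> carried out on both components at once:
    subtracting corresponding multiples of \<open>p0\<close> and \<open>q0\<close> lowers the degree
    of p, and the multiple of \<open>q0\<close> contributes nothing at a'.\<close>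
  have key: "poly q a' = 0" if "\<forall>i. (coeff p i, coeff q i) \<in> G" "poly p a = 0" for p q
    using that
  proof (induction "degree p" arbitrary: p q rule: less_induct)
    case less
    show ?case
    proof (cases "p = 0")
      case True
      hence "coeff q i = 0" for i using less.prems(1) sv by simp
      hence "q = 0" by (simp add: poly_eq_iff)
      thus ?thesis by simp
    next
      case False
      have dle: "degree p0 \<le> degree p" using min[of p q] less.prems False by blast
      define n where "n = degree p - degree p0"
      define c where "c = lead_coeff p"
      define d where "d = coeff q (degree p)"
      define p1 where "p1 = p - monom c n * p0"
      define q1 where "q1 = q - monom d n * q0"
      have cd: "(c, d) \<in> G" using less.prems by (simp add: c_def d_def)
      have rel: "\<forall>i. (coeff p1 i, coeff q1 i) \<in> G"
      proof
        fix i
        have "(coeff (monom c n * p0) i, coeff (monom d n * q0) i) \<in> G"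
          using monomG[OF cd] p0(1) by (auto simp only: coeff_mult intro!: pair_subring_sum[OF R] RD)
        thus "(coeff p1 i, coeff q1 i) \<in> G" using less.prems RD(3) by (simp add: p1_def q1_def)
      qed
      have root: "poly p1 a = 0" using less.prems p0 by (simp add: p1_def)
      have deg: "degree (monom c n * p0) = degree p"
        using False p0(2) dle by (subst degree_mult_eq) (auto simp: c_def degree_monom_eq n_def)
      have lc: "coeff (monom c n * p0) (degree p) = c"
        using p0(2) dle by (simp add: coeff_monom_mult n_def)
      have "poly q1 a' = 0"
      proof (cases "p1 = 0")
        case True
        hence "coeff q1 i = 0" for i using rel sv by (metis coeff_0)
        hence "q1 = 0" by (simp add: poly_eq_iff)
        thus ?thesis by simp
      next
        case p1: False
        have "degree p1 \<le> degree p" unfolding p1_def using deg by (metis degree_diff_le order_refl)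
        moreover have "coeff p1 (degree p) = 0" using lc by (simp add: p1_def c_def)
        ultimately have "degree p1 < degree p" using p1 by (metis leading_coeff_0_iff le_neq_implies_less)
        thus ?thesis using less.hyps rel root by blast
      qed
      thus ?thesis using p0(4) by (simp add: q1_def)
    qed
  qed
  have "iso_graph S"
  proof (rule iso_graphI[OF S])
    show "(r, r) \<in> S" if "r \<in> \<rat>" for r using iso_graph_Rats[OF G that] sub by blast
    show "b = 0" if "(0, b) \<in> S" for b
      using that key unfolding S_def by force
    show "fst ` S \<subseteq> Qbar"
    proof
      fix x assume "x \<in> fst ` S"
      then obtain p q where pq: "\<forall>i. (coeff p i, coeff q i) \<in> G" "x = poly p a"
        unfolding S_def by force
      hence "coeff p i \<in> Qbar" for i using alg by force
      thus "x \<in> Qbar" unfolding pq(2) poly_altdef using a by (intro Qbar_sum Qbar_mult Qbar_power) auto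
    qed
  qed
  thus ?thesis using sub aS by blast
qed

text \<open>Zorn's lemma. At a maximal graph every algebraic a already lies in the domain, since the
  partner of its minimal polynomial has a complex root to which a can be sent.\<close>

lemma iso_graph_total_extension:
  assumes "iso_graph G"
  obtains M where "iso_graph M" "G \<subseteq> M" "fst ` M = Qbar"
proof -
  define \<A> where "\<A> = {S. iso_graph S \<and> G \<subseteq> S}"
  have "\<exists>M\<in>\<A>. \<forall>X\<in>\<A>. M \<subseteq> X \<longrightarrow> X = M"
  proof (rule subset_Zorn_nonempty)
    show "\<A> \<noteq> {}" using assms by (auto simp: \<A>_def)
    fix C assume C: "C \<noteq> {}" "subset.chain \<A> C"
    have ch: "X \<subseteq> Y \<or> Y \<subseteq> X" if "X \<in> C" "Y \<in> C" for X Y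
      using C(2) that unfolding subset.chain_def by blast
    have CA: "X \<in> \<A>" if "X \<in> C" for X using C(2) that unfolding subset.chain_def by blast
    have iso: "iso_graph X" if "X \<in> C" for X using CA[OF that] by (simp add: \<A>_def)
    have sr: "pair_subring X" if "X \<in> C" for X using iso[OF that] by (simp add: iso_graph_def)
    have "iso_graph (\<Union>C)"
      unfolding iso_graph_def pair_subring_def
    proof (intro conjI allI impI)
      show "(1, 1) \<in> \<Union>C" using C(1) pair_subringD(1)[OF sr] by blast
      fix a b c d assume "(a, b) \<in> \<Union>C" "(c, d) \<in> \<Union>C"
      then obtain X where "X \<in> C" "(a, b) \<in> X" "(c, d) \<in> X" using ch by blast
      thus "(a - c, b - d) \<in> \<Union>C" "(a * c, b * d) \<in> \<Union>C"
        using pair_subringD[OF sr] by blast+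
    next
      show "(inverse a, inverse b) \<in> \<Union>C" if "(a, b) \<in> \<Union>C" for a b
        using that iso unfolding iso_graph_def by blast
      show "b = 0" if "(0, b) \<in> \<Union>C" for b
        using that iso unfolding iso_graph_def by blast
      show "fst ` \<Union>C \<subseteq> Qbar" using iso unfolding iso_graph_def by blast
    qed
    thus "\<Union>C \<in> \<A>" using C(1) CA by (auto simp: \<A>_def)
  qed
  then obtain M where M: "iso_graph M" "G \<subseteq> M" and max: "\<And>X. iso_graph X \<Longrightarrow> M \<subseteq> X \<Longrightarrow> X = M"
    unfolding \<A>_def by auto
  have R: "pair_subring M" using M(1) by (simp add: iso_graph_def)
  have sv: "\<And>b. (0, b) \<in> M \<Longrightarrow> b = 0" using M(1) by (simp add: iso_graph_def)
  have "Qbar \<subseteq> fst ` M"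
  proof
    fix a assume a: "a \<in> Qbar"
    define Pr where "Pr = (\<lambda>(p, q). (\<forall>i. (coeff p i, coeff q i) \<in> M) \<and> p \<noteq> 0 \<and> poly p a = 0)"
    obtain p :: "int poly" where p: "p \<noteq> 0" "poly (map_poly of_int p) a = 0"
      using a by (auto simp: Qbar_def elim: algebraicE')
    have "Pr (map_poly of_int p, map_poly of_int p)"
      unfolding Pr_def using p pair_subring_of_int[OF R]
      by (auto simp: coeff_map_poly poly_eq_iff)
    hence "\<exists>x. Pr x \<and> (\<forall>y. Pr y \<longrightarrow> degree (fst x) \<le> degree (fst y))"
      by (rule ex_has_least_nat)
    then obtain p1 q1 where pq1: "Pr (p1, q1)" and min: "\<And>p q. Pr (p, q) \<Longrightarrow> degree p1 \<le> degree p"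
      by (metis fst_conv surj_pair)
    have p1: "\<And>i. (coeff p1 i, coeff q1 i) \<in> M" "p1 \<noteq> 0" "poly p1 a = 0" using pq1 by (auto simp: Pr_def)
    define c d where "c = inverse (lead_coeff p1)" and "d = inverse (coeff q1 (degree p1))"
    have cd: "(c, d) \<in> M" using p1(1) M(1) by (auto simp: c_def d_def iso_graph_def)
    define p0 q0 where "p0 = Polynomial.smult c p1" and "q0 = Polynomial.smult d q1"
    have rel: "(coeff p0 i, coeff q0 i) \<in> M" for i
      using pair_subringD(5)[OF R cd p1(1)] by (simp add: p0_def q0_def)
    have deg0: "degree p0 = degree p1" and lc0: "lead_coeff p0 = 1" and root0: "poly p0 a = 0"
      using p1 by (auto simp: p0_def c_def)
    \<comment> \<open>The leading coefficient of \<open>p0\<close> is 1, so its partner is 1 as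
      well; hence \<open>q0\<close> is not constant and has a root.\<close>
    have "(1 - 1, coeff q0 (degree p0) - 1) \<in> M"
      using pair_subringD(3)[OF R rel pair_subringD(1)[OF R], of "degree p0"] lc0 by simp
    hence lq: "coeff q0 (degree p0) = 1" using sv[of "coeff q0 (degree p0) - 1"] by simp
    have "degree p0 \<noteq> 0"
    proof
      assume "degree p0 = 0"
      then obtain z where "p0 = [:z:]" by (rule degree_eq_zeroE)
      thus False using lc0 root0 by simp
    qed
    hence "degree q0 > 0" using lq by (metis le_degree zero_neq_one gr0I le_zero_eq)
    then obtain a' where a': "poly q0 a' = 0"
      using alg_closed_imp_poly_has_root by blast
    have "\<exists>S. iso_graph S \<and> M \<subseteq> S \<and> (a, a') \<in> S"
    proof (rule iso_graph_extend[OF M(1) a rel lc0 root0 a'])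
      fix p q assume "\<And>i. (coeff p i, coeff q i) \<in> M" "p \<noteq> 0" "poly p a = 0"
      thus "degree p0 \<le> degree p" using min[of p q] deg0 by (simp add: Pr_def)
    qed
    then obtain S where "iso_graph S" "M \<subseteq> S" "(a, a') \<in> S" by blast
    with max[of S] show "a \<in> fst ` M" by force
  qed
  moreover have "fst ` M \<subseteq> Qbar" using M(1) by (simp add: iso_graph_def)
  ultimately show ?thesis using that M by blast
qed

lemma iso_graph_automorphism:
  assumes M: "iso_graph M" and dom: "fst ` M = Qbar"
  obtains \<sigma> where "Qbar_automorphism \<sigma>" "\<And>a b. (a, b) \<in> M \<Longrightarrow> \<sigma> a = b"
proof -
  have R: "pair_subring M" and sv: "\<And>b. (0, b) \<in> M \<Longrightarrow> b = 0"
    using M by (auto simp: iso_graph_def)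
  have uniq: "b = c" if "(a, b) \<in> M" "(a, c) \<in> M" for a b c
    using pair_subringD(3)[OF R that] sv[of "b - c"] by simp
  define \<sigma> where "\<sigma> a = (THE b. (a, b) \<in> M)" for a
  have \<sigma>: "\<sigma> a = b" if "(a, b) \<in> M" for a b
    unfolding \<sigma>_def using that uniq by (intro the_equality) blast+
  have \<sigma>M: "(a, \<sigma> a) \<in> M" if "a \<in> Qbar" for a
    using that dom \<sigma> by (metis (no_types, lifting) imageE prod.collapse)
  have rootmap: "poly p (\<sigma> a) = 0" if "a \<in> Qbar" "poly p a = 0" "\<And>i. coeff p i \<in> \<rat>" for p a
    using pair_subring_poly[OF R _ \<sigma>M[OF that(1)], of p p] iso_graph_Rats[OF M that(3)] that(2) sv by simp
  have inj: "a = b" if "a \<in> Qbar" "b \<in> Qbar" "\<sigma> a = \<sigma> b" for a b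
  proof (rule ccontr)
    assume "a \<noteq> b"
    have "(a - b, 0) \<in> M" using pair_subringD(3)[OF R \<sigma>M[OF that(1)] \<sigma>M[OF that(2)]] that(3) by simp
    moreover have "(inverse (a - b), 0) \<in> M" using M calculation unfolding iso_graph_def by force
    ultimately have "((a - b) * inverse (a - b) - 1, 0 * 0 - 1) \<in> M"
      by (intro pair_subringD[OF R])
    hence "(0, -1) \<in> M" using \<open>a \<noteq> b\<close> by simp
    thus False using sv by force
  qed
  have alg: "\<sigma> a \<in> Qbar" if "a \<in> Qbar" for a
  proof -
    obtain p where p: "\<And>i. coeff p i \<in> \<rat>" "p \<noteq> 0" "poly p a = 0"
      using \<open>a \<in> Qbar\<close> unfolding Qbar_def algebraic_altdef by auto
    thus ?thesis using rootmap[OF that p(3,1)] unfolding Qbar_def algebraic_altdef by auto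
  qed
  \<comment> \<open>The map permutes the finite set of roots of each rational polynomial, being
    injective on it.\<close>
  have surj: "y \<in> \<sigma> ` Qbar" if "y \<in> Qbar" for y
  proof -
    obtain p where p: "\<And>i. coeff p i \<in> \<rat>" "p \<noteq> 0" "poly p y = 0"
      using \<open>y \<in> Qbar\<close> unfolding Qbar_def algebraic_altdef by auto
    define Z where "Z = {x. poly p x = 0}"
    have "finite Z" unfolding Z_def using p(2) by (rule poly_roots_finite)
    have ZQ: "Z \<subseteq> Qbar" using p unfolding Z_def Qbar_def algebraic_altdef by auto
    have "\<sigma> ` Z \<subseteq> Z" using rootmap ZQ p(1) unfolding Z_def by blast
    moreover have "inj_on \<sigma> Z" using inj ZQ by (auto simp: inj_on_def)
    ultimately have "\<sigma> ` Z = Z" using \<open>finite Z\<close> by (simp add: endo_inj_surj)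
    thus ?thesis using p(3) ZQ unfolding Z_def by blast
  qed
  have "Qbar_automorphism \<sigma>"
    unfolding Qbar_automorphism_def bij_betw_def
  proof (intro conjI ballI)
    show "inj_on \<sigma> Qbar" using inj by (auto simp: inj_on_def)
    show "\<sigma> ` Qbar = Qbar" using surj alg by blast
    fix x y assume "x \<in> Qbar" "y \<in> Qbar"
    hence xy: "(x, \<sigma> x) \<in> M" "(y, \<sigma> y) \<in> M" by (auto intro: \<sigma>M)
    show "\<sigma> (x + y) = \<sigma> x + \<sigma> y" "\<sigma> (x * y) = \<sigma> x * \<sigma> y"
      by (rule \<sigma>, rule pair_subringD[OF R] xy, rule xy, rule xy)+
  qed
  thus ?thesis using that \<sigma> by blast
qed

lemma iso_graph_rat: "iso_graph {(r, r) | r. r \<in> \<rat>}"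
proof (rule iso_graphI)
  show "pair_subring {(r, r) | r. r \<in> \<rat>}" by (auto simp: pair_subring_def)
  show "fst ` {(r, r) | r. r \<in> \<rat>} \<subseteq> Qbar"
    by (auto elim!: Rats_cases' intro!: Qbar_divide)
qed auto

section \<open>Automorphisms and conjugates of algebraic integers\<close>

lemma Qbar_automorphismD:
  assumes "Qbar_automorphism \<sigma>"
  shows "x \<in> Qbar \<Longrightarrow> y \<in> Qbar \<Longrightarrow> \<sigma> (x + y) = \<sigma> x + \<sigma> y"
    "x \<in> Qbar \<Longrightarrow> y \<in> Qbar \<Longrightarrow> \<sigma> (x * y) = \<sigma> x * \<sigma> y"
    "\<sigma> 0 = 0" "\<sigma> 1 = 1" "x \<in> Qbar \<Longrightarrow> \<sigma> x \<in> Qbar"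
    "x \<in> Qbar \<Longrightarrow> \<sigma> x = 0 \<longleftrightarrow> x = 0"
proof -
  show add: "x \<in> Qbar \<Longrightarrow> y \<in> Qbar \<Longrightarrow> \<sigma> (x + y) = \<sigma> x + \<sigma> y"
    and mult: "x \<in> Qbar \<Longrightarrow> y \<in> Qbar \<Longrightarrow> \<sigma> (x * y) = \<sigma> x * \<sigma> y" for x y
    using assms by (auto simp: Qbar_automorphism_def)
  show 0: "\<sigma> 0 = 0" using add[of 0 0] by simp
  have inj: "inj_on \<sigma> Qbar" using assms by (auto simp: Qbar_automorphism_def bij_betw_def)
  show z: "x \<in> Qbar \<Longrightarrow> \<sigma> x = 0 \<longleftrightarrow> x = 0" for x
    using inj_onD[OF inj, of x 0] 0 by auto
  show "\<sigma> 1 = 1" using mult[of 1 1] z[of 1] by simp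
  show "x \<in> Qbar \<Longrightarrow> \<sigma> x \<in> Qbar"
    using assms by (auto simp: Qbar_automorphism_def bij_betw_def)
qed

lemma Qbar_automorphism_power:
  "Qbar_automorphism \<sigma> \<Longrightarrow> x \<in> Qbar \<Longrightarrow> \<sigma> (x ^ n) = \<sigma> x ^ n"
  by (induction n) (simp_all add: Qbar_automorphismD Qbar_power)

lemma Qbar_automorphism_sum:
  "Qbar_automorphism \<sigma> \<Longrightarrow> (\<And>i. i \<in> A \<Longrightarrow> f i \<in> Qbar) \<Longrightarrow> \<sigma> (\<Sum>i\<in>A. f i) = (\<Sum>i\<in>A. \<sigma> (f i))"
  by (induction A rule: infinite_finite_induct) (simp_all add: Qbar_automorphismD Qbar_sum)

lemma Qbar_automorphism_of_nat:
  "Qbar_automorphism \<sigma> \<Longrightarrow> \<sigma> (of_nat n) = of_nat n"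
  by (induction n) (simp_all add: Qbar_automorphismD)

lemma Qbar_automorphism_minus:
  assumes "Qbar_automorphism \<sigma>" "x \<in> Qbar" shows "\<sigma> (- x) = - \<sigma> x"
  using Qbar_automorphismD(1)[OF assms(1), of x "- x"] Qbar_automorphismD(3)[OF assms(1)] assms(2)
  by (simp add: Qbar_minus) (metis add_eq_0_iff)

lemma Qbar_automorphism_of_int:
  "Qbar_automorphism \<sigma> \<Longrightarrow> \<sigma> (of_int n) = of_int n"
  by (cases n rule: int_cases2)
     (simp_all add: Qbar_automorphism_of_nat Qbar_automorphism_minus)

lemma Qbar_automorphism_algebraic_int:
  assumes \<sigma>: "Qbar_automorphism \<sigma>" and x: "algebraic_int x"
  shows "algebraic_int (\<sigma> x)"
proof -
  obtain n :: nat and c where n: "n > 0" "x ^ n = (\<Sum>i<n. of_int (c i) * x ^ i)"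
    using algebraic_int_reduce[OF x] by metis
  have xQ: "x \<in> Qbar" using x by (rule algebraic_int_imp_Qbar)
  have "\<sigma> x ^ n = \<sigma> (x ^ n)" using \<sigma> xQ by (simp add: Qbar_automorphism_power)
  also have "\<dots> = (\<Sum>i<n. of_int (c i) * \<sigma> x ^ i)"
    unfolding n(2) using \<sigma> xQ
    by (subst Qbar_automorphism_sum)
       (auto simp: Qbar_automorphismD(2) Qbar_automorphism_power Qbar_power Qbar_automorphism_of_int)
  finally have e: "\<sigma> x ^ n = (\<Sum>i<n. of_int (c i) * \<sigma> x ^ i)" .
  define p where "p = monom 1 n - (\<Sum>i<n. monom (c i) i)"
  have cf: "coeff (\<Sum>i<n. monom (c i) i) j = (if j < n then c j else 0)" for j
    by (simp add: coeff_sum)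
  have "degree p \<le> n" by (rule degree_le) (auto simp: p_def cf)
  moreover have "coeff p n = 1" by (simp add: p_def cf)
  ultimately have "degree p = n" by (metis le_antisym le_degree zero_neq_one)
  hence "lead_coeff p = 1" using \<open>coeff p n = 1\<close> by simp
  have "poly (map_poly of_int p) (\<sigma> x) = (\<Sum>i\<le>n. of_int (coeff p i) * \<sigma> x ^ i)"
    using \<open>degree p = n\<close> by (simp add: poly_altdef degree_map_poly coeff_map_poly)
  also have "\<dots> = 0" using e
    by (simp add: lessThan_Suc_atMost[symmetric] p_def cf sum_negf)
  finally show ?thesis using \<open>lead_coeff p = 1\<close> unfolding algebraic_int_altdef_ipoly by blast
qed

lemma algebraic_int_prod_mset:
  "(\<And>x. x \<in># A \<Longrightarrow> algebraic_int (f x :: complex)) \<Longrightarrow> algebraic_int (\<Prod>x\<in>#A. f x)"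
  by (induction A) (auto intro: algebraic_int_add_mult)

lemma cmod_prod_mset_less_1:
  "A \<noteq> {#} \<Longrightarrow> (\<And>x. x \<in># A \<Longrightarrow> cmod (f x) < 1) \<Longrightarrow> cmod (\<Prod>x\<in>#A. f x) < 1"
proof (induction A)
  case (add x A)
  have 1: "cmod (f x) < 1" using add.prems by auto
  show ?case
  proof (cases "A = {#}")
    case False
    hence "cmod (\<Prod>x\<in>#A. f x) < 1" using add by auto
    hence "cmod (f x) * cmod (\<Prod>x\<in>#A. f x) < 1 * 1"
      using 1 by (intro mult_strict_mono') auto
    thus ?thesis by (simp add: norm_mult)
  qed (use 1 in simp)
qed auto

text \<open>The product of the roots of the minimal polynomial is a rational integer of modulus
  less than 1, hence vanishes.\<close>

lemma algebraic_int_small_conjugates: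
  assumes \<beta>: "algebraic_int \<beta>" and small: "\<And>\<sigma>. Qbar_automorphism \<sigma> \<Longrightarrow> cmod (\<sigma> \<beta>) < 1"
  shows "\<beta> = 0"
proof -
  have \<beta>Q: "\<beta> \<in> Qbar" using \<beta> by (rule algebraic_int_imp_Qbar)
  define Pr where "Pr = (\<lambda>p. (\<forall>i. coeff p i \<in> \<rat>) \<and> p \<noteq> 0 \<and> poly p \<beta> = 0)"
  have "\<exists>p. Pr p" using \<beta>Q unfolding Pr_def Qbar_def algebraic_altdef by blast
  hence "\<exists>p. Pr p \<and> (\<forall>q. Pr q \<longrightarrow> degree p \<le> degree q)" by (metis ex_has_least_nat)
  then obtain p1 where p1: "Pr p1" and min1: "\<And>q. Pr q \<Longrightarrow> degree p1 \<le> degree q" by blast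
  define p where "p = Polynomial.smult (inverse (lead_coeff p1)) p1"
  have p: "\<And>i. coeff p i \<in> \<rat>" "lead_coeff p = 1" "poly p \<beta> = 0" "degree p = degree p1"
    using p1 by (auto simp: p_def Pr_def)
  \<comment> \<open>Every root of the minimal polynomial is the image of \<beta> under some
    automorphism: the isomorphism from Q(\<beta>) to Q(\<beta>') over the identity of Q extends to
    all of \<open>Qbar\<close>.\<close>
  have conj: "\<exists>\<sigma>. Qbar_automorphism \<sigma> \<and> \<sigma> \<beta> = \<beta>'" if "poly p \<beta>' = 0" for \<beta>'
  proof -
    have "\<exists>S. iso_graph S \<and> {(r, r) | r. r \<in> \<rat>} \<subseteq> S \<and> (\<beta>, \<beta>') \<in> S"
    proof (rule iso_graph_extend[OF iso_graph_rat \<beta>Q _ p(2,3) that])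
      show "(coeff p i, coeff p i) \<in> {(r, r) |r. r \<in> \<rat>}" for i using p(1) by auto
      fix q r :: "complex poly"
      assume "\<And>i. (coeff q i, coeff r i) \<in> {(r, r) |r. r \<in> \<rat>}" "q \<noteq> 0" "poly q \<beta> = 0"
      thus "degree p \<le> degree q" using min1[of q] p(4) by (auto simp: Pr_def)
    qed
    then obtain S where S: "iso_graph S" "(\<beta>, \<beta>') \<in> S" by blast
    obtain M where M: "iso_graph M" "S \<subseteq> M" "fst ` M = Qbar"
      using iso_graph_total_extension[OF S(1)] by blast
    obtain \<sigma> where "Qbar_automorphism \<sigma>" "\<And>a b. (a, b) \<in> M \<Longrightarrow> \<sigma> a = b"
      using iso_graph_automorphism[OF M(1,3)] by blast
    thus ?thesis using S(2) M(2) by blast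
  qed
  have "p \<noteq> 0" using p(2) by auto
  then obtain A where A: "p = Polynomial.smult (lead_coeff p) (\<Prod>x\<in>#A. [:-x, 1:])"
    using alg_closed_imp_factorization by blast
  have roots: "poly p x = 0" if "x \<in># A" for x
  proof -
    have "poly p x = (\<Prod>y\<in>#A. poly [:-y, 1:] x)"
      by (subst A) (simp add: p(2) poly_prod_mset)
    also have "\<dots> = 0" using that by (auto simp: prod_mset_zero_iff)
    finally show ?thesis .
  qed
  have p0: "poly p 0 = (\<Prod>x\<in>#A. - x)"
    by (subst A) (simp add: p(2) poly_prod_mset)
  have "A \<noteq> {#}"
  proof
    assume "A = {#}"
    hence "p = 1" using A p(2) by simp
    thus False using p(3) by simp
  qed
  hence "cmod (poly p 0) < 1"
    unfolding p0 by (rule cmod_prod_mset_less_1) (use conj[OF roots] small in fastforce)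
  moreover have "algebraic_int (poly p 0)"
    unfolding p0 by (rule algebraic_int_prod_mset)
      (use conj[OF roots] Qbar_automorphism_algebraic_int[OF _ \<beta>] in fastforce)
  moreover have "poly p 0 \<in> \<rat>" using p(1)[of 0] by (simp add: poly_0_coeff_0)
  ultimately obtain k :: int where "poly p 0 = of_int k" "\<bar>k\<bar> < 1"
    using rational_algebraic_int_is_int by (metis Ints_cases norm_of_int of_int_abs of_int_less_1_iff)
  hence "poly p 0 = 0" by simp
  then obtain \<sigma> where "Qbar_automorphism \<sigma>" "\<sigma> \<beta> = 0" using conj by blast
  thus ?thesis using Qbar_automorphismD(6) \<beta>Q by blast
qed

section \<open>Polynomial rows and the lemma of Siegel\<close>

abbreviation lincomb :: "'i set \<Rightarrow> ('i \<Rightarrow> complex poly) \<Rightarrow> ('i \<Rightarrow> complex fps) \<Rightarrow> complex fps" where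
  "lincomb I b u \<equiv> (\<Sum>i\<in>I. fps_of_poly (b i) * u i)"

section \<open>Polynomials with algebraic coefficients\<close>

lemma polys_over_iff: "p \<in> polys_over K \<longleftrightarrow> (\<forall>i. coeff p i \<in> K)"
  by (simp add: polys_over_def)

abbreviation "QP \<equiv> polys_over Qbar"

lemma QP_coeff: "p \<in> QP \<Longrightarrow> coeff p i \<in> Qbar"
  by (simp add: polys_over_iff)

lemma QP_0 [simp, intro]: "0 \<in> QP" and QP_1 [simp, intro]: "1 \<in> QP"
  by (auto simp: polys_over_iff coeff_1)

lemma QP_add [intro]: "p \<in> QP \<Longrightarrow> q \<in> QP \<Longrightarrow> p + q \<in> QP"
  and QP_diff [intro]: "p \<in> QP \<Longrightarrow> q \<in> QP \<Longrightarrow> p - q \<in> QP"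
  and QP_minus [intro]: "p \<in> QP \<Longrightarrow> - p \<in> QP"
  by (auto simp: polys_over_iff)

lemma QP_mult [intro]: "p \<in> QP \<Longrightarrow> q \<in> QP \<Longrightarrow> p * q \<in> QP"
  by (auto simp: polys_over_iff coeff_mult)

lemma QP_power [intro]: "p \<in> QP \<Longrightarrow> p ^ n \<in> QP"
  by (induction n) auto

lemma QP_sum [intro]: "(\<And>i. i \<in> A \<Longrightarrow> f i \<in> QP) \<Longrightarrow> (\<Sum>i\<in>A. f i) \<in> QP"
  by (induction A rule: infinite_finite_induct) auto

lemma QP_prod [intro]: "(\<And>i. i \<in> A \<Longrightarrow> f i \<in> QP) \<Longrightarrow> (\<Prod>i\<in>A. f i) \<in> QP"
  by (induction A rule: infinite_finite_induct) auto

lemma QP_const [simp]: "[:a:] \<in> QP \<longleftrightarrow> a \<in> Qbar"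
  by (auto simp: polys_over_iff coeff_pCons split: nat.splits)

lemma QP_linear: "a \<in> Qbar \<Longrightarrow> b \<in> Qbar \<Longrightarrow> [:a, b:] \<in> QP"
  by (auto simp: polys_over_iff coeff_pCons split: nat.splits)

lemma QP_monom [simp]: "monom a n \<in> QP \<longleftrightarrow> a \<in> Qbar"
  by (auto simp: polys_over_iff)

lemma QP_smult [intro]: "a \<in> Qbar \<Longrightarrow> p \<in> QP \<Longrightarrow> Polynomial.smult a p \<in> QP"
  by (auto simp: polys_over_iff)

lemma QP_of_nat [simp, intro]: "of_nat n \<in> QP"
  by (induction n) auto

lemma QP_pderiv [intro]: "p \<in> QP \<Longrightarrow> pderiv p \<in> QP"
  by (auto simp: polys_over_iff coeff_pderiv simp del: of_nat_Suc)

lemma QP_pcompose [intro]: "p \<in> QP \<Longrightarrow> q \<in> QP \<Longrightarrow> pcompose p q \<in> QP"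
proof (induction p)
  case (pCons a p)
  have "a \<in> Qbar" "p \<in> QP" using pCons.prems(1) unfolding polys_over_iff
    by (metis coeff_pCons_0, metis coeff_pCons_Suc)
  thus ?case using pCons by (auto simp: pcompose_pCons)
qed simp

lemma QP_poly [intro]: "p \<in> QP \<Longrightarrow> x \<in> Qbar \<Longrightarrow> poly p x \<in> Qbar"
  by (auto simp: poly_altdef polys_over_iff)

text \<open>The coefficients of q are solved for from the constant term upwards, dividing only by
  c.\<close>

lemma QP_linear_factor:
  assumes "[:-c, 1:] * q \<in> QP" "c \<in> Qbar" "c \<noteq> 0"
  shows "q \<in> QP"
  unfolding polys_over_iff
proof
  fix i show "coeff q i \<in> Qbar"
  proof (induction i)
    case 0
    have "coeff ([:-c, 1:] * q) 0 = - c * coeff q 0" by simp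
    hence "- c * coeff q 0 \<in> Qbar" using QP_coeff[OF assms(1), of 0] by simp
    hence "(- c * coeff q 0) / (- c) \<in> Qbar" using assms(2) by blast
    thus ?case using assms(3) by simp
  next
    case (Suc i)
    have "coeff ([:-c, 1:] * q) (Suc i) = coeff q i - c * coeff q (Suc i)" by simp
    hence "coeff q i - c * coeff q (Suc i) \<in> Qbar" using QP_coeff[OF assms(1), of "Suc i"] by simp
    hence "(coeff q i - (coeff q i - c * coeff q (Suc i))) / c \<in> Qbar" using assms(2) Suc by blast
    thus ?case using assms(3) by simp
  qed
qed

lemma QP_linear_factor_power:
  "[:-c, 1:] ^ n * q \<in> QP \<Longrightarrow> c \<in> Qbar \<Longrightarrow> c \<noteq> 0 \<Longrightarrow> q \<in> QP"
proof (induction n)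
  case (Suc n)
  have "[:-c, 1:] * ([:-c, 1:] ^ n * q) \<in> QP" using Suc.prems by (simp only: power_Suc mult.assoc)
  from QP_linear_factor[OF this Suc.prems(2,3)] Suc show ?case by simp
qed simp

text \<open>Gaussian elimination by cross-multiplication. No division occurs, so the solution stays
  in any subring S of the domain that contains the entries; it is applied to algebraic numbers, to
  polynomials and to subfields.\<close>

lemma homogeneous_system_solution:
  fixes a :: "'r \<Rightarrow> 'u \<Rightarrow> 'a::idom"
  assumes "finite R" "finite U" "card R < card U"
    and S: "0 \<in> S" "1 \<in> S" "\<And>x y. x \<in> S \<Longrightarrow> y \<in> S \<Longrightarrow> x * y \<in> S" "\<And>x y. x \<in> S \<Longrightarrow> y \<in> S \<Longrightarrow> x - y \<in> S"
    and "\<And>r u. r \<in> R \<Longrightarrow> u \<in> U \<Longrightarrow> a r u \<in> S"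
  shows "\<exists>x. (\<forall>u. x u \<in> S) \<and> (\<exists>u\<in>U. x u \<noteq> 0) \<and> (\<forall>r\<in>R. (\<Sum>u\<in>U. a r u * x u) = 0)"
  using assms(1,2,3,8)
proof (induction R arbitrary: U a rule: finite_induct)
  case empty
  then obtain u where "u \<in> U" by fastforce
  thus ?case using S by (intro exI[of _ "\<lambda>_. 1"]) auto
next
  case (insert r R)
  have neg: "- x \<in> S" if "x \<in> S" for x using S(4)[OF S(1) that] by simp
  have add: "x + y \<in> S" if "x \<in> S" "y \<in> S" for x y using S(4)[OF that(1) neg[OF that(2)]] by simp
  have sumS: "(\<Sum>u\<in>V. f u) \<in> S" if "\<And>u. u \<in> V \<Longrightarrow> f u \<in> S" for V and f :: "'u \<Rightarrow> 'a"
    using that by (induction V rule: infinite_finite_induct) (simp_all add: add S(1))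
  show ?case
  proof (cases "\<forall>u\<in>U. a r u = 0")
    case True
    have c: "card R < card U" using insert by simp
    have pre: "a r' u \<in> S" if "r' \<in> R" "u \<in> U" for r' u using insert.prems(3) that by simp
    have "\<exists>x. (\<forall>u. x u \<in> S) \<and> (\<exists>u\<in>U. x u \<noteq> 0) \<and> (\<forall>r\<in>R. (\<Sum>u\<in>U. a r u * x u) = 0)"
      by (rule insert.IH[OF insert.prems(1) c]) (rule pre)
    then obtain x where "\<forall>u. x u \<in> S" "\<exists>u\<in>U. x u \<noteq> 0" "\<forall>r\<in>R. (\<Sum>u\<in>U. a r u * x u) = 0"
      by blast
    thus ?thesis using True by (intro exI[of _ x]) auto
  next
    case False
    then obtain u0 where u0: "u0 \<in> U" "a r u0 \<noteq> 0" by blast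
    define U' where "U' = U - {u0}"
    define a' where "a' r' u = a r u0 * a r' u - a r' u0 * a r u" for r' u
    have U': "finite U'" "card R < card U'" using insert u0 by (auto simp: U'_def)
    have "a' r' u \<in> S" if "r' \<in> R" "u \<in> U'" for r' u
      unfolding a'_def using insert.prems(3) u0 that by (intro S(3) S(4)) (auto simp: U'_def)
    hence "\<exists>x'. (\<forall>u. x' u \<in> S) \<and> (\<exists>u\<in>U'. x' u \<noteq> 0) \<and> (\<forall>r\<in>R. (\<Sum>u\<in>U'. a' r u * x' u) = 0)"
      by (rule insert.IH[OF U'])
    then obtain x' where x': "\<forall>u. x' u \<in> S" "\<exists>u\<in>U'. x' u \<noteq> 0"
      "\<forall>r\<in>R. (\<Sum>u\<in>U'. a' r u * x' u) = 0" by blast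
    define x where "x u = (if u = u0 then - (\<Sum>u\<in>U'. a r u * x' u) else if u \<in> U' then a r u0 * x' u else 0)" for u
    have split: "(\<Sum>u\<in>U. f u) = f u0 + (\<Sum>u\<in>U'. f u)" for f :: "'u \<Rightarrow> 'a"
      unfolding U'_def using sum.remove[OF insert.prems(1) u0(1)] .
    have xU': "(\<Sum>u\<in>U'. c u * x u) = (\<Sum>u\<in>U'. c u * (a r u0 * x' u))" for c
      by (rule sum.cong) (auto simp: x_def U'_def)
    show ?thesis
    proof (intro exI[of _ x] conjI ballI allI)
      fix u show "x u \<in> S"
        unfolding x_def using x'(1) insert.prems(3) u0 S(1) by (auto intro!: neg sumS S(3) simp: U'_def)
    next
      from x'(2) obtain u where "u \<in> U'" "x' u \<noteq> 0" by blast
      thus "\<exists>u\<in>U. x u \<noteq> 0" using u0 by (intro bexI[of _ u]) (auto simp: x_def U'_def)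
    next
      fix r' assume r': "r' \<in> insert r R"
      have "(\<Sum>u\<in>U. a r' u * x u) = (\<Sum>u\<in>U'. a r' u * (a r u0 * x' u)) - a r' u0 * (\<Sum>u\<in>U'. a r u * x' u)"
        unfolding split xU' by (simp add: x_def)
      also have "\<dots> = (\<Sum>u\<in>U'. a' r' u * x' u)"
        by (simp add: a'_def sum_distrib_left sum_subtractf[symmetric] algebra_simps)
      also have "\<dots> = 0"
        using r' x'(3) by (auto simp: a'_def mult.commute)
      finally show "(\<Sum>u\<in>U. a r' u * x u) = 0" .
    qed
  qed
qed

text \<open>Pigeonhole on the vectors with entries in 0..X; the solution is the difference of two
  vectors with the same image. The hypothesis is kept as the raw count, so that no roots have to be
  extracted.\<close>

lemma siegel_lemma:
  fixes A :: "'e \<Rightarrow> 'u \<Rightarrow> int" and M X :: nat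
  assumes E: "finite E" and U: "finite U"
    and A: "\<And>e u. e \<in> E \<Longrightarrow> u \<in> U \<Longrightarrow> \<bar>A e u\<bar> \<le> int M"
    and count: "(2 * card U * M * X + 1) ^ card E < (X + 1) ^ card U"
  shows "\<exists>x. (\<exists>u\<in>U. x u \<noteq> 0) \<and> (\<forall>u\<in>U. \<bar>x u\<bar> \<le> int X) \<and> (\<forall>e\<in>E. (\<Sum>u\<in>U. A e u * x u) = 0)"
proof -
  define D where "D = PiE U (\<lambda>_. {0..int X})"
  define B where "B = card U * M * X"
  define \<phi> where "\<phi> x = restrict (\<lambda>e. \<Sum>u\<in>U. A e u * x u) E" for x
  have cD: "card D = (X + 1) ^ card U" using U by (simp add: D_def card_PiE nat_add_distrib)
  have "\<phi> ` D \<subseteq> PiE E (\<lambda>_. {- int B..int B})"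
  proof
    fix y assume "y \<in> \<phi> ` D"
    then obtain x where x: "x \<in> D" "y = \<phi> x" by blast
    have "\<bar>\<Sum>u\<in>U. A e u * x u\<bar> \<le> int B" if "e \<in> E" for e
    proof -
      have xb: "\<bar>x u\<bar> \<le> int X" if "u \<in> U" for u
      proof -
        have "x u \<in> {0..int X}" using x(1) that unfolding D_def by blast
        thus ?thesis by simp
      qed
      have "\<bar>\<Sum>u\<in>U. A e u * x u\<bar> \<le> (\<Sum>u\<in>U. \<bar>A e u * x u\<bar>)" by (rule sum_abs)
      also have "\<dots> \<le> (\<Sum>u\<in>U. int M * int X)"
        unfolding abs_mult using A[OF that] xb by (intro sum_mono mult_mono) auto
      also have "\<dots> = int B" by (simp add: B_def)
      finally show ?thesis .
    qed
    thus "y \<in> PiE E (\<lambda>_. {- int B..int B})"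
      unfolding x(2) \<phi>_def by (auto simp: abs_le_iff minus_le_iff)
  qed
  hence "card (\<phi> ` D) \<le> card (PiE E (\<lambda>_. {- int B..int B}))"
    using E by (intro card_mono) (auto intro: finite_PiE)
  also have "\<dots> = (2 * B + 1) ^ card E" using E by (simp add: card_PiE nat_add_distrib nat_mult_distrib)
  also have "\<dots> < card D" using count by (simp add: cD B_def mult.assoc)
  finally have "\<not> inj_on \<phi> D" by (rule pigeonhole)
  then obtain x y where xy: "x \<in> D" "y \<in> D" "\<phi> x = \<phi> y" "x \<noteq> y" by (auto simp: inj_on_def)
  have "\<exists>u\<in>U. x u \<noteq> y u"
    using xy(1,2,4) unfolding D_def by (metis PiE_ext)
  moreover have "\<bar>x u - y u\<bar> \<le> int X" if "u \<in> U" for u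
  proof -
    have "x u \<in> {0..int X}" "y u \<in> {0..int X}" using xy that unfolding D_def by blast+
    thus ?thesis by auto
  qed
  moreover have "(\<Sum>u\<in>U. A e u * (x u - y u)) = 0" if "e \<in> E" for e
  proof -
    have "\<phi> x e = \<phi> y e" using xy(3) by simp
    thus ?thesis using that by (simp add: \<phi>_def right_diff_distrib sum_subtractf)
  qed
  ultimately show ?thesis by (intro exI[of _ "\<lambda>u. x u - y u"]) auto
qed

text \<open>Taylor expansion at 1: coefficient i of \<open>tay p\<close> is the coefficient of (z -
  1)^i in p.\<close>

definition tay :: "complex poly \<Rightarrow> complex poly" where
  "tay p = pcompose p [:1, 1:]"

lemma tay_simps [simp]:
  "tay 0 = 0" "tay (p + q) = tay p + tay q" "tay (p - q) = tay p - tay q" "tay (p * q) = tay p * tay q"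
  "tay [:0, 1:] = [:1, 1:]"
  by (simp_all add: tay_def pcompose_add pcompose_diff pcompose_mult pcompose_pCons)

lemma poly_tay: "poly (tay p) x = poly p (1 + x)"
  by (simp add: tay_def poly_pcompose)

lemma degree_tay [simp]: "degree (tay p) = degree p"
  by (simp add: tay_def)

lemma pcompose_tay: "pcompose (tay p) [:-1, 1:] = p"
proof -
  have "pcompose (tay p) [:-1, 1:] = pcompose p (pcompose [:1, 1:] [:-1, 1:])"
    unfolding tay_def by (rule pcompose_assoc[symmetric])
  also have "pcompose [:1, 1:] [:-1, 1 :: complex:] = [:0, 1:]" by (simp add: pcompose_pCons one_pCons)
  finally show ?thesis by (simp add: pcompose_idR)
qed

lemma higher_pderiv_tay: "(pderiv ^^ i) (tay p) = tay ((pderiv ^^ i) p)"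
proof (induction i)
  case (Suc i)
  have "pderiv (tay q) = tay (pderiv q)" for q
    by (simp add: tay_def pderiv_pcompose pderiv_pCons)
  thus ?case using Suc by simp
qed simp

lemma poly_higher_pderiv_0: "poly ((pderiv ^^ i) p) (0::complex) = fact i * coeff p i"
  by (simp add: poly_0_coeff_0 coeff_higher_pderiv pochhammer_fact)

lemma coeff_tay: "fact i * coeff (tay p) i = poly ((pderiv ^^ i) p) 1"
proof -
  have "fact i * coeff (tay p) i = poly ((pderiv ^^ i) (tay p)) 0" by (simp add: poly_higher_pderiv_0)
  also have "\<dots> = poly ((pderiv ^^ i) p) 1" by (simp add: higher_pderiv_tay poly_tay)
  finally show ?thesis .
qed

text \<open>The substitutions z + 1 and z - 1 act on coefficients by integer matrices, hence
  preserve every additive group S.\<close>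

lemma coeff_pcompose_unit_shift:
  assumes S: "0 \<in> S" "\<And>x y. x \<in> S \<Longrightarrow> y \<in> S \<Longrightarrow> x - y \<in> S"
    and p: "\<And>i. coeff p i \<in> S" and e: "e = 1 \<or> e = (-1::complex)"
  shows "coeff (pcompose p [:e, 1:]) i \<in> S"
  using p
proof (induction p arbitrary: i)
  case 0
  thus ?case using S by simp
next
  case (pCons a p)
  have neg: "- x \<in> S" if "x \<in> S" for x using S(2)[OF S(1) that] by simp
  have add: "x + y \<in> S" if "x \<in> S" "y \<in> S" for x y using S(2)[OF that(1) neg[OF that(2)]] by simp
  have "coeff p i \<in> S" for i using pCons.prems[of "Suc i"] by simp
  hence IH: "coeff (pcompose p [:e, 1:]) i \<in> S" for i using pCons.IH by blast
  have "e * coeff (pcompose p [:e, 1:]) i \<in> S" for i using IH e neg by auto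
  thus ?case using IH pCons.prems[of 0]
    by (cases i) (auto simp: pcompose_pCons simp del: coeff_pcompose_0 intro!: add)
qed

text \<open>Write H = z^n0 (g + z^k Q) with deg g < k. The tail has coefficients in S by
  \<open>high\<close>, so the first k Taylor coefficients of z^n0 g at 1 lie in S. As z^n0 = (1 +
  t)^n0 is invertible among integer power series in t = z - 1, the first k Taylor coefficients of g
  lie in S. These are all of them, and expanding at 0 again reaches the constant term of g. In the
  applications S consists of numbers divisible by a factorial.\<close>

lemma lowest_coeff_from_jet:
  assumes S: "0 \<in> S" "\<And>x y. x \<in> S \<Longrightarrow> y \<in> S \<Longrightarrow> x - y \<in> S"
    and low: "\<And>t. t < n0 \<Longrightarrow> coeff H t = 0"
    and high: "\<And>t. t \<ge> n0 + k \<Longrightarrow> coeff H t \<in> S"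
    and jet: "\<And>i. i < k \<Longrightarrow> coeff (tay H) i \<in> S"
  shows "coeff H n0 \<in> S"
proof (cases "k = 0")
  case True
  thus ?thesis using high by simp
next
  case False
  define P where "P = poly_shift n0 H"
  define g where "g = poly_cutoff k P"
  define Q where "Q = poly_shift k P"
  have HP: "H = monom 1 n0 * P"
    by (rule poly_eqI) (auto simp: P_def coeff_monom_mult coeff_poly_shift low)
  have PgQ: "P = g + monom 1 k * Q"
    by (rule poly_eqI) (auto simp: g_def Q_def coeff_monom_mult coeff_poly_shift coeff_poly_cutoff)
  have HgQ: "monom 1 n0 * g = H - monom 1 (n0 + k) * Q"
    unfolding HP PgQ by (simp add: algebra_simps mult_monom)
  have "coeff (monom 1 (n0 + k) * Q) t \<in> S" for t
    using high S(1) by (auto simp: coeff_monom_mult Q_def P_def coeff_poly_shift add.commute add.left_commute)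
  hence "coeff (tay (monom 1 (n0 + k) * Q)) t \<in> S" for t
    unfolding tay_def by (intro coeff_pcompose_unit_shift S) auto
  hence j1: "\<forall>i<k. coeff (tay (monom 1 n0 * g)) i \<in> S"
    unfolding HgQ using jet S by simp
  have "\<forall>i<k. coeff (tay (monom 1 n * g)) i \<in> S \<Longrightarrow> \<forall>i<k. coeff (tay g) i \<in> S" for n
  proof (induction n)
    case (Suc n)
    define f where "f = tay (monom 1 n * g)"
    have "monom 1 (Suc n) * g = [:0, 1:] * (monom 1 n * g)"
      by (simp add: monom_Suc)
    hence e: "tay (monom 1 (Suc n) * g) = [:1, 1:] * f"
      by (metis f_def tay_simps(4,5))
    \<comment> \<open>Division by 1 + t, one coefficient after the other.\<close>
    have "i < k \<Longrightarrow> coeff f i \<in> S" for i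
    proof (induction i)
      case 0
      thus ?case using Suc.prems unfolding e by (auto dest!: spec[of _ 0])
    next
      case (Suc i)
      have "coeff f (Suc i) + coeff f i \<in> S"
        using \<open>\<forall>i<k. coeff (tay (monom 1 (Suc n) * g)) i \<in> S\<close> Suc.prems unfolding e
        by (auto dest!: spec[of _ "Suc i"])
      from S(2)[OF this Suc.IH] Suc.prems show ?case by simp
    qed
    thus ?case using Suc.IH by (simp add: f_def)
  qed (simp add: monom_0)
  with j1 have j2: "\<forall>i<k. coeff (tay g) i \<in> S" by blast
  have "coeff (tay g) i \<in> S" for i
  proof (cases "i < k")
    case False
    have "degree g < k"
      using \<open>k \<noteq> 0\<close> by (intro degree_lessI) (auto simp: g_def coeff_poly_cutoff)
    hence "coeff (tay g) i = 0" using False by (intro coeff_eq_0) simp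
    thus ?thesis using S by simp
  qed (use j2 in auto)
  hence "coeff (pcompose (tay g) [:-1, 1:]) 0 \<in> S"
    by (intro coeff_pcompose_unit_shift S) auto
  hence "coeff g 0 \<in> S" by (simp only: pcompose_tay)
  thus ?thesis using False by (simp add: g_def P_def coeff_poly_cutoff coeff_poly_shift)
qed

text \<open>The correction with \<open>pderiv T\<close> cancels the derivative of T^i. Row i
  therefore belongs to T^i times the plain i-th derivative and not to an iterate of T d/dz; plain
  derivatives at 1 are what Taylor coefficients require.\<close>

primrec Dit :: "complex poly \<Rightarrow> ('i \<Rightarrow> 'i \<Rightarrow> complex poly) \<Rightarrow> 'i set \<Rightarrow> nat \<Rightarrow> ('i \<Rightarrow> complex poly) \<Rightarrow> 'i \<Rightarrow> complex poly" where
  "Dit T G I 0 b = b"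
| "Dit T G I (Suc i) b = (\<lambda>j. T * pderiv (Dit T G I i b j) - of_nat i * pderiv T * Dit T G I i b j
      + (\<Sum>k\<in>I. Dit T G I i b k * G k j))"

lemma QP_Dit:
  assumes "T \<in> QP" "\<And>i j. i \<in> I \<Longrightarrow> j \<in> I \<Longrightarrow> G i j \<in> QP" "\<And>j. j \<in> I \<Longrightarrow> b j \<in> QP" "j \<in> I"
  shows "Dit T G I i b j \<in> QP"
  using assms(4) by (induction i arbitrary: j) (use assms in \<open>auto intro!: QP_add QP_diff QP_mult QP_sum QP_of_nat QP_pderiv\<close>)

text \<open>The rows \<open>Dit i b\<close> express \<open>T\<^sup>i (b \<cdot> V)\<^sup>(\<^sup>i\<^sup>)\<close> through \<open>V\<close>; here for an approximate
  polynomial solution \<open>V\<close> with error \<open>E\<close>.\<close>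

lemma Dit_approx:
  fixes V E :: "'i \<Rightarrow> complex poly"
  assumes I: "finite I"
    and V: "\<And>k. k \<in> I \<Longrightarrow> T * pderiv (V k) = (\<Sum>j\<in>I. G k j * V j) + E k"
    and S: "0 \<in> S" "\<And>x y. x \<in> S \<Longrightarrow> y \<in> S \<Longrightarrow> x - y \<in> S"
      "\<And>x y. algebraic_int x \<Longrightarrow> y \<in> S \<Longrightarrow> x * y \<in> S"
    and E: "\<And>k i. k \<in> I \<Longrightarrow> coeff (E k) i \<in> S"
    and T: "\<And>i. algebraic_int (coeff T i)"
    and D: "\<And>i j l. j \<in> I \<Longrightarrow> algebraic_int (coeff (Dit T G I i b j) l)"
  shows "\<exists>r. (\<forall>l. coeff r l \<in> S) \<and>
     T ^ i * (pderiv ^^ i) (\<Sum>j\<in>I. b j * V j) = (\<Sum>j\<in>I. Dit T G I i b j * V j) + r"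
proof (induction i)
  case 0
  show ?case using S by (intro exI[of _ 0]) auto
next
  case (Suc i)
  then obtain r where r: "\<forall>l. coeff r l \<in> S"
    and eq: "T ^ i * (pderiv ^^ i) (\<Sum>j\<in>I. b j * V j) = (\<Sum>j\<in>I. Dit T G I i b j * V j) + r" by blast
  have neg: "- x \<in> S" if "x \<in> S" for x using S(2)[OF S(1) that] by simp
  have add: "x + y \<in> S" if "x \<in> S" "y \<in> S" for x y using S(2)[OF that(1) neg[OF that(2)]] by simp
  have sumS: "(\<Sum>u\<in>W. f u) \<in> S" if "\<And>u. u \<in> W \<Longrightarrow> f u \<in> S" for W and f :: "'w \<Rightarrow> complex"
    using that by (induction W rule: infinite_finite_induct) (simp_all add: add S(1))
  have multS: "coeff (p * q) l \<in> S" if "\<And>l. algebraic_int (coeff p l)" "\<And>l. coeff q l \<in> S" for p q l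
    unfolding coeff_mult by (intro sumS S(3) that)
  define h where "h = (\<Sum>j\<in>I. b j * V j)"
  define W where "W = T ^ i * (pderiv ^^ i) h"
  \<comment> \<open>The new error stays in the additive group S because S is stable under algebraic
    integers, and the rows, T and the integers from differentiation are the only factors.\<close>
  define r' where "r' = (\<Sum>j\<in>I. Dit T G I i b j * E j) + T * pderiv r - of_nat i * (pderiv T * r)"
  have "T ^ Suc i * (pderiv ^^ Suc i) h = T * pderiv W - of_nat i * pderiv T * W"
  proof -
    have "T * pderiv (T ^ i) = of_nat i * pderiv T * T ^ i"
      by (induction i) (simp_all add: pderiv_mult algebra_simps)
    moreover have "T * pderiv W = (T * pderiv (T ^ i)) * (pderiv ^^ i) h + T ^ Suc i * pderiv ((pderiv ^^ i) h)"
      unfolding W_def pderiv_mult by (simp add: distrib_left mult_ac)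
    ultimately have "T * pderiv W = of_nat i * pderiv T * W + T ^ Suc i * pderiv ((pderiv ^^ i) h)"
      by (simp add: W_def mult.assoc)
    thus ?thesis by simp
  qed
  also have "\<dots> = (\<Sum>j\<in>I. T * pderiv (Dit T G I i b j) * V j + Dit T G I i b j * (T * pderiv (V j))
        - of_nat i * pderiv T * Dit T G I i b j * V j) + T * pderiv r - of_nat i * (pderiv T * r)"
    unfolding W_def h_def eq
    by (simp add: pderiv_add pderiv_sum pderiv_mult sum.distrib sum_subtractf sum_distrib_left algebra_simps)
  also have "\<dots> = (\<Sum>j\<in>I. (T * pderiv (Dit T G I i b j) - of_nat i * pderiv T * Dit T G I i b j) * V j)
       + (\<Sum>j\<in>I. Dit T G I i b j * (\<Sum>k\<in>I. G j k * V k)) + r'"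
    by (simp add: V r'_def sum.distrib sum_subtractf algebra_simps)
  also have "(\<Sum>j\<in>I. Dit T G I i b j * (\<Sum>k\<in>I. G j k * V k)) = (\<Sum>k\<in>I. \<Sum>j\<in>I. Dit T G I i b j * G j k * V k)"
    by (subst sum.swap) (simp add: sum_distrib_left mult.assoc)
  also have "(\<Sum>j\<in>I. (T * pderiv (Dit T G I i b j) - of_nat i * pderiv T * Dit T G I i b j) * V j)
       + (\<Sum>k\<in>I. \<Sum>j\<in>I. Dit T G I i b j * G j k * V k) = (\<Sum>j\<in>I. Dit T G I (Suc i) b j * V j)"
    by (simp add: sum.distrib[symmetric] algebra_simps sum_distrib_left sum_distrib_right)
  finally have "T ^ Suc i * (pderiv ^^ Suc i) h = (\<Sum>j\<in>I. Dit T G I (Suc i) b j * V j) + r'" .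
  moreover have "\<forall>l. coeff r' l \<in> S"
  proof
    fix l
    have 1: "coeff (\<Sum>j\<in>I. Dit T G I i b j * E j) l \<in> S"
      unfolding coeff_sum by (intro sumS multS D E)
    have "coeff (pderiv r) l \<in> S" for l
      unfolding coeff_pderiv using r S(3)[OF algebraic_int_of_nat] by blast
    hence 2: "coeff (T * pderiv r) l \<in> S" by (intro multS T)
    have "algebraic_int (coeff (pderiv T) l)" for l
      unfolding coeff_pderiv using T by (intro algebraic_int_add_mult algebraic_int_of_nat) auto
    hence "coeff (pderiv T * r) l \<in> S" using r by (intro multS) auto
    hence 3: "coeff (of_nat i * (pderiv T * r)) l \<in> S"
      using S(3)[OF algebraic_int_of_nat] by (simp add: of_nat_poly)
    show "coeff r' l \<in> S" unfolding r'_def using 1 2 3 S(2) add by simp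
  qed
  ultimately show ?case unfolding h_def by blast
qed

lemma fps_of_poly_of_nat: "fps_of_poly (of_nat n) = of_nat n"
  by (induction n) (simp_all add: fps_of_poly_add)

lemma Dit_fps:
  fixes u :: "'i \<Rightarrow> complex fps"
  assumes I: "finite I"
    and u: "\<And>k. k \<in> I \<Longrightarrow> fps_of_poly T * fps_deriv (u k) = (lincomb I (G k) u)"
  shows "fps_of_poly T ^ i * (fps_deriv ^^ i) (lincomb I b u) =
     (lincomb I (Dit T G I i b) u)"
proof (induction i)
  case (Suc i)
  define h where "h = (lincomb I b u)"
  define T' where "T' = fps_of_poly T"
  define W where "W = T' ^ i * (fps_deriv ^^ i) h"
  define d where "d j = fps_of_poly (Dit T G I i b j)" for j
  have "T' ^ Suc i * (fps_deriv ^^ Suc i) h = T' * fps_deriv W - of_nat i * fps_deriv T' * W"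
  proof -
    have "T' * fps_deriv (T' ^ i) = of_nat i * fps_deriv T' * T' ^ i"
      by (induction i) (simp_all add: algebra_simps del: fps_deriv_power)
    moreover have "T' * fps_deriv W = (T' * fps_deriv (T' ^ i)) * (fps_deriv ^^ i) h + T' ^ Suc i * fps_deriv ((fps_deriv ^^ i) h)"
      unfolding W_def fps_deriv_mult by (simp add: distrib_left mult_ac del: fps_deriv_power)
    ultimately have "T' * fps_deriv W = of_nat i * fps_deriv T' * W + T' ^ Suc i * fps_deriv ((fps_deriv ^^ i) h)"
      by (simp add: W_def mult.assoc del: fps_deriv_power)
    thus ?thesis by simp
  qed
  also have "W = (\<Sum>j\<in>I. d j * u j)" using Suc by (simp add: W_def h_def T'_def d_def)
  also have "T' * fps_deriv (\<Sum>j\<in>I. d j * u j) - of_nat i * fps_deriv T' * (\<Sum>j\<in>I. d j * u j)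
     = (\<Sum>j\<in>I. (T' * fps_deriv (d j) - of_nat i * fps_deriv T' * d j) * u j) + (\<Sum>j\<in>I. d j * (T' * fps_deriv (u j)))"
    by (simp add: fps_deriv_sum sum.distrib sum_subtractf sum_distrib_left algebra_simps)
  also have "(\<Sum>j\<in>I. d j * (T' * fps_deriv (u j))) = (\<Sum>j\<in>I. d j * (lincomb I (G j) u))"
    by (simp add: u T'_def)
  also have "\<dots> = (\<Sum>k\<in>I. \<Sum>j\<in>I. d j * fps_of_poly (G j k) * u k)"
    by (subst sum.swap) (simp add: sum_distrib_left mult.assoc)
  also have "(\<Sum>j\<in>I. (T' * fps_deriv (d j) - of_nat i * fps_deriv T' * d j) * u j) + \<dots>
     = (\<Sum>j\<in>I. fps_of_poly (Dit T G I (Suc i) b j) * u j)"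
    by (simp add: sum.distrib[symmetric] fps_of_poly_add fps_of_poly_diff fps_of_poly_mult fps_of_poly_sum
        fps_of_poly_pderiv fps_of_poly_of_nat d_def T'_def algebra_simps sum_distrib_left sum_distrib_right)
  finally show ?case by (simp add: h_def T'_def)
qed simp

section \<open>Lattices of algebraic integers closed under multiplication\<close>

interpretation Zmod: Modules.module "\<lambda>(n::int) (x::complex). of_int n * x"
  by unfold_locales (auto simp: algebra_simps)

interpretation Qvec: Vector_Spaces.vector_space "\<lambda>(q::rat) (x::complex). of_rat q * x"
  by unfold_locales (auto simp: algebra_simps of_rat_add of_rat_mult)

declare Zmod.scale_scale [simp del] Qvec.scale_scale [simp del]

lemma Zspan_mult:
  assumes AB: "\<And>a b. a \<in> A \<Longrightarrow> b \<in> B \<Longrightarrow> a * b \<in> Zmod.span C"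
    and x: "x \<in> Zmod.span A" and y: "y \<in> Zmod.span B"
  shows "x * y \<in> Zmod.span C"
proof -
  have "a * y \<in> Zmod.span C" if a: "a \<in> A" for a
    using y
  proof (induction rule: Zmod.span_induct_alt)
    case (step c x z)
    have "of_int c * (a * x) + a * z \<in> Zmod.span C"
      by (intro Zmod.span_add Zmod.span_scale AB a step)
    thus ?case by (simp add: algebra_simps)
  qed (use Zmod.span_zero in auto)
  note * = this
  show ?thesis
    using x
  proof (induction rule: Zmod.span_induct_alt)
    case (step c x z)
    have "of_int c * (x * y) + z * y \<in> Zmod.span C"
      by (intro Zmod.span_add Zmod.span_scale * step)
    thus ?case by (simp add: algebra_simps)
  qed (use Zmod.span_zero in auto)
qed

lemma Zspan_powers:
  assumes "x ^ n = (\<Sum>i<n. of_int (c i) * x ^ i)"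
  shows "x ^ m \<in> Zmod.span ((\<lambda>i. x ^ i) ` {..<n})"
proof (induction m rule: less_induct)
  case (less m)
  show ?case
  proof (cases "m < n")
    case True
    thus ?thesis by (intro Zmod.span_base) auto
  next
    case False
    hence "x ^ m = x ^ (m - n) * x ^ n" by (simp add: power_add[symmetric])
    also have "\<dots> = (\<Sum>i<n. of_int (c i) * x ^ (m - n + i))"
      unfolding assms by (simp add: sum_distrib_left power_add algebra_simps)
    also have "\<dots> \<in> Zmod.span ((\<lambda>i. x ^ i) ` {..<n})"
      using False by (intro Zmod.span_sum Zmod.span_scale less) auto
    finally show ?thesis .
  qed
qed

text \<open>The ring generated by finitely many algebraic integers is a finitely generated module:
  adjoining a root a of a monic equation of degree n multiplies the generators by a^i, i <
  n.\<close>

lemma finite_ring_span: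
  assumes "finite A" "\<And>a. a \<in> A \<Longrightarrow> algebraic_int a"
  shows "\<exists>B. finite B \<and> 1 \<in> B \<and> (\<forall>b\<in>B. algebraic_int b) \<and> A \<subseteq> Zmod.span B \<and>
    (\<forall>b\<in>B. \<forall>b'\<in>B. b * b' \<in> Zmod.span B)"
  using assms
proof (induction A rule: finite_induct)
  case empty
  show ?case by (intro exI[of _ "{1}"]) (auto intro: Zmod.span_base)
next
  case (insert a A)
  have "\<exists>B. finite B \<and> 1 \<in> B \<and> (\<forall>b\<in>B. algebraic_int b) \<and> A \<subseteq> Zmod.span B \<and>
    (\<forall>b\<in>B. \<forall>b'\<in>B. b * b' \<in> Zmod.span B)"
    by (rule insert.IH) (simp add: insert.prems)
  then obtain B where B: "finite B" "1 \<in> B" "\<And>b. b \<in> B \<Longrightarrow> algebraic_int b" "A \<subseteq> Zmod.span B"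
    "\<And>b b'. b \<in> B \<Longrightarrow> b' \<in> B \<Longrightarrow> b * b' \<in> Zmod.span B" by blast
  have aI: "algebraic_int a" using insert by auto
  obtain n :: nat and c where n: "n > 0" "a ^ n = (\<Sum>i<n. of_int (c i) * a ^ i)"
    using algebraic_int_reduce[OF aI] by metis
  define B' where "B' = (\<lambda>(b,i). b * a ^ i) ` (B \<times> {..<n})"
  have mem: "b * a ^ i \<in> Zmod.span B'" if "b \<in> Zmod.span B" for b i
  proof (rule Zspan_mult[OF _ that Zspan_powers[OF n(2)]])
    fix x y assume "x \<in> B" "y \<in> (\<lambda>i. a ^ i) ` {..<n}"
    thus "x * y \<in> Zmod.span B'" unfolding B'_def by (intro Zmod.span_base) auto
  qed
  have "finite B'" using B(1) by (simp add: B'_def)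
  moreover have "1 \<in> B'" unfolding B'_def by (rule image_eqI[of _ _ "(1,0)"]) (use B(2) n(1) in auto)
  moreover have "\<forall>b\<in>B'. algebraic_int b"
    unfolding B'_def using B(3) aI by (auto intro!: algebraic_int_add_mult(2) algebraic_int_power)
  moreover have "insert a A \<subseteq> Zmod.span B'"
  proof
    fix x assume "x \<in> insert a A"
    thus "x \<in> Zmod.span B'"
      using mem[of 1 1] mem[of x 0] B(2,4) by (auto intro: Zmod.span_base)
  qed
  moreover have "\<forall>b\<in>B'. \<forall>b'\<in>B'. b * b' \<in> Zmod.span B'"
  proof (intro ballI)
    fix x y assume "x \<in> B'" "y \<in> B'"
    then obtain b i b' i' where "x = b * a ^ i" "y = b' * a ^ i'" "b \<in> B" "b' \<in> B"
      unfolding B'_def by auto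
    thus "x * y \<in> Zmod.span B'" using mem[OF B(5), of b b' "i + i'"] by (simp add: power_add mult_ac)
  qed
  ultimately show ?case by blast
qed

lemma common_denominator:
  assumes "finite (Q :: rat set)"
  shows "\<exists>N::nat. N > 0 \<and> (\<forall>q\<in>Q. \<exists>z::int. of_nat N * q = of_int z)"
  using assms
proof (induction Q rule: finite_induct)
  case empty
  show ?case by (intro exI[of _ 1]) auto
next
  case (insert q Q)
  then obtain N :: nat where N: "N > 0" "\<forall>q\<in>Q. \<exists>z::int. of_nat N * q = of_int z" by blast
  obtain a b where ab: "q = of_int a / of_int b" "b > 0"
    by (metis quotient_of_denom_pos quotient_of_div surj_pair)
  show ?case
  proof (intro exI[of _ "N * nat b"] conjI ballI)
    fix x assume x: "x \<in> insert q Q"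
    show "\<exists>z::int. of_nat (N * nat b) * x = of_int z"
    proof (cases "x = q")
      case True
      thus ?thesis using ab by (intro exI[of _ "int N * a"]) simp
    next
      case False
      then obtain z :: int where "of_nat N * x = of_int z" using N(2) x by blast
      hence "of_nat (N * nat b) * x = of_int (z * b)" using ab(2) by (simp add: mult_ac)
      thus ?thesis by blast
    qed
  qed (use N ab in auto)
qed

text \<open>A rational basis \<open>B1\<close> is chosen among module generators of the ring
  generated by integral multiples of A, then scaled by a common denominator N of its structure
  constants; since (N x) (N y) = N (N x y), the scaled basis has integer structure constants. Linear
  independence ensures later that a non-zero integer solution gives a non-zero row.\<close>

lemma order_exists:
  assumes "finite A" "A \<subseteq> Qbar"
  shows "\<exists>B (t::nat). finite B \<and> B \<noteq> {} \<and> (\<forall>b\<in>B. algebraic_int b) \<and>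
    (\<forall>b\<in>B. \<forall>b'\<in>B. b * b' \<in> Zmod.span B) \<and> t > 0 \<and> (\<forall>a\<in>A. of_nat t * a \<in> Zmod.span B) \<and>
    (\<forall>c. (\<Sum>b\<in>B. of_int (c b) * b) = 0 \<longrightarrow> (\<forall>b\<in>B. c b = 0))"
proof -
  have "\<exists>d::nat. d > 0 \<and> algebraic_int (of_nat d * a)" if "a \<in> A" for a
    using that assms(2) by (auto simp: Qbar_iff)
  then obtain d :: "complex \<Rightarrow> nat" where d: "\<And>a. a \<in> A \<Longrightarrow> d a > 0 \<and> algebraic_int (of_nat (d a) * a)" by metis
  define A' where "A' = (\<lambda>a. of_nat (d a) * a) ` A"
  have "finite A'" "\<And>a. a \<in> A' \<Longrightarrow> algebraic_int a" using assms d by (auto simp: A'_def)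
  from finite_ring_span[OF this] obtain B0 where B0: "finite B0" "1 \<in> B0" "\<And>b. b \<in> B0 \<Longrightarrow> algebraic_int b"
    "A' \<subseteq> Zmod.span B0" "\<And>b b'. b \<in> B0 \<Longrightarrow> b' \<in> B0 \<Longrightarrow> b * b' \<in> Zmod.span B0" by blast
  have ZQ: "Zmod.span S \<subseteq> Qvec.span S" for S
  proof
    fix x assume "x \<in> Zmod.span S"
    thus "x \<in> Qvec.span S"
    proof (induction rule: Zmod.span_induct_alt)
      case base
      show ?case by (rule Qvec.span_zero)
    next
      case (step c x y)
      have "of_rat (of_int c) * x + y \<in> Qvec.span S"
        by (intro Qvec.span_add Qvec.span_scale Qvec.span_base step)
      thus ?case by simp
    qed
  qed
  obtain B1 where B1: "B1 \<subseteq> B0" "Qvec.independent B1" "B0 \<subseteq> Qvec.span B1"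
    using Qvec.maximal_independent_subset[of B0] by blast
  have fB1: "finite B1" using B1(1) B0(1) by (rule finite_subset)
  have spanB1: "Qvec.span B0 \<subseteq> Qvec.span B1"
    using B1(3) by (metis Qvec.span_minimal Qvec.subspace_span)
  have rep: "\<exists>q. x = (\<Sum>v\<in>B1. of_rat (q v) * v)" if "x \<in> Qvec.span B0" for x
    using that spanB1 Qvec.span_finite[OF fB1] by auto
  have ex: "\<exists>q. b \<in> B1 \<longrightarrow> b' \<in> B1 \<longrightarrow> b * b' = (\<Sum>v\<in>B1. of_rat (q v) * v)" for b b'
  proof (cases "b \<in> B1 \<and> b' \<in> B1")
    case True
    hence "b * b' \<in> Qvec.span B0" using B0(5) B1(1) ZQ by blast
    thus ?thesis using rep by blast
  qed auto
  define q where "q p = (SOME q. fst p \<in> B1 \<longrightarrow> snd p \<in> B1 \<longrightarrow> fst p * snd p = (\<Sum>v\<in>B1. of_rat (q v) * v))" for p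
  have q: "b * b' = (\<Sum>v\<in>B1. of_rat (q (b, b') v) * v)" if "b \<in> B1" "b' \<in> B1" for b b'
    using someI_ex[OF ex[of b b']] that by (simp add: q_def)
  have "finite ((\<lambda>(b,b',v). q (b,b') v) ` (B1 \<times> B1 \<times> B1))" using fB1 by simp
  from common_denominator[OF this] obtain N :: nat where N: "N > 0"
    "\<forall>x\<in>(\<lambda>(b,b',v). q (b,b') v) ` (B1 \<times> B1 \<times> B1). \<exists>z::int. of_nat N * x = of_int z" by blast
  define B where "B = (\<lambda>b. of_nat N * b) ` B1"
  have inj: "inj_on (\<lambda>b::complex. of_nat N * b) B1" using N(1) by (auto simp: inj_on_def)
  have Bsum: "(\<Sum>b\<in>B. f b) = (\<Sum>v\<in>B1. f (of_nat N * v))" for f :: "complex \<Rightarrow> complex"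
    unfolding B_def by (subst sum.reindex[OF inj]) simp
  have "\<forall>a\<in>A. \<exists>q. a = (\<Sum>v\<in>B1. of_rat (q v) * v)"
  proof
    fix a assume a: "a \<in> A"
    have "of_nat (d a) * a \<in> Zmod.span B0" using B0(4) a by (auto simp: A'_def)
    then obtain q where q: "of_nat (d a) * a = (\<Sum>v\<in>B1. of_rat (q v) * v)" using rep ZQ by blast
    have "a = (\<Sum>v\<in>B1. of_rat (q v / of_nat (d a)) * v)"
      using d[OF a] q by (simp add: of_rat_divide sum_divide_distrib[symmetric] field_simps)
    thus "\<exists>q. a = (\<Sum>v\<in>B1. of_rat (q v) * v)" by (intro exI[of _ "\<lambda>v. q v / of_nat (d a)"])
  qed
  then obtain w where w: "\<And>a. a \<in> A \<Longrightarrow> a = (\<Sum>v\<in>B1. of_rat (w a v) * v)" by metis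
  have "finite ((\<lambda>(a,v). w a v / of_nat N) ` (A \<times> B1))" using assms fB1 by simp
  from common_denominator[OF this] obtain t :: nat where t: "t > 0"
    "\<forall>x\<in>(\<lambda>(a,v). w a v / of_nat N) ` (A \<times> B1). \<exists>z::int. of_nat t * x = of_int z" by blast
  have Nc: "complex_of_nat N \<noteq> 0" using N(1) by simp
  show ?thesis
  proof (intro exI[of _ B] exI[of _ t] conjI ballI allI impI)
    show "finite B" using fB1 by (simp add: B_def)
    have "B1 \<noteq> {}"
    proof
      assume "B1 = {}"
      hence "(1::complex) \<in> Qvec.span {}" using B1(3) B0(2) by auto
      thus False by (simp add: Qvec.span_empty)
    qed
    thus "B \<noteq> {}" by (simp add: B_def)
    show "algebraic_int b" if "b \<in> B" for b
      using that B0(3) B1(1) by (auto simp: B_def intro!: algebraic_int_add_mult(2) algebraic_int_of_nat)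
    show "b * b' \<in> Zmod.span B" if "b \<in> B" "b' \<in> B" for b b'
    proof -
      obtain x y where xy: "b = of_nat N * x" "b' = of_nat N * y" "x \<in> B1" "y \<in> B1"
        using \<open>b \<in> B\<close> \<open>b' \<in> B\<close> by (auto simp: B_def)
      have "b * b' = of_nat N * of_nat N * (x * y)" by (simp add: xy)
      also have "\<dots> = (\<Sum>v\<in>B1. of_rat (of_nat N * q (x,y) v) * (of_nat N * v))"
        by (simp add: q[OF xy(3,4)] sum_distrib_left of_rat_mult algebra_simps)
      also have "\<dots> \<in> Zmod.span B"
      proof (rule Zmod.span_sum)
        fix v assume v: "v \<in> B1"
        from v obtain z :: int where "of_nat N * q (x,y) v = of_int z" using bspec[OF N(2), of "q (x,y) v"] xy v by force
        moreover have "of_int z * (of_nat N * v) \<in> Zmod.span B"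
          using v by (intro Zmod.span_scale Zmod.span_base) (auto simp: B_def)
        ultimately show "of_rat (of_nat N * q (x,y) v) * (of_nat N * v) \<in> Zmod.span B" by simp
      qed
      finally show ?thesis .
    qed
    show "t > 0" by (rule t)
    show "of_nat t * a \<in> Zmod.span B" if a: "a \<in> A" for a
    proof -
      have "of_nat t * a = (\<Sum>v\<in>B1. of_rat (of_nat t * (w a v / of_nat N)) * (of_nat N * v))"
        using Nc by (subst w[OF a]) (simp add: sum_distrib_left of_rat_mult of_rat_divide field_simps)
      also have "\<dots> \<in> Zmod.span B"
      proof (rule Zmod.span_sum)
        fix v assume v: "v \<in> B1"
        obtain z :: int where z: "of_nat t * (w a v / of_nat N) = of_int z" using bspec[OF t(2), of "w a v / of_nat N"] a v by force
        have "of_int z * (of_nat N * v) \<in> Zmod.span B"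
          using v by (intro Zmod.span_scale Zmod.span_base) (auto simp: B_def)
        thus "of_rat (of_nat t * (w a v / of_nat N)) * (of_nat N * v) \<in> Zmod.span B" unfolding z by simp
      qed
      finally show ?thesis .
    qed
    fix c b assume c: "(\<Sum>b\<in>B. of_int (c b) * b) = 0" and b: "b \<in> B"
    obtain v where v: "v \<in> B1" "b = of_nat N * v" using b by (auto simp: B_def)
    have "(\<Sum>v\<in>B1. of_rat (of_int (c (of_nat N * v)) * of_nat N) * v) = 0"
      using c by (simp add: Bsum of_rat_mult mult.assoc)
    hence "of_int (c (of_nat N * v)) * (of_nat N :: rat) = 0"
      using Qvec.independentD[OF B1(2) fB1 order_refl, of "\<lambda>v. of_int (c (of_nat N * v)) * of_nat N"] v(1) by blast
    thus "c b = 0" using N(1) v by simp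
  qed
qed

text \<open>A height on the lattice spanned by B, read off integer coordinates: with it, Siegel's
  lemma over the integers applies coordinate by coordinate to algebraic unknowns.\<close>

definition bd :: "complex set \<Rightarrow> nat \<Rightarrow> complex \<Rightarrow> bool" where
  "bd B M x \<longleftrightarrow> (\<exists>c. x = (\<Sum>b\<in>B. of_int (c b) * b) \<and> (\<forall>b\<in>B. \<bar>c b\<bar> \<le> int M))"

lemma bd_mono: "bd B M x \<Longrightarrow> M \<le> M' \<Longrightarrow> bd B M' x"
  unfolding bd_def by (elim exE, rule_tac x = c in exI) force

lemma bd_0 [simp, intro]: "bd B M 0"
  unfolding bd_def by (intro exI[of _ "\<lambda>_. 0"]) auto

lemma bd_add: "bd B M x \<Longrightarrow> bd B M' y \<Longrightarrow> bd B (M + M') (x + y)"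
proof -
  assume "bd B M x" "bd B M' y"
  then obtain c c' where "x = (\<Sum>b\<in>B. of_int (c b) * b)" "\<forall>b\<in>B. \<bar>c b\<bar> \<le> int M"
    "y = (\<Sum>b\<in>B. of_int (c' b) * b)" "\<forall>b\<in>B. \<bar>c' b\<bar> \<le> int M'" unfolding bd_def by blast
  note c = this
  show ?thesis unfolding bd_def
  proof (intro exI[of _ "\<lambda>b. c b + c' b"] conjI ballI)
    show "x + y = (\<Sum>b\<in>B. of_int (c b + c' b) * b)"
      by (simp add: c(1,3) sum.distrib distrib_right)
    fix b assume "b \<in> B"
    hence "\<bar>c b\<bar> \<le> int M" "\<bar>c' b\<bar> \<le> int M'" using c(2,4) by auto
    thus "\<bar>c b + c' b\<bar> \<le> int (M + M')" by simp
  qed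
qed

lemma bd_of_int: "bd B M x \<Longrightarrow> bd B (nat \<bar>z\<bar> * M) (of_int z * x)"
proof -
  assume "bd B M x"
  then obtain c where "x = (\<Sum>b\<in>B. of_int (c b) * b)" "\<forall>b\<in>B. \<bar>c b\<bar> \<le> int M" unfolding bd_def by blast
  note c = this
  show ?thesis unfolding bd_def
  proof (intro exI[of _ "\<lambda>b. z * c b"] conjI ballI)
    show "of_int z * x = (\<Sum>b\<in>B. of_int (z * c b) * b)"
      by (simp add: c(1) sum_distrib_left mult.assoc)
    fix b assume "b \<in> B"
    hence "\<bar>z\<bar> * \<bar>c b\<bar> \<le> \<bar>z\<bar> * int M" using c(2) by (intro mult_left_mono) auto
    thus "\<bar>z * c b\<bar> \<le> int (nat \<bar>z\<bar> * M)" by (simp add: abs_mult)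
  qed
qed

lemma bd_of_nat: "bd B M x \<Longrightarrow> bd B (n * M) (of_nat n * x)"
  using bd_of_int[of B M x "int n"] by simp

lemma bd_minus: "bd B M x \<Longrightarrow> bd B M (- x)"
  using bd_of_int[of B M x "-1"] by simp

lemma bd_diff: "bd B M x \<Longrightarrow> bd B M' y \<Longrightarrow> bd B (M + M') (x - y)"
  using bd_add[of B M x M' "- y"] bd_minus[of B M' y] by simp

lemma bd_sum: "(\<And>i. i \<in> A \<Longrightarrow> bd B M (f i)) \<Longrightarrow> bd B (card A * M) (\<Sum>i\<in>A. f i)"
  by (induction A rule: infinite_finite_induct) (auto intro: bd_add)

lemma bd_base: "finite B \<Longrightarrow> b \<in> B \<Longrightarrow> bd B 1 b"
  unfolding bd_def
  by (intro exI[of _ "\<lambda>x. if x = b then 1 else 0"]) (auto simp: if_distrib if_distribR sum.delta cong: if_cong)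

lemma bd_combination:
  "(\<And>b. b \<in> B \<Longrightarrow> \<bar>c b\<bar> \<le> int M) \<Longrightarrow> bd B M (\<Sum>b\<in>B. of_int (c b) * b)"
  unfolding bd_def by blast

lemma Zspan_bd: "finite B \<Longrightarrow> x \<in> Zmod.span B \<Longrightarrow> \<exists>M. bd B M x"
proof -
  assume B: "finite B" and x: "x \<in> Zmod.span B"
  then obtain c where c: "x = (\<Sum>b\<in>B. of_int (c b) * b)" by (auto simp: Zmod.span_finite)
  have "\<bar>c b\<bar> \<le> int (nat (\<Sum>b\<in>B. \<bar>c b\<bar>))" if "b \<in> B" for b
    using member_le_sum[OF that _ B, of "\<lambda>b. \<bar>c b\<bar>"] by (simp add: sum_nonneg)
  thus ?thesis using c unfolding bd_def by blast
qed

lemma finite_uniform_bd: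
  assumes "finite A" "\<And>a. a \<in> A \<Longrightarrow> \<exists>M. bd B M (f a)"
  shows "\<exists>M>0. \<forall>a\<in>A. bd B M (f a)"
proof -
  obtain M where M: "\<And>a. a \<in> A \<Longrightarrow> bd B (M a) (f a)" using assms(2) by metis
  have "bd B (Suc (\<Sum>a\<in>A. M a)) (f a)" if "a \<in> A" for a
    using M[OF that] by (rule bd_mono) (simp add: member_le_sum[OF that _ assms(1)] le_SucI)
  thus ?thesis by blast
qed

lemma bd_algebraic_int:
  "(\<And>b. b \<in> B \<Longrightarrow> algebraic_int b) \<Longrightarrow> bd B M x \<Longrightarrow> algebraic_int x"
  unfolding bd_def by (auto intro!: algebraic_int_sum algebraic_int_add_mult(2) algebraic_int_of_int)

text \<open>The constant \<kappa> comes from the structure constants of B alone; the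
  \<open>Suc\<close> makes it positive.\<close>

lemma bd_mult_const:
  assumes B: "finite B" "\<And>b b'. b \<in> B \<Longrightarrow> b' \<in> B \<Longrightarrow> b * b' \<in> Zmod.span B"
  shows "\<exists>\<kappa>>0. \<forall>M M' x y. bd B M x \<longrightarrow> bd B M' y \<longrightarrow> bd B (\<kappa> * M * M') (x * y)"
proof -
  have "\<exists>K>0. \<forall>p\<in>B \<times> B. bd B K (fst p * snd p)"
    using B by (intro finite_uniform_bd Zspan_bd) auto
  then obtain K where K: "K > 0" "\<And>b b'. b \<in> B \<Longrightarrow> b' \<in> B \<Longrightarrow> bd B K (b * b')" by fastforce
  have "bd B (Suc (card (B \<times> B) * K) * M * M') (x * y)" if "bd B M x" "bd B M' y" for M M' x y
  proof -
    obtain c c' where c: "x = (\<Sum>b\<in>B. of_int (c b) * b)" "\<forall>b\<in>B. \<bar>c b\<bar> \<le> int M"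
      "y = (\<Sum>b\<in>B. of_int (c' b) * b)" "\<forall>b\<in>B. \<bar>c' b\<bar> \<le> int M'"
      using \<open>bd B M x\<close> \<open>bd B M' y\<close> unfolding bd_def by blast
    have e: "x * y = (\<Sum>p\<in>B\<times>B. of_int (c (fst p) * c' (snd p)) * (fst p * snd p))"
      unfolding c(1,3) sum_product sum.cartesian_product by (intro sum.cong) (auto simp: mult_ac)
    have "bd B (card (B \<times> B) * (M * M' * K)) (x * y)"
      unfolding e
    proof (rule bd_sum)
      fix p assume p: "p \<in> B \<times> B"
      have "nat \<bar>c (fst p) * c' (snd p)\<bar> \<le> M * M'"
        using p c(2,4) by (auto simp: nat_le_iff abs_mult intro!: mult_mono)
      hence "nat \<bar>c (fst p) * c' (snd p)\<bar> * K \<le> M * M' * K" by simp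
      moreover have "bd B K (fst p * snd p)" using K(2) p by auto
      ultimately show "bd B (M * M' * K) (of_int (c (fst p) * c' (snd p)) * (fst p * snd p))"
        by (intro bd_mono[OF bd_of_int])
    qed
    thus ?thesis by (rule bd_mono) (simp add: mult_ac)
  qed
  thus ?thesis by (intro exI[of _ "Suc (card (B \<times> B) * K)"]) auto
qed

section \<open>Linearity and size of the derived rows\<close>

lemma Dit_add_smult:
  "Dit T G I i (\<lambda>j. Polynomial.smult x (b j) + c j) =
     (\<lambda>j. Polynomial.smult x (Dit T G I i b j) + Dit T G I i c j)"
proof (induction i)
  case (Suc i)
  show ?case
    unfolding Dit.simps Suc
    by (rule ext) (simp add: pderiv_add pderiv_smult algebra_simps smult_add_right smult_diff_right sum.distrib
        smult_sum2 distrib_left distrib_right)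
qed simp

lemma Dit_zero: "Dit T G I i (\<lambda>j. 0) = (\<lambda>j. 0)"
  by (induction i) auto

lemma Dit_sum_smult:
  "finite U \<Longrightarrow> Dit T G I i (\<lambda>j. \<Sum>u\<in>U. Polynomial.smult (x u) (b u j)) =
     (\<lambda>j. \<Sum>u\<in>U. Polynomial.smult (x u) (Dit T G I i (b u) j))"
  by (induction U rule: finite_induct) (simp_all add: Dit_zero Dit_add_smult)

definition pbd :: "complex set \<Rightarrow> nat \<Rightarrow> nat \<Rightarrow> complex poly \<Rightarrow> bool" where
  "pbd B M D p \<longleftrightarrow> (\<forall>i. bd B M (coeff p i)) \<and> degree p \<le> D"

lemma pbd_mono: "pbd B M D p \<Longrightarrow> M \<le> M' \<Longrightarrow> D \<le> D' \<Longrightarrow> pbd B M' D' p"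
  unfolding pbd_def by (meson bd_mono order_trans)

lemma pbd_add: "pbd B M D p \<Longrightarrow> pbd B M' D q \<Longrightarrow> pbd B (M + M') D (p + q)"
  unfolding pbd_def by (auto intro: bd_add degree_add_le)

lemma pbd_diff: "pbd B M D p \<Longrightarrow> pbd B M' D q \<Longrightarrow> pbd B (M + M') D (p - q)"
  unfolding pbd_def by (auto intro: bd_diff degree_diff_le)

lemma pbd_sum: "(\<And>k. k \<in> A \<Longrightarrow> pbd B M D (f k)) \<Longrightarrow> pbd B (card A * M) D (\<Sum>k\<in>A. f k)"
  unfolding pbd_def
  by (cases "finite A") (auto simp: coeff_sum intro: bd_sum degree_sum_le)

lemma pbd_of_nat: "pbd B M D p \<Longrightarrow> pbd B (n * M) D (of_nat n * p)"
  unfolding pbd_def by (auto simp: of_nat_poly intro: bd_of_nat)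

lemma pbd_pderiv: "pbd B M D p \<Longrightarrow> pbd B (D * M) D (pderiv p)"
  unfolding pbd_def
proof (intro conjI allI; elim conjE)
  assume p: "\<forall>i. bd B M (coeff p i)" "degree p \<le> D"
  show "degree (pderiv p) \<le> D" using p(2) degree_pderiv[of p] by simp
  fix i
  show "bd B (D * M) (coeff (pderiv p) i)"
  proof (cases "Suc i \<le> D")
    case True
    have "bd B (Suc i * M) (of_nat (Suc i) * coeff p (Suc i))" using p by (intro bd_of_nat) auto
    thus ?thesis unfolding coeff_pderiv by (rule bd_mono) (rule mult_le_mono1[OF True])
  next
    case False
    hence "coeff p (Suc i) = 0" using p(2) by (intro coeff_eq_0) auto
    thus ?thesis unfolding coeff_pderiv by simp
  qed
qed

lemma pbd_mult:
  assumes \<kappa>: "\<And>M M' x y. bd B M x \<Longrightarrow> bd B M' y \<Longrightarrow> bd B (\<kappa> * M * M') (x * y)"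
    and p: "pbd B M s p" and q: "pbd B M' D q"
  shows "pbd B (Suc s * (\<kappa> * M * M')) (s + D) (p * q)"
  unfolding pbd_def
proof (intro conjI allI)
  show "degree (p * q) \<le> s + D"
    using p q degree_mult_le[of p q] unfolding pbd_def by linarith
  fix i
  have "coeff (p * q) i = (\<Sum>a\<in>{..i} \<inter> {..s}. coeff p a * coeff q (i - a))"
    unfolding coeff_mult
    by (rule sum.mono_neutral_right) (use p in \<open>auto simp: pbd_def intro!: coeff_eq_0\<close>)
  moreover have "bd B (card ({..i} \<inter> {..s}) * (\<kappa> * M * M')) (\<Sum>a\<in>{..i} \<inter> {..s}. coeff p a * coeff q (i - a))"
    by (intro bd_sum \<kappa>) (use p q in \<open>auto simp: pbd_def\<close>)
  moreover have "card ({..i} \<inter> {..s}) \<le> Suc s"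
    using card_mono[of "{..s}" "{..i} \<inter> {..s}"] by simp
  ultimately show "bd B (Suc s * (\<kappa> * M * M')) (coeff (p * q) i)"
    by (metis bd_mono mult_le_mono1)
qed

lemma pbd_poly_1: "pbd B M D p \<Longrightarrow> bd B (Suc D * M) (poly p 1)"
proof -
  assume p: "pbd B M D p"
  have "poly p 1 = (\<Sum>i\<le>degree p. coeff p i)" by (simp add: poly_altdef)
  moreover have "bd B (card {..degree p} * M) (\<Sum>i\<le>degree p. coeff p i)"
    by (intro bd_sum) (use p in \<open>auto simp: pbd_def\<close>)
  ultimately show ?thesis using p
    by (metis bd_mono card_atMost mult_le_mono1 pbd_def Suc_le_mono)
qed

text \<open>One derivation multiplies coordinates by at most a constant times a quantity linear in
  the current degree, which grows by s per step. Bounding it by its value for the last index k makes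
  the estimate a pure power. The rows start with coordinates at most 1 because they will be elements
  of B times powers of z.\<close>

lemma Dit_bound:
  assumes I: "finite I"
    and \<kappa>: "\<And>M M' x y. bd B M x \<Longrightarrow> bd B M' y \<Longrightarrow> bd B (\<kappa> * M * M') (x * y)"
    and T: "pbd B M s T" and G: "\<And>i j. i \<in> I \<Longrightarrow> j \<in> I \<Longrightarrow> pbd B M s (G i j)"
    and b: "\<And>j. j \<in> I \<Longrightarrow> pbd B 1 D (b j)"
    and C: "C = Suc s * \<kappa> * M * (1 + s + card I)" and i: "i \<le> k" and j: "j \<in> I"
  shows "pbd B ((C * (D + k * (s + 1) + 1)) ^ i) (D + i * s) (Dit T G I i b j)"
  using i j
proof (induction i arbitrary: j)
  case 0
  thus ?case using b by simp
next
  case (Suc i)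
  define A where "A = C * (D + k * (s + 1) + 1)"
  define N where "N = A ^ i"
  define D' where "D' = D + i * s"
  define c where "c = Suc s * \<kappa> * M"
  have IH: "pbd B N D' (Dit T G I i b j)" if "j \<in> I" for j
    using Suc that unfolding N_def A_def D'_def by simp
  have 1: "pbd B (c * (D' * N)) (s + D') (T * pderiv (Dit T G I i b j))"
    using pbd_mult[OF \<kappa> T pbd_pderiv[OF IH[OF Suc.prems(2)]]] by (simp add: c_def mult_ac)
  have "pbd B (Suc s * (\<kappa> * (s * M) * N)) (s + D') (pderiv T * Dit T G I i b j)"
    by (rule pbd_mult[OF \<kappa> pbd_pderiv[OF T] IH[OF Suc.prems(2)]])
  from pbd_of_nat[OF this, of i]
  have 2: "pbd B (c * (i * s * N)) (s + D') (of_nat i * (pderiv T * Dit T G I i b j))"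
    by (simp only: c_def mult_ac)
  have "pbd B (c * N) (s + D') (Dit T G I i b k' * G k' j)" if "k' \<in> I" for k'
    using pbd_mult[OF \<kappa> G[OF that Suc.prems(2)] IH[OF that]] by (simp add: c_def mult_ac)
  hence 3: "pbd B (card I * (c * N)) (s + D') (\<Sum>k'\<in>I. Dit T G I i b k' * G k' j)"
    by (rule pbd_sum)
  have le: "c * (D' * N) + c * (i * s * N) + card I * (c * N) \<le> A ^ Suc i"
  proof -
    have ik: "i * s \<le> k * s" using Suc.prems by (intro mult_le_mono1) simp
    have "D' + i * s + card I \<le> D + (k * s + k * s) + card I" using ik unfolding D'_def by linarith
    also have "\<dots> \<le> (1 + s + card I) * (D + k * (s + 1) + 1)"
    proof -
      have "k \<ge> 1" using Suc.prems by simp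
      hence "k * s \<le> s * (D + k * (s + 1) + 1)" "card I \<le> card I * (D + k * (s + 1) + 1)"
        by (auto simp: algebra_simps)
      moreover have "(1 + s + card I) * (D + k * (s + 1) + 1) =
        (D + k * (s + 1) + 1) + s * (D + k * (s + 1) + 1) + card I * (D + k * (s + 1) + 1)"
        by (simp add: algebra_simps)
      moreover have "D + k * s \<le> D + k * (s + 1) + 1" by simp
      ultimately show ?thesis by linarith
    qed
    finally have "c * N * (D' + i * s + card I) \<le> c * N * ((1 + s + card I) * (D + k * (s + 1) + 1))"
      by (rule mult_le_mono2)
    also have "\<dots> = A * N"
    proof -
      have "A = c * ((1 + s + card I) * (D + k * (s + 1) + 1))"
        unfolding A_def C c_def by (simp only: mult.assoc)
      thus ?thesis by (simp only: mult_ac)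
    qed
    also have "\<dots> = A ^ Suc i" by (simp add: N_def)
    finally show ?thesis by (simp add: algebra_simps)
  qed
  have "pbd B (c * (D' * N) + c * (i * s * N) + card I * (c * N)) (s + D') (Dit T G I (Suc i) b j)"
    using pbd_add[OF pbd_diff[OF 1 2] 3] by (simp add: mult.assoc)
  thus ?case by (rule pbd_mono) (use le in \<open>auto simp: A_def D'_def\<close>)
qed

lemma pbd_exists:
  assumes "finite B" "finite J" "\<And>j i. j \<in> J \<Longrightarrow> coeff (f j) i \<in> Zmod.span B"
  shows "\<exists>M>0. \<exists>s. \<forall>j\<in>J. pbd B M s (f j)"
proof -
  define s where "s = Max (insert 0 ((\<lambda>j. degree (f j)) ` J))"
  have s: "degree (f j) \<le> s" if "j \<in> J" for j unfolding s_def using assms(2) that by (intro Max_ge) auto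
  have "\<exists>M>0. \<forall>p\<in>J \<times> {..s}. bd B M (coeff (f (fst p)) (snd p))"
    using assms by (intro finite_uniform_bd Zspan_bd) auto
  then obtain M where M: "M > 0" "\<And>j i. j \<in> J \<Longrightarrow> i \<le> s \<Longrightarrow> bd B M (coeff (f j) i)" by fastforce
  have "bd B M (coeff (f j) i)" if "j \<in> J" for j i
    using M(2)[OF that, of i] s[OF that] by (cases "i \<le> s") (auto simp: coeff_eq_0)
  thus ?thesis using M(1) s unfolding pbd_def by blast
qed

text \<open>A row \<open>b\<close> of polynomials whose derived rows at 1 are proportional to \<open>l\<close> up to order \<open>k\<close>.
  With weights \<open>t!\<close> on the coefficients of \<open>z\<^sup>t\<close>, Siegel's lemma costs less than the factor \<open>k!\<close>
  which the \<open>k\<close>-fold zero gains, because there are \<open>m - 1\<close> conditions for \<open>m\<close> components.\<close>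

lemma auxiliary_row:
  fixes I :: "'i set" and l :: "'i \<Rightarrow> complex"
  assumes I: "finite I" "p0 \<in> I"
    and B: "finite B" "B \<noteq> {}" "\<And>b. b \<in> B \<Longrightarrow> algebraic_int b"
      "\<And>b b'. b \<in> B \<Longrightarrow> b' \<in> B \<Longrightarrow> b * b' \<in> Zmod.span B"
    and ind: "\<And>c. (\<Sum>b\<in>B. of_int (c b) * b) = 0 \<Longrightarrow> \<forall>b\<in>B. c b = 0"
    and T: "\<And>i. coeff T i \<in> Zmod.span B"
    and G: "\<And>i j a. i \<in> I \<Longrightarrow> j \<in> I \<Longrightarrow> coeff (G i j) a \<in> Zmod.span B"
    and l: "t > 0" "\<And>j. j \<in> I \<Longrightarrow> of_nat t * l j \<in> Zmod.span B" "l p0 = 1"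
    and m: "m = card I" "q = 2 * m" "P = 2 * m * m - m + 1"
  shows "\<exists>C>0. \<forall>r>0. \<exists>b. (\<exists>j\<in>I. b j \<noteq> 0) \<and> (\<forall>j a. a \<ge> q * (P * r) \<longrightarrow> coeff (b j) a = 0) \<and>
    (\<forall>j a. \<exists>\<beta>. coeff (b j) a = fact a * \<beta> \<and> bd B ((C * (P * r)) ^ ((P - 2) * r)) \<beta>) \<and>
    (\<forall>i<P * r. \<forall>j\<in>I. poly (Dit T G I i b j) 1 = l j * poly (Dit T G I i b p0) 1) \<and>
    (\<forall>i a. \<forall>j\<in>I. algebraic_int (coeff (Dit T G I i b j) a))"
proof -
  have m1: "m \<ge> 1" using I m(1) by (metis One_nat_def Suc_leI card_gt_0_iff empty_iff)
  obtain \<kappa> where \<kappa>: "\<kappa> > 0" "\<And>M M' x y. bd B M x \<Longrightarrow> bd B M' y \<Longrightarrow> bd B (\<kappa> * M * M') (x * y)"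
    using bd_mult_const[OF B(1,4)] by blast
  obtain MT sT where MT: "pbd B MT sT T"
    using pbd_exists[OF B(1), of "{()}" "\<lambda>_. T"] T by auto
  have "\<exists>M>0. \<exists>s. \<forall>p\<in>I \<times> I. pbd B M s (G (fst p) (snd p))"
    using pbd_exists[OF B(1), of "I \<times> I" "\<lambda>p. G (fst p) (snd p)"] I G by auto
  then obtain MG sG where MG: "\<And>i j. i \<in> I \<Longrightarrow> j \<in> I \<Longrightarrow> pbd B MG sG (G i j)" by fastforce
  define M where "M = MT + MG + 1"
  define s where "s = sT + sG"
  have T': "pbd B M s T" by (rule pbd_mono[OF MT]) (auto simp: M_def s_def)
  have G': "pbd B M s (G i j)" if "i \<in> I" "j \<in> I" for i j
    by (rule pbd_mono[OF MG[OF that]]) (auto simp: M_def s_def)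
  have "\<exists>M>0. \<forall>j\<in>I. bd B M (of_nat t * l j)"
    by (intro finite_uniform_bd I Zspan_bd B l)
  then obtain Ml where Ml: "\<And>j. j \<in> I \<Longrightarrow> bd B Ml (of_nat t * l j)" by blast
  define c0 where "c0 = Suc s * \<kappa> * M * (1 + s + card I)"
  have c0: "c0 > 0" using \<kappa>(1) by (simp add: c0_def M_def)
  define \<delta> where "\<delta> = card B"
  have \<delta>: "\<delta> > 0" using B by (simp add: \<delta>_def card_gt_0_iff)
  \<comment> \<open>The product \<open>c1\<close> k bounds the cost of one derivation,
    \<open>c2\<close> gathers what does not depend on k, and the 4 in \<open>C\<close> absorbs k^2
    \<le> 4^k.\<close>
  define c1 where "c1 = c0 * (q + s + 2)"
  define c2 where "c2 = 2 * (m * q * \<delta>) * (t + \<kappa> * Ml) * (q + s + 1)"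
  define C where "C = 4 * (c2 + 1) * (c1 + q)"
  have q: "q > 0" using m1 m by simp
  have P: "P \<ge> 2"
  proof -
    have "2 * m * m \<ge> 2 * m" using m1 by simp
    thus ?thesis using m1 unfolding m(3) by linarith
  qed
  have C: "C > 0" using c0 q by (simp add: C_def c1_def)
  show ?thesis
  proof (intro exI[of _ C] conjI C allI impI)
    fix r :: nat assume r: "r > 0"
    \<comment> \<open>Unknowns exceed equations by P k for each element of B, so the exponent in
      Siegel's lemma is (q + 1) k (m - 1) / P. For k a multiple of P it is the integer (P - 2) r,
      because (q + 1) (m - 1) = P - 2.\<close>
    define k where "k = P * r"
    define L where "L = q * k"
    have k: "k > 0" using P r by (simp add: k_def)
    define X where "X = (C * k) ^ ((P - 2) * r)"
    define A where "A = (t + \<kappa> * Ml) * (fact L * (Suc (L + k * s) * (c0 * (L + k * (s + 1) + 1)) ^ k))"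
    define U where "U = I \<times> {..<L} \<times> B"
    define E where "E = {..<k} \<times> (I - {p0}) \<times> B"
    have fU: "finite U" and fE: "finite E" using I B by (auto simp: U_def E_def)
    \<comment> \<open>The unknown with index (j', a, v) is the integer coordinate along v of the
      coefficient of z^a in component j', once the weight a!, kept in \<open>fu\<close>, is
      removed.\<close>
    define bu where "bu = (\<lambda>(j' :: 'i, a :: nat, v :: complex). \<lambda>j. if j = j' then monom v a else (0 :: complex poly))"
    define fu where "fu = (\<lambda>(j' :: 'i, a :: nat, v :: complex). fact a :: nat)"
    have bu: "pbd B 1 L (bu u j)" if "u \<in> U" for u j
      using that B(1) unfolding bu_def U_def pbd_def
      by (auto intro: bd_base[unfolded One_nat_def] intro!: order_trans[OF degree_monom_le])
    have Db: "pbd B ((c0 * (L + k * (s + 1) + 1)) ^ i) (L + i * s) (Dit T G I i (bu u) j)"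
      if "u \<in> U" "j \<in> I" "i \<le> k" for u j i
      using Dit_bound[OF I(1) \<kappa>(2) T' G' bu[OF that(1)] c0_def that(3,2)] .
    \<comment> \<open>The contribution of one unknown to the defect of proportionality of the i-th
      row; the factor t clears the denominators of l.\<close>
    define y where "y i j u = of_nat (fu u) * (of_nat t * poly (Dit T G I i (bu u) j) 1
       - (of_nat t * l j) * poly (Dit T G I i (bu u) p0) 1)" for i j u
    have y: "bd B A (y i j u)" if "i < k" "j \<in> I" "u \<in> U" for i j u
    proof -
      define K where "K = Suc (L + k * s) * (c0 * (L + k * (s + 1) + 1)) ^ k"
      have K: "bd B K (poly (Dit T G I i (bu u) j') 1)" if "j' \<in> I" for j'
      proof (rule bd_mono[OF pbd_poly_1[OF Db[OF \<open>u \<in> U\<close> that]]])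
        show "i \<le> k" using \<open>i < k\<close> by simp
        have "(c0 * (L + k * (s + 1) + 1)) ^ i \<le> (c0 * (L + k * (s + 1) + 1)) ^ k"
          using \<open>i < k\<close> c0 by (intro power_increasing) (auto simp: Suc_le_eq)
        moreover have "i * s \<le> k * s" using \<open>i < k\<close> by simp
        ultimately show "Suc (L + i * s) * (c0 * (L + k * (s + 1) + 1)) ^ i \<le> K"
          unfolding K_def by (intro mult_le_mono) auto
      qed
      have "bd B (t * K + \<kappa> * Ml * K) (of_nat t * poly (Dit T G I i (bu u) j) 1
       - (of_nat t * l j) * poly (Dit T G I i (bu u) p0) 1)"
        by (intro bd_diff bd_of_nat \<kappa>(2) K Ml that I)
      hence "bd B (fu u * (t * K + \<kappa> * Ml * K)) (y i j u)"
        unfolding y_def by (rule bd_of_nat)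
      moreover have "fu u \<le> fact L"
        using \<open>u \<in> U\<close> by (auto simp: fu_def U_def intro!: fact_mono)
      hence "fu u * (t * K + \<kappa> * Ml * K) \<le> fact L * (t * K + \<kappa> * Ml * K)" by simp
      ultimately show ?thesis unfolding A_def K_def[symmetric]
        by (elim bd_mono) (simp add: algebra_simps)
    qed
    \<comment> \<open>Each condition splits into one integer equation for every element of
      B.\<close>
    define co where "co i j u = (SOME c. y i j u = (\<Sum>b\<in>B. of_int (c b) * b) \<and> (\<forall>b\<in>B. \<bar>c b\<bar> \<le> int A))" for i j u
    have co: "y i j u = (\<Sum>b\<in>B. of_int (co i j u b) * b)" "\<And>b. b \<in> B \<Longrightarrow> \<bar>co i j u b\<bar> \<le> int A"
      if "i < k" "j \<in> I" "u \<in> U" for i j u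
      using someI_ex[OF y[OF that, unfolded bd_def]] unfolding co_def by blast+
    define AA where "AA = (\<lambda>(i,j,v) u. co i j u v)"
    have AA: "\<bar>AA e u\<bar> \<le> int A" if "e \<in> E" "u \<in> U" for e u
    proof -
      obtain i j v where e: "e = (i, j, v)" "i < k" "j \<in> I" "v \<in> B" using \<open>e \<in> E\<close> by (auto simp: E_def)
      show ?thesis using co(2)[OF e(2,3) \<open>u \<in> U\<close> e(4)] by (simp add: AA_def e(1))
    qed
    have cU: "card U = m * L * \<delta>" using I B by (simp add: U_def card_cartesian_product m \<delta>_def mult.assoc)
    have cE: "card E = k * (m - 1) * \<delta>" using I B by (simp add: E_def card_cartesian_product m \<delta>_def mult.assoc card_Diff_singleton)
    have cUE: "card U = card E + \<delta> * k * P"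
    proof -
      obtain m' where m': "m = Suc m'" using m1 by (cases m) auto
      have "P = 2 * m' * m' + 3 * m' + 2" unfolding m(3) m' by (simp add: algebra_simps)
      thus ?thesis unfolding cU cE L_def m(2) m' by (simp add: algebra_simps)
    qed
    define Z where "Z = 2 * card U * A"
    \<comment> \<open>The weights cost (q k)! and the derivations the k-th power of a multiple of k,
      together about k^((q + 1) k). All other factors are geometric in k.\<close>
    have Zle: "Z \<le> (C * k) ^ ((q + 1) * k)"
    proof -
      define W where "W = (c1 + q) * k"
      have W1: "L \<le> W" by (simp add: L_def W_def)
      have W2: "c0 * (L + k * (s + 1) + 1) \<le> W"
      proof -
        have "L + k * (s + 1) + 1 \<le> (q + s + 2) * k" using k by (simp add: L_def algebra_simps)
        from mult_le_mono2[OF this, of c0] have "c0 * (L + k * (s + 1) + 1) \<le> c1 * k"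
          by (simp only: c1_def mult.assoc)
        also have "c1 * k \<le> W" by (simp add: W_def)
        finally show ?thesis .
      qed
      have F: "fact L \<le> W ^ (q * k)"
      proof -
        have "fact L \<le> L ^ L" by (rule order_trans[OF fact_le_power]) simp
        also have "\<dots> \<le> W ^ L" using W1 by (rule power_mono) simp
        finally show ?thesis by (simp add: L_def)
      qed
      have S: "Suc (L + k * s) \<le> (q + s + 1) * k" using k by (simp add: L_def algebra_simps)
      define w1 w2 w3 where "w1 = Suc (L + k * s)" and "w2 = c0 * (L + k * (s + 1) + 1)" and "w3 = t + \<kappa> * Ml"
      have "Z = 2 * (m * L * \<delta>) * (w3 * (fact L * (w1 * w2 ^ k)))"
        by (simp only: Z_def A_def cU w1_def w2_def w3_def)
      also have "\<dots> = 2 * (m * q * \<delta>) * w3 * (k * w1) * (fact L * w2 ^ k)"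
        by (simp only: L_def mult_ac)
      also have "\<dots> = 2 * (m * q * \<delta>) * (t + \<kappa> * Ml) * (k * Suc (L + k * s)) * (fact L * (c0 * (L + k * (s + 1) + 1)) ^ k)"
        by (simp only: w1_def w2_def w3_def)
      also have "\<dots> \<le> 2 * (m * q * \<delta>) * (t + \<kappa> * Ml) * (k * ((q + s + 1) * k)) * (W ^ (q * k) * W ^ k)"
        using S F power_mono[OF W2, of k] by (intro mult_le_mono order_refl) auto
      also have "\<dots> = c2 * (k * k) * (W ^ (q * k) * W ^ k)" by (simp only: c2_def mult_ac)
      also have "W ^ (q * k) * W ^ k = W ^ ((q + 1) * k)" by (simp add: power_add[symmetric] add.commute)
      also have "c2 * (k * k) \<le> (4 * (c2 + 1)) ^ ((q + 1) * k)"
      proof -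
        have k2: "k \<le> 2 ^ k" by (rule less_imp_le) (rule less_exp)
        have "k * k \<le> 2 ^ k * 2 ^ k" by (intro mult_le_mono k2)
        also have "(2::nat) ^ k * 2 ^ k = 4 ^ k" by (simp add: power_mult_distrib[symmetric])
        finally have "k * k \<le> 4 ^ k" .
        moreover have "c2 \<le> (c2 + 1) ^ k" using k
          by (metis Suc_eq_plus1 le_SucI le_add2 order_trans power_increasing power_one_right Suc_leI One_nat_def le_refl)
        ultimately have "c2 * (k * k) \<le> (c2 + 1) ^ k * 4 ^ k" by (rule mult_le_mono[rotated])
        also have "\<dots> = (4 * (c2 + 1)) ^ k" by (simp only: power_mult_distrib mult.commute)
        also have "\<dots> \<le> (4 * (c2 + 1)) ^ ((q + 1) * k)" by (rule power_increasing) auto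
        finally show ?thesis .
      qed
      hence "c2 * (k * k) * W ^ ((q + 1) * k) \<le> (4 * (c2 + 1)) ^ ((q + 1) * k) * W ^ ((q + 1) * k)"
        by (rule mult_le_mono1)
      also have "\<dots> = (C * k) ^ ((q + 1) * k)"
        by (simp only: C_def W_def power_mult_distrib[symmetric] mult.assoc)
      finally show ?thesis .
    qed
    \<comment> \<open>It suffices that \<open>max Z 1\<close> to the power card E is less than X + 1
      to the power card U - card E. The number \<open>X\<close> is the exact root of the bound for
      the left side, and X + 1 provides the strict inequality.\<close>
    have count: "(2 * card U * A * X + 1) ^ card E < (X + 1) ^ card U"
    proof -
      have qm: "(q + 1) * (m - 1) = P - 2"
      proof -
        obtain m' where m': "m = Suc m'" using m1 by (cases m) auto
        have "P = 2 * m' * m' + 3 * m' + 2" unfolding m(3) m' by (simp add: algebra_simps)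
        thus ?thesis unfolding m(2) m' by (simp add: algebra_simps)
      qed
      have "(max Z 1) ^ card E \<le> ((C * k) ^ ((q + 1) * k)) ^ card E"
        using Zle C k by (intro power_mono) auto
      also have "\<dots> = (C * k) ^ ((q + 1) * (m - 1) * (k * k * \<delta>))"
        by (simp only: power_mult[symmetric] cE mult_ac)
      also have "\<dots> = X ^ (\<delta> * k * P)"
        unfolding qm X_def power_mult[symmetric] by (simp only: k_def mult_ac)
      also have "\<dots> < (X + 1) ^ (\<delta> * k * P)"
        using \<delta> k P by (intro power_strict_mono) auto
      finally have "(max Z 1) ^ card E * (X + 1) ^ card E < (X + 1) ^ (\<delta> * k * P) * (X + 1) ^ card E"
        by (intro mult_strict_right_mono) auto
      also have "\<dots> = (X + 1) ^ card U" by (simp only: cUE power_add mult.commute)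
      finally have lt: "(max Z 1 * (X + 1)) ^ card E < (X + 1) ^ card U" by (simp only: power_mult_distrib)
      have "(2 * card U * A * X + 1) ^ card E \<le> (max Z 1 * (X + 1)) ^ card E"
      proof (rule power_mono)
        have "Z * X + 1 \<le> max Z 1 * X + max Z 1" by (intro add_mono mult_le_mono) auto
        thus "2 * card U * A * X + 1 \<le> max Z 1 * (X + 1)" by (simp add: Z_def)
      qed simp
      with lt show ?thesis by (rule le_less_trans[rotated])
    qed
    have "\<exists>x. (\<exists>u\<in>U. x u \<noteq> 0) \<and> (\<forall>u\<in>U. \<bar>x u\<bar> \<le> int X) \<and> (\<forall>e\<in>E. (\<Sum>u\<in>U. AA e u * x u) = 0)"
      by (rule siegel_lemma[OF fE fU _ count]) (rule AA)
    then obtain x where x: "\<exists>u\<in>U. x u \<noteq> 0" "\<forall>u\<in>U. \<bar>x u\<bar> \<le> int X" "\<forall>e\<in>E. (\<Sum>u\<in>U. AA e u * x u) = 0" by blast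
    define b where "b j = (\<Sum>u\<in>U. Polynomial.smult (of_int (x u) * of_nat (fu u)) (bu u j))" for j
    define \<beta> where "\<beta> j a = (if j \<in> I \<and> a < L then (\<Sum>v\<in>B. of_int (x (j,a,v)) * v) else 0)" for j a
    have cb: "coeff (b j) a = fact a * \<beta> j a" for j a
    proof -
      have "coeff (b j) a = (\<Sum>u\<in>U. if fst u = j \<and> fst (snd u) = a then of_int (x u) * fact a * snd (snd u) else 0)"
        unfolding b_def coeff_sum
        by (intro sum.cong) (auto simp: bu_def fu_def split: if_splits)
      also have "\<dots> = (\<Sum>u\<in>{u\<in>U. fst u = j \<and> fst (snd u) = a}. of_int (x u) * fact a * snd (snd u))"
        using fU by (simp add: sum.inter_filter)
      also have "\<dots> = fact a * \<beta> j a"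
      proof (cases "j \<in> I \<and> a < L")
        case True
        have "(\<Sum>u\<in>{u\<in>U. fst u = j \<and> fst (snd u) = a}. of_int (x u) * fact a * snd (snd u)) =
           (\<Sum>v\<in>B. of_int (x (j,a,v)) * fact a * v)"
          by (rule sum.reindex_bij_witness[of _ "\<lambda>v. (j,a,v)" "\<lambda>u. snd (snd u)"]) (use True in \<open>auto simp: U_def\<close>)
        thus ?thesis using True by (simp add: \<beta>_def sum_distrib_left mult_ac)
      next
        case False
        hence "{u\<in>U. fst u = j \<and> fst (snd u) = a} = {}" by (auto simp: U_def)
        thus ?thesis using False by (simp only: \<beta>_def) auto
      qed
      finally show ?thesis .
    qed
    have \<beta>: "bd B X (\<beta> j a)" for j a
      unfolding \<beta>_def using x(2) by (auto simp: U_def intro!: bd_combination)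
    have Dx: "Dit T G I i b j = (\<Sum>u\<in>U. Polynomial.smult (of_int (x u) * of_nat (fu u)) (Dit T G I i (bu u) j))" for i j
      unfolding b_def[abs_def] by (simp add: Dit_sum_smult[OF fU])
    show "\<exists>b. (\<exists>j\<in>I. b j \<noteq> 0) \<and> (\<forall>j a. a \<ge> q * (P * r) \<longrightarrow> coeff (b j) a = 0) \<and>
      (\<forall>j a. \<exists>\<beta>. coeff (b j) a = fact a * \<beta> \<and> bd B ((C * (P * r)) ^ ((P - 2) * r)) \<beta>) \<and>
      (\<forall>i<P * r. \<forall>j\<in>I. poly (Dit T G I i b j) 1 = l j * poly (Dit T G I i b p0) 1) \<and>
      (\<forall>i a. \<forall>j\<in>I. algebraic_int (coeff (Dit T G I i b j) a))"
    proof (intro exI[of _ b] conjI allI impI ballI)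
      obtain j a v where u: "(j,a,v) \<in> U" "x (j,a,v) \<noteq> 0" using x(1) by auto
      \<comment> \<open>A non-zero family of integer coordinates gives a non-zero coefficient by the
        independence of B.\<close>
      hence "\<beta> j a \<noteq> 0" using ind[of "\<lambda>v. x (j,a,v)"] by (auto simp: \<beta>_def U_def)
      hence "b j \<noteq> 0" using cb[of j a] by auto
      thus "\<exists>j\<in>I. b j \<noteq> 0" using u by (auto simp: U_def)
    next
      fix j a assume "q * (P * r) \<le> a"
      thus "coeff (b j) a = 0" by (simp add: cb \<beta>_def L_def k_def)
    next
      fix j a
      show "\<exists>\<beta>. coeff (b j) a = fact a * \<beta> \<and> bd B ((C * (P * r)) ^ ((P - 2) * r)) \<beta>"
        using cb \<beta> unfolding X_def k_def by blast
    next
      fix i j assume "i < P * r" and j: "j \<in> I"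
      hence i: "i < k" by (simp add: k_def)
      show "poly (Dit T G I i b j) 1 = l j * poly (Dit T G I i b p0) 1"
      proof (cases "j = p0")
        case True
        thus ?thesis using l by simp
      next
        case False
        have "of_nat t * (poly (Dit T G I i b j) 1 - l j * poly (Dit T G I i b p0) 1) = (\<Sum>u\<in>U. of_int (x u) * y i j u)"
          unfolding Dx by (simp add: poly_sum y_def sum_distrib_left sum_subtractf[symmetric] algebra_simps)
        also have "\<dots> = (\<Sum>u\<in>U. \<Sum>v\<in>B. of_int (co i j u v * x u) * v)"
          by (intro sum.cong) (simp_all add: co(1)[OF i j] sum_distrib_left mult_ac)
        also have "\<dots> = (\<Sum>v\<in>B. of_int (\<Sum>u\<in>U. co i j u v * x u) * v)"
          by (subst sum.swap) (simp add: sum_distrib_right)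
        also have "\<dots> = (\<Sum>v\<in>B. 0)"
        proof (rule sum.cong)
          fix v assume "v \<in> B"
          hence "(i,j,v) \<in> E" using i j False by (auto simp: E_def)
          hence "(\<Sum>u\<in>U. co i j u v * x u) = 0" using x(3) by (auto simp: AA_def)
          thus "of_int (\<Sum>u\<in>U. co i j u v * x u) * v = 0" by simp
        qed simp
        finally show ?thesis using l(1) by simp
      qed
    next
      fix i a j assume j: "j \<in> I"
      have "algebraic_int (coeff (Dit T G I i (bu u) j) a)" if "u \<in> U" for u
        using Dit_bound[where i = i and k = i and j = j and b = "bu u" and G = G, OF I(1) \<kappa>(2) T' G' bu[OF that] c0_def order_refl j]
        by (auto simp: pbd_def intro: bd_algebraic_int[OF B(3)])
      thus "algebraic_int (coeff (Dit T G I i b j) a)"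
        unfolding Dx coeff_sum
        by (auto intro!: algebraic_int_sum algebraic_int_add_mult(2) algebraic_int_of_nat algebraic_int_of_int)
    qed
  qed
qed

section \<open>Arithmetic of the coefficients\<close>

text \<open>Induction along Leibniz's harmonic triangle. With a = l C(n + l, l), b = (l + 1) C(n + l
  + 1, l + 1) and c = l C(n + l + 1, l), where C denotes binomial coefficients, 1/c = 1/a - 1/b.
  Hence M/c is an integer if M/a and M/b are.\<close>

lemma binomial_dvd_of_dvd_all:
  fixes M :: nat
  assumes "\<And>j. 1 \<le> j \<Longrightarrow> j \<le> n + l \<Longrightarrow> j dvd M" "1 \<le> l"
  shows "l * (n + l choose l) dvd M"
  using assms
proof (induction n arbitrary: l)
  case 0
  thus ?case by simp
next
  case (Suc n)
  have 1: "l * (n + l choose l) dvd M" using Suc.prems by (intro Suc.IH) auto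
  have 2: "Suc l * (n + Suc l choose Suc l) dvd M" using Suc.prems by (intro Suc.IH) auto
  define a b c where "a = l * (n + l choose l)" and "b = Suc l * (n + Suc l choose Suc l)"
    and "c = l * (Suc n + l choose l)"
  have pos: "a > 0" "b > 0" "c > 0" using Suc.prems by (auto simp: a_def b_def c_def)
  have A: "Suc l * (Suc (n + l) choose Suc l) = Suc (n + l) * (n + l choose l)"
    by (simp only: Suc_times_binomial_eq mult.commute)
  have B: "Suc n * (Suc (n + l) choose l) = Suc (n + l) * (n + l choose l)"
    using binomial_absorb_comp[of "Suc (n + l)" l] by simp
  have "real (Suc n) * real c = real (Suc (n + l)) * real a"
    using arg_cong[OF B, of "\<lambda>x. real (l * x)"] by (simp add: a_def c_def algebra_simps)
  moreover have "real l * real b = real (Suc (n + l)) * real a"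
    using arg_cong[OF A, of "\<lambda>x. real (l * x)"] by (simp add: a_def b_def algebra_simps)
  moreover have "real l > 0" using Suc.prems by simp
  ultimately have c_eq: "real c = real (Suc (n + l)) * real a / real (Suc n)" and b_eq: "real b = real (Suc (n + l)) * real a / real l"
    by (auto simp: field_simps)
  have "real M / real c = real M / real a - real M / real b"
  proof -
    define S where "S = real (Suc (n + l))"
    have S: "S > 0" "S = real (Suc n) + real l" by (simp_all add: S_def)
    have "real M / real c = real M * real (Suc n) / (S * real a)" unfolding c_eq by (simp add: S_def)
    moreover have "real M / real b = real M * real l / (S * real a)" unfolding b_eq by (simp add: S_def)
    moreover have "real M / real a = real M * S / (S * real a)" using S by simp
    moreover have "real M * S - real M * real l = real M * real (Suc n)" by (simp add: S algebra_simps)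
    ultimately show ?thesis by (simp only: diff_divide_distrib[symmetric])
  qed
  moreover have "real M / real a = real (M div a)" "real M / real b = real (M div b)"
    using 1 2 by (simp_all add: a_def b_def real_of_nat_div)
  ultimately have "real M / real c = real (M div a) - real (M div b)" by simp
  hence "of_nat M = (of_int (int (M div a) - int (M div b)) * of_nat c :: real)"
    using pos by (simp add: field_simps)
  hence "int M = (int (M div a) - int (M div b)) * int c"
    by (metis of_int_eq_iff of_int_mult of_int_of_nat_eq)
  hence "int c dvd int M" by (rule dvdI[of _ _ "int (M div a) - int (M div b)", OF trans[OF _ mult.commute]])
  hence "c dvd M" by (simp only: int_dvd_int_iff)
  thus ?case by (simp only: c_def)
qed

text \<open>Legendre's formula. The common cut-off N allows the formulas for m! and (2 m)! to be
  compared term by term.\<close>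

lemma multiplicity_fact:
  fixes p :: nat
  assumes "prime p" "n \<le> N"
  shows "multiplicity p (fact n) = (\<Sum>i\<in>{1..N}. n div p ^ i)"
  using assms(2)
proof (induction n)
  case (Suc n)
  have p: "p > 1" using assms(1) prime_gt_1_nat by blast
  have "multiplicity p (fact (Suc n)) = multiplicity p (Suc n) + multiplicity p (fact n)"
    unfolding fact_Suc of_nat_id
    by (rule prime_elem_multiplicity_mult_distrib) (use assms(1) in auto)
  also have "multiplicity p (Suc n) = card {i\<in>{1..N}. p ^ i dvd Suc n}"
  proof -
    have "{i\<in>{1..N}. p ^ i dvd Suc n} = {1..multiplicity p (Suc n)}"
    proof (intro equalityI subsetI)
      fix i assume "i \<in> {i\<in>{1..N}. p ^ i dvd Suc n}"
      thus "i \<in> {1..multiplicity p (Suc n)}"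
        using p by (auto intro!: multiplicity_geI)
    next
      fix i assume i: "i \<in> {1..multiplicity p (Suc n)}"
      hence d: "p ^ i dvd Suc n" by (auto intro: multiplicity_dvd')
      hence "p ^ i \<le> Suc n" by (rule dvd_imp_le) simp
      moreover have "i < p ^ i" using p by (metis less_exp less_le_trans power_mono Suc_1 Suc_leI zero_le)
      ultimately have "i \<le> N" using Suc.prems by linarith
      thus "i \<in> {i\<in>{1..N}. p ^ i dvd Suc n}" using i d by auto
    qed
    thus ?thesis by simp
  qed
  also have "card {i\<in>{1..N}. p ^ i dvd Suc n} = (\<Sum>i\<in>{1..N}. if p ^ i dvd Suc n then 1 else 0)"
    by (simp add: sum.If_cases Int_def)
  also have "\<dots> + multiplicity p (fact n) = (\<Sum>i\<in>{1..N}. Suc n div p ^ i)"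
    using Suc by (simp add: sum.distrib[symmetric] div_Suc mod_eq_0_iff_dvd[symmetric] cong: sum.cong)
      (intro sum.cong refl, auto simp: div_Suc mod_eq_0_iff_dvd)
  finally show ?case .
qed simp

text \<open>In Legendre's formula for (2 m)! / (m!)^2 no term is negative, and the term with index e
  is positive.\<close>

lemma prime_dvd_central_binomial:
  fixes p :: nat
  assumes p: "prime p" and "m < p ^ e" "p ^ e \<le> 2 * m"
  shows "p dvd (2 * m choose m)"
proof -
  have p1: "p > 1" using p prime_gt_1_nat by blast
  have m: "m > 0" using assms by (cases m) auto
  have e1: "e \<ge> 1" using assms m by (cases e) auto
  have e2: "e \<le> 2 * m" using assms(3) p1 by (metis less_exp less_le_trans less_imp_le order_trans power_mono Suc_1 Suc_leI zero_le)
  have "fact (2 * m) = fact m * fact m * (2 * m choose m)"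
    using binomial_fact_lemma[of m "2 * m"] by (simp add: mult_2)
  hence "multiplicity p (fact (2 * m)) = multiplicity p (fact m :: nat) + multiplicity p (fact m :: nat) + multiplicity p (2 * m choose m)"
    using p by (simp add: prime_elem_multiplicity_mult_distrib)
  hence *: "(\<Sum>i\<in>{1..2*m}. 2 * m div p ^ i) = (\<Sum>i\<in>{1..2*m}. m div p ^ i + m div p ^ i) + multiplicity p (2 * m choose m)"
    using multiplicity_fact[OF p, of "2 * m" "2 * m"] multiplicity_fact[OF p, of m "2 * m"] by (simp add: sum.distrib)
  have le: "m div q + m div q \<le> 2 * m div q" for q
    by (metis div_add1_eq le_add1 mult_2)
  have "(\<Sum>i\<in>{1..2*m}. m div p ^ i + m div p ^ i) < (\<Sum>i\<in>{1..2*m}. 2 * m div p ^ i)"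
  proof (rule sum_strict_mono_ex1)
    show "\<exists>a\<in>{1..2*m}. m div p ^ a + m div p ^ a < 2 * m div p ^ a"
    proof (rule bexI[of _ e])
      have "m div p ^ e = 0" using assms(2) by simp
      moreover have "2 * m div p ^ e > 0" using assms(3) p1 by (simp add: div_greater_zero_iff)
      ultimately show "m div p ^ e + m div p ^ e < 2 * m div p ^ e" by simp
    qed (use e1 e2 in auto)
  qed (use le in auto)
  hence "multiplicity p (2 * m choose m) > 0" using * by simp
  thus ?thesis by (metis not_dvd_imp_multiplicity_0 less_irrefl)
qed

text \<open>A prime power p^e \<le> 2 m either is at most m, or p^(e - 1) \<le> m and the missing p
  divides the central binomial coefficient, which is at most 4^m.\<close>

lemma Lcm_double_bound:
  "Lcm {1..2 * m} \<le> Lcm {1..m} * 4 ^ (m::nat)"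
proof -
  have "Lcm {1..2 * m} dvd Lcm {1..m} * (2 * m choose m)"
  proof (rule Lcm_least)
    fix j assume j: "j \<in> {1..2 * m}"
    show "j dvd Lcm {1..m} * (2 * m choose m)"
    proof (rule multiplicity_le_imp_dvd)
      show "j \<noteq> 0" using j by simp
      fix p :: nat assume p: "prime p"
      have p1: "p > 1" using p prime_gt_1_nat by blast
      define e where "e = multiplicity p j"
      have pe: "p ^ e dvd j" by (simp add: e_def multiplicity_dvd)
      have "p ^ e \<le> j" using pe by (rule dvd_imp_le) (use j in simp)
      hence pe2: "p ^ e \<le> 2 * m" using j by simp
      have nz: "Lcm {1..m} * (2 * m choose m) \<noteq> 0" by (auto simp: Lcm_0_iff)
      have "p ^ e dvd Lcm {1..m} * (2 * m choose m)"
      proof (cases "p ^ e \<le> m")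
        case True
        hence "p ^ e \<in> {1..m}" using p1 by simp
        thus ?thesis by (intro dvd_mult2 dvd_Lcm)
      next
        case False
        have "e \<noteq> 0" using False j by (cases "e = 0") auto
        then obtain e' where e': "e = Suc e'" by (cases e) auto
        have "2 * p ^ e' \<le> p * p ^ e'" using p1 by (intro mult_le_mono1) simp
        also have "\<dots> \<le> 2 * m" using pe2 e' by simp
        finally have "p ^ e' \<le> m" by simp
        hence "p ^ e' dvd Lcm {1..m}" using p1 by (intro dvd_Lcm) simp
        moreover have "p dvd (2 * m choose m)"
          using prime_dvd_central_binomial[OF p, of m e] False pe2 by simp
        ultimately show ?thesis unfolding e' power_Suc2 by (rule mult_dvd_mono)
      qed
      thus "multiplicity p j \<le> multiplicity p (Lcm {1..m} * (2 * m choose m))"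
        using nz p1 by (intro multiplicity_geI) (auto simp: e_def)
    qed
  qed
  moreover have "Lcm {1..m} * (2 * m choose m) > 0" by (auto simp: Lcm_0_iff intro!: Nat.gr0I)
  ultimately have "Lcm {1..2 * m} \<le> Lcm {1..m} * (2 * m choose m)" by (rule dvd_imp_le)
  also have "(2 * m choose m) \<le> 2 ^ (2 * m)" by (rule binomial_le_pow2)
  also have "(2::nat) ^ (2 * m) = 4 ^ m" by (simp add: power_mult)
  finally show ?thesis by simp
qed

text \<open>Repeated halving. The generous base 64 absorbs the rounding, as 4^m \<le> 64^(m - 1) for
  m \<ge> 2; only geometric growth matters later.\<close>

lemma Lcm_upto_bound: "Lcm {1..n} \<le> (64::nat) ^ n"
proof (induction n rule: less_induct)
  case (less n)
  show ?case
  proof (cases "n \<le> 2")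
    case True
    hence "n = 0 \<or> n = 1 \<or> n = 2" by auto
    moreover have "{1..2::nat} = {1,2}" by auto
    ultimately show ?thesis by auto
  next
    case False
    define m where "m = (n + 1) div 2"
    have m: "m < n" "n \<le> 2 * m" "2 * m \<le> n + 1" "m \<ge> 2" using False by (auto simp: m_def)
    have "Lcm {1..n} dvd Lcm {1..2 * m}" by (rule Lcm_subset) (use m in auto)
    hence "Lcm {1..n} \<le> Lcm {1..2 * m}" by (rule dvd_imp_le) (auto simp: Lcm_0_iff intro!: Nat.gr0I)
    also have "\<dots> \<le> Lcm {1..m} * 4 ^ m" by (rule Lcm_double_bound)
    also have "\<dots> \<le> 64 ^ m * 4 ^ m" using less.IH[OF m(1)] by simp
    also have "(4::nat) ^ m \<le> 64 ^ (m - 1)"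
    proof -
      have "(4::nat) ^ m \<le> 4 ^ (3 * (m - 1))" using m(4) by (intro power_increasing) auto
      thus ?thesis by (simp add: power_mult)
    qed
    hence "(64::nat) ^ m * 4 ^ m \<le> 64 ^ m * 64 ^ (m - 1)" by simp
    also have "\<dots> = 64 ^ (2 * m - 1)" using m(4) by (simp add: power_add[symmetric] mult_2)
    also have "\<dots> \<le> 64 ^ n" using m(3) by (intro power_increasing) auto
    finally show ?thesis .
  qed
qed

text \<open>One geometrically bounded number clears the denominators 1 / (t choose l) for all t
  \<le> n at once. They appear whenever series with factorial weights are multiplied.\<close>

lemma binomial_dvd_Lcm:
  assumes "l \<le> t" "t \<le> n"
  shows "(t choose l) dvd Lcm {1..n + 1}"
proof -
  have "Suc l * ((t - l) + Suc l choose Suc l) dvd Lcm {1..n + 1}"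
    by (rule binomial_dvd_of_dvd_all) (use assms in \<open>auto intro!: dvd_Lcm\<close>)
  also have "Suc l * ((t - l) + Suc l choose Suc l) = Suc t * (t choose l)"
  proof -
    have "(t - l) + Suc l = Suc t" using assms by simp
    thus ?thesis by (simp only: Suc_times_binomial_eq mult.commute)
  qed
  finally show ?thesis by (rule dvd_mult_right)
qed

section \<open>Sizes of conjugates\<close>

text \<open>In number-theoretic terms, R bounds the house of x.\<close>

definition conj_bound :: "real \<Rightarrow> complex \<Rightarrow> bool" where
  "conj_bound R x \<longleftrightarrow> x \<in> Qbar \<and> (\<forall>\<sigma>. Qbar_automorphism \<sigma> \<longrightarrow> cmod (\<sigma> x) \<le> R)"

lemma conj_bound_mono: "conj_bound R x \<Longrightarrow> R \<le> R' \<Longrightarrow> conj_bound R' x"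
  unfolding conj_bound_def by (meson order_trans)

lemma conj_bound_mult:
  assumes "conj_bound R x" "conj_bound R' y"
  shows "conj_bound (R * R') (x * y)"
  unfolding conj_bound_def
proof (intro conjI allI impI)
  fix \<sigma> assume \<sigma>: "Qbar_automorphism \<sigma>"
  have "cmod (\<sigma> x) \<le> R" "cmod (\<sigma> y) \<le> R'" "x \<in> Qbar" "y \<in> Qbar"
    using assms \<sigma> by (auto simp: conj_bound_def)
  thus "cmod (\<sigma> (x * y)) \<le> R * R'"
    using \<sigma> by (simp add: Qbar_automorphismD(2) norm_mult mult_mono' order_trans[OF norm_ge_zero])
qed (use assms in \<open>auto simp: conj_bound_def\<close>)

lemma conj_bound_add:
  assumes "conj_bound R x" "conj_bound R' y"
  shows "conj_bound (R + R') (x + y)"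
  unfolding conj_bound_def
proof (intro conjI allI impI)
  fix \<sigma> assume \<sigma>: "Qbar_automorphism \<sigma>"
  have "cmod (\<sigma> x) \<le> R" "cmod (\<sigma> y) \<le> R'" "x \<in> Qbar" "y \<in> Qbar"
    using assms \<sigma> by (auto simp: conj_bound_def)
  thus "cmod (\<sigma> (x + y)) \<le> R + R'"
    using \<sigma> by (simp add: Qbar_automorphismD(1) norm_triangle_mono)
qed (use assms in \<open>auto simp: conj_bound_def\<close>)

lemma conj_bound_0: "conj_bound 0 0"
  by (simp add: conj_bound_def Qbar_automorphismD)

lemma conj_bound_sum:
  "(\<And>i. i \<in> A \<Longrightarrow> conj_bound (R i) (f i)) \<Longrightarrow> conj_bound (\<Sum>i\<in>A. R i) (\<Sum>i\<in>A. f i)"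
  by (induction A rule: infinite_finite_induct) (auto intro: conj_bound_add conj_bound_0)

lemma conj_bound_of_nat: "conj_bound (real n) (of_nat n)"
  by (simp add: conj_bound_def Qbar_automorphism_of_nat)

lemma conj_bound_divide_of_nat:
  assumes "conj_bound R x" shows "conj_bound (R / real n) (x / of_nat n)"
proof (cases "n = 0")
  case False
  show ?thesis unfolding conj_bound_def
  proof (intro conjI allI impI)
    fix \<sigma> assume \<sigma>: "Qbar_automorphism \<sigma>"
    have x: "x \<in> Qbar" "cmod (\<sigma> x) \<le> R" using assms \<sigma> by (auto simp: conj_bound_def)
    have xn: "x / of_nat n \<in> Qbar" using x by (intro Qbar_divide) auto
    have "\<sigma> (of_nat n * (x / of_nat n)) = of_nat n * \<sigma> (x / of_nat n)"
      using Qbar_automorphismD(2)[OF \<sigma> Qbar_of_nat xn, of n] by (simp only: Qbar_automorphism_of_nat[OF \<sigma>])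
    moreover have "of_nat n * (x / of_nat n) = x" using False by simp
    ultimately have "\<sigma> x = of_nat n * \<sigma> (x / of_nat n)" by simp
    hence "cmod (\<sigma> x) = real n * cmod (\<sigma> (x / of_nat n))" by (simp add: norm_mult)
    thus "cmod (\<sigma> (x / of_nat n)) \<le> R / real n" using x(2) False by (simp add: field_simps)
  qed (use assms in \<open>auto simp: conj_bound_def intro!: Qbar_divide\<close>)
qed (simp add: conj_bound_0)

lemma conj_bound_nonneg:
  assumes "conj_bound R x" shows "0 \<le> R"
proof -
  have "Qbar_automorphism (\<lambda>x. x)"
    by (simp add: Qbar_automorphism_def bij_betw_def)
  hence "cmod x \<le> R" using assms by (auto simp: conj_bound_def)
  thus ?thesis using norm_ge_zero[of x] by linarith
qed

text \<open>All conjugates of an integral multiple y satisfy the same monic integer equation, whose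
  coefficients bound every root.\<close>

lemma Qbar_conj_bound:
  assumes "x \<in> Qbar" shows "\<exists>R>0. conj_bound R x"
proof -
  obtain d :: nat where d: "d > 0" "algebraic_int (of_nat d * x)" using assms by (auto simp: Qbar_iff)
  define y where "y = of_nat d * x"
  obtain n :: nat and c where n: "n > 0" "y ^ n = (\<Sum>i<n. of_int (c i) * y ^ i)"
    using algebraic_int_reduce[OF d(2)] unfolding y_def by metis
  have yQ: "y \<in> Qbar" using assms by (auto simp: y_def)
  define R where "R = 1 + (\<Sum>i<n. cmod (of_int (c i)))"
  have R1: "R \<ge> 1" by (simp add: R_def sum_nonneg)
  have "conj_bound R y" unfolding conj_bound_def
  proof (intro conjI allI impI yQ)
    fix \<sigma> assume \<sigma>: "Qbar_automorphism \<sigma>"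
    define z where "z = \<sigma> y"
    have "z ^ n = \<sigma> (y ^ n)" using \<sigma> yQ by (simp add: Qbar_automorphism_power z_def)
    also have "\<dots> = (\<Sum>i<n. of_int (c i) * z ^ i)"
      unfolding n(2) z_def using \<sigma> yQ
      by (subst Qbar_automorphism_sum)
         (auto simp: Qbar_automorphismD(2) Qbar_automorphism_power Qbar_power Qbar_automorphism_of_int)
    finally have e: "z ^ n = (\<Sum>i<n. of_int (c i) * z ^ i)" .
    show "cmod (\<sigma> y) \<le> R"
    proof (rule ccontr)
      assume "\<not> cmod (\<sigma> y) \<le> R"
      hence zR: "cmod z > R" by (simp add: z_def)
      hence z1: "cmod z \<ge> 1" using R1 by simp
      have "cmod z ^ n \<le> (\<Sum>i<n. cmod (of_int (c i)) * cmod z ^ i)"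
        by (metis (no_types, lifting) e norm_mult norm_power norm_sum sum.cong)
      also have "\<dots> \<le> (\<Sum>i<n. cmod (of_int (c i)) * cmod z ^ (n - 1))"
        using z1 by (intro sum_mono mult_left_mono power_increasing) auto
      also have "\<dots> = (R - 1) * cmod z ^ (n - 1)" by (simp add: R_def sum_distrib_right)
      also have "\<dots> < cmod z * cmod z ^ (n - 1)"
        using zR z1 by (intro mult_strict_right_mono zero_less_power) linarith+
      also have "\<dots> = cmod z ^ n" using n(1) by (simp add: power_Suc[symmetric] del: power_Suc)
      finally show False by simp
    qed
  qed
  from conj_bound_divide_of_nat[OF this, of d] have "conj_bound (R / real d) x"
    using d(1) by (simp add: y_def)
  thus ?thesis using R1 d(1) by (intro exI[of _ "R / real d"]) auto
qed

lemma algebraic_int_conj_bound_less_1: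
  "algebraic_int x \<Longrightarrow> conj_bound R x \<Longrightarrow> R < 1 \<Longrightarrow> x = 0"
  by (rule algebraic_int_small_conjugates) (auto simp: conj_bound_def)

text \<open>The arithmetic half of \<open>Eh_function\<close>, read on the numbers f_n / n!, with
  common denominators \<open>D\<close> as explicit data instead of least ones. Differential
  equations are left out because the lifting argument knows the quotient y only through its
  arithmetic.\<close>

definition tame_bounds :: "nat \<Rightarrow> (nat \<Rightarrow> nat) \<Rightarrow> complex fps \<Rightarrow> bool" where
  "tame_bounds C D f \<longleftrightarrow>
     (\<forall>n. 0 < D n \<and> D n \<le> C ^ (n + 1)) \<and>
     (\<forall>n. \<forall>i\<le>n. algebraic_int (of_nat (D n) * (fps_nth f i / fact i))) \<and>
     (\<forall>n. conj_bound (real C ^ (n + 1)) (fps_nth f n / fact n))"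

definition tame :: "complex fps \<Rightarrow> bool" where
  "tame f \<longleftrightarrow> (\<exists>C D. tame_bounds C D f)"

lemma tame_bounds_pos: "tame_bounds C D f \<Longrightarrow> C > 0"
  unfolding tame_bounds_def by (metis One_nat_def add_0 gr0I less_le_trans not_less_zero power_one_right le_zero_eq less_irrefl)

lemma tame_bounds_scale:
  assumes "tame_bounds C D f" "C' > 0" "\<And>n. 0 < D' n \<and> D' n \<le> C' ^ (n + 1)"
  shows "tame_bounds (C * C') (\<lambda>n. D n * D' n) f"
  unfolding tame_bounds_def
proof (intro conjI allI impI)
  fix n
  show "0 < D n * D' n" using assms by (simp add: tame_bounds_def)
  show "D n * D' n \<le> (C * C') ^ (n + 1)"
    unfolding power_mult_distrib using assms by (intro mult_le_mono) (auto simp: tame_bounds_def)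
  show "algebraic_int (of_nat (D n * D' n) * (fps_nth f i / fact i))" if "i \<le> n" for i
  proof -
    have "algebraic_int (of_nat (D' n) * (of_nat (D n) * (fps_nth f i / fact i)))"
      using assms(1) that by (intro algebraic_int_add_mult(2)[OF algebraic_int_of_nat, of _ "D' n"]) (auto simp: tame_bounds_def)
    thus ?thesis by (simp add: mult_ac)
  qed
  have "real C ^ (n + 1) * 1 \<le> real C ^ (n + 1) * real C' ^ (n + 1)"
    using assms(2) by (intro mult_left_mono one_le_power) auto
  moreover have "conj_bound (real C ^ (n + 1)) (fps_nth f n / fact n)"
    using assms(1) by (simp add: tame_bounds_def)
  ultimately show "conj_bound (real (C * C') ^ (n + 1)) (fps_nth f n / fact n)"
    by (elim conj_bound_mono) (simp only: of_nat_mult power_mult_distrib mult_1_right)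
qed

lemma tame_family:
  assumes "finite F" "\<And>f. f \<in> F \<Longrightarrow> tame f"
  shows "\<exists>C D. C > 0 \<and> (\<forall>n. 0 < D n \<and> D n \<le> C ^ (n + 1)) \<and> (\<forall>f\<in>F. tame_bounds C D f)"
  using assms
proof (induction F rule: finite_induct)
  case empty
  show ?case by (intro exI[of _ 1] exI[of _ "\<lambda>_. 1"]) auto
next
  case (insert f F)
  then obtain C D where CD: "C > 0" "\<forall>n. 0 < D n \<and> D n \<le> C ^ (n + 1)" "\<forall>f\<in>F. tame_bounds C D f" by auto
  obtain C' D' where f: "tame_bounds C' D' f" using insert unfolding tame_def by blast
  have f': "C' > 0" "\<forall>n. 0 < D' n \<and> D' n \<le> C' ^ (n + 1)"
    using f tame_bounds_pos by (auto simp: tame_bounds_def)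
  have 1: "tame_bounds (C * C') (\<lambda>n. D n * D' n) g" if "g \<in> F" for g
    using CD(3) f' that by (intro tame_bounds_scale) auto
  have 2: "tame_bounds (C * C') (\<lambda>n. D n * D' n) f"
    using tame_bounds_scale[OF f CD(1), of D] CD(2) by (simp add: mult.commute)
  show ?case
    using 1 2 CD(1) f'(1)
    by (intro exI[of _ "C * C'"] exI[of _ "\<lambda>n. D n * D' n"]) (auto simp: tame_bounds_def)
qed

definition trunc_poly :: "nat \<Rightarrow> complex fps \<Rightarrow> complex poly" where
  "trunc_poly n f = (\<Sum>t\<le>n. monom (fps_nth f t) t)"

lemma coeff_trunc_poly: "coeff (trunc_poly n f) t = (if t \<le> n then fps_nth f t else 0)"
  by (simp add: trunc_poly_def coeff_sum)

lemma poly_trunc_poly_1: "poly (trunc_poly n f) 1 = (\<Sum>t\<le>n. fps_nth f t)"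
  by (simp add: trunc_poly_def poly_sum poly_monom)

lemma algebraic_int_poly: "(\<And>i. algebraic_int (coeff (p :: complex poly) i)) \<Longrightarrow> algebraic_int (poly p (of_nat a))"
  unfolding poly_altdef
  by (intro algebraic_int_sum algebraic_int_add_mult(2) algebraic_int_power algebraic_int_of_nat)

text \<open>The \<open>t\<close>-th coefficients of \<open>b \<cdot> u\<close> are divisible by \<open>t!\<close> up to geometric factors, and
  \<open>l \<cdot> u\<close> vanishes \<open>p\<close>-adically at 1 for all \<open>p\<close>. The proportionality of the derived rows to \<open>l\<close>
  therefore makes \<open>b \<cdot> u\<close> vanish to order \<open>k\<close> at 1, which improves the divisibility of
  the lowest coefficient from \<open>n0!\<close> to \<open>(n0 + k)!\<close>. All of this is carried out with truncations,
  so that no \<open>p\<close>-adic completions are needed.\<close>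

lemma lowest_coeff_vanishes:
  fixes u :: "'i \<Rightarrow> complex fps" and l :: "'i \<Rightarrow> complex" and d \<kappa> q :: nat
  assumes I: "finite I" "p0 \<in> I"
    and u: "\<And>i. i \<in> I \<Longrightarrow> tame (u i)" and y: "tame y"
    and yu: "(fps_X - 1) * y = (\<Sum>i\<in>I. fps_const (l i) * u i)"
    and T: "\<And>i. algebraic_int (coeff T i)" "poly T 1 = of_nat d" "d > 0"
    and G: "\<And>i j a. i \<in> I \<Longrightarrow> j \<in> I \<Longrightarrow> algebraic_int (coeff (G i j) a)"
    and sys: "\<And>i. i \<in> I \<Longrightarrow> fps_of_poly T * fps_deriv (u i) = (lincomb I (G i) u)"
  shows "\<exists>c::nat. c > 0 \<and> (\<forall>k>0. \<forall>n0\<le>\<kappa> * k. \<forall>b (X::real).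
     (\<forall>j\<in>I. \<forall>a\<ge>q * k. coeff (b j) a = 0) \<longrightarrow>
     (\<forall>j\<in>I. \<forall>a. \<exists>\<beta>. coeff (b j) a = fact a * \<beta> \<and> algebraic_int \<beta> \<and> conj_bound X \<beta>) \<longrightarrow>
     (\<forall>i<k. \<forall>j\<in>I. poly (Dit T G I i b j) 1 = l j * poly (Dit T G I i b p0) 1) \<longrightarrow>
     (\<forall>i a. \<forall>j\<in>I. algebraic_int (coeff (Dit T G I i b j) a)) \<longrightarrow>
     (\<forall>t<n0. fps_nth (lincomb I b u) t = 0) \<longrightarrow>
     X * real c ^ k < fact k \<longrightarrow>
     fps_nth (lincomb I b u) n0 = 0)"
proof -
  have "finite (insert y (u ` I))" "\<And>f. f \<in> insert y (u ` I) \<Longrightarrow> tame f" using I u y by auto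
  from tame_family[OF this] obtain C D where CD: "C > 0" "\<And>n. 0 < D n \<and> D n \<le> C ^ (n + 1)"
    and tb: "tame_bounds C D y" "\<And>i. i \<in> I \<Longrightarrow> tame_bounds C D (u i)" by auto
  define s where "s = degree T + (\<Sum>p\<in>I \<times> I. degree (G (fst p) (snd p)))"
  have sT: "degree T \<le> s" by (simp add: s_def)
  have sG: "degree (G i j) \<le> s" if "i \<in> I" "j \<in> I" for i j
    using member_le_sum[of "(i,j)" "I \<times> I" "\<lambda>p. degree (G (fst p) (snd p))"] that I by (simp add: s_def)
  \<comment> \<open>The product K k bounds n + 1 for the truncation order n chosen below. So each
    factor of \<open>c\<close>, raised to the power k, absorbs one geometric loss.\<close>
  define K where "K = \<kappa> + s + 3"
  define c where "c = C ^ K * 64 ^ (K + q) * d * (card I + 1) * 2 ^ K * C ^ K"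
  have c: "c > 0" using CD(1) T(3) by (simp add: c_def)
  show ?thesis
  proof (intro exI[of _ c] conjI c allI impI)
    fix k n0 b and X :: real
    assume k: "0 < k" and n0: "n0 \<le> \<kappa> * k"
      and bL: "\<forall>j\<in>I. \<forall>a\<ge>q * k. coeff (b j) a = 0"
      and b\<beta>: "\<forall>j\<in>I. \<forall>a. \<exists>\<beta>. coeff (b j) a = fact a * \<beta> \<and> algebraic_int \<beta> \<and> conj_bound X \<beta>"
      and pr: "\<forall>i<k. \<forall>j\<in>I. poly (Dit T G I i b j) 1 = l j * poly (Dit T G I i b p0) 1"
      and bD: "\<forall>i a. \<forall>j\<in>I. algebraic_int (coeff (Dit T G I i b j) a)"
      and low: "\<forall>t<n0. fps_nth (lincomb I b u) t = 0"
      and small: "X * real c ^ k < fact k"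
    define h where "h = (lincomb I b u)"
    \<comment> \<open>With this truncation order (n - s)! = (n0 + 2 k)! is divisible by i! (n0 + k)!
      for all i < k; s is the loss of index caused by multiplication by T and G.\<close>
    define n where "n = n0 + 2 * k + s"
    define L where "L = q * k"
    define V where "V j = trunc_poly n (u j)" for j
    define E where "E j = T * pderiv (V j) - (\<Sum>i\<in>I. G j i * V i)" for j
    \<comment> \<open>Numbers divisible by (n - s)! up to the denominator
      \<open>D n\<close>.\<close>
    define S1 :: "complex set" where "S1 = {x. algebraic_int (of_nat (D n) * x / fact (n - s))}"
    have S1: "0 \<in> S1" "\<And>x y. x \<in> S1 \<Longrightarrow> y \<in> S1 \<Longrightarrow> x - y \<in> S1"
      "\<And>x y. algebraic_int x \<Longrightarrow> y \<in> S1 \<Longrightarrow> x * y \<in> S1"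
    proof -
      show "0 \<in> S1" by (simp add: S1_def)
      show "x - y \<in> S1" if "x \<in> S1" "y \<in> S1" for x y
        using that algebraic_int_diff unfolding S1_def by (simp add: right_diff_distrib diff_divide_distrib)
      show "x * y \<in> S1" if "algebraic_int x" "y \<in> S1" for x y
        using algebraic_int_add_mult(2)[OF that(1), of "of_nat (D n) * y / fact (n - s)"] that(2)
        unfolding S1_def by (simp add: mult_ac)
    qed
    have S1neg: "- x \<in> S1" if "x \<in> S1" for x using S1(2)[OF S1(1) that] by simp
    have S1add: "x + y \<in> S1" if "x \<in> S1" "y \<in> S1" for x y using S1(2)[OF that(1) S1neg[OF that(2)]] by simp
    have S1sum: "(\<Sum>u\<in>W. f u) \<in> S1" if "\<And>u. u \<in> W \<Longrightarrow> f u \<in> S1" for W and f :: "'w \<Rightarrow> complex"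
      using that by (induction W rule: infinite_finite_induct) (simp_all add: S1add S1(1))
    have S1tail: "fps_nth f w \<in> S1" if "tame_bounds C D f" "w \<le> n" "n - s \<le> w" for f w
    proof -
      have "fact (n - s) dvd (fact w :: nat)" using that(3) by (rule fact_dvd)
      then obtain e where e: "fact w = fact (n - s) * (e :: nat)" by blast
      have e': "(fact w :: complex) = fact (n - s) * of_nat e"
        using arg_cong[OF e, of "of_nat :: nat \<Rightarrow> complex"] by simp
      have "algebraic_int (of_nat (D n) * (fps_nth f w / fact w))"
        using that by (auto simp: tame_bounds_def)
      hence "algebraic_int (of_nat e * (of_nat (D n) * (fps_nth f w / fact w)))"
        by (rule algebraic_int_add_mult(2)[OF algebraic_int_of_nat])
      moreover have "e \<noteq> 0" using e by (metis fact_nonzero mult_0_right)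
      hence "of_nat e * (of_nat (D n) * (fps_nth f w / fact w)) = of_nat (D n) * fps_nth f w / fact (n - s)"
        unfolding e' by simp
      ultimately show ?thesis by (simp add: S1_def)
    qed
    have S1V: "coeff (V j) w \<in> S1" if "j \<in> I" "n - s \<le> w" for j w
      using S1tail[OF tb(2)[OF that(1)] _ that(2)] S1(1) by (simp add: V_def coeff_trunc_poly)
    \<comment> \<open>Below degree n the truncations satisfy the system exactly. From n on, only
      coefficients of index at least n - s are involved, and these are divisible by (n - s)! up to
      \<open>D n\<close>.\<close>
    have Eco: "coeff (E j) t \<in> S1" if j: "j \<in> I" for j t
    proof (cases "t < n")
      case True
      have "coeff (T * pderiv (V j)) t = fps_nth (fps_of_poly T * fps_deriv (u j)) t"
        unfolding coeff_mult fps_mult_nth atLeast0AtMost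
        by (intro sum.cong) (use True in \<open>auto simp: coeff_pderiv V_def coeff_trunc_poly\<close>)
      moreover have "coeff (\<Sum>i\<in>I. G j i * V i) t = fps_nth (lincomb I (G j) u) t"
        unfolding coeff_sum fps_sum_nth coeff_mult fps_mult_nth atLeast0AtMost
        by (intro sum.cong) (use True in \<open>auto simp: V_def coeff_trunc_poly\<close>)
      ultimately have "coeff (E j) t = 0" using sys[OF j] by (simp add: E_def)
      thus ?thesis using S1 by simp
    next
      case False
      have 1: "coeff (T * pderiv (V j)) t \<in> S1"
        unfolding coeff_mult
      proof (rule S1sum)
        fix a assume "a \<in> {..t}"
        show "coeff T a * coeff (pderiv (V j)) (t - a) \<in> S1"
        proof (cases "a \<le> s")
          case True
          have "coeff (V j) (Suc (t - a)) \<in> S1" using False True by (intro S1V j) auto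
          thus ?thesis unfolding coeff_pderiv by (intro S1(3) T algebraic_int_of_nat)
        next
          case False
          hence "coeff T a = 0" using sT by (intro coeff_eq_0) auto
          thus ?thesis using S1 by simp
        qed
      qed
      have 2: "coeff (\<Sum>i\<in>I. G j i * V i) t \<in> S1"
        unfolding coeff_sum coeff_mult
      proof (intro S1sum)
        fix i a assume i: "i \<in> I" and "a \<in> {..t}"
        show "coeff (G j i) a * coeff (V i) (t - a) \<in> S1"
        proof (cases "a \<le> s")
          case True
          have "coeff (V i) (t - a) \<in> S1" using False True by (intro S1V i) auto
          thus ?thesis by (intro S1(3) G j i)
        next
          case False
          hence "coeff (G j i) a = 0" using sG[OF j i] by (intro coeff_eq_0) auto
          thus ?thesis using S1 by simp
        qed
      qed
      show ?thesis using S1(2)[OF 1 2] by (simp add: E_def)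
    qed
    define H where "H = (\<Sum>j\<in>I. b j * V j)"
    \<comment> \<open>The partial sum of (X - 1) y at 1 telescopes. This is the vanishing at 1 for
      all primes simultaneously, since y_n is divisible by n! up to denominators.\<close>
    have lV: "(\<Sum>j\<in>I. l j * poly (V j) 1) = - fps_nth y n"
    proof -
      have "(\<Sum>j\<in>I. l j * poly (V j) 1) = (\<Sum>t\<le>n. fps_nth (\<Sum>i\<in>I. fps_const (l i) * u i) t)"
        unfolding V_def poly_trunc_poly_1 sum_distrib_left fps_sum_nth
        by (subst sum.swap) simp
      also have "\<dots> = (\<Sum>t\<le>n. fps_nth ((fps_X - 1) * y) t)" by (simp only: yu)
      also have "\<dots> = - fps_nth y n"
        by (induction n) (simp_all add: left_diff_distrib)
      finally show ?thesis .
    qed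
    \<comment> \<open>At 1 the i-th row is a multiple of l, so applied to the truncations it gives a
      multiple of the telescoped sum. Together with the error of truncation this makes i! times the
      i-th Taylor coefficient divisible by (n - s)!.\<close>
    have jet1: "of_nat (d ^ i) * (fact i * coeff (tay H) i) \<in> S1" if i: "i < k" for i
    proof -
      obtain r where r: "\<forall>a. coeff r a \<in> S1"
        and eq: "T ^ i * (pderiv ^^ i) H = (\<Sum>j\<in>I. Dit T G I i b j * V j) + r"
        using Dit_approx[where E = E and V = V and S = S1 and b = b and G = G and i = i, OF I(1) _ S1 Eco T(1)] bD
        unfolding H_def by (auto simp: E_def)
      have "of_nat (d ^ i) * (fact i * coeff (tay H) i) = poly (T ^ i * (pderiv ^^ i) H) 1"
        by (simp add: coeff_tay T(2))
      also have "\<dots> = (\<Sum>j\<in>I. poly (Dit T G I i b j) 1 * poly (V j) 1) + poly r 1"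
        by (simp add: eq poly_sum)
      also have "(\<Sum>j\<in>I. poly (Dit T G I i b j) 1 * poly (V j) 1) =
         (\<Sum>j\<in>I. poly (Dit T G I i b p0) 1 * (l j * poly (V j) 1))"
        using pr i by (intro sum.cong) (auto simp: mult_ac)
      also have "\<dots> = poly (Dit T G I i b p0) 1 * (- fps_nth y n)"
        by (simp only: sum_distrib_left[symmetric] lV)
      finally have e: "of_nat (d ^ i) * (fact i * coeff (tay H) i) =
        poly (Dit T G I i b p0) 1 * (- fps_nth y n) + poly r 1" .
      have "algebraic_int (poly (Dit T G I i b p0) 1)"
        using algebraic_int_poly[of "Dit T G I i b p0" 1] bD I by simp
      moreover have "- fps_nth y n \<in> S1" by (intro S1neg S1tail tb) auto
      moreover have "poly r 1 \<in> S1" unfolding poly_altdef using r by (auto intro: S1sum)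
      ultimately show ?thesis unfolding e by (intro S1add S1(3))
    qed
    \<comment> \<open>In coefficient t of b . u, the weight a! of b and the weight w! of u give a!
      w! = t! / (t choose a); \<open>\<Lambda>\<close> clears these binomial coefficients, the
      remaining t! being divisible by (n0 + k)! for t \<ge> n0 + k.\<close>
    define \<Lambda> where "\<Lambda> = Lcm {1..n + L + 1}"
    define DD where "DD = D n * \<Lambda> * d ^ k"
    define S :: "complex set" where "S = {x. algebraic_int (of_nat DD * x / fact (n0 + k))}"
    have S: "0 \<in> S" "\<And>x y. x \<in> S \<Longrightarrow> y \<in> S \<Longrightarrow> x - y \<in> S"
      using algebraic_int_diff unfolding S_def by (auto simp: right_diff_distrib diff_divide_distrib)
    have Sneg: "- x \<in> S" if "x \<in> S" for x using S(2)[OF S(1) that] by simp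
    have Sadd: "x + y \<in> S" if "x \<in> S" "y \<in> S" for x y using S(2)[OF that(1) Sneg[OF that(2)]] by simp
    have Ssum: "(\<Sum>u\<in>W. f u) \<in> S" if "\<And>u. u \<in> W \<Longrightarrow> f u \<in> S" for W and f :: "'w \<Rightarrow> complex"
      using that by (induction W rule: infinite_finite_induct) (simp_all add: Sadd S(1))
    have Hco: "coeff H t = fps_nth h t" if "t \<le> n" for t
      unfolding H_def h_def coeff_sum fps_sum_nth coeff_mult fps_mult_nth atLeast0AtMost
      by (intro sum.cong) (use that in \<open>auto simp: V_def coeff_trunc_poly\<close>)
    have "coeff H n0 \<in> S"
    proof (rule lowest_coeff_from_jet[of S n0 H k])
      show "0 \<in> S" "\<And>x y. x \<in> S \<Longrightarrow> y \<in> S \<Longrightarrow> x - y \<in> S" by (rule S, rule S(2))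
      show "coeff H t = 0" if "t < n0" for t
        using Hco[of t] low that by (simp add: n_def h_def)
      show "coeff (tay H) i \<in> S" if i: "i < k" for i
      proof -
        have "fact i * fact (n0 + k) dvd (fact (i + (n0 + k)) :: nat)" by (rule fact_fact_dvd_fact)
        also have "\<dots> dvd fact (n - s)" by (rule fact_dvd) (use i in \<open>simp add: n_def\<close>)
        finally obtain e where e: "fact (n - s) = fact i * fact (n0 + k) * (e :: nat)" by blast
        have e': "(fact (n - s) :: complex) = fact i * fact (n0 + k) * of_nat e"
          using arg_cong[OF e, of "of_nat :: nat \<Rightarrow> complex"] by simp
        have e0: "e \<noteq> 0" using e by (metis fact_nonzero mult_0_right)
        have dk: "(of_nat d :: complex) ^ k = of_nat d ^ (k - i) * of_nat d ^ i"
          using i by (simp add: power_add[symmetric])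
        have "algebraic_int (of_nat (\<Lambda> * d ^ (k - i) * e) * (of_nat (D n) * (of_nat (d ^ i) * (fact i * coeff (tay H) i)) / fact (n - s)))"
          using jet1[OF i] unfolding S1_def by (intro algebraic_int_add_mult(2)[OF algebraic_int_of_nat, of _ "\<Lambda> * d ^ (k - i) * e"]) simp
        also have "of_nat (\<Lambda> * d ^ (k - i) * e) * (of_nat (D n) * (of_nat (d ^ i) * (fact i * coeff (tay H) i)) / fact (n - s))
           = of_nat DD * coeff (tay H) i / fact (n0 + k)"
          unfolding e' DD_def using e0 by (simp add: dk field_simps)
        finally show ?thesis by (simp add: S_def)
      qed
      show "coeff H t \<in> S" if t: "n0 + k \<le> t" for t
        unfolding H_def coeff_sum coeff_mult
      proof (intro Ssum)
        fix j a assume j: "j \<in> I" and a: "a \<in> {..t}"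
        define w where "w = t - a"
        have taw: "t = a + w" using a by (simp add: w_def)
        obtain \<beta> where \<beta>: "coeff (b j) a = fact a * \<beta>" "algebraic_int \<beta>" using b\<beta> j by blast
        show "coeff (b j) a * coeff (V j) (t - a) \<in> S"
        proof (cases "a < L \<and> w \<le> n")
          case True
          have "(t choose a) dvd \<Lambda>" unfolding \<Lambda>_def by (rule binomial_dvd_Lcm) (use True taw in auto)
          then obtain e1 where e1: "\<Lambda> = (t choose a) * e1" by blast
          have "fact (n0 + k) dvd (fact t :: nat)" using t by (rule fact_dvd)
          then obtain e2 where e2: "fact t = fact (n0 + k) * (e2 :: nat)" by blast
          have e2': "(fact t :: complex) = fact (n0 + k) * of_nat e2"
            using arg_cong[OF e2, of "of_nat :: nat \<Rightarrow> complex"] by simp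
          have "fact a * fact w * (t choose a) = fact t"
            using binomial_fact_lemma[of a t] taw by simp
          hence ch: "fact a * fact w * of_nat (t choose a) = (fact t :: complex)"
            by (metis of_nat_fact of_nat_mult)
          have "algebraic_int (of_nat (D n) * (fps_nth (u j) w / fact w))"
            using tb(2)[OF j] True by (auto simp: tame_bounds_def)
          hence "algebraic_int (of_nat (e1 * e2 * d ^ k) * (\<beta> * (of_nat (D n) * (fps_nth (u j) w / fact w))))"
            by (rule algebraic_int_add_mult(2)[OF algebraic_int_of_nat algebraic_int_add_mult(2)[OF \<beta>(2)]])
          also have "of_nat (e1 * e2 * d ^ k) * (\<beta> * (of_nat (D n) * (fps_nth (u j) w / fact w))) =
             of_nat DD * (coeff (b j) a * coeff (V j) (t - a)) / fact (n0 + k)"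
          proof -
            have "coeff (V j) (t - a) = fps_nth (u j) w" using True by (simp add: V_def coeff_trunc_poly w_def)
            moreover have fa: "(fact a :: complex) * of_nat (t choose a) = fact (n0 + k) * of_nat e2 / fact w"
              using ch e2' by (simp add: field_simps)
            have "of_nat DD * (fact a * \<beta> * fps_nth (u j) w) / fact (n0 + k) =
              of_nat (D n) * of_nat e1 * of_nat d ^ k * (fact a * of_nat (t choose a)) * \<beta> * fps_nth (u j) w / fact (n0 + k)"
              by (simp only: DD_def e1 of_nat_mult of_nat_power mult_ac)
            hence "of_nat DD * (fact a * \<beta> * fps_nth (u j) w) / fact (n0 + k) =
              of_nat (D n) * of_nat e1 * of_nat d ^ k * (fact (n0 + k) * of_nat e2 / fact w) * \<beta> * fps_nth (u j) w / fact (n0 + k)"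
              unfolding fa .
            ultimately show ?thesis by (simp add: \<beta>(1) mult_ac)
          qed
          finally show ?thesis by (simp add: S_def)
        next
          case False
          hence "coeff (b j) a = 0 \<or> coeff (V j) (t - a) = 0"
            using bL j by (auto simp: L_def V_def coeff_trunc_poly w_def)
          thus ?thesis using S(1) by auto
        qed
      qed
    qed
    hence hS: "algebraic_int (of_nat DD * fps_nth h n0 / of_nat (fact (n0 + k)))"
      using Hco[of n0] by (simp add: S_def n_def)
    have X0: "X \<ge> 0" using b\<beta> I(2) conj_bound_nonneg by blast
    \<comment> \<open>The conjugates of the lowest coefficient are bounded with n0! only, because a!
      w! \<le> (a + w)! = n0!. The divisibility by (n0 + k)! is stronger by at least k!, which
      forces the coefficient to vanish.\<close>
    have hcb: "conj_bound (\<Sum>j\<in>I. \<Sum>a\<in>{0..n0}. X * real C ^ (n0 + 1) * fact n0) (fps_nth h n0)"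
      unfolding h_def fps_sum_nth fps_mult_nth
    proof (intro conj_bound_sum)
      fix j a assume j: "j \<in> I" and a: "a \<in> {0..n0}"
      obtain \<beta> where \<beta>: "coeff (b j) a = fact a * \<beta>" "conj_bound X \<beta>" using b\<beta> j by blast
      define w where "w = n0 - a"
      have "conj_bound (real C ^ (w + 1)) (fps_nth (u j) w / fact w)"
        using tb(2)[OF j] by (auto simp: tame_bounds_def)
      hence cb1: "conj_bound (X * real C ^ (w + 1) * real (fact a * fact w)) (\<beta> * (fps_nth (u j) w / fact w) * of_nat (fact a * fact w))"
        by (intro conj_bound_mult \<beta> conj_bound_of_nat)
      have cb2: "\<beta> * (fps_nth (u j) w / fact w) * of_nat (fact a * fact w) = fps_nth (fps_of_poly (b j)) a * fps_nth (u j) (n0 - a)"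
        by (simp add: \<beta>(1) w_def)
      have cb3: "X * real C ^ (w + 1) * real (fact a * fact w) \<le> X * real C ^ (n0 + 1) * fact n0"
      proof -
        have "fact a * fact w dvd (fact (a + w) :: nat)" by (rule fact_fact_dvd_fact)
        hence "fact a * fact w \<le> (fact (a + w) :: nat)" by (rule dvd_imp_le) simp
        moreover have "a + w = n0" using a by (simp add: w_def)
        ultimately have "real (fact a * fact w) \<le> real (fact n0)" by (simp only: of_nat_le_iff)
        hence "real (fact a * fact w) \<le> fact n0" by (simp only: of_nat_fact)
        moreover have "real C ^ (w + 1) \<le> real C ^ (n0 + 1)"
          using CD(1) by (intro power_increasing) (auto simp: w_def)
        ultimately show ?thesis
          by (intro mult_mono mult_left_mono mult_nonneg_nonneg X0 zero_le_power of_nat_0_le_iff)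
      qed
      show "conj_bound (X * real C ^ (n0 + 1) * fact n0) (fps_nth (fps_of_poly (b j)) a * fps_nth (u j) (n0 - a))"
        by (rule conj_bound_mono[OF cb1[unfolded cb2] cb3])
    qed
    define R where "R = real DD * (\<Sum>j\<in>I. \<Sum>a\<in>{0..n0}. X * real C ^ (n0 + 1) * fact n0) / real (fact (n0 + k))"
    have cbR: "conj_bound R (of_nat DD * fps_nth h n0 / of_nat (fact (n0 + k)))"
      unfolding R_def by (intro conj_bound_divide_of_nat conj_bound_mult conj_bound_of_nat hcb)
    have "DD * (card I * (n0 + 1) * C ^ (n0 + 1)) \<le> c ^ k"
    proof -
      have s_le: "s \<le> s * k" "3 * k \<ge> 2 * k + 1" using k by auto
      have nK: "n + 1 \<le> K * k"
      proof -
        have "K * k = \<kappa> * k + s * k + 3 * k" by (simp add: K_def algebra_simps)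
        thus ?thesis using n0 s_le k unfolding n_def by linarith
      qed
      have n0K: "n0 + 1 \<le> K * k" using nK by (simp add: n_def)
      have "D n \<le> C ^ (n + 1)" using CD by blast
      also have "\<dots> \<le> C ^ (K * k)" using nK CD(1) by (intro power_increasing) auto
      finally have 1: "D n \<le> (C ^ K) ^ k" by (simp add: power_mult)
      have "\<Lambda> \<le> 64 ^ (n + L + 1)" unfolding \<Lambda>_def by (rule Lcm_upto_bound)
      also have "\<dots> \<le> 64 ^ ((K + q) * k)" using nK by (intro power_increasing) (auto simp: L_def algebra_simps)
      finally have 2: "\<Lambda> \<le> (64 ^ (K + q)) ^ k" by (simp add: power_mult)
      have 3: "card I \<le> (card I + 1) ^ k"
        using power_increasing[of 1 k "card I + 1"] k by simp
      have "n0 + 1 \<le> 2 ^ (n0 + 1)" by (rule less_imp_le) (rule less_exp)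
      also have "\<dots> \<le> 2 ^ (K * k)" using n0K by (intro power_increasing) auto
      finally have 4: "n0 + 1 \<le> (2 ^ K) ^ k" by (simp add: power_mult)
      have "C ^ (n0 + 1) \<le> C ^ (K * k)" using n0K CD(1) by (intro power_increasing) auto
      hence 5: "C ^ (n0 + 1) \<le> (C ^ K) ^ k" by (simp add: power_mult)
      have "DD * (card I * (n0 + 1) * C ^ (n0 + 1)) \<le> (C ^ K) ^ k * (64 ^ (K + q)) ^ k * d ^ k * ((card I + 1) ^ k * (2 ^ K) ^ k * (C ^ K) ^ k)"
        unfolding DD_def by (intro mult_le_mono 1 2 3 4 5 order_refl)
      also have "\<dots> = c ^ k" unfolding c_def by (simp only: power_mult_distrib mult_ac)
      finally show ?thesis .
    qed
    hence "real (DD * (card I * (n0 + 1) * C ^ (n0 + 1))) \<le> real (c ^ k)" by (rule of_nat_mono)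
    hence cc: "real DD * (real (card I) * real (n0 + 1) * real C ^ (n0 + 1)) \<le> real c ^ k"
      by (simp only: of_nat_mult of_nat_power)
    have "R = real DD * (real (card I) * real (n0 + 1) * real C ^ (n0 + 1)) * X * (fact n0 / fact (n0 + k))"
      by (simp add: R_def)
    also have "\<dots> \<le> real c ^ k * X * (fact n0 / fact (n0 + k))"
      using cc X0 by (intro mult_right_mono) auto
    also have "\<dots> \<le> real c ^ k * X * (1 / fact k)"
    proof (rule mult_left_mono)
      have "fact n0 * fact k dvd (fact (n0 + k) :: nat)" by (rule fact_fact_dvd_fact)
      hence "fact n0 * fact k \<le> (fact (n0 + k) :: nat)" by (rule dvd_imp_le) simp
      hence "real (fact n0 * fact k) \<le> real (fact (n0 + k))" by (rule of_nat_mono)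
      thus "fact n0 / fact (n0 + k) \<le> (1 / fact k :: real)" by (simp add: field_simps)
    qed (use X0 in simp)
    also have "\<dots> < 1" using small by (simp add: field_simps)
    finally have "R < 1" .
    from algebraic_int_conj_bound_less_1[OF hS cbR this]
    have "fps_nth h n0 = 0" using CD(2)[of n] T(3) by (auto simp: DD_def \<Lambda>_def Lcm_0_iff)
    thus "fps_nth (lincomb I b u) n0 = 0" by (simp add: h_def)
  qed
qed

section \<open>Closure properties of tame series\<close>

lemma algebraic_int_scale_of_nat: "algebraic_int (x :: complex) \<Longrightarrow> algebraic_int (of_nat n * x)"
  by (rule algebraic_int_add_mult(2)[OF algebraic_int_of_nat])

lemma tame_add:
  assumes "tame f" "tame g" shows "tame (f + g)"
proof -
  obtain C D where CD: "C > 0" "\<forall>n. 0 < D n \<and> D n \<le> C ^ (n + 1)" "tame_bounds C D f" "tame_bounds C D g"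
    using tame_family[of "{f,g}"] assms by auto
  have "tame_bounds (2 * C) D (f + g)"
    unfolding tame_bounds_def
  proof (intro conjI allI impI)
    fix n
    show "0 < D n" using CD by blast
    have "D n \<le> C ^ (n + 1)" using CD by blast
    also have "\<dots> \<le> (2 * C) ^ (n + 1)" by (rule power_mono) auto
    finally show "D n \<le> (2 * C) ^ (n + 1)" .
    show "algebraic_int (of_nat (D n) * (fps_nth (f + g) i / fact i))" if "i \<le> n" for i
    proof -
      have "algebraic_int (of_nat (D n) * (fps_nth f i / fact i) + of_nat (D n) * (fps_nth g i / fact i))"
        by (rule algebraic_int_add_mult(1)) (use CD(3,4) that in \<open>simp_all add: tame_bounds_def\<close>)
      thus ?thesis by (simp add: add_divide_distrib distrib_left)
    qed
    have "conj_bound (real C ^ (n + 1) + real C ^ (n + 1)) (fps_nth f n / fact n + fps_nth g n / fact n)"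
      by (rule conj_bound_add) (use CD(3,4) in \<open>simp_all add: tame_bounds_def\<close>)
    moreover have "real C ^ (n + 1) + real C ^ (n + 1) \<le> real (2 * C) ^ (n + 1)"
    proof -
      have "2 * real C ^ (n + 1) \<le> 2 ^ (n + 1) * real C ^ (n + 1)"
        using power_increasing[of 1 "n + 1" "2 :: real"] by (intro mult_right_mono) auto
      thus ?thesis by (simp only: of_nat_mult power_mult_distrib of_nat_numeral mult_2[of "real C ^ (n + 1)"])
    qed
    ultimately show "conj_bound (real (2 * C) ^ (n + 1)) (fps_nth (f + g) n / fact n)"
      unfolding fps_add_nth add_divide_distrib by (rule conj_bound_mono)
  qed
  thus ?thesis unfolding tame_def by blast
qed

text \<open>Expressed through f_i / i! and g_j / j!, the normalised coefficients of the product
  carry inverse binomial coefficients. Their common denominator is the least common multiple of 1,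
  ..., n + 1.\<close>

lemma tame_mult:
  assumes "tame f" "tame g" shows "tame (f * g)"
proof -
  obtain C D where CD: "C > 0" "\<forall>n. 0 < D n \<and> D n \<le> C ^ (n + 1)" "tame_bounds C D f" "tame_bounds C D g"
    using tame_family[of "{f,g}"] assms by auto
  define D' where "D' n = D n * D n * Lcm {1..n + 1}" for n
  define C' where "C' = C * C * 64"
  have Lpos: "Lcm {1..n + 1} > (0::nat)" for n by (auto simp: Lcm_0_iff intro!: Nat.gr0I)
  have trm: "fps_nth f i * fps_nth g (n - i) / fact n =
      (fps_nth f i / fact i) * (fps_nth g (n - i) / fact (n - i)) / of_nat (n choose i)" if "i \<le> n" for i n
    using that by (simp add: binomial_fact)
  have "tame_bounds C' D' (f * g)"
    unfolding tame_bounds_def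
  proof (intro conjI allI impI)
    fix n
    show "0 < D' n" using CD(2) Lpos by (simp add: D'_def)
    have "D' n \<le> C ^ (n + 1) * C ^ (n + 1) * 64 ^ (n + 1)"
      unfolding D'_def using CD(2) by (intro mult_le_mono Lcm_upto_bound) auto
    thus "D' n \<le> C' ^ (n + 1)" by (simp only: C'_def power_mult_distrib)
    show "algebraic_int (of_nat (D' n) * (fps_nth (f * g) i / fact i))" if i: "i \<le> n" for i
    proof -
      have "of_nat (D' n) * (fps_nth (f * g) i / fact i) =
        (\<Sum>a=0..i. of_nat (D' n) * (fps_nth f a * fps_nth g (i - a) / fact i))"
        by (simp add: fps_mult_nth sum_divide_distrib sum_distrib_left)
      also have "algebraic_int \<dots>"
      proof (rule algebraic_int_sum)
        fix a assume "a \<in> {0..i}"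
        hence a: "a \<le> i" by simp
        have "(i choose a) dvd Lcm {1..n + 1}" by (rule binomial_dvd_Lcm[OF a i])
        then obtain e where e: "Lcm {1..n + 1} = (i choose a) * e" by blast
        have ne: "(i choose a) \<noteq> 0" using a by simp
        have "algebraic_int (of_nat (D n) * (fps_nth f a / fact a) * (of_nat (D n) * (fps_nth g (i - a) / fact (i - a))))"
          by (rule algebraic_int_add_mult(2)) (use CD(3,4) a i in \<open>simp_all add: tame_bounds_def\<close>)
        from algebraic_int_scale_of_nat[OF this, of e]
        show "algebraic_int (of_nat (D' n) * (fps_nth f a * fps_nth g (i - a) / fact i))"
          unfolding trm[OF a] D'_def e using ne by (simp add: mult_ac)
      qed
      finally show ?thesis .
    qed
    have "conj_bound (\<Sum>a=0..n. real C ^ (n + 1) * real C ^ (n + 1)) (\<Sum>a=0..n. fps_nth f a * fps_nth g (n - a) / fact n)"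
    proof (rule conj_bound_sum)
      fix a assume "a \<in> {0..n}"
      hence a: "a \<le> n" by simp
      have "conj_bound (real C ^ (a + 1) * real C ^ (n - a + 1) / real (n choose a)) (fps_nth f a * fps_nth g (n - a) / fact n)"
        unfolding trm[OF a]
        by (intro conj_bound_divide_of_nat conj_bound_mult) (use CD(3,4) in \<open>simp_all add: tame_bounds_def\<close>)
      moreover have "real C ^ (a + 1) * real C ^ (n - a + 1) / real (n choose a) \<le> real C ^ (n + 1) * real C ^ (n + 1)"
      proof -
        have "real C ^ (a + 1) * real C ^ (n - a + 1) / real (n choose a) \<le> real C ^ (a + 1) * real C ^ (n - a + 1) / 1"
          using a by (intro divide_left_mono) (auto simp: Suc_le_eq)
        also have "\<dots> \<le> real C ^ (n + 1) * real C ^ (n + 1)"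
          unfolding div_by_1 using a CD(1) by (intro mult_mono power_increasing) auto
        finally show ?thesis .
      qed
      ultimately show "conj_bound (real C ^ (n + 1) * real C ^ (n + 1)) (fps_nth f a * fps_nth g (n - a) / fact n)"
        by (rule conj_bound_mono)
    qed
    moreover have "(\<Sum>a=0..n. fps_nth f a * fps_nth g (n - a) / fact n) = fps_nth (f * g) n / fact n"
      by (simp add: fps_mult_nth sum_divide_distrib)
    moreover have "(\<Sum>a=0..n. real C ^ (n + 1) * real C ^ (n + 1)) \<le> real C' ^ (n + 1)"
    proof -
      have "n + 1 \<le> 64 ^ (n + 1)"
        using less_exp[of "n + 1"] power_mono[of "2::nat" 64 "n + 1"] by simp
      hence "real (n + 1) \<le> real (64 ^ (n + 1))" by (rule of_nat_mono)
      hence "real (n + 1) * (real C ^ (n + 1) * real C ^ (n + 1)) \<le> 64 ^ (n + 1) * (real C ^ (n + 1) * real C ^ (n + 1))"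
        by (intro mult_right_mono) auto
      also have "\<dots> = real C' ^ (n + 1)"
        by (simp only: C'_def of_nat_mult power_mult_distrib of_nat_numeral mult_ac)
      finally show ?thesis by simp
    qed
    ultimately show "conj_bound (real C' ^ (n + 1)) (fps_nth (f * g) n / fact n)"
      by (metis conj_bound_mono)
  qed
  thus ?thesis unfolding tame_def by blast
qed

lemma tame_const: assumes "a \<in> Qbar" shows "tame (fps_const a)"
proof -
  obtain d :: nat where d: "d > 0" "algebraic_int (of_nat d * a)" using assms by (auto simp: Qbar_iff)
  obtain R where R: "R > 0" "conj_bound R a" using Qbar_conj_bound[OF assms] by blast
  define C where "C = d + nat \<lceil>R\<rceil>"
  have CR: "R \<le> real C" unfolding C_def using R(1) by linarith
  have C1: "C \<ge> 1" using d by (simp add: C_def)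
  have "tame_bounds C (\<lambda>_. d) (fps_const a)"
    unfolding tame_bounds_def
  proof (intro conjI allI impI)
    fix n
    show "0 < d" by (rule d)
    have "d \<le> C ^ 1" by (simp add: C_def)
    also have "\<dots> \<le> C ^ (n + 1)" using C1 by (intro power_increasing) auto
    finally show "d \<le> C ^ (n + 1)" .
    show "algebraic_int (of_nat d * (fps_nth (fps_const a) i / fact i))" for i
      using d by (cases i) auto
    show "conj_bound (real C ^ (n + 1)) (fps_nth (fps_const a) n / fact n)"
    proof (cases n)
      case 0
      thus ?thesis using conj_bound_mono[OF R(2) CR] by simp
    next
      case (Suc n')
      thus ?thesis using conj_bound_mono[OF conj_bound_0, of "real C ^ (n + 1)"] by simp
    qed
  qed
  thus ?thesis unfolding tame_def by blast
qed

lemma tame_X: "tame fps_X"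
proof -
  have "tame_bounds 1 (\<lambda>_. 1) fps_X"
    unfolding tame_bounds_def
    using conj_bound_of_nat[of 1] conj_bound_mono[OF conj_bound_0, of 1] by (auto simp: fps_X_def)
  thus ?thesis unfolding tame_def by blast
qed

lemma tame_poly: "p \<in> QP \<Longrightarrow> tame (fps_of_poly p)"
proof (induction p)
  case 0
  thus ?case using tame_const[of 0] by simp
next
  case (pCons a p)
  have "a \<in> Qbar" "p \<in> QP" using pCons.prems unfolding polys_over_iff
    by (metis coeff_pCons_0, metis coeff_pCons_Suc)
  thus ?case unfolding fps_of_poly_pCons
    by (intro tame_add tame_mult tame_const tame_X pCons.IH)
qed

lemma tame_sum: "(\<And>i. i \<in> A \<Longrightarrow> tame (f i)) \<Longrightarrow> tame (\<Sum>i\<in>A. f i)"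
  using tame_const[of 0]
  by (induction A rule: infinite_finite_induct) (auto intro: tame_add)

lemma tame_diff: "tame f \<Longrightarrow> tame g \<Longrightarrow> tame (f - g)"
  using tame_add[of f "fps_const (-1) * g"] tame_mult[OF tame_const[of "-1"], of g] Qbar_minus[OF Qbar_1]
  by (simp add: fps_const_neg[symmetric] del: fps_const_neg)

lemma tame_poly_combination:
  "(\<And>i. i \<in> A \<Longrightarrow> p i \<in> QP) \<Longrightarrow> (\<And>i. i \<in> A \<Longrightarrow> tame (u i)) \<Longrightarrow> tame (lincomb A p u)"
  by (intro tame_sum tame_mult tame_poly)

lemma tay_linear_power: "tay ([:-1, 1:] ^ k) = monom 1 k"
proof (induction k)
  case (Suc k)
  have "tay [:-1, 1:] = [:0, 1:]" by (simp add: tay_def pcompose_pCons)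
  thus ?case using Suc by (simp only: power_Suc tay_simps) (simp add: monom_Suc)
qed (simp add: tay_def monom_0 one_pCons)

text \<open>The factorial argument once more, with a component of the row in place of b . u: a
  k-fold zero at 1 makes the jet vanish, so the lowest coefficient is divisible by (n0 + k)!,
  whereas its conjugates are at most n0! X < n0! k!.\<close>

lemma high_multiplicity_contradiction:
  assumes p: "p \<noteq> 0" "[:-1, 1:] ^ k dvd p"
    and \<beta>: "\<And>a. \<exists>\<beta>. coeff p a = fact a * \<beta> \<and> algebraic_int \<beta> \<and> conj_bound X \<beta>"
    and X: "X < fact k"
  shows False
proof -
  define n0 where "n0 = (LEAST t. coeff p t \<noteq> 0)"
  have ex: "\<exists>t. coeff p t \<noteq> 0" using p(1) by (auto simp: poly_eq_iff)
  have n0: "coeff p n0 \<noteq> 0" unfolding n0_def using ex by (rule LeastI_ex)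
  have low: "coeff p t = 0" if "t < n0" for t using that not_less_Least unfolding n0_def by blast
  define S :: "complex set" where "S = {x. algebraic_int (x / of_nat (fact (n0 + k)))}"
  have S: "0 \<in> S" "\<And>x y. x \<in> S \<Longrightarrow> y \<in> S \<Longrightarrow> x - y \<in> S"
    using algebraic_int_diff unfolding S_def by (auto simp: diff_divide_distrib)
  obtain p' where p': "p = [:-1, 1:] ^ k * p'" using p(2) by blast
  have "coeff p n0 \<in> S"
  proof (rule lowest_coeff_from_jet[OF S low])
    fix t assume "n0 + k \<le> t"
    hence "fact (n0 + k) dvd (fact t :: nat)" by (rule fact_dvd)
    then obtain e where e: "fact t = fact (n0 + k) * (e :: nat)" by blast
    have e': "(fact t :: complex) = fact (n0 + k) * of_nat e"
      using arg_cong[OF e, of "of_nat :: nat \<Rightarrow> complex"] by simp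
    obtain \<beta> where "coeff p t = fact t * \<beta>" "algebraic_int \<beta>" using \<beta> by blast
    thus "coeff p t \<in> S" using algebraic_int_scale_of_nat[of \<beta> e] unfolding S_def by (simp add: e')
  next
    fix i assume "i < k"
    thus "coeff (tay p) i \<in> S"
      unfolding p' tay_simps tay_linear_power using S(1) by (simp add: coeff_monom_mult)
  qed
  hence A: "algebraic_int (coeff p n0 / of_nat (fact (n0 + k)))" by (simp add: S_def)
  obtain \<beta> where b: "coeff p n0 = fact n0 * \<beta>" "conj_bound X \<beta>" using \<beta> by blast
  have "conj_bound (real (fact n0) * X / real (fact (n0 + k))) (of_nat (fact n0) * \<beta> / of_nat (fact (n0 + k)))"
    by (intro conj_bound_divide_of_nat conj_bound_mult conj_bound_of_nat b)
  hence B: "conj_bound (real (fact n0) * X / real (fact (n0 + k))) (coeff p n0 / of_nat (fact (n0 + k)))"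
    by (simp add: b)
  have "fact n0 * fact k dvd (fact (n0 + k) :: nat)" by (rule fact_fact_dvd_fact)
  hence "fact n0 * fact k \<le> (fact (n0 + k) :: nat)" by (rule dvd_imp_le) simp
  hence "real (fact n0 * fact k) \<le> real (fact (n0 + k))" by (rule of_nat_mono)
  moreover have "real (fact n0) * X < real (fact n0) * fact k" using X by (intro mult_strict_left_mono) auto
  ultimately have "real (fact n0) * X < real (fact (n0 + k))"
    unfolding of_nat_mult of_nat_fact by linarith
  hence "real (fact n0) * X / real (fact (n0 + k)) < 1" by simp
  from algebraic_int_conj_bound_less_1[OF A B this] show False using n0 by simp
qed

section \<open>Elimination and reduced bases of polynomial modules\<close>

text \<open>The exponent t is the least order at a of the non-zero entries. After division by this
  power a relation specialises non-trivially at a.\<close>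

lemma strip_linear_factor:
  fixes w :: "'i \<Rightarrow> complex poly"
  assumes "finite I" "\<exists>i\<in>I. w i \<noteq> 0" "\<And>i. i \<in> I \<Longrightarrow> w i \<in> QP" "a \<in> Qbar" "a \<noteq> 0"
  shows "\<exists>t w'. (\<forall>i\<in>I. w i = [:-a, 1:] ^ t * w' i \<and> w' i \<in> QP) \<and> (\<exists>i\<in>I. poly (w' i) a \<noteq> 0)"
proof -
  define Os where "Os = (\<lambda>i. order a (w i)) ` {i\<in>I. w i \<noteq> 0}"
  have Os: "finite Os" "Os \<noteq> {}" using assms by (auto simp: Os_def)
  define t where "t = Min Os"
  have "t \<in> Os" unfolding t_def using Os by (rule Min_in)
  then obtain i0 where i0: "i0 \<in> I" "w i0 \<noteq> 0" "t = order a (w i0)" by (auto simp: Os_def)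
  have "\<exists>v. w i = [:-a, 1:] ^ t * v" if "i \<in> I" for i
  proof (cases "w i = 0")
    case False
    hence "t \<le> order a (w i)" unfolding t_def using Os that by (intro Min_le) (auto simp: Os_def)
    hence "[:-a, 1:] ^ t dvd [:-a, 1:] ^ order a (w i)" by (rule le_imp_power_dvd)
    also have "\<dots> dvd w i" by (rule order_1)
    finally show ?thesis by blast
  qed (auto intro: exI[of _ 0])
  then obtain w' where w': "\<And>i. i \<in> I \<Longrightarrow> w i = [:-a, 1:] ^ t * w' i" by metis
  have QPw: "w' i \<in> QP" if "i \<in> I" for i
    by (rule QP_linear_factor_power[of a t]) (use assms w'[OF that] that in metis)+
  obtain v where v: "w i0 = [:-a, 1:] ^ order a (w i0) * v" "\<not> [:-a, 1:] dvd v"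
    using order_decomp[OF i0(2), of a] by blast
  have "[:-a, 1:] ^ t * v = [:-a, 1:] ^ t * w' i0" using v(1) w'[OF i0(1)] i0(3) by metis
  hence "v = w' i0" by simp
  hence "poly (w' i0) a \<noteq> 0" using v(2) by (simp add: poly_eq_0_iff_dvd)
  thus ?thesis using w' QPw i0(1) by blast
qed

text \<open>Comparing coefficients gives m (d + 1) unknowns and (m - 1) (d + N + 1) equations, where
  d = m N. The explicit degree is needed for the bound on the order of b . u at 0.\<close>

lemma bounded_elimination:
  fixes w :: "nat \<Rightarrow> 'i \<Rightarrow> complex poly"
  assumes I: "finite I" "p0 \<in> I" "card I = m"
    and w: "\<And>i j. i < m \<Longrightarrow> j \<in> I \<Longrightarrow> w i j \<in> QP" "\<And>i j. i < m \<Longrightarrow> j \<in> I \<Longrightarrow> degree (w i j) \<le> N"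
  shows "\<exists>c. (\<forall>i<m. c i \<in> QP \<and> degree (c i) \<le> m * N) \<and> (\<exists>i<m. c i \<noteq> 0) \<and>
     (\<forall>j\<in>I - {p0}. (\<Sum>i<m. c i * w i j) = 0)"
proof -
  define d where "d = m * N"
  define U where "U = {..<m} \<times> {..d}"
  define R where "R = (I - {p0}) \<times> {..d + N}"
  define A where "A = (\<lambda>(j, e) (i, f). if f \<le> e then coeff (w i j) (e - f) else 0)"
  have m: "m > 0" using I by (metis card_gt_0_iff empty_iff)
  obtain m' where m': "m = Suc m'" using m by (cases m) auto
  have "card R = m' * (d + N + 1)" using I m' by (simp add: R_def card_cartesian_product)
  also have "\<dots> < m * (d + 1)" unfolding d_def m' by (simp add: algebra_simps)
  also have "\<dots> = card U" by (simp add: U_def card_cartesian_product)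
  finally have card: "card R < card U" .
  have "\<exists>x. (\<forall>u. x u \<in> Qbar) \<and> (\<exists>u\<in>U. x u \<noteq> 0) \<and> (\<forall>r\<in>R. (\<Sum>u\<in>U. A r u * x u) = 0)"
  proof (rule homogeneous_system_solution[OF _ _ card])
    fix r u assume "r \<in> R" "u \<in> U"
    then obtain j e i f where ru: "r = (j, e)" "u = (i, f)" "j \<in> I" "i < m"
      by (auto simp: R_def U_def)
    show "A r u \<in> Qbar" using QP_coeff[OF w(1)[OF ru(4,3)]] by (simp add: A_def ru(1,2))
  qed (use I in \<open>auto simp: R_def U_def\<close>)
  then obtain x where x: "\<forall>u. x u \<in> Qbar" "\<exists>u\<in>U. x u \<noteq> 0" "\<forall>r\<in>R. (\<Sum>u\<in>U. A r u * x u) = 0" by blast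
  define c where "c i = (\<Sum>f\<le>d. monom (x (i, f)) f)" for i
  have cc: "coeff (c i) f = (if f \<le> d then x (i, f) else 0)" for i f
    by (simp add: c_def coeff_sum)
  show ?thesis
  proof (intro exI[of _ c] conjI allI impI ballI)
    show "c i \<in> QP" for i using x(1) by (auto simp: polys_over_iff cc)
    show "degree (c i) \<le> m * N" for i by (rule degree_le) (auto simp: cc d_def)
    obtain i f where "(i, f) \<in> U" "x (i, f) \<noteq> 0" using x(2) by auto
    hence "i < m" "coeff (c i) f \<noteq> 0" by (auto simp: cc U_def)
    thus "\<exists>i<m. c i \<noteq> 0" by auto
    fix j assume j: "j \<in> I - {p0}"
    show "(\<Sum>i<m. c i * w i j) = 0"
    proof (rule poly_eqI)
      fix e
      show "coeff (\<Sum>i<m. c i * w i j) e = coeff 0 e"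
      proof (cases "e \<le> d + N")
        case True
        have "coeff (\<Sum>i<m. c i * w i j) e = (\<Sum>i<m. \<Sum>f\<le>e. coeff (c i) f * coeff (w i j) (e - f))"
          by (simp add: coeff_sum coeff_mult)
        also have "\<dots> = (\<Sum>i<m. \<Sum>f\<le>d. A (j, e) (i, f) * x (i, f))"
        proof (rule sum.cong)
          fix i
          have "(\<Sum>f\<le>e. coeff (c i) f * coeff (w i j) (e - f)) = (\<Sum>f\<in>{..e}\<inter>{..d}. A (j, e) (i, f) * x (i, f))"
            by (intro sum.mono_neutral_cong_right) (auto simp: cc A_def)
          also have "\<dots> = (\<Sum>f\<le>d. A (j, e) (i, f) * x (i, f))"
            by (intro sum.mono_neutral_left) (auto simp: A_def)
          finally show "(\<Sum>f\<le>e. coeff (c i) f * coeff (w i j) (e - f)) = (\<Sum>f\<le>d. A (j, e) (i, f) * x (i, f))" .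
        qed simp
        also have "\<dots> = (\<Sum>u\<in>U. A (j, e) u * x u)" by (simp add: U_def sum.cartesian_product)
        also have "\<dots> = 0" using x(3) True j by (auto simp: R_def)
        finally show ?thesis by simp
      next
        case False
        have "degree (\<Sum>i<m. c i * w i j) \<le> d + N"
        proof (rule degree_sum_le)
          fix i assume "i \<in> {..<m}"
          hence "degree (w i j) \<le> N" using w(2) j by auto
          moreover have "degree (c i) \<le> d" by (rule degree_le) (auto simp: cc)
          ultimately show "degree (c i * w i j) \<le> d + N" using degree_mult_le[of "c i" "w i j"] by linarith
        qed simp
        thus ?thesis using False by (simp add: coeff_eq_0)
      qed
    qed
  qed
qed

lemma degree_Dit:
  assumes "degree T \<le> s" "\<And>i j. i \<in> I \<Longrightarrow> j \<in> I \<Longrightarrow> degree (G i j) \<le> s" "finite I"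
    "\<And>j. j \<in> I \<Longrightarrow> degree (b j) \<le> N" "j \<in> I"
  shows "degree (Dit T G I i b j) \<le> N + i * s"
  using assms(5)
proof (induction i arbitrary: j)
  case (Suc i)
  have IH: "degree (Dit T G I i b j) \<le> N + i * s" if "j \<in> I" for j using Suc.IH that by blast
  have 1: "degree (T * pderiv (Dit T G I i b j)) \<le> N + Suc i * s"
    using degree_mult_le[of T "pderiv (Dit T G I i b j)"] degree_pderiv[of "Dit T G I i b j"] IH[OF Suc.prems] assms(1) by simp
  have 2: "degree (of_nat i * pderiv T * Dit T G I i b j) \<le> N + Suc i * s"
  proof -
    have "degree (of_nat i * pderiv T * Dit T G I i b j) \<le> degree (of_nat i * pderiv T) + degree (Dit T G I i b j)"
      by (rule degree_mult_le)
    also have "degree (of_nat i * pderiv T) \<le> s"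
      using degree_mult_le[of "of_nat i" "pderiv T"] degree_pderiv[of T] assms(1) by simp
    finally show ?thesis using IH[OF Suc.prems] by simp
  qed
  have 3: "degree (\<Sum>k\<in>I. Dit T G I i b k * G k j) \<le> N + Suc i * s"
  proof (rule degree_sum_le[OF assms(3)])
    fix k assume k: "k \<in> I"
    show "degree (Dit T G I i b k * G k j) \<le> N + Suc i * s"
      using degree_mult_le[of "Dit T G I i b k" "G k j"] IH[OF k] assms(2)[OF k Suc.prems] by simp
  qed
  show ?case using 1 2 3 by (auto intro!: degree_add_le degree_diff_le)
qed (use assms in simp)

text \<open>Up to higher powers of z - 1, each step only differentiates the power of z - 1, so the
  leading value is multiplied by T(1) and the current exponent. For i = t this recovers b' at 1 from
  the derived row at 1.\<close>

lemma Dit_strip: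
  assumes b: "\<And>j. j \<in> I \<Longrightarrow> b j = [:-1, 1:] ^ t * b' j" and i: "i \<le> t"
  shows "\<exists>e. \<forall>j\<in>I. Dit T G I i b j = [:-1, 1:] ^ (t - i) * e j \<and>
     poly (e j) 1 * fact (t - i) = poly T 1 ^ i * fact t * poly (b' j) (1::complex)"
  using i
proof (induction i)
  case 0
  show ?case using b by (intro exI[of _ b']) auto
next
  case (Suc i)
  then obtain e where e: "\<And>j. j \<in> I \<Longrightarrow> Dit T G I i b j = [:-1, 1:] ^ (t - i) * e j"
    "\<And>j. j \<in> I \<Longrightarrow> poly (e j) 1 * fact (t - i) = poly T 1 ^ i * fact t * poly (b' j) 1" by auto
  define n where "n = t - Suc i"
  have tn: "t - i = Suc n" using Suc.prems by (simp add: n_def)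
  define x where "x = [:-1, 1 :: complex:]"
  define e' where "e' j = of_nat (Suc n) * (T * e j) + x * (T * pderiv (e j) - of_nat i * pderiv T * e j + (\<Sum>k\<in>I. e k * G k j))" for j
  have dx: "pderiv (x ^ Suc n) = of_nat (Suc n) * x ^ n"
  proof -
    have "pderiv x = 1" by (simp add: x_def pderiv_pCons one_pCons)
    thus ?thesis by (simp only: pderiv_power_Suc mult_1_right of_nat_poly) simp
  qed
  show ?case
  proof (intro exI[of _ e'] ballI conjI)
    fix j assume j: "j \<in> I"
    have "Dit T G I (Suc i) b j = T * pderiv (x ^ Suc n * e j) - of_nat i * pderiv T * (x ^ Suc n * e j)
        + (\<Sum>k\<in>I. x ^ Suc n * e k * G k j)"
      using j by (simp only: Dit.simps e(1) tn x_def cong: sum.cong)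
    also have "\<dots> = x ^ n * e' j"
      unfolding pderiv_mult dx e'_def by (simp add: algebra_simps sum_distrib_left)
    finally show "Dit T G I (Suc i) b j = [:-1, 1:] ^ (t - Suc i) * e' j" by (simp add: n_def x_def)
    have "poly (e' j) 1 = of_nat (Suc n) * (poly T 1 * poly (e j) 1)"
      by (simp add: e'_def x_def of_nat_poly)
    hence "poly (e' j) 1 * fact n = poly T 1 * (poly (e j) 1 * fact (Suc n))" by (simp add: mult_ac)
    thus "poly (e' j) 1 * fact (t - Suc i) = poly T 1 ^ Suc i * fact t * poly (b' j) 1"
      using e(2)[OF j] by (simp add: tn n_def[symmetric] mult_ac)
  qed
qed

text \<open>Gauss-Jordan elimination over the local ring at 1: rows of the saturated module L that
  are diagonal in the columns J, with a pivot q not vanishing at 1. If a row vanishing on J were not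
  zero, dividing it by its power of z - 1 would give one more pivot k, against the maximality of
  J.\<close>

lemma reduced_basis:
  fixes L :: "('i \<Rightarrow> complex poly) set"
  assumes I: "finite I"
    and LQ: "\<And>p j. p \<in> L \<Longrightarrow> j \<in> I \<Longrightarrow> p j \<in> QP"
    and Ldiff: "\<And>p q. p \<in> L \<Longrightarrow> q \<in> L \<Longrightarrow> (\<lambda>j. p j - q j) \<in> L"
    and Lmult: "\<And>p q. p \<in> L \<Longrightarrow> q \<in> QP \<Longrightarrow> (\<lambda>j. q * p j) \<in> L"
    and Lsat: "\<And>p p' q. p \<in> L \<Longrightarrow> q \<in> QP \<Longrightarrow> q \<noteq> 0 \<Longrightarrow> (\<And>j. j \<in> I \<Longrightarrow> p' j \<in> QP \<and> q * p' j = p j) \<Longrightarrow> p' \<in> L"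
  shows "\<exists>J q p. J \<subseteq> I \<and> q \<in> QP \<and> poly q 1 \<noteq> 0 \<and>
     (\<forall>j\<in>J. p j \<in> L \<and> (\<forall>i\<in>J. p j i = (if i = j then q else 0))) \<and>
     (\<forall>w\<in>L. (\<forall>j\<in>J. w j = 0) \<longrightarrow> (\<forall>i\<in>I. w i = 0))"
proof -
  define good where "good J \<longleftrightarrow> J \<subseteq> I \<and> (\<exists>q p. q \<in> QP \<and> poly q 1 \<noteq> 0 \<and>
     (\<forall>j\<in>J. p j \<in> L \<and> (\<forall>i\<in>J. p j i = (if i = j then q else (0::complex poly)))))" for J
  have "good {}" unfolding good_def by (intro conjI exI[of _ 1]) auto
  moreover have "\<forall>J. good J \<longrightarrow> card J < card I + 1"
    using I by (auto simp: good_def less_Suc_eq_le intro: card_mono)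
  ultimately obtain J where J: "good J" and max: "\<And>J'. good J' \<Longrightarrow> card J' \<le> card J"
    using ex_has_greatest_nat[of good "{}" card "card I + 1"] by (metis less_imp_le_nat)
  obtain q p where qp: "q \<in> QP" "poly q 1 \<noteq> 0" "\<And>j. j \<in> J \<Longrightarrow> p j \<in> L"
    "\<And>i j. j \<in> J \<Longrightarrow> i \<in> J \<Longrightarrow> p j i = (if i = j then q else 0)" and JI: "J \<subseteq> I"
    using J unfolding good_def by blast
  have "w i = 0" if w: "w \<in> L" "\<forall>j\<in>J. w j = 0" "i \<in> I" for w i
  proof (rule ccontr)
    assume "w i \<noteq> 0"
    hence "\<exists>t w'. (\<forall>i\<in>I. w i = [:-1, 1:] ^ t * w' i \<and> w' i \<in> QP) \<and> (\<exists>i\<in>I. poly (w' i) 1 \<noteq> 0)"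
      using w(3) by (intro strip_linear_factor I LQ w(1)) auto
    then obtain t w' where w': "\<And>i. i \<in> I \<Longrightarrow> w i = [:-1, 1:] ^ t * w' i" "\<And>i. i \<in> I \<Longrightarrow> w' i \<in> QP"
      and ex: "\<exists>i\<in>I. poly (w' i) 1 \<noteq> 0" by blast
    from ex obtain k where k: "k \<in> I" "poly (w' k) 1 \<noteq> 0" by blast
    have w'L: "w' \<in> L"
    proof (rule Lsat[OF w(1)])
      show "[:-1, 1:] ^ t \<in> QP" using Qbar_minus[OF Qbar_1] by (intro QP_power QP_linear) auto
      show "w' j \<in> QP \<and> [:-1, 1:] ^ t * w' j = w j" if "j \<in> I" for j using w' that by simp
    qed simp
    have w'J: "w' j = 0" if "j \<in> J" for j
      using w(2) w'(1)[of j] JI that by auto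
    have kJ: "k \<notin> J" using k(2) w'J by auto
    \<comment> \<open>The new row is multiplied by q and the old rows are cleared in column k, so
      that all pivots become q w'_k.\<close>
    define p' where "p' j = (if j = k then (\<lambda>i. q * w' i) else (\<lambda>i. w' k * p j i - p j k * w' i))" for j
    have "good (insert k J)"
      unfolding good_def
    proof (intro conjI exI[of _ "q * w' k"] exI[of _ p'] ballI)
      show "insert k J \<subseteq> I" using k JI by simp
      show "q * w' k \<in> QP" using qp w' k by blast
      show "poly (q * w' k) 1 \<noteq> 0" using qp k by simp
      fix j assume j: "j \<in> insert k J"
      show "p' j \<in> L"
      proof (cases "j = k")
        case True
        thus ?thesis using Lmult[OF w'L qp(1)] by (simp add: p'_def)
      next
        case False
        hence jJ: "j \<in> J" using j by simp
        have "p j k \<in> QP" using LQ[OF qp(3)[OF jJ] k(1)] .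
        thus ?thesis unfolding p'_def using False
          by (simp add: Ldiff[OF Lmult[OF qp(3)[OF jJ] w'(2)[OF k(1)]] Lmult[OF w'L]])
      qed
      fix i assume i: "i \<in> insert k J"
      show "p' j i = (if i = j then q * w' k else 0)"
        using i j kJ qp(4) w'J by (auto simp: p'_def)
    qed
    from max[OF this] show False using kJ finite_subset[OF JI I] by simp
  qed
  hence "\<forall>w\<in>L. (\<forall>j\<in>J. w j = 0) \<longrightarrow> (\<forall>i\<in>I. w i = 0)" by auto
  thus ?thesis using qp JI by (intro exI[of _ J] exI[of _ q] exI[of _ p]) auto
qed

text \<open>The quotient k^k / k! is a single term of the exponential series at k, and e \<le>
  3.\<close>

lemma power_le_exp_fact: "real k ^ k \<le> 3 ^ k * fact k"
proof -
  have s: "summable (\<lambda>n. real k ^ n /\<^sub>R fact n)" using exp_converges[of "real k"] by (rule sums_summable)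
  have "(\<Sum>n\<in>{k}. real k ^ n /\<^sub>R fact n) \<le> suminf (\<lambda>n. real k ^ n /\<^sub>R fact n)"
    by (rule sum_le_suminf[OF s]) auto
  also have "\<dots> = exp (real k)" by (simp add: exp_def)
  also have "\<dots> = exp 1 ^ k" by (metis exp_of_nat_mult mult.right_neutral)
  also have "\<dots> \<le> 3 ^ k" using exp_le by (rule power_mono) simp
  finally show ?thesis by (simp add: field_simps)
qed

text \<open>Relative to k^k, the size k^((P - 2) r) leaves the factor k^(2 r). As k = P r, this
  outgrows N^r, where \<open>N\<close> collects all constants, including the 3^k from k^k \<le> 3^k
  k!.\<close>

lemma siegel_gain:
  fixes C c P :: nat and R :: real
  assumes "C > 0" "c > 0" "P \<ge> 2" "R \<ge> 0"
  shows "\<exists>r>0. real ((C * (P * r)) ^ ((P - 2) * r)) * R * real c ^ (P * r) < fact (P * r)"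
proof -
  define N where "N = Suc (nat \<lceil>R\<rceil>) * C ^ (P - 2) * (3 * c) ^ P"
  define r where "r = Suc N"
  define k where "k = P * r"
  define Rn where "Rn = Suc (nat \<lceil>R\<rceil>)"
  have kr: "r \<le> k" using assms(3) by (simp add: k_def)
  have k0: "k > 0" using kr by (simp add: r_def)
  have Rle: "R \<le> real Rn" unfolding Rn_def by linarith
  have "Rn * ((C * k) ^ ((P - 2) * r) * (3 * c) ^ k) < k ^ k"
  proof -
    have "Rn * ((C * k) ^ ((P - 2) * r) * (3 * c) ^ k) \<le> Rn ^ r * ((C * k) ^ ((P - 2) * r) * (3 * c) ^ k)"
      using power_increasing[of 1 r Rn] by (intro mult_le_mono1) (simp add: Rn_def r_def)
    also have "\<dots> = N ^ r * k ^ ((P - 2) * r)"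
    proof -
      have a: "(C * k) ^ ((P - 2) * r) = (C ^ (P - 2)) ^ r * k ^ ((P - 2) * r)"
        by (simp only: power_mult_distrib power_mult)
      define z where "z = (3 * c) ^ P"
      have b: "(3 * c) ^ k = z ^ r" by (simp only: k_def z_def power_mult)
      have "N = Rn * C ^ (P - 2) * z" by (simp only: N_def Rn_def z_def)
      hence "N ^ r = Rn ^ r * (C ^ (P - 2)) ^ r * z ^ r" by (simp only: power_mult_distrib)
      thus ?thesis unfolding a b by (simp only: mult_ac)
    qed
    also have "\<dots> < (k ^ 2) ^ r * k ^ ((P - 2) * r)"
    proof (rule mult_strict_right_mono)
      have "N < k" using kr by (simp add: r_def)
      also have "k \<le> k ^ 2" using k0 by (simp add: power2_eq_square)
      finally show "N ^ r < (k ^ 2) ^ r" by (rule power_strict_mono) (auto simp: r_def)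
    qed (use k0 in simp)
    also have "\<dots> = k ^ (2 * r + (P - 2) * r)" by (simp add: power_mult power_add)
    also have "2 * r + (P - 2) * r = k"     proof -
      have "2 + (P - 2) = P" using assms(3) by simp
      thus ?thesis unfolding k_def by (metis add_mult_distrib)
    qed
    finally show ?thesis .
  qed
  hence "real (Rn * ((C * k) ^ ((P - 2) * r) * (3 * c) ^ k)) < real (k ^ k)" by (simp only: of_nat_less_iff)
  hence "3 ^ k * (real Rn * (real ((C * k) ^ ((P - 2) * r)) * real c ^ k)) < real k ^ k"
    by (simp only: of_nat_mult of_nat_power power_mult_distrib of_nat_numeral mult_ac)
  also have "\<dots> \<le> 3 ^ k * fact k" by (rule power_le_exp_fact)
  finally have "real Rn * (real ((C * k) ^ ((P - 2) * r)) * real c ^ k) < fact k" by simp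
  moreover have "R * (real ((C * k) ^ ((P - 2) * r)) * real c ^ k) \<le> real Rn * (real ((C * k) ^ ((P - 2) * r)) * real c ^ k)"
    using Rle by (intro mult_right_mono) auto
  ultimately have "real ((C * k) ^ ((P - 2) * r)) * R * real c ^ k < fact k" by (simp add: mult_ac)
  thus ?thesis unfolding k_def by (intro exI[of _ r]) (simp add: r_def)
qed

section \<open>Lifting linear relations at 1\<close>

lemma bd_conj_bound:
  assumes "finite B" "\<And>b. b \<in> B \<Longrightarrow> b \<in> Qbar"
  shows "\<exists>R\<ge>0. \<forall>M x. bd B M x \<longrightarrow> conj_bound (real M * R) x"
proof -
  have "\<forall>b\<in>B. \<exists>R>0. conj_bound R b" using Qbar_conj_bound assms(2) by blast
  then obtain R where R: "\<And>b. b \<in> B \<Longrightarrow> R b > 0 \<and> conj_bound (R b) b" by metis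
  show ?thesis
  proof (intro exI[of _ "\<Sum>b\<in>B. R b"] conjI allI impI)
    show "0 \<le> (\<Sum>b\<in>B. R b)" using R by (intro sum_nonneg) (auto intro: less_imp_le)
    fix M x assume "bd B M x"
    then obtain c where c: "x = (\<Sum>b\<in>B. of_int (c b) * b)" "\<forall>b\<in>B. \<bar>c b\<bar> \<le> int M" unfolding bd_def by blast
    have "conj_bound (\<Sum>b\<in>B. real M * R b) (\<Sum>b\<in>B. of_int (c b) * b)"
    proof (rule conj_bound_sum)
      fix b assume b: "b \<in> B"
      have "\<bar>real_of_int (c b)\<bar> \<le> real M" using c(2) b by (metis of_int_abs of_int_le_iff of_int_of_nat_eq)
      hence "conj_bound (real M) (of_int (c b))"
        by (simp add: conj_bound_def Qbar_automorphism_of_int)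
      thus "conj_bound (real M * R b) (of_int (c b) * b)" using R[OF b] by (intro conj_bound_mult) auto
    qed
    thus "conj_bound (real M * (\<Sum>b\<in>B. R b)) x" by (simp add: c(1) sum_distrib_left)
  qed
qed

definition fps_independent :: "'i set \<Rightarrow> ('i \<Rightarrow> complex fps) \<Rightarrow> bool" where
  "fps_independent I u \<longleftrightarrow> (\<forall>w. (\<forall>i\<in>I. w i \<in> QP) \<longrightarrow> (lincomb I w u) = 0 \<longrightarrow> (\<forall>i\<in>I. w i = 0))"

lemma fps_X_minus_1: "fps_X - 1 = fps_of_poly [:-1, 1::complex:]"
  by (simp add: fps_of_poly_pCons fps_const_neg[symmetric] del: fps_const_neg)

lemma poly_minus_value:
  fixes p :: "complex poly"
  shows "\<exists>v. p = [:poly p 1:] + [:-1, 1:] * v"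
proof -
  have "poly (p - [:poly p 1:]) 1 = 0" by simp
  hence "[:-1, 1:] dvd p - [:poly p 1:]" by (simp only: poly_eq_0_iff_dvd)
  then obtain v where "p - [:poly p 1:] = [:-1, 1:] * v" by (rule dvdE)
  hence "p = [:poly p 1:] + [:-1, 1:] * v" by (simp add: algebra_simps)
  thus ?thesis by blast
qed

lemma QP_minus_value:
  assumes "p \<in> QP"
  shows "\<exists>v\<in>QP. p = [:poly p 1:] + [:-1, 1:] * v"
proof -
  obtain v where v: "p = [:poly p 1:] + [:-1, 1:] * v" using poly_minus_value by blast
  have "[:poly p 1:] \<in> QP" using assms by (simp add: QP_poly)
  with assms have "p - [:poly p 1:] \<in> QP" by (rule QP_diff)
  moreover have "p - [:poly p 1:] = [:-1, 1:] * v" using v by (metis add_diff_cancel_left')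
  ultimately have "v \<in> QP" using QP_linear_factor[of 1 v] by simp
  thus ?thesis using v by blast
qed

text \<open>Replacing polynomial coefficients by their values at 1 changes a combination by X - 1
  times a tame series. Vanishing at 1, in the sense of a tame quotient by X - 1, therefore depends
  on these values only.\<close>

lemma combination_minus_value:
  assumes "\<And>i. i \<in> I \<Longrightarrow> p i \<in> QP" "\<And>i. i \<in> I \<Longrightarrow> tame (u i)"
  shows "\<exists>v. tame v \<and> (lincomb I p u) = (\<Sum>i\<in>I. fps_const (poly (p i) 1) * u i) + (fps_X - 1) * v"
proof -
  have "\<forall>i\<in>I. \<exists>v\<in>QP. p i = [:poly (p i) 1:] + [:-1, 1:] * v" using QP_minus_value assms(1) by blast
  then obtain v where v: "\<And>i. i \<in> I \<Longrightarrow> v i \<in> QP" "\<And>i. i \<in> I \<Longrightarrow> p i = [:poly (p i) 1:] + [:-1, 1:] * v i"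
    by metis
  have e: "fps_of_poly (p i) * u i = fps_const (poly (p i) 1) * u i + (fps_X - 1) * (fps_of_poly (v i) * u i)" if "i \<in> I" for i
  proof -
    have "fps_of_poly (p i) = fps_const (poly (p i) 1) + (fps_X - 1) * fps_of_poly (v i)"
      using arg_cong[OF v(2)[OF that], of fps_of_poly] unfolding fps_X_minus_1
      by (simp only: fps_of_poly_add fps_of_poly_mult fps_of_poly_const)
    thus ?thesis by (simp only: distrib_right mult.assoc)
  qed
  show ?thesis
  proof (intro exI[of _ "\<Sum>i\<in>I. fps_of_poly (v i) * u i"] conjI)
    show "tame (lincomb I v u)" using v(1) assms(2) by (rule tame_poly_combination)
    show "(lincomb I p u) =
      (\<Sum>i\<in>I. fps_const (poly (p i) 1) * u i) + (fps_X - 1) * (lincomb I v u)"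
      by (simp only: sum_distrib_left sum.distrib[symmetric]) (rule sum.cong[OF refl e])
  qed
qed

text \<open>The induction statement for a given number of functions. All other data are quantified,
  since eliminating a function or passing to a submodule changes the functions, the relation, the
  quotient y and the system.\<close>

definition relation_lifts :: "'i set \<Rightarrow> bool" where
  "relation_lifts I \<longleftrightarrow> (\<forall>u y l T G. (\<forall>i\<in>I. tame (u i)) \<longrightarrow> tame y \<longrightarrow> (\<forall>i\<in>I. l i \<in> Qbar) \<longrightarrow>
     (fps_X - 1) * y = (\<Sum>i\<in>I. fps_const (l i) * u i) \<longrightarrow> T \<in> QP \<longrightarrow> poly T 1 \<noteq> 0 \<longrightarrow>
     (\<forall>i\<in>I. \<forall>j\<in>I. G i j \<in> QP) \<longrightarrow>
     (\<forall>i\<in>I. fps_of_poly T * fps_deriv (u i) = (lincomb I (G i) u)) \<longrightarrow>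
     (\<exists>b. (\<forall>i\<in>I. b i \<in> QP \<and> poly (b i) 1 = l i) \<and> (lincomb I b u) = 0))"

lemma relation_liftsD:
  assumes "relation_lifts I" "\<And>i. i \<in> I \<Longrightarrow> tame (u i)" "tame y" "\<And>i. i \<in> I \<Longrightarrow> l i \<in> Qbar"
    "(fps_X - 1) * y = (\<Sum>i\<in>I. fps_const (l i) * u i)" "T \<in> QP" "poly T 1 \<noteq> 0"
    "\<And>i j. i \<in> I \<Longrightarrow> j \<in> I \<Longrightarrow> G i j \<in> QP"
    "\<And>i. i \<in> I \<Longrightarrow> fps_of_poly T * fps_deriv (u i) = (lincomb I (G i) u)"
  shows "\<exists>b. (\<forall>i\<in>I. b i \<in> QP \<and> poly (b i) 1 = l i) \<and> (lincomb I b u) = 0"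
  using assms(1)[unfolded relation_lifts_def, THEN spec[of _ u], THEN spec[of _ y], THEN spec[of _ l],
      THEN spec[of _ T], THEN spec[of _ G]] assms(2-) by simp

text \<open>The derived rows of \<open>b\<close> span a proper differential submodule. Its elements give fewer
  functions, regular at 1, one combination of which still vanishes at 1.\<close>

lemma smaller_system:
  fixes u :: "'i \<Rightarrow> complex fps" and l :: "'i \<Rightarrow> complex"
  assumes I: "finite I" "p0 \<in> I" and u: "\<And>i. i \<in> I \<Longrightarrow> tame (u i)" and y: "tame y"
    and yu: "(fps_X - 1) * y = (\<Sum>i\<in>I. fps_const (l i) * u i)"
    and T: "T \<in> QP" "poly T 1 \<noteq> 0"
    and G: "\<And>i j. i \<in> I \<Longrightarrow> j \<in> I \<Longrightarrow> G i j \<in> QP"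
    and sys: "\<And>i. i \<in> I \<Longrightarrow> fps_of_poly T * fps_deriv (u i) = (lincomb I (G i) u)"
    and ind: "fps_independent I u"
    and b: "\<And>j. j \<in> I \<Longrightarrow> b j \<in> QP" "\<exists>j\<in>I. b j \<noteq> 0"
    and bt: "\<And>j. j \<in> I \<Longrightarrow> b j = [:-1, 1:] ^ t * b' j" "\<And>j. j \<in> I \<Longrightarrow> b' j \<in> QP" "\<exists>j\<in>I. poly (b' j) 1 \<noteq> 0"
    and b'l: "\<And>j. j \<in> I \<Longrightarrow> poly (b' j) 1 = l j * poly (b' p0) 1"
    and c: "\<And>i. i < card I \<Longrightarrow> c i \<in> QP" "\<exists>i<card I. c i \<noteq> 0"
      "\<And>j. j \<in> I \<Longrightarrow> (\<Sum>i<card I. c i * Dit T G I i b j) = 0"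
    and IH: "\<And>J :: 'i set. finite J \<Longrightarrow> card J < card I \<Longrightarrow> relation_lifts J"
  shows False
proof -
  define Di where "Di i = Dit T G I i b" for i
  have DQ: "Di i j \<in> QP" if "j \<in> I" for i j
    unfolding Di_def using that by (intro QP_Dit T G b(1))
  \<comment> \<open>Over the fraction field row \<open>rr\<close> depends on its predecessors, so
    the rows before it span a space that is stable under derivation and smaller than the
    whole.\<close>
  define rr where "rr = Max {i. i < card I \<and> c i \<noteq> 0}"
  have fin: "finite {i. i < card I \<and> c i \<noteq> 0}" by (rule finite_subset[of _ "{..<card I}"]) auto
  have "rr \<in> {i. i < card I \<and> c i \<noteq> 0}" unfolding rr_def using c(2) by (intro Max_in fin) auto
  hence rr: "rr < card I" "c rr \<noteq> 0" by auto
  have cz: "c i = 0" if "rr < i" "i < card I" for i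
    using Max_ge[OF fin, of i] that unfolding rr_def by fastforce
  have rel: "(\<Sum>i<rr. c i * Di i j) + c rr * Di rr j = 0" if "j \<in> I" for j
  proof -
    have "(\<Sum>i<Suc rr. c i * Di i j) = (\<Sum>i<card I. c i * Di i j)"
      by (rule sum.mono_neutral_left) (use rr cz in \<open>auto simp: less_Suc_eq_le not_le\<close>)
    thus ?thesis using c(3)[OF that] by (simp add: Di_def)
  qed
  define Sp where "Sp = {z. \<exists>a. (\<forall>i<rr. a i \<in> QP) \<and> (\<forall>j\<in>I. z j = (\<Sum>i<rr. a i * Di i j))}"
  have Sp_diff: "(\<lambda>j. x j - z j) \<in> Sp" if "x \<in> Sp" "z \<in> Sp" for x z
  proof -
    obtain a a' where "\<forall>i<rr. a i \<in> QP" "\<forall>j\<in>I. x j = (\<Sum>i<rr. a i * Di i j)"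
      "\<forall>i<rr. a' i \<in> QP" "\<forall>j\<in>I. z j = (\<Sum>i<rr. a' i * Di i j)"
      using \<open>x \<in> Sp\<close> \<open>z \<in> Sp\<close> unfolding Sp_def by blast
    thus ?thesis unfolding Sp_def
      by (intro CollectI exI[of _ "\<lambda>i. a i - a' i"]) (auto simp: sum_subtractf left_diff_distrib)
  qed
  have Sp_mult: "(\<lambda>j. q * z j) \<in> Sp" if "z \<in> Sp" "q \<in> QP" for z q
  proof -
    obtain a where "\<forall>i<rr. a i \<in> QP" "\<forall>j\<in>I. z j = (\<Sum>i<rr. a i * Di i j)"
      using \<open>z \<in> Sp\<close> unfolding Sp_def by blast
    thus ?thesis unfolding Sp_def using that(2)
      by (intro CollectI exI[of _ "\<lambda>i. q * a i"]) (auto simp: sum_distrib_left mult.assoc)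
  qed
  have Sp_Di: "Di i \<in> Sp" if "i < rr" for i
  proof -
    have "(\<Sum>k<rr. (if k = i then 1 else 0) * Di k j) = Di i j" for j
    proof -
      have "(\<Sum>k<rr. (if k = i then 1 else 0) * Di k j) = (\<Sum>k<rr. if k = i then Di k j else 0)"
        by (rule sum.cong) auto
      thus ?thesis using that by (simp add: sum.delta)
    qed
    thus ?thesis unfolding Sp_def by (intro CollectI exI[of _ "\<lambda>k. if k = i then 1 else 0"]) auto
  qed
  have Sp_cong: "x \<in> Sp" if "z \<in> Sp" "\<And>j. j \<in> I \<Longrightarrow> x j = z j" for x z
    using that unfolding Sp_def by auto
  \<comment> \<open>The saturation of \<open>Sp\<close>: all polynomial rows in its span over the
    fraction field. It contains row \<open>rr\<close>, obtained by dividing by \<open>c rr\<close>,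
    and with each row the quotient by its power of z - 1.\<close>
  define L where "L = {p. (\<forall>j\<in>I. p j \<in> QP) \<and> (\<exists>Q\<in>QP. Q \<noteq> 0 \<and> (\<lambda>j. Q * p j) \<in> Sp)}"
  have L_QP: "p j \<in> QP" if "p \<in> L" "j \<in> I" for p j using that by (auto simp: L_def)
  have L_sat: "p' \<in> L" if p: "p \<in> L" and q: "q \<in> QP" "q \<noteq> 0" and e: "\<And>j. j \<in> I \<Longrightarrow> p' j \<in> QP \<and> q * p' j = p j" for p p' q
  proof -
    obtain Q where Q: "Q \<in> QP" "Q \<noteq> 0" "(\<lambda>j. Q * p j) \<in> Sp" using p by (auto simp: L_def)
    have "(\<lambda>j. (Q * q) * p' j) \<in> Sp" by (rule Sp_cong[OF Q(3)]) (use e in \<open>simp add: mult.assoc\<close>)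
    thus ?thesis unfolding L_def using Q q e by (intro CollectI conjI ballI bexI[of _ "Q * q"]) auto
  qed
  have Sp_L: "z \<in> L" if "z \<in> Sp" "\<And>j. j \<in> I \<Longrightarrow> z j \<in> QP" for z
    unfolding L_def using that by (intro CollectI conjI ballI bexI[of _ 1]) auto
  have L_mult: "(\<lambda>j. q * p j) \<in> L" if "p \<in> L" "q \<in> QP" for p q
  proof -
    obtain Q where Q: "Q \<in> QP" "Q \<noteq> 0" "(\<lambda>j. Q * p j) \<in> Sp" using \<open>p \<in> L\<close> by (auto simp: L_def)
    have "(\<lambda>j. Q * (q * p j)) \<in> Sp" by (rule Sp_cong[OF Sp_mult[OF Q(3) that(2)]]) (simp add: mult_ac)
    thus ?thesis unfolding L_def using Q that L_QP by auto
  qed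
  have L_diff: "(\<lambda>j. p j - p' j) \<in> L" if "p \<in> L" "p' \<in> L" for p p'
  proof -
    obtain Q where Q: "Q \<in> QP" "Q \<noteq> 0" "(\<lambda>j. Q * p j) \<in> Sp" using \<open>p \<in> L\<close> by (auto simp: L_def)
    obtain Q' where Q': "Q' \<in> QP" "Q' \<noteq> 0" "(\<lambda>j. Q' * p' j) \<in> Sp" using \<open>p' \<in> L\<close> by (auto simp: L_def)
    have "(\<lambda>j. (Q * Q') * (p j - p' j)) \<in> Sp"
      by (rule Sp_cong[OF Sp_diff[OF Sp_mult[OF Q(3) Q'(1)] Sp_mult[OF Q'(3) Q(1)]]])
         (simp add: algebra_simps)
    thus ?thesis unfolding L_def using Q Q' that L_QP
      by (intro CollectI conjI ballI bexI[of _ "Q * Q'"]) auto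
  qed
  have L_cong: "x \<in> L" if "z \<in> L" "\<And>j. j \<in> I \<Longrightarrow> x j = z j" for x z
    by (rule L_sat[OF that(1), of 1]) (use that L_QP in auto)
  have L_0: "(\<lambda>j. 0) \<in> L"
  proof -
    have "(\<lambda>j. 0) \<in> Sp" unfolding Sp_def by (intro CollectI exI[of _ "\<lambda>_. 0"]) auto
    thus ?thesis by (rule Sp_L) auto
  qed
  have L_add: "(\<lambda>j. p j + p' j) \<in> L" if "p \<in> L" "p' \<in> L" for p p'
    by (rule L_cong[OF L_diff[OF that(1) L_diff[OF L_0 that(2)]]]) simp
  have L_sum: "(\<lambda>j. \<Sum>k\<in>A. f k j) \<in> L" if "\<And>k. k \<in> A \<Longrightarrow> f k \<in> L" for A :: "nat set" and f
    using that by (induction A rule: infinite_finite_induct) (simp_all add: L_0 L_add)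
  have L_Di: "Di i \<in> L" if "i \<le> rr" for i
  proof (cases "i = rr")
    case False
    thus ?thesis using that by (intro Sp_L Sp_Di DQ) auto
  next
    case True
    have s: "(\<lambda>j. \<Sum>i<rr. c i * Di i j) \<in> Sp"
      unfolding Sp_def using c(1) rr(1) by (intro CollectI exI[of _ c]) auto
    have "(\<lambda>j. c rr * Di rr j) \<in> Sp"
    proof (rule Sp_cong[OF Sp_mult[OF s, of "-1"]])
      show "- 1 \<in> QP" by auto
      fix j assume "j \<in> I"
      from rel[OF this] show "c rr * Di rr j = - 1 * (\<Sum>i<rr. c i * Di i j)"
        by (simp add: add_eq_0_iff)
    qed
    thus ?thesis unfolding L_def True using rr c(1) DQ by auto
  qed
  \<comment> \<open>The derivation that the system induces on rows: T (p . u)' = (N p) . u.\<close>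
  define N where "N p j = T * pderiv (p j) + (\<Sum>k\<in>I. p k * G k j)" for p :: "'i \<Rightarrow> complex poly" and j
  have N_mult: "N (\<lambda>j. q * p j) j = T * pderiv q * p j + q * N p j" for q p j
    by (simp add: N_def pderiv_mult algebra_simps sum_distrib_left)
  have N_QP: "N p j \<in> QP" if "\<And>j. j \<in> I \<Longrightarrow> p j \<in> QP" "j \<in> I" for p j
    unfolding N_def using that T(1) G by (intro QP_add QP_mult QP_pderiv QP_sum) auto
  have N_cong: "N x j = N z j" if "\<And>j. j \<in> I \<Longrightarrow> x j = z j" "j \<in> I" for x z j
    using that unfolding N_def by simp
  have N_sum: "N (\<lambda>j. \<Sum>k\<in>A. f k j) j = (\<Sum>k\<in>A. N (f k) j)" if "j \<in> I" for A :: "nat set" and f j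
  proof (induction A rule: infinite_finite_induct)
    case (insert x F)
    thus ?case by (simp add: N_def pderiv_add algebra_simps sum.distrib)
  qed (simp_all add: N_def)
  have N_Di: "N (Di i) \<in> L" if "i < rr" for i
  proof -
    have e: "N (Di i) j = Di (Suc i) j + (of_nat i * pderiv T) * Di i j" for j
      by (simp add: N_def Di_def)
    have "(\<lambda>j. Di (Suc i) j + (of_nat i * pderiv T) * Di i j) \<in> L"
      using that T(1) by (intro L_add L_mult L_Di) auto
    thus ?thesis by (rule L_cong) (simp add: e)
  qed
  have N_L: "N p \<in> L" if p: "p \<in> L" for p
  proof -
    obtain Q where Q: "Q \<in> QP" "Q \<noteq> 0" "(\<lambda>j. Q * p j) \<in> Sp" using p by (auto simp: L_def)
    obtain a where a: "\<forall>i<rr. a i \<in> QP" "\<forall>j\<in>I. Q * p j = (\<Sum>i<rr. a i * Di i j)"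
      using Q(3) unfolding Sp_def by auto
    have "(\<lambda>j. \<Sum>i<rr. T * pderiv (a i) * Di i j + a i * N (Di i) j) \<in> L"
    proof (rule L_sum)
      fix i assume "i \<in> {..<rr}"
      thus "(\<lambda>j. T * pderiv (a i) * Di i j + a i * N (Di i) j) \<in> L"
        using a(1) T(1) by (intro L_add L_mult L_Di N_Di) auto
    qed
    hence NQp: "N (\<lambda>j. Q * p j) \<in> L"
    proof (rule L_cong)
      fix j assume j: "j \<in> I"
      have "N (\<lambda>j. Q * p j) j = N (\<lambda>j. \<Sum>i<rr. a i * Di i j) j"
        using a(2) j by (intro N_cong) auto
      also have "\<dots> = (\<Sum>i<rr. N (\<lambda>j. a i * Di i j) j)" by (rule N_sum[OF j])
      finally show "N (\<lambda>j. Q * p j) j = (\<Sum>i<rr. T * pderiv (a i) * Di i j + a i * N (Di i) j)"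
        by (simp add: N_mult)
    qed
    have "(\<lambda>j. N (\<lambda>j. Q * p j) j - (T * pderiv Q) * p j) \<in> L"
      using T(1) Q(1) by (intro L_diff NQp L_mult p) auto
    thus ?thesis
    proof (rule L_sat[OF _ Q(1,2)])
      fix j assume "j \<in> I"
      thus "N p j \<in> QP \<and> Q * N p j = N (\<lambda>j. Q * p j) j - (T * pderiv Q) * p j"
        using N_QP[of p j] L_QP[OF p] by (simp add: N_mult)
    qed
  qed
  have "\<exists>J q p. J \<subseteq> I \<and> q \<in> QP \<and> poly q 1 \<noteq> 0 \<and>
     (\<forall>j\<in>J. p j \<in> L \<and> (\<forall>i\<in>J. p j i = (if i = j then q else 0))) \<and>
     (\<forall>w\<in>L. (\<forall>j\<in>J. w j = 0) \<longrightarrow> (\<forall>i\<in>I. w i = 0))"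
  proof (rule reduced_basis[OF I(1)])
    fix p p' q assume "p \<in> L" "q \<in> QP" "q \<noteq> 0" "\<And>j. j \<in> I \<Longrightarrow> p' j \<in> QP \<and> q * p' j = p j"
    thus "p' \<in> L" by (rule L_sat)
  qed (use L_QP L_diff L_mult in auto)
  then obtain J q p where J: "J \<subseteq> I" and q: "q \<in> QP" "poly q 1 \<noteq> 0"
    and pLJ: "\<forall>j\<in>J. p j \<in> L \<and> (\<forall>i\<in>J. p j i = (if i = j then q else 0))"
    and zeroL: "\<forall>w\<in>L. (\<forall>j\<in>J. w j = 0) \<longrightarrow> (\<forall>i\<in>I. w i = 0)"
    by (elim exE conjE) (rule that)
  have pL: "p j \<in> L" if "j \<in> J" for j using pLJ that by simp
  have pJ: "p j i = (if i = j then q else 0)" if "j \<in> J" "i \<in> J" for i j using pLJ that by simp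
  have zero: "\<forall>i\<in>I. w i = 0" if "w \<in> L" "\<forall>j\<in>J. w j = 0" for w using zeroL that by simp
  have fJ: "finite J" using J I(1) by (rule finite_subset)
  have q0: "q \<noteq> 0" using q(2) by auto
  \<comment> \<open>Rows of L are determined by their entries in J, so the rows \<open>p k\<close>
    act as a basis of L up to the factor q, which is harmless at 1.\<close>
  have expand: "q * w i = (\<Sum>k\<in>J. w k * p k i)" if w: "w \<in> L" and i: "i \<in> I" for w i
  proof -
    have "(\<lambda>i. \<Sum>k\<in>J. w k * p k i) \<in> L"
    proof -
      have "(\<lambda>i. \<Sum>k\<in>A. w k * p k i) \<in> L" if "finite A" "A \<subseteq> J" for A
        using that
      proof (induction A rule: finite_induct)
        case (insert k A)
        have "(\<lambda>i. w k * p k i + (\<Sum>k\<in>A. w k * p k i)) \<in> L"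
          using insert L_QP[OF w] J by (intro L_add L_mult pL) auto
        thus ?case using insert by simp
      qed (simp add: L_0)
      thus ?thesis using fJ by blast
    qed
    hence "(\<lambda>i. q * w i - (\<Sum>k\<in>J. w k * p k i)) \<in> L"
      using L_mult[OF w q(1)] by (intro L_diff)
    moreover have "q * w j - (\<Sum>k\<in>J. w k * p k j) = 0" if j: "j \<in> J" for j
    proof -
      have "(\<Sum>k\<in>J. w k * p k j) = (\<Sum>k\<in>J. if k = j then w k * q else 0)"
        by (rule sum.cong) (use pJ j in auto)
      thus ?thesis using fJ j by (simp add: sum.delta)
    qed
    ultimately have "\<forall>i\<in>I. q * w i - (\<Sum>k\<in>J. w k * p k i) = 0" by (intro zero) auto
    thus ?thesis using i by simp
  qed
  \<comment> \<open>Since \<open>rr\<close> is less than card I, some non-zero x annihilates the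
    spanning rows and hence L. Pivots in all columns would force x = 0.\<close>
  have JI: "card J < card I"
  proof -
    have "\<exists>x. (\<forall>j. x j \<in> (UNIV :: complex poly set)) \<and> (\<exists>j\<in>I. x j \<noteq> 0) \<and> (\<forall>i\<in>{..<rr}. (\<Sum>j\<in>I. Di i j * x j) = 0)"
      by (rule homogeneous_system_solution) (use I rr in auto)
    then obtain x where x: "\<exists>j\<in>I. x j \<noteq> 0" "\<And>i. i < rr \<Longrightarrow> (\<Sum>j\<in>I. Di i j * x j) = 0" by auto
    have ann: "(\<Sum>j\<in>I. w j * x j) = 0" if "w \<in> L" for w
    proof -
      obtain Q where Q: "Q \<in> QP" "Q \<noteq> 0" "(\<lambda>j. Q * w j) \<in> Sp" using \<open>w \<in> L\<close> by (auto simp: L_def)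
      obtain a where a: "\<forall>j\<in>I. Q * w j = (\<Sum>i<rr. a i * Di i j)"
        using Q(3) unfolding Sp_def by auto
      have "Q * (\<Sum>j\<in>I. w j * x j) = (\<Sum>j\<in>I. (Q * w j) * x j)" by (simp add: sum_distrib_left mult.assoc)
      also have "\<dots> = (\<Sum>j\<in>I. \<Sum>i<rr. a i * (Di i j * x j))"
        using a by (intro sum.cong) (auto simp: sum_distrib_right mult.assoc)
      also have "\<dots> = (\<Sum>i<rr. a i * (\<Sum>j\<in>I. Di i j * x j))"
        by (subst sum.swap) (simp add: sum_distrib_left)
      also have "\<dots> = 0" using x(2) by simp
      finally show ?thesis using Q(2) by simp
    qed
    have "J \<noteq> I"
    proof
      assume JeqI: "J = I"
      have "x k = 0" if k: "k \<in> I" for k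
      proof -
        have "(\<Sum>j\<in>I. p k j * x j) = (\<Sum>j\<in>I. if j = k then q * x j else 0)"
          by (rule sum.cong) (use pJ k JeqI in auto)
        also have "\<dots> = q * x k" using k I by (simp add: sum.delta)
        finally show ?thesis using ann[OF pL] k JeqI q0 by simp
      qed
      thus False using x(1) by blast
    qed
    thus ?thesis using J I(1) by (intro psubset_card_mono) auto
  qed
  have b'L: "b' \<in> L"
  proof (rule L_sat[OF L_Di[of 0], of "[:-1, 1:] ^ t"])
    show "[:-1, 1:] ^ t \<in> QP" using Qbar_minus[OF Qbar_1] by (intro QP_power QP_linear) auto
  qed (use bt in \<open>auto simp: Di_def\<close>)
  \<comment> \<open>The functions of the smaller system. Since q (b' . u) is the sum of b'_k w_k
    over J, the values b'_k(1) with k in J are the coefficients of a combination of the w_k that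
    vanishes at 1.\<close>
  define w where "w k = (lincomb I (p k) u)" for k
  have tw: "tame (w k)" if "k \<in> J" for k
    unfolding w_def using L_QP[OF pL[OF that]] u by (intro tame_poly_combination)
  have comb: "(lincomb J a w) = (\<Sum>i\<in>I. fps_of_poly (\<Sum>k\<in>J. a k * p k i) * u i)" for a
    unfolding w_def sum_distrib_left
    by (subst sum.swap) (simp add: fps_of_poly_sum fps_of_poly_mult sum_distrib_right mult.assoc)
  have combL: "(lincomb J z w) = fps_of_poly q * (lincomb I z u)" if "z \<in> L" for z
  proof -
    have "(lincomb J z w) = (\<Sum>i\<in>I. fps_of_poly (q * z i) * u i)"
      unfolding comb by (rule sum.cong) (simp_all add: expand[OF that])
    thus ?thesis by (simp add: fps_of_poly_mult sum_distrib_left mult.assoc)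
  qed
  obtain v1 where v1: "tame v1" "(lincomb I b' u) =
      (\<Sum>i\<in>I. fps_const (poly (b' i) 1) * u i) + (fps_X - 1) * v1"
    using combination_minus_value[of I b' u] bt(2) u by blast
  obtain v2 where v2: "tame v2" "(lincomb J b' w) =
      (\<Sum>k\<in>J. fps_const (poly (b' k) 1) * w k) + (fps_X - 1) * v2"
    using combination_minus_value[of J b' w] bt(2) tw J by blast
  define \<mu> where "\<mu> = poly (b' p0) 1"
  have \<mu>Q: "\<mu> \<in> Qbar" unfolding \<mu>_def using bt(2) I by blast
  have lu: "(\<Sum>i\<in>I. fps_const (poly (b' i) 1) * u i) = (fps_X - 1) * (fps_const \<mu> * y)"
  proof -
    have "(\<Sum>i\<in>I. fps_const (poly (b' i) 1) * u i) = fps_const \<mu> * (\<Sum>i\<in>I. fps_const (l i) * u i)"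
      unfolding sum_distrib_left
    proof (rule sum.cong)
      fix i assume "i \<in> I"
      hence "poly (b' i) 1 = \<mu> * l i" using b'l[of i] by (simp only: \<mu>_def mult.commute)
      thus "fps_const (poly (b' i) 1) * u i = fps_const \<mu> * (fps_const (l i) * u i)"
        by (simp only: fps_const_mult[symmetric] mult.assoc)
    qed simp
    thus ?thesis unfolding yu[symmetric] by (simp add: mult_ac)
  qed
  define y' where "y' = fps_of_poly q * (fps_const \<mu> * y + v1) - v2"
  have "\<exists>\<beta>. (\<forall>i\<in>J. \<beta> i \<in> QP \<and> poly (\<beta> i) 1 = poly (b' i) 1) \<and> (\<Sum>i\<in>J. fps_of_poly (\<beta> i) * w i) = 0"
  proof (rule relation_liftsD[OF IH[OF fJ JI], where y = y' and T = "q * T" and G = "\<lambda>i j. N (p i) j"])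
    show "tame (w i)" if "i \<in> J" for i using that by (rule tw)
    show "tame y'" unfolding y'_def
      by (intro tame_diff tame_mult tame_add tame_poly tame_const q \<mu>Q y v1 v2)
    show "poly (b' i) 1 \<in> Qbar" if "i \<in> J" for i using bt(2) J that by blast
    have "(\<Sum>k\<in>J. fps_const (poly (b' k) 1) * w k) = (lincomb J b' w) - (fps_X - 1) * v2"
      using v2(2) by simp
    also have "\<dots> = (fps_X - 1) * y'"
      unfolding combL[OF b'L] v1(2) lu y'_def by (simp add: algebra_simps)
    finally show "(fps_X - 1) * y' = (\<Sum>i\<in>J. fps_const (poly (b' i) 1) * w i)" by simp
    show "q * T \<in> QP" "poly (q * T) 1 \<noteq> 0" using q T by auto
    show "N (p i) j \<in> QP" if "i \<in> J" "j \<in> J" for i j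
      using N_QP[of "p i" j] L_QP[OF pL[OF that(1)]] that J by blast
    show "fps_of_poly (q * T) * fps_deriv (w i) = (\<Sum>j\<in>J. fps_of_poly (N (p i) j) * w j)" if i: "i \<in> J" for i
    proof -
      have "fps_of_poly T * fps_deriv (w i) = (\<Sum>j\<in>I. fps_of_poly (N (p i) j) * u j)"
        using Dit_fps[OF I(1) sys, of 1 "p i"] by (simp add: w_def N_def)
      thus ?thesis using combL[OF N_L[OF pL[OF i]]] by (simp add: fps_of_poly_mult mult.assoc)
    qed
  qed
  then obtain \<beta> where \<beta>: "\<And>i. i \<in> J \<Longrightarrow> \<beta> i \<in> QP" "\<And>i. i \<in> J \<Longrightarrow> poly (\<beta> i) 1 = poly (b' i) 1"
    "(\<Sum>i\<in>J. fps_of_poly (\<beta> i) * w i) = 0" by blast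
  \<comment> \<open>A relation between the w_k is one between the independent u_i, hence trivial.
    Its coefficients lift the values b'_k(1), which therefore vanish on J; \<open>expand\<close>
    carries this over to I, against the choice of b'.\<close>
  have "\<forall>i\<in>I. (\<Sum>k\<in>J. \<beta> k * p k i) = 0"
  proof (rule ind[unfolded fps_independent_def, THEN spec, THEN mp, THEN mp])
    show "\<forall>i\<in>I. (\<Sum>k\<in>J. \<beta> k * p k i) \<in> QP" using \<beta>(1) L_QP[OF pL] by (intro ballI QP_sum QP_mult) auto
    show "(\<Sum>i\<in>I. fps_of_poly (\<Sum>k\<in>J. \<beta> k * p k i) * u i) = 0" using \<beta>(3) unfolding comb .
  qed
  have "\<beta> j = 0" if j: "j \<in> J" for j
  proof -
    have "(\<Sum>k\<in>J. \<beta> k * p k j) = (\<Sum>k\<in>J. if k = j then \<beta> k * q else 0)"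
      by (rule sum.cong) (use pJ j in auto)
    also have "\<dots> = \<beta> j * q" using fJ j by (simp add: sum.delta)
    finally show ?thesis using \<open>\<forall>i\<in>I. (\<Sum>k\<in>J. \<beta> k * p k i) = 0\<close> j J q0 by auto
  qed
  hence bJ: "poly (b' j) 1 = 0" if "j \<in> J" for j using \<beta>(2) that by fastforce
  have "poly (b' i) 1 = 0" if i: "i \<in> I" for i
  proof -
    have "poly (q * b' i) 1 = (\<Sum>k\<in>J. poly (b' k) 1 * poly (p k i) 1)"
      unfolding expand[OF b'L i] by (simp add: poly_sum)
    also have "\<dots> = 0" using bJ by simp
    finally show ?thesis using q(2) by simp
  qed
  thus False using bt(3) by blast
qed

lemma fps_independentD:
  assumes "fps_independent I u" "\<And>i. i \<in> I \<Longrightarrow> w i \<in> QP" "(lincomb I w u) = 0" "i \<in> I"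
  shows "w i = 0"
  using assms(1)[unfolded fps_independent_def, THEN spec, THEN mp, THEN mp, of w] assms(2,3,4) by simp

text \<open>The dichotomy is on \<open>\<Delta>\<close>, which is left of the first m derived rows
  after elimination of all columns but p0. If it is not 0, the order of b . u at 0 is bounded
  linearly in k and the factorial argument kills its lowest coefficient. If it is 0, these rows are
  dependent and span a submodule to which the induction hypothesis applies.\<close>

lemma vanishing_combination_contradiction:
  fixes u :: "'i \<Rightarrow> complex fps" and l :: "'i \<Rightarrow> complex"
  assumes I: "finite I" "p0 \<in> I" and u: "\<And>i. i \<in> I \<Longrightarrow> tame (u i)" and y: "tame y"
    and l: "\<And>i. i \<in> I \<Longrightarrow> l i \<in> Qbar" "l p0 = 1"
    and yu: "(fps_X - 1) * y = (\<Sum>i\<in>I. fps_const (l i) * u i)"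
    and T: "T \<in> QP" "poly T 1 \<noteq> 0"
    and G: "\<And>i j. i \<in> I \<Longrightarrow> j \<in> I \<Longrightarrow> G i j \<in> QP"
    and sys: "\<And>i. i \<in> I \<Longrightarrow> fps_of_poly T * fps_deriv (u i) = (lincomb I (G i) u)"
    and ind: "fps_independent I u"
    and IH: "\<And>J :: 'i set. finite J \<Longrightarrow> card J < card I \<Longrightarrow> relation_lifts J"
  shows False
proof -
  define \<tau> where "\<tau> = poly T 1"
  have \<tau>: "\<tau> \<in> Qbar" "\<tau> \<noteq> 0" using T by (auto simp: \<tau>_def)
  define A where "A = (\<lambda>i. coeff T i / \<tau>) ` {..degree T} \<union> l ` I \<union>
     (\<Union>p\<in>I\<times>I. (\<lambda>a. coeff (G (fst p) (snd p)) a / \<tau>) ` {..degree (G (fst p) (snd p))})"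
  have fA: "finite A" using I by (auto simp: A_def)
  have AQ: "A \<subseteq> Qbar"
    using \<tau> l T G by (auto simp: A_def intro!: Qbar_divide QP_coeff)
  obtain B and t :: nat where Bt: "finite B" "B \<noteq> {}" "\<forall>b\<in>B. algebraic_int b"
      "\<forall>b\<in>B. \<forall>b'\<in>B. b * b' \<in> Zmod.span B" "t > 0" "\<forall>a\<in>A. of_nat t * a \<in> Zmod.span B"
      "\<forall>c. (\<Sum>b\<in>B. of_int (c b) * b) = 0 \<longrightarrow> (\<forall>b\<in>B. c b = 0)"
    using order_exists[OF fA AQ] by (elim exE conjE) (rule that)
  note B = Bt(1,2) bspec[OF Bt(3)] bspec[OF bspec[OF Bt(4)]]
  note t = Bt(5) bspec[OF Bt(6)]
  note Bi = mp[OF spec[OF Bt(7)]]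
  \<comment> \<open>Makes the value of T at 1 the positive integer t, so that the powers T(1)^i cost
    only integer factors.\<close>
  define \<rho> where "\<rho> = of_nat t / \<tau>"
  have \<rho>: "\<rho> \<noteq> 0" "\<rho> \<in> Qbar" using t \<tau> by (auto simp: \<rho>_def)
  define T1 where "T1 = Polynomial.smult \<rho> T"
  define G1 where "G1 i j = Polynomial.smult \<rho> (G i j)" for i j
  have T1: "T1 \<in> QP" "poly T1 1 = of_nat t" "poly T1 1 \<noteq> 0" "coeff T1 i \<in> Zmod.span B" for i
  proof -
    show "T1 \<in> QP" using T \<rho> by (auto simp: T1_def)
    show "poly T1 1 = of_nat t" using \<tau> by (simp add: T1_def \<rho>_def \<tau>_def)
    thus "poly T1 1 \<noteq> 0" using t by simp
    show "coeff T1 i \<in> Zmod.span B"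
    proof (cases "i \<le> degree T")
      case True
      hence "of_nat t * (coeff T i / \<tau>) \<in> Zmod.span B" by (intro t) (auto simp: A_def)
      thus ?thesis by (simp add: T1_def \<rho>_def)
    next
      case False
      thus ?thesis using Zmod.span_zero by (simp add: T1_def coeff_eq_0)
    qed
  qed
  have G1: "G1 i j \<in> QP" "coeff (G1 i j) a \<in> Zmod.span B" if ij: "i \<in> I" "j \<in> I" for i j a
  proof -
    show "G1 i j \<in> QP" using G[OF ij] \<rho> by (auto simp: G1_def)
    show "coeff (G1 i j) a \<in> Zmod.span B"
    proof (cases "a \<le> degree (G i j)")
      case True
      hence "of_nat t * (coeff (G i j) a / \<tau>) \<in> Zmod.span B" using ij by (intro t) (force simp: A_def)
      thus ?thesis by (simp add: G1_def \<rho>_def)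
    next
      case False
      thus ?thesis using Zmod.span_zero by (simp add: G1_def coeff_eq_0)
    qed
  qed
  have sys1: "fps_of_poly T1 * fps_deriv (u i) = (lincomb I (G1 i) u)" if "i \<in> I" for i
    using arg_cong[OF sys[OF that], of "\<lambda>x. fps_const \<rho> * x"]
    by (simp add: T1_def G1_def fps_of_poly_smult sum_distrib_left mult.assoc)
  have span_ai: "algebraic_int x" if "x \<in> Zmod.span B" for x
    using Zspan_bd[OF B(1) that] bd_algebraic_int[OF B(3)] by blast
  define m q P where "m = card I" and "q = 2 * m" and "P = 2 * m * m - m + 1"
  have m1: "m \<ge> 1" using I by (metis m_def One_nat_def Suc_leI card_gt_0_iff empty_iff)
  have P2: "P \<ge> 2"
  proof -
    have "2 * m * m \<ge> 2 * m" using m1 by simp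
    thus ?thesis using m1 unfolding P_def by linarith
  qed
  have lspan: "of_nat t * l j \<in> Zmod.span B" if "j \<in> I" for j using that by (intro t) (auto simp: A_def)
  have "\<exists>C>0. \<forall>r>0. \<exists>b. (\<exists>j\<in>I. b j \<noteq> 0) \<and> (\<forall>j a. a \<ge> q * (P * r) \<longrightarrow> coeff (b j) a = 0) \<and>
    (\<forall>j a. \<exists>\<beta>. coeff (b j) a = fact a * \<beta> \<and> bd B ((C * (P * r)) ^ ((P - 2) * r)) \<beta>) \<and>
    (\<forall>i<P * r. \<forall>j\<in>I. poly (Dit T1 G1 I i b j) 1 = l j * poly (Dit T1 G1 I i b p0) 1) \<and>
    (\<forall>i a. \<forall>j\<in>I. algebraic_int (coeff (Dit T1 G1 I i b j) a))"
    by (rule auxiliary_row[OF I B(1,2)]) (fact B Bi T1 G1 t lspan l m_def q_def P_def)+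
  then obtain C where C: "C > 0" and aux: "\<forall>r>0. \<exists>b. (\<exists>j\<in>I. b j \<noteq> 0) \<and> (\<forall>j a. a \<ge> q * (P * r) \<longrightarrow> coeff (b j) a = 0) \<and>
    (\<forall>j a. \<exists>\<beta>. coeff (b j) a = fact a * \<beta> \<and> bd B ((C * (P * r)) ^ ((P - 2) * r)) \<beta>) \<and>
    (\<forall>i<P * r. \<forall>j\<in>I. poly (Dit T1 G1 I i b j) 1 = l j * poly (Dit T1 G1 I i b p0) 1) \<and>
    (\<forall>i a. \<forall>j\<in>I. algebraic_int (coeff (Dit T1 G1 I i b j) a))"
    by (elim exE conjE) (rule that)
  obtain R where R: "R \<ge> 0" "\<And>M x. bd B M x \<Longrightarrow> conj_bound (real M * R) x"
    using bd_conj_bound[OF B(1)] B(3) algebraic_int_imp_Qbar by blast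
  define s where "s = degree T1 + (\<Sum>p\<in>I \<times> I. degree (G1 (fst p) (snd p)))"
  have sT: "degree T1 \<le> s" by (simp add: s_def)
  have sG: "degree (G1 i j) \<le> s" if "i \<in> I" "j \<in> I" for i j
    using member_le_sum[of "(i,j)" "I \<times> I" "\<lambda>p. degree (G1 (fst p) (snd p))"] that I by (simp add: s_def)
  \<comment> \<open>Comes from ord(b . u) \<le> m + deg \<Delta> + ord(u_p0), where deg \<Delta>
    \<le> (m + 1) N and N \<le> (q + m s) k.\<close>
  define \<kappa> where "\<kappa> = m + (m + 1) * (q + m * s) + subdegree (u p0)"
  have "\<exists>c::nat. c > 0 \<and> (\<forall>k>0. \<forall>n0\<le>\<kappa> * k. \<forall>b (X::real).
     (\<forall>j\<in>I. \<forall>a\<ge>q * k. coeff (b j) a = 0) \<longrightarrow>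
     (\<forall>j\<in>I. \<forall>a. \<exists>\<beta>. coeff (b j) a = fact a * \<beta> \<and> algebraic_int \<beta> \<and> conj_bound X \<beta>) \<longrightarrow>
     (\<forall>i<k. \<forall>j\<in>I. poly (Dit T1 G1 I i b j) 1 = l j * poly (Dit T1 G1 I i b p0) 1) \<longrightarrow>
     (\<forall>i a. \<forall>j\<in>I. algebraic_int (coeff (Dit T1 G1 I i b j) a)) \<longrightarrow>
     (\<forall>t<n0. fps_nth (lincomb I b u) t = 0) \<longrightarrow>
     X * real c ^ k < fact k \<longrightarrow>
     fps_nth (lincomb I b u) n0 = 0)"
    by (rule lowest_coeff_vanishes[OF I _ y yu _ T1(2) t(1)]) (fact u sys1 | rule span_ai T1 | rule span_ai G1, assumption+)+
  then obtain c :: nat where c: "c > 0" and low: "\<forall>k>0. \<forall>n0\<le>\<kappa> * k. \<forall>b (X::real).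
     (\<forall>j\<in>I. \<forall>a\<ge>q * k. coeff (b j) a = 0) \<longrightarrow>
     (\<forall>j\<in>I. \<forall>a. \<exists>\<beta>. coeff (b j) a = fact a * \<beta> \<and> algebraic_int \<beta> \<and> conj_bound X \<beta>) \<longrightarrow>
     (\<forall>i<k. \<forall>j\<in>I. poly (Dit T1 G1 I i b j) 1 = l j * poly (Dit T1 G1 I i b p0) 1) \<longrightarrow>
     (\<forall>i a. \<forall>j\<in>I. algebraic_int (coeff (Dit T1 G1 I i b j) a)) \<longrightarrow>
     (\<forall>t<n0. fps_nth (lincomb I b u) t = 0) \<longrightarrow>
     X * real c ^ k < fact k \<longrightarrow>
     fps_nth (lincomb I b u) n0 = 0"
    by (elim exE conjE) (rule that)
  obtain r where r: "r > 0" "real ((C * (P * r)) ^ ((P - 2) * r)) * R * real c ^ (P * r) < fact (P * r)"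
    using siegel_gain[OF C c P2 R(1)] by blast
  define k where "k = P * r"
  have k: "k > 0" using P2 r by (simp add: k_def)
  define X where "X = real ((C * k) ^ ((P - 2) * r)) * R"
  have Xc: "X * real c ^ k < fact k" using r(2) by (simp add: X_def k_def)
  have X0: "X \<ge> 0" using R(1) by (simp add: X_def)
  obtain b where b0: "\<exists>j\<in>I. b j \<noteq> 0" and bL: "\<forall>j a. a \<ge> q * k \<longrightarrow> coeff (b j) a = 0"
    and b\<beta>': "\<forall>j a. \<exists>\<beta>. coeff (b j) a = fact a * \<beta> \<and> bd B ((C * k) ^ ((P - 2) * r)) \<beta>"
    and bp: "\<forall>i<k. \<forall>j\<in>I. poly (Dit T1 G1 I i b j) 1 = l j * poly (Dit T1 G1 I i b p0) 1"
    and bA: "\<forall>i a. \<forall>j\<in>I. algebraic_int (coeff (Dit T1 G1 I i b j) a)"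
    using mp[OF spec[OF aux] r(1)] unfolding k_def[symmetric] by (elim exE conjE) (rule that)
  have b\<beta>: "\<exists>\<beta>. coeff (b j) a = fact a * \<beta> \<and> algebraic_int \<beta> \<and> conj_bound X \<beta>" for j a
    using b\<beta>' R(2) bd_algebraic_int[OF B(3)] unfolding X_def by meson
  have bQ: "b j \<in> QP" if "j \<in> I" for j
    using bA[rule_format, OF that, of 0] by (auto simp: polys_over_iff intro: algebraic_int_imp_Qbar)
  have DQ: "Dit T1 G1 I i b j \<in> QP" if "j \<in> I" for i j
    using that by (intro QP_Dit T1 G1 bQ)
  have bdeg: "degree (b j) \<le> q * k" for j
    by (rule degree_le) (use bL in auto)
  define N where "N = q * k + m * s"
  have Ddeg: "degree (Dit T1 G1 I i b j) \<le> N" if "i < m" "j \<in> I" for i j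
  proof -
    have "degree (Dit T1 G1 I i b j) \<le> q * k + i * s"
      using degree_Dit[where G = G1 and b = b and N = "q * k", OF sT sG I(1) bdeg that(2)] .
    also have "\<dots> \<le> N" using that(1) by (simp add: N_def)
    finally show ?thesis .
  qed
  have "\<exists>c. (\<forall>i<m. c i \<in> QP \<and> degree (c i) \<le> m * N) \<and> (\<exists>i<m. c i \<noteq> 0) \<and>
     (\<forall>j\<in>I - {p0}. (\<Sum>i<m. c i * Dit T1 G1 I i b j) = 0)"
    by (rule bounded_elimination[OF I m_def[symmetric]]) (use DQ Ddeg in auto)
  then obtain e where e: "\<forall>i<m. e i \<in> QP \<and> degree (e i) \<le> m * N" "\<exists>i<m. e i \<noteq> 0"
    "\<forall>j\<in>I - {p0}. (\<Sum>i<m. e i * Dit T1 G1 I i b j) = 0" by blast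
  \<comment> \<open>All columns but p0 cancel, so \<Delta> u_p0 is a combination of the derivatives
    of b . u of order below m; its order at 0 is at least that of b . u minus m.\<close>
  define \<Delta> where "\<Delta> = (\<Sum>i<m. e i * Dit T1 G1 I i b p0)"
  define h where "h = (lincomb I b u)"
  show False
  proof (cases "\<Delta> = 0")
    case False
    have h0: "h \<noteq> 0"
    proof
      assume "h = 0"
      have "b i = 0" if "i \<in> I" for i
        by (rule fps_independentD[OF ind _ _ that, of b]) (use bQ h_def \<open>h = 0\<close> in auto)
      thus False using b0 by blast
    qed
    have up: "u p0 \<noteq> 0"
    proof
      assume "u p0 = 0"
      define w where "w i = (if i = p0 then 1 else 0 :: complex poly)" for i
      have "(lincomb I w u) = 0"
        by (rule sum.neutral) (auto simp: w_def \<open>u p0 = 0\<close>)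
      hence "w p0 = 0" by (intro fps_independentD[OF ind _ _ I(2)]) (simp_all add: w_def)
      thus False by (simp add: w_def)
    qed
    define n0 where "n0 = subdegree h"
    have \<Delta>u: "fps_of_poly \<Delta> * u p0 = (\<Sum>i<m. fps_of_poly (e i * T1 ^ i) * (fps_deriv ^^ i) h)"
    proof -
      have "(\<Sum>i<m. fps_of_poly (e i * T1 ^ i) * (fps_deriv ^^ i) h) =
        (\<Sum>i<m. fps_of_poly (e i) * (lincomb I (Dit T1 G1 I i b) u))"
        unfolding h_def
        by (intro sum.cong) (simp_all add: Dit_fps[OF I(1) sys1, symmetric] fps_of_poly_mult fps_of_poly_power mult.assoc)
      also have "\<dots> = (\<Sum>j\<in>I. fps_of_poly (\<Sum>i<m. e i * Dit T1 G1 I i b j) * u j)"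
        unfolding sum_distrib_left
        by (subst sum.swap) (simp add: fps_of_poly_sum fps_of_poly_mult sum_distrib_right mult.assoc)
      also have "\<dots> = (\<Sum>j\<in>I. if j = p0 then fps_of_poly \<Delta> * u j else 0)"
        by (rule sum.cong) (use e(3) in \<open>auto simp: \<Delta>_def\<close>)
      also have "\<dots> = fps_of_poly \<Delta> * u p0" using I by (simp add: sum.delta)
      finally show ?thesis by simp
    qed
    have dz: "fps_nth ((fps_deriv ^^ i) h) a = 0" if "a + i < n0" for i a
      using that
    proof (induction i arbitrary: a)
      case 0
      hence "a < subdegree h" by (simp add: n0_def)
      thus ?case by (simp only: funpow_0) (rule nth_less_subdegree_zero)
    next
      case (Suc i)
      thus ?case by simp
    qed
    have "n0 - m \<le> subdegree (fps_of_poly \<Delta> * u p0)"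
    proof (rule subdegree_geI)
      show "fps_of_poly \<Delta> * u p0 \<noteq> 0" using False up by simp
      fix a assume a: "a < n0 - m"
      show "fps_nth (fps_of_poly \<Delta> * u p0) a = 0"
        unfolding \<Delta>u fps_sum_nth fps_mult_nth
        by (intro sum.neutral ballI) (use a dz in auto)
    qed
    also have "\<dots> = subdegree (fps_of_poly \<Delta>) + subdegree (u p0)"
      using False up by (intro subdegree_mult) auto
    also have "subdegree (fps_of_poly \<Delta>) \<le> degree \<Delta>"
      using False by (intro subdegree_leI) auto
    also have "degree \<Delta> \<le> (m + 1) * N"
      unfolding \<Delta>_def
    proof (rule degree_sum_le)
      fix i assume "i \<in> {..<m}"
      thus "degree (e i * Dit T1 G1 I i b p0) \<le> (m + 1) * N"
        using degree_mult_le[of "e i" "Dit T1 G1 I i b p0"] e(1) Ddeg[of i p0] I by fastforce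
    qed simp
    finally have "n0 \<le> m + (m + 1) * N + subdegree (u p0)" by simp
    also have "\<dots> \<le> \<kappa> * k"
    proof -
      have "m * s \<le> m * s * k" "m \<le> m * k" "subdegree (u p0) \<le> subdegree (u p0) * k" using k by auto
      moreover from this have "(m + 1) * N \<le> (m + 1) * (q + m * s) * k"
      proof -
        have "N \<le> (q + m * s) * k" unfolding N_def add_mult_distrib using \<open>m * s \<le> m * s * k\<close> by (rule add_left_mono)
        from mult_le_mono2[OF this, of "m + 1"] show ?thesis by (simp only: mult.assoc)
      qed
      moreover have "\<kappa> * k = m * k + (m + 1) * (q + m * s) * k + subdegree (u p0) * k"
        by (simp only: \<kappa>_def add_mult_distrib)
      ultimately show ?thesis by linarith
    qed
    finally have n0k: "n0 \<le> \<kappa> * k" .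
    have "fps_nth h n0 = 0"
      unfolding h_def
    proof (rule low[THEN spec, THEN mp, OF k, THEN spec, THEN mp, OF n0k, THEN spec, THEN spec,
          THEN mp, THEN mp, THEN mp, THEN mp, THEN mp, THEN mp, OF _ _ bp bA _ Xc])
      show "\<forall>j\<in>I. \<forall>a\<ge>q * k. coeff (b j) a = 0" using bL by blast
      show "\<forall>j\<in>I. \<forall>a. \<exists>\<beta>. coeff (b j) a = fact a * \<beta> \<and> algebraic_int \<beta> \<and> conj_bound X \<beta>" using b\<beta> by blast
      show "\<forall>t<n0. fps_nth (lincomb I b u) t = 0"
      proof (intro allI impI)
        fix t assume "t < n0"
        thus "fps_nth (lincomb I b u) t = 0"
          unfolding h_def[symmetric] n0_def by (rule nth_less_subdegree_zero)
      qed
    qed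
    thus False using h0 by (simp add: n0_def)
  next
    case True
    have "\<exists>t w'. (\<forall>i\<in>I. b i = [:-1, 1:] ^ t * w' i \<and> w' i \<in> QP) \<and> (\<exists>i\<in>I. poly (w' i) 1 \<noteq> 0)"
      by (rule strip_linear_factor) (use I b0 bQ in auto)
    then obtain \<nu> b' where b': "\<And>i. i \<in> I \<Longrightarrow> b i = [:-1, 1:] ^ \<nu> * b' i" "\<And>i. i \<in> I \<Longrightarrow> b' i \<in> QP"
      "\<exists>i\<in>I. poly (b' i) 1 \<noteq> 0" by blast
    \<comment> \<open>A higher multiplicity at 1 is excluded by the size of the coefficients of b.
      The bound \<nu> < k makes the proportionality to l available for the derived row with index
      \<nu>, whose value at 1 is a multiple of b'(1).\<close>
    have \<nu>k: "\<nu> < k"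
    proof (rule ccontr)
      assume "\<not> \<nu> < k"
      obtain j where j: "j \<in> I" "b j \<noteq> 0" using b0 by blast
      have "[:-1, 1:] ^ k dvd ([:-1, 1:] ^ \<nu> :: complex poly)" using \<open>\<not> \<nu> < k\<close> by (intro le_imp_power_dvd) simp
      also have "\<dots> dvd b j" using b'(1)[OF j(1)] by simp
      finally have dv: "[:-1, 1:] ^ k dvd b j" .
      have "X * 1 \<le> X * real c ^ k" using c X0 by (intro mult_left_mono one_le_power) auto
      hence "X < fact k" using Xc by simp
      from high_multiplicity_contradiction[OF j(2) dv b\<beta> this] show False .
    qed
    have b'l: "poly (b' j) 1 = l j * poly (b' p0) 1" if j: "j \<in> I" for j
    proof -
      obtain d where d: "\<And>j. j \<in> I \<Longrightarrow> Dit T1 G1 I \<nu> b j = [:-1, 1:] ^ (\<nu> - \<nu>) * d j"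
         "\<And>j. j \<in> I \<Longrightarrow> poly (d j) 1 * fact (\<nu> - \<nu>) = poly T1 1 ^ \<nu> * fact \<nu> * poly (b' j) 1"
        using Dit_strip[where b = b and b' = b' and t = \<nu> and i = \<nu> and I = I and T = T1 and G = G1] b'(1) by blast
      have e: "poly (Dit T1 G1 I \<nu> b j) 1 = poly T1 1 ^ \<nu> * fact \<nu> * poly (b' j) 1" if "j \<in> I" for j
        using d[OF that] by simp
      have "poly (Dit T1 G1 I \<nu> b j) 1 = l j * poly (Dit T1 G1 I \<nu> b p0) 1" using bp \<nu>k j by blast
      hence "(poly T1 1 ^ \<nu> * fact \<nu>) * poly (b' j) 1 = (poly T1 1 ^ \<nu> * fact \<nu>) * (l j * poly (b' p0) 1)"
        unfolding e[OF j] e[OF I(2)] by (simp only: mult_ac)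
      thus ?thesis using T1(3) by simp
    qed
    have ez: "(\<Sum>i<card I. e i * Dit T1 G1 I i b j) = 0" if "j \<in> I" for j
      using e(3) True that unfolding \<Delta>_def m_def by (cases "j = p0") auto
    show False
    proof (rule smaller_system[where T = T1 and G = G1 and b = b and b' = b' and c = e and t = \<nu>,
          OF I u y yu T1(1,3) G1(1) sys1 ind bQ b0 b' b'l _ _ ez])
      show "e i \<in> QP" if "i < card I" for i using e(1) that by (simp add: m_def)
      show "\<exists>i<card I. e i \<noteq> 0" using e(2) by (simp add: m_def)
    qed (assumption | rule IH)+
  qed
qed

text \<open>Strong induction on the number of functions. Independent functions admit only l = 0.
  Otherwise a relation v with v_k(1) \<noteq> 0 eliminates u_k, and the system for the other
  functions has the denominator T v_k, still non-zero at 1.\<close>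

lemma linear_relation_lifts:
  "finite (I :: 'i set) \<Longrightarrow> relation_lifts I"
proof (induction "card I" arbitrary: I rule: less_induct)
  case less
  note I = less.prems
  have hyps: "relation_lifts J" if "finite J" "card J < card I" for J :: "'i set"
    using less.hyps that by blast
  show ?case
    unfolding relation_lifts_def
  proof (intro allI impI)
    fix u :: "'i \<Rightarrow> complex fps" and y l T G
    assume u': "\<forall>i\<in>I. tame (u i)" and y: "tame y" and l': "\<forall>i\<in>I. l i \<in> Qbar"
      and yu: "(fps_X - 1) * y = (\<Sum>i\<in>I. fps_const (l i) * u i)" and T: "T \<in> QP" "poly T 1 \<noteq> 0"
      and G': "\<forall>i\<in>I. \<forall>j\<in>I. G i j \<in> QP"
      and sys': "\<forall>i\<in>I. fps_of_poly T * fps_deriv (u i) = (lincomb I (G i) u)"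
    have u: "tame (u i)" if "i \<in> I" for i using u' that by blast
    have l: "l i \<in> Qbar" if "i \<in> I" for i using l' that by blast
    have G: "G i j \<in> QP" if "i \<in> I" "j \<in> I" for i j using G' that by blast
    have sys: "fps_of_poly T * fps_deriv (u i) = (lincomb I (G i) u)" if "i \<in> I" for i
      using sys' that by blast
  show "\<exists>b. (\<forall>i\<in>I. b i \<in> QP \<and> poly (b i) 1 = l i) \<and> (lincomb I b u) = 0"
  proof (cases "\<forall>i\<in>I. l i = 0")
    case True
    thus ?thesis by (intro exI[of _ "\<lambda>_. 0"]) auto
  next
    case nz: False
    then obtain p0 where p0: "p0 \<in> I" "l p0 \<noteq> 0" by blast
    show ?thesis
    proof (cases "fps_independent I u")
      case True
      have lp: "l p0 \<in> Qbar" using l p0 by blast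
      define \<rho> where "\<rho> = inverse (l p0)"
      have \<rho>: "\<rho> \<in> Qbar" using lp by (auto simp: \<rho>_def)
      have False
      proof (rule vanishing_combination_contradiction[where l = "\<lambda>i. \<rho> * l i" and y = "fps_const \<rho> * y",
            OF I p0(1) u _ _ _ _ T G sys True])
        show "tame (fps_const \<rho> * y)" by (intro tame_mult tame_const \<rho> y)
        show "\<rho> * l i \<in> Qbar" if "i \<in> I" for i using \<rho> l that by blast
        show "\<rho> * l p0 = 1" using p0 by (simp add: \<rho>_def)
        show "(fps_X - 1) * (fps_const \<rho> * y) = (\<Sum>i\<in>I. fps_const (\<rho> * l i) * u i)"
          using arg_cong[OF yu, of "\<lambda>x. fps_const \<rho> * x"]
          by (simp add: sum_distrib_left fps_const_mult[symmetric] mult_ac del: fps_const_mult)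
      qed (assumption | rule hyps)+
      thus ?thesis ..
    next
      case False
      then obtain w where w: "\<And>i. i \<in> I \<Longrightarrow> w i \<in> QP" "(lincomb I w u) = 0" "\<exists>i\<in>I. w i \<noteq> 0"
        unfolding fps_independent_def by blast
      have "\<exists>t w'. (\<forall>i\<in>I. w i = [:-1, 1:] ^ t * w' i \<and> w' i \<in> QP) \<and> (\<exists>i\<in>I. poly (w' i) 1 \<noteq> 0)"
        by (rule strip_linear_factor) (use I w in auto)
      then obtain \<nu> v where v: "\<And>i. i \<in> I \<Longrightarrow> w i = [:-1, 1:] ^ \<nu> * v i" "\<And>i. i \<in> I \<Longrightarrow> v i \<in> QP"
        "\<exists>i\<in>I. poly (v i) 1 \<noteq> 0" by blast
      have "fps_of_poly ([:-1, 1:] ^ \<nu>) * (lincomb I v u) = 0"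
        using w(2) v(1) by (simp add: sum_distrib_left fps_of_poly_mult mult.assoc cong: sum.cong)
      hence vu: "(lincomb I v u) = 0"
        by simp
      obtain k where k: "k \<in> I" "poly (v k) 1 \<noteq> 0" using v(3) by blast
      define J where "J = I - {k}"
      have J: "finite J" "card J < card I" using I card_Diff1_less[OF I k(1)] by (simp_all add: J_def)
      have split: "(\<Sum>i\<in>I. f i) = f k + (\<Sum>i\<in>J. f i)" for f :: "'i \<Rightarrow> complex fps"
        unfolding J_def using sum.remove[OF I k(1)] .
      have uk: "fps_of_poly (v k) * u k = - (lincomb J v u)"
        using vu unfolding split by (rule eq_neg_iff_add_eq_0[THEN iffD2])
      \<comment> \<open>Subtracting \<gamma> v removes u_k from the relation at 1; the same multiple
        of v, itself a relation between the functions, is added to the lifted relation at the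
        end.\<close>
      define \<gamma> where "\<gamma> = l k / poly (v k) 1"
      have \<gamma>: "\<gamma> \<in> Qbar" using l k v(2) unfolding \<gamma>_def by blast
      define l' where "l' i = l i - \<gamma> * poly (v i) 1" for i
      have l'k: "l' k = 0" using k(2) by (simp add: l'_def \<gamma>_def)
      obtain v1 where v1: "tame v1" "(lincomb I v u) =
         (\<Sum>i\<in>I. fps_const (poly (v i) 1) * u i) + (fps_X - 1) * v1"
        using combination_minus_value[of I v u] v(2) u by blast
      define y' where "y' = y + fps_const \<gamma> * v1"
      have y'u: "(fps_X - 1) * y' = (\<Sum>i\<in>J. fps_const (l' i) * u i)"
      proof -
        have "(\<Sum>i\<in>I. fps_const (l' i) * u i) = (\<Sum>i\<in>I. fps_const (l i) * u i) - fps_const \<gamma> * (\<Sum>i\<in>I. fps_const (poly (v i) 1) * u i)"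
          unfolding l'_def sum_distrib_left sum_subtractf[symmetric]
          by (intro sum.cong refl) (simp only: fps_const_sub[symmetric] fps_const_mult[symmetric] left_diff_distrib mult.assoc)
        also have "(\<Sum>i\<in>I. fps_const (poly (v i) 1) * u i) = - ((fps_X - 1) * v1)"
          using v1(2) unfolding vu by (simp add: eq_neg_iff_add_eq_0)
        finally show ?thesis unfolding yu[symmetric] y'_def split l'k
          by (simp add: algebra_simps)
      qed
      have "\<exists>b. (\<forall>i\<in>J. b i \<in> QP \<and> poly (b i) 1 = l' i) \<and> (lincomb J b u) = 0"
      proof (rule relation_liftsD[OF hyps[OF J], where y = y' and T = "T * v k" and G = "\<lambda>i j. G i j * v k - G i k * v j"])
        show "tame (u i)" if "i \<in> J" for i using u that by (simp add: J_def)
        show "tame y'" unfolding y'_def by (intro tame_add tame_mult tame_const \<gamma> v1 y)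
        show "l' i \<in> Qbar" if "i \<in> J" for i
          unfolding l'_def using l v(2) \<gamma> that by (intro Qbar_diff Qbar_mult QP_poly Qbar_1) (auto simp: J_def)
        show "(fps_X - 1) * y' = (\<Sum>i\<in>J. fps_const (l' i) * u i)" by (rule y'u)
        show "T * v k \<in> QP" "poly (T * v k) 1 \<noteq> 0" using T v k by auto
        show "G i j * v k - G i k * v j \<in> QP" if "i \<in> J" "j \<in> J" for i j
          using that G v(2) k by (intro QP_diff QP_mult) (auto simp: J_def)
        show "fps_of_poly (T * v k) * fps_deriv (u i) = (\<Sum>j\<in>J. fps_of_poly (G i j * v k - G i k * v j) * u j)"
          if i: "i \<in> J" for i
        proof -
          have "fps_of_poly (T * v k) * fps_deriv (u i) = fps_of_poly (v k) * (fps_of_poly T * fps_deriv (u i))"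
            by (simp add: fps_of_poly_mult mult_ac)
          also have "\<dots> = fps_of_poly (G i k) * (fps_of_poly (v k) * u k) + (\<Sum>j\<in>J. fps_of_poly (v k) * (fps_of_poly (G i j) * u j))"
            using sys[of i] i unfolding split by (simp add: J_def distrib_left sum_distrib_left mult_ac)
          also have "\<dots> = (\<Sum>j\<in>J. fps_of_poly (G i j * v k - G i k * v j) * u j)"
            unfolding uk
            by (simp add: sum_distrib_left sum_negf[symmetric] sum.distrib[symmetric] fps_of_poly_mult fps_of_poly_diff algebra_simps)
          finally show ?thesis .
        qed
      qed
      then obtain b where b: "\<And>i. i \<in> J \<Longrightarrow> b i \<in> QP \<and> poly (b i) 1 = l' i" "(lincomb J b u) = 0"
        by blast
      define b' where "b' i = (if i = k then 0 else b i) + Polynomial.smult \<gamma> (v i)" for i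
      show ?thesis
      proof (intro exI[of _ b'] conjI ballI)
        fix i assume i: "i \<in> I"
        show "b' i \<in> QP" using b(1)[of i] v(2) \<gamma> i by (auto simp: b'_def J_def)
        show "poly (b' i) 1 = l i"
        proof (cases "i = k")
          case True
          thus ?thesis using k(2) by (simp add: b'_def \<gamma>_def)
        next
          case False
          thus ?thesis using b(1)[of i] i by (simp add: b'_def l'_def J_def)
        qed
      next
        have "(lincomb I b' u) = (\<Sum>i\<in>I. fps_of_poly (if i = k then 0 else b i) * u i)
           + fps_const \<gamma> * (lincomb I v u)"
          by (simp add: b'_def fps_of_poly_add fps_of_poly_smult distrib_right sum.distrib sum_distrib_left mult.assoc)
        also have "(\<Sum>i\<in>I. fps_of_poly (if i = k then 0 else b i) * u i) = (lincomb J b u)"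
          unfolding split by (auto simp: J_def intro!: sum.cong)
        finally show "(lincomb I b' u) = 0" using b(2) vu by simp
      qed
    qed
  qed
  qed
qed

section \<open>Ramis sums\<close>

lemma large_sector_mono: "\<epsilon> \<le> \<epsilon>' \<Longrightarrow> large_sector \<theta> \<epsilon> \<subseteq> large_sector \<theta> \<epsilon>'"
  by (auto simp: large_sector_def)

text \<open>The bound \<epsilon> \<le> \<pi>/4 keeps the imaginary part in the range where Arg
  inverts exp.\<close>

lemma large_sector_exp:
  assumes "\<bar>Im w\<bar> < pi / 2 + \<epsilon>" "\<epsilon> \<le> pi / 4"
  shows "cis \<theta> * exp w \<in> large_sector \<theta> \<epsilon>"
proof -
  have "cis \<theta> * exp w * cis (- \<theta>) = exp w"
    by (simp add: mult.commute mult.left_commute cis_mult)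
  moreover have "Arg (exp w) = Im w"
    using assms by (intro Arg_exp) auto
  ultimately show ?thesis using assms(1) unfolding large_sector_def mem_Collect_eq by (simp only:) simp
qed

lemma large_sector_imp_exp:
  assumes "z \<in> large_sector \<theta> \<epsilon>"
  obtains w where "z = cis \<theta> * exp w" "\<bar>Im w\<bar> < pi / 2 + \<epsilon>"
proof -
  define v where "v = z * cis (- \<theta>)"
  have v: "v \<noteq> 0" "\<bar>Arg v\<bar> < pi / 2 + \<epsilon>" using assms by (auto simp: large_sector_def v_def)
  have "cis \<theta> * exp (Ln v) = z" using v(1) by (simp add: v_def mult.commute mult.left_commute cis_mult)
  moreover have "Im (Ln v) = Arg v" using v(1) by (simp add: Arg_eq_Im_Ln)
  ultimately show ?thesis using that[of "Ln v"] v(2) by simp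
qed

text \<open>Summation to the least term: N about r / (2 B) turns the factorial bounds into
  exponential decay.\<close>

lemma gevrey_decay:
  fixes r B :: real
  assumes "r > 0" "B > 0" and x: "\<And>N. x \<le> C * B ^ N * fact N / r ^ N" and "C \<ge> 0"
  shows "x \<le> 2 * C * exp (- (ln 2 / (2 * B)) * r)"
proof -
  define N where "N = nat \<lfloor>r / (2 * B)\<rfloor>"
  have N: "real N \<le> r / (2 * B)" "r / (2 * B) - 1 \<le> real N"
  proof -
    have "0 \<le> r / (2 * B)" using assms by simp
    thus "real N \<le> r / (2 * B)" unfolding N_def by (rule of_nat_floor)
    show "r / (2 * B) - 1 \<le> real N" unfolding N_def by linarith
  qed
  have "fact N \<le> real N ^ N" using fact_le_power[of N, where 'a = real] by simp
  hence "B ^ N * fact N / r ^ N \<le> B ^ N * real N ^ N / r ^ N"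
    using assms by (intro divide_right_mono mult_left_mono) auto
  also have "\<dots> = (B * real N / r) ^ N" by (simp add: power_mult_distrib power_divide)
  also have "\<dots> \<le> (1 / 2) ^ N"
    using N(1) assms by (intro power_mono) (auto simp: field_simps)
  also have "(1 / 2 :: real) ^ N = exp (- (ln 2) * real N)"
    by (simp add: exp_minus exp_of_nat2_mult inverse_eq_divide power_divide)
  also have "\<dots> \<le> exp (- (ln 2) * (r / (2 * B) - 1))"
    using N(2) by (intro iffD2[OF exp_le_cancel_iff] mult_left_mono_neg) auto
  also have "\<dots> = 2 * exp (- (ln 2 / (2 * B)) * r)"
  proof -
    have "- (ln 2) * (r / (2 * B) - 1) = ln 2 + (- (ln 2 / (2 * B)) * r)" by (simp add: algebra_simps)
    thus ?thesis by (simp only: exp_add) simp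
  qed
  finally have "C * (B ^ N * fact N / r ^ N) \<le> C * (2 * exp (- (ln 2 / (2 * B)) * r))"
    using assms(4) by (rule mult_left_mono)
  thus ?thesis using x[of N] by (simp add: mult.assoc)
qed

text \<open>On a half-plane, decay faster than every exponential forces a holomorphic function to vanish;
  \<open>s \<mapsto> p log s\<close> with \<open>p > 1\<close> maps a half-plane into the strip, which has width greater than \<open>pi\<close>.\<close>

lemma watson_strip:
  fixes H :: "complex \<Rightarrow> complex"
  assumes \<epsilon>: "0 < \<epsilon>" "\<epsilon> \<le> pi / 4"
    and hol: "H holomorphic_on {w. \<bar>Im w\<bar> < pi / 2 + \<epsilon>}"
    and R: "R > 0" and C: "C \<ge> 0" and B: "B > 0"
    and bnd: "\<And>w N. \<bar>Im w\<bar> < pi / 2 + \<epsilon> \<Longrightarrow> exp (Re w) > R \<Longrightarrow> cmod (H w) \<le> C * B ^ N * fact N / exp (Re w) ^ N"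
    and w: "\<bar>Im w\<bar> < pi / 2 + \<epsilon>"
  shows "H w = 0"
proof -
  define St where "St = {w. \<bar>Im w\<bar> < pi / 2 + \<epsilon>}"
  have St: "St = {w. Im w < pi / 2 + \<epsilon>} \<inter> {w. Im w > - (pi / 2 + \<epsilon>)}" by (auto simp: St_def)
  have oSt: "open St" unfolding St by (intro open_Int open_halfspace_Im_lt open_halfspace_Im_gt)
  have cSt: "connected St" unfolding St
    by (intro convex_connected convex_Int convex_halfspace_Im_lt convex_halfspace_Im_gt)
  \<comment> \<open>The angle p \<pi>/2 = \<pi>/2 + \<epsilon>/2 still fits into the strip, while p
    > 1 makes exp(- a |s|^p) smaller than every exponential in |s|.\<close>
  define p where "p = 1 + \<epsilon> / pi"
  have p1: "p > 1" using \<epsilon> by (simp add: p_def)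
  define a where "a = ln 2 / (2 * B)"
  have a: "a > 0" using B by (simp add: a_def)
  have pSt: "of_real p * Ln s \<in> St" if "Re s > 0" for s
  proof -
    have "\<bar>Im (Ln s)\<bar> < pi / 2" using that by (rule Re_Ln_pos_lt_imp)
    hence "\<bar>p * Im (Ln s)\<bar> < p * (pi / 2)" using p1 by (simp add: abs_mult)
    also have "p * (pi / 2) \<le> pi / 2 + \<epsilon>" using \<epsilon> by (simp add: p_def field_simps)
    finally show ?thesis by (simp add: St_def)
  qed
  define K where "K s = H (of_real p * Ln s)" for s
  have Khol: "K holomorphic_on {s. Re s > 0}"
  proof -
    have "(\<lambda>s. of_real p * Ln s) holomorphic_on {s. Re s > 0}"
      by (intro holomorphic_intros) (auto simp: complex_nonpos_Reals_iff)
    moreover have "H holomorphic_on St" using hol by (simp add: St_def)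
    moreover have "(\<lambda>s. of_real p * Ln s) ` {s. Re s > 0} \<subseteq> St" by (rule image_subsetI) (use pSt in simp)
    ultimately show ?thesis unfolding K_def by (rule holomorphic_on_compose_gen[unfolded o_def])
  qed
  define \<sigma> where "\<sigma> = max 1 (R + 1)"
  have \<sigma>: "\<sigma> \<ge> 1" "\<sigma> > R" by (auto simp: \<sigma>_def)
  have Kb: "cmod (K s) \<le> 2 * C * exp (- a * cmod s powr p)" if s: "Re s \<ge> \<sigma>" for s
  proof -
    have s0: "Re s > 0" "s \<noteq> 0" using s \<sigma> by auto
    have c1: "cmod s \<ge> \<sigma>" using s complex_Re_le_cmod[of s] by linarith
    have e: "exp (Re (of_real p * Ln s)) = cmod s powr p" using s0 by (simp add: powr_def)
    have "cmod s powr 1 \<le> cmod s powr p" using c1 \<sigma> p1 by (intro powr_mono) auto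
    hence gt: "cmod s powr p > R" using c1 \<sigma> by simp
    have "cmod (K s) \<le> C * B ^ N * fact N / (cmod s powr p) ^ N" for N
      using bnd[of "of_real p * Ln s" N] pSt[OF s0(1)] gt unfolding K_def e St_def by simp
    thus ?thesis unfolding a_def using R gt B C by (intro gevrey_decay) auto
  qed
  have K0: "K s = 0" if s: "Re s > \<sigma>" for s
  proof -
    \<comment> \<open>The factor exp(M (s - \<sigma>)) has modulus 1 on the line Re s = \<sigma>,
      and on a large arc it is beaten by exp(- a r^p). The maximum principle on the region between
      them bounds K by 2 C exp(- M (Re s - \<sigma>)) for every M.\<close>
    have bound: "cmod (K s) \<le> 2 * C * exp (- M * (Re s - \<sigma>))" if M: "M > 0" for M
    proof -
      have "((\<lambda>r. exp (M * r) * exp (- a * r powr p)) \<longlongrightarrow> 0) at_top"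
        using p1 a M by real_asymp
      hence "eventually (\<lambda>r. exp (M * r) * exp (- a * r powr p) < 1) at_top"
        by (rule order_tendstoD) simp
      moreover have "eventually (\<lambda>r. r > cmod s) at_top" by (rule eventually_gt_at_top)
      ultimately obtain r where r: "exp (M * r) * exp (- a * r powr p) < 1" "r > cmod s"
        by (metis (mono_tags, lifting) eventually_conj eventually_happens trivial_limit_at_top_linorder)
      define S where "S = {z. Re z \<ge> \<sigma>} \<inter> cball 0 r"
      define \<Phi> where "\<Phi> z = exp (of_real M * (z - of_real \<sigma>)) * K z" for z
      have S0: "S \<subseteq> {z. Re z > 0}" using \<sigma> by (auto simp: S_def)
      have \<Phi>h: "\<Phi> holomorphic_on {z. Re z > 0}"
        unfolding \<Phi>_def by (intro holomorphic_intros Khol)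
      have closedS: "closed S" unfolding S_def by (intro closed_Int closed_halfspace_Re_ge closed_cball)
      have "cmod (\<Phi> s) \<le> 2 * C"
      proof (rule maximum_modulus_frontier[of \<Phi> S])
        show "\<Phi> holomorphic_on interior S" using \<Phi>h S0 interior_subset by (metis holomorphic_on_subset)
        show "continuous_on (closure S) \<Phi>"
          using holomorphic_on_imp_continuous_on[OF \<Phi>h] S0 closedS by (metis closure_closed continuous_on_subset)
        show "bounded S" unfolding S_def by (intro bounded_Int) auto
        show "s \<in> S" using s r by (simp add: S_def)
        fix z assume z: "z \<in> frontier S"
        have zS: "z \<in> S" using z closedS by (metis frontier_subset_closed subsetD)
        have zfr: "Re z = \<sigma> \<or> cmod z = r"
        proof (rule ccontr)
          assume "\<not> (Re z = \<sigma> \<or> cmod z = r)"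
          hence "z \<in> {z. Re z > \<sigma>} \<inter> ball 0 r" using zS by (auto simp: S_def)
          moreover have "open ({z. Re z > \<sigma>} \<inter> ball 0 r)" by (intro open_Int open_halfspace_Re_gt open_ball)
          moreover have "{z. Re z > \<sigma>} \<inter> ball 0 r \<subseteq> S" by (auto simp: S_def)
          ultimately have "z \<in> interior S" by (meson interior_maximal subsetD)
          thus False using z by (simp add: frontier_def)
        qed
        have Rez: "Re z \<ge> \<sigma>" using zS by (simp add: S_def)
        have n\<Phi>: "cmod (\<Phi> z) = exp (M * (Re z - \<sigma>)) * cmod (K z)" by (simp add: \<Phi>_def norm_mult)
        show "cmod (\<Phi> z) \<le> 2 * C"
        proof (cases "Re z = \<sigma>")
          case True
          have "exp (- a * cmod z powr p) \<le> 1" using a by simp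
          hence "2 * C * exp (- a * cmod z powr p) \<le> 2 * C * 1" using C by (intro mult_left_mono) auto
          thus ?thesis using Kb[OF Rez] by (simp add: n\<Phi> True)
        next
          case False
          hence zr: "cmod z = r" using zfr by simp
          have "M * (Re z - \<sigma>) \<le> M * r"
            using M \<sigma> complex_Re_le_cmod[of z] zr by (intro mult_left_mono) auto
          hence "cmod (\<Phi> z) \<le> exp (M * r) * (2 * C * exp (- a * r powr p))"
            unfolding n\<Phi> using Kb[OF Rez] zr by (intro mult_mono) auto
          also have "\<dots> = 2 * C * (exp (M * r) * exp (- a * r powr p))" by simp
          also have "\<dots> \<le> 2 * C * 1" using r(1) C by (intro mult_left_mono) auto
          finally show ?thesis by simp
        qed
      qed
      hence "exp (M * (Re s - \<sigma>)) * cmod (K s) \<le> 2 * C" by (simp add: \<Phi>_def norm_mult)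
      hence "cmod (K s) \<le> 2 * C / exp (M * (Re s - \<sigma>))" by (simp add: pos_le_divide_eq mult.commute)
      thus ?thesis by (simp add: exp_minus divide_inverse del: minus_mult_left)
    qed
    have "((\<lambda>M. 2 * C * exp (- M * (Re s - \<sigma>))) \<longlongrightarrow> 0) at_top"
      using s by real_asymp
    hence "cmod (K s) \<le> 0"
      by (rule tendsto_lowerbound) (use bound in \<open>auto intro: eventually_mono[OF eventually_gt_at_top[of 0]]\<close>)
    thus ?thesis by simp
  qed
  \<comment> \<open>An open part of the strip in the image of the half-plane Re s > \<sigma>, where
    the vanishing is already known; the identity theorem extends it to the whole strip.\<close>
  define U where "U = {w. \<bar>Im w\<bar> < pi / 2 \<and> Re (exp (w / of_real p)) > \<sigma>}"
  have U: "U = {w. Im w < pi / 2} \<inter> {w. Im w > - (pi / 2)} \<inter> {w. Re (exp (w / of_real p)) > \<sigma>}"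
    by (auto simp: U_def)
  have oU: "open U" unfolding U
    by (intro open_Int open_halfspace_Im_lt open_halfspace_Im_gt open_Collect_less continuous_intros)
       (use p1 in auto)
  have UH: "H z = 0" if "z \<in> U" for z
  proof -
    have "\<bar>Im (z / of_real p)\<bar> < pi"
    proof -
      have "\<bar>Im z\<bar> / p \<le> \<bar>Im z\<bar>" using p1 using mult_right_mono[of 1 p "\<bar>Im z\<bar>"] by (simp add: field_simps)
      moreover have "\<bar>Im z\<bar> < pi / 2" using that by (simp add: U_def)
      moreover have "\<bar>Im (z / of_real p)\<bar> = \<bar>Im z\<bar> / p" using p1 by simp
      ultimately show ?thesis using pi_gt_zero by linarith
    qed
    hence "- pi < Im (z / of_real p)" "Im (z / of_real p) \<le> pi" by linarith+
    hence "Ln (exp (z / of_real p)) = z / of_real p" by (rule Ln_exp)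
    hence "K (exp (z / of_real p)) = H z" using p1 by (simp add: K_def)
    thus ?thesis using K0[of "exp (z / of_real p)"] that by (simp add: U_def)
  qed
  define x :: complex where "x = of_real (p * ln (\<sigma> + 1))"
  have "x / of_real p = of_real (ln (\<sigma> + 1))" using p1 by (simp add: x_def)
  hence "exp (x / of_real p) = of_real (\<sigma> + 1)" using \<sigma> by (simp only: exp_of_real) simp
  hence "x \<in> U" by (simp add: U_def x_def)
  moreover have "U \<subseteq> St" using \<epsilon> by (auto simp: U_def St_def)
  moreover have "w \<in> St" using w by (simp add: St_def)
  ultimately show ?thesis
    using analytic_continuation_open[of U St H "\<lambda>_. 0" w] oU oSt cSt hol UH by (auto simp: St_def)
qed

text \<open>A single B replaces the two constants of \<open>is_Ramis_sum\<close>, so that two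
  expansions are brought to common parameters by maxima and minima.\<close>

definition gevrey_on :: "complex fps \<Rightarrow> real \<Rightarrow> (complex \<Rightarrow> complex) \<Rightarrow> real \<Rightarrow> real \<Rightarrow> real \<Rightarrow> bool" where
  "gevrey_on f \<theta> F \<epsilon> R B \<longleftrightarrow> (\<lambda>z. F (1 / z)) holomorphic_on large_sector \<theta> \<epsilon> \<and>
     (\<forall>z\<in>large_sector \<theta> \<epsilon>. cmod z > R \<longrightarrow>
        (\<forall>N. cmod (F (1 / z) - (\<Sum>k<N. fps_nth f k / z ^ k)) \<le> B * B ^ N * fact N / cmod z ^ N))"

lemma is_Ramis_sumI:
  assumes "\<epsilon> > 0" "R > 0" "B > 0" "gevrey_on f \<theta> F \<epsilon> R B"
  shows "is_Ramis_sum f \<theta> F"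
  unfolding is_Ramis_sum_def using assms(4) unfolding gevrey_on_def
  by (intro exI[of _ \<epsilon>] exI[of _ R] exI[of _ B] conjI assms(1-3)) auto

lemma gevrey_on_mono:
  assumes "gevrey_on f \<theta> F \<epsilon> R B" "\<epsilon>' \<le> \<epsilon>" "R \<le> R'" "B \<le> B'" "0 \<le> B" "0 \<le> R"
  shows "gevrey_on f \<theta> F \<epsilon>' R' B'"
  unfolding gevrey_on_def
proof (intro conjI ballI impI allI)
  show "(\<lambda>z. F (1 / z)) holomorphic_on large_sector \<theta> \<epsilon>'"
    using assms large_sector_mono unfolding gevrey_on_def by (metis holomorphic_on_subset)
  fix z N assume z: "z \<in> large_sector \<theta> \<epsilon>'" "R' < cmod z"
  have "cmod (F (1 / z) - (\<Sum>k<N. fps_nth f k / z ^ k)) \<le> B * B ^ N * fact N / cmod z ^ N"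
  proof -
    have "z \<in> large_sector \<theta> \<epsilon>" using z(1) large_sector_mono[OF assms(2)] by blast
    moreover have "cmod z > R" using z(2) assms(3) by simp
    ultimately show ?thesis using assms(1) unfolding gevrey_on_def by blast
  qed
  also have "\<dots> \<le> B' * B' ^ N * fact N / cmod z ^ N"
    using assms by (intro divide_right_mono mult_right_mono mult_mono power_mono) auto
  finally show "cmod (F (1 / z) - (\<Sum>k<N. fps_nth f k / z ^ k)) \<le> B' * B' ^ N * fact N / cmod z ^ N" .
qed

lemma is_Ramis_sumE:
  assumes "is_Ramis_sum f \<theta> F"
  obtains \<epsilon> R B where "0 < \<epsilon>" "\<epsilon> \<le> pi / 4" "R \<ge> 1" "B \<ge> 1" "gevrey_on f \<theta> F \<epsilon> R B"
proof -
  obtain \<epsilon> R C B where e: "\<epsilon> > 0" "R > 0" "C > 0" "B > 0"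
    and hol: "(\<lambda>z. F (1 / z)) holomorphic_on large_sector \<theta> \<epsilon>"
    and b: "\<forall>z\<in>large_sector \<theta> \<epsilon>. cmod z > R \<longrightarrow>
           (\<forall>N. cmod (F (1 / z) - (\<Sum>k<N. fps_nth f k / z ^ k)) \<le> C * B ^ N * fact N / cmod z ^ N)"
    using assms unfolding is_Ramis_sum_def by blast
  define A where "A = max C (max B 1)"
  have "gevrey_on f \<theta> F \<epsilon> R A"
    unfolding gevrey_on_def
  proof (intro conjI hol ballI impI allI)
    fix z N assume "z \<in> large_sector \<theta> \<epsilon>" "cmod z > R"
    hence "cmod (F (1 / z) - (\<Sum>k<N. fps_nth f k / z ^ k)) \<le> C * B ^ N * fact N / cmod z ^ N" using b by blast
    also have "\<dots> \<le> A * A ^ N * fact N / cmod z ^ N"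
      using e by (intro divide_right_mono mult_right_mono mult_mono power_mono) (auto simp: A_def)
    finally show "cmod (F (1 / z) - (\<Sum>k<N. fps_nth f k / z ^ k)) \<le> A * A ^ N * fact N / cmod z ^ N" .
  qed
  hence "gevrey_on f \<theta> F (min \<epsilon> (pi / 4)) (max R 1) A"
    by (rule gevrey_on_mono) (use e in \<open>auto simp: A_def\<close>)
  thus ?thesis using that[of "min \<epsilon> (pi / 4)" "max R 1" A] e by (simp add: A_def)
qed

lemma is_Ramis_sum_commonE:
  assumes "is_Ramis_sum f \<theta> F" "is_Ramis_sum g \<theta> G"
  obtains \<epsilon> R B where "0 < \<epsilon>" "\<epsilon> \<le> pi / 4" "R \<ge> 1" "B \<ge> 1" "gevrey_on f \<theta> F \<epsilon> R B" "gevrey_on g \<theta> G \<epsilon> R B"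
proof -
  obtain \<epsilon>1 R1 B1 where 1: "0 < \<epsilon>1" "\<epsilon>1 \<le> pi / 4" "R1 \<ge> 1" "B1 \<ge> 1" "gevrey_on f \<theta> F \<epsilon>1 R1 B1"
    using is_Ramis_sumE[OF assms(1)] by blast
  obtain \<epsilon>2 R2 B2 where 2: "0 < \<epsilon>2" "\<epsilon>2 \<le> pi / 4" "R2 \<ge> 1" "B2 \<ge> 1" "gevrey_on g \<theta> G \<epsilon>2 R2 B2"
    using is_Ramis_sumE[OF assms(2)] by blast
  show ?thesis
  proof (rule that[of "min \<epsilon>1 \<epsilon>2" "max R1 R2" "max B1 B2"])
    show "gevrey_on f \<theta> F (min \<epsilon>1 \<epsilon>2) (max R1 R2) (max B1 B2)"
      by (rule gevrey_on_mono[OF 1(5)]) (use 1 2 in auto)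
    show "gevrey_on g \<theta> G (min \<epsilon>1 \<epsilon>2) (max R1 R2) (max B1 B2)"
      by (rule gevrey_on_mono[OF 2(5)]) (use 1 2 in auto)
  qed (use 1 2 in auto)
qed

text \<open>Watson's lemma for the difference of two sums, which is asymptotic to 0; the coordinate
  w with z = \<open>cis \<theta> * exp w\<close> maps the sector to a strip.\<close>

lemma is_Ramis_sum_unique:
  assumes F: "is_Ramis_sum f \<theta> F" and G: "is_Ramis_sum f \<theta> G"
    and z: "z \<noteq> 0" "\<bar>Arg (z * cis (- \<theta>))\<bar> < pi / 2"
  shows "F (1 / z) = G (1 / z)"
proof -
  obtain \<epsilon> R B where e: "0 < \<epsilon>" "\<epsilon> \<le> pi / 4" "R \<ge> 1" "B \<ge> 1" and gF: "gevrey_on f \<theta> F \<epsilon> R B"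
    and gG: "gevrey_on f \<theta> G \<epsilon> R B"
    using is_Ramis_sum_commonE[OF F G] by blast
  define H where "H w = F (1 / (cis \<theta> * exp w)) - G (1 / (cis \<theta> * exp w))" for w
  have hol: "H holomorphic_on {w. \<bar>Im w\<bar> < pi / 2 + \<epsilon>}"
  proof -
    have h: "(\<lambda>w. X (1 / (cis \<theta> * exp w))) holomorphic_on {w. \<bar>Im w\<bar> < pi / 2 + \<epsilon>}"
      if "(\<lambda>z. X (1 / z)) holomorphic_on large_sector \<theta> \<epsilon>" for X
    proof -
      have "(\<lambda>w. cis \<theta> * exp w) holomorphic_on {w. \<bar>Im w\<bar> < pi / 2 + \<epsilon>}" by (intro holomorphic_intros)
      thus ?thesis
        by (rule holomorphic_on_compose_gen[OF _ that, unfolded o_def]) (use large_sector_exp e in auto)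
    qed
    show ?thesis unfolding H_def using gF gG unfolding gevrey_on_def by (intro holomorphic_on_diff h) auto
  qed
  have "z \<in> large_sector \<theta> \<epsilon>" using z e by (auto simp: large_sector_def)
  then obtain w where w: "z = cis \<theta> * exp w" "\<bar>Im w\<bar> < pi / 2 + \<epsilon>" by (rule large_sector_imp_exp)
  have "H w = 0"
  proof (rule watson_strip[OF e(1,2) hol, of R "2 * B" B])
    fix w N assume w: "\<bar>Im w\<bar> < pi / 2 + \<epsilon>" "exp (Re w) > R"
    define x where "x = cis \<theta> * exp w"
    have x: "x \<in> large_sector \<theta> \<epsilon>" unfolding x_def using large_sector_exp w e by blast
    have cx: "cmod x = exp (Re w)" by (simp add: x_def norm_mult)
    have 1: "cmod (F (1 / x) - (\<Sum>k<N. fps_nth f k / x ^ k)) \<le> B * B ^ N * fact N / cmod x ^ N"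
      using gF x w(2) unfolding gevrey_on_def cx[symmetric] by blast
    have 2: "cmod (G (1 / x) - (\<Sum>k<N. fps_nth f k / x ^ k)) \<le> B * B ^ N * fact N / cmod x ^ N"
      using gG x w(2) unfolding gevrey_on_def cx[symmetric] by blast
    have "cmod (H w) = cmod ((F (1 / x) - (\<Sum>k<N. fps_nth f k / x ^ k)) - (G (1 / x) - (\<Sum>k<N. fps_nth f k / x ^ k)))"
      by (simp add: H_def x_def)
    also have "\<dots> \<le> B * B ^ N * fact N / cmod x ^ N + B * B ^ N * fact N / cmod x ^ N"
      by (rule order_trans[OF norm_triangle_ineq4 add_mono[OF 1 2]])
    finally show "cmod (H w) \<le> 2 * B * B ^ N * fact N / exp (Re w) ^ N" by (simp add: cx mult_ac)
  qed (use e w in auto)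
  thus ?thesis by (simp add: H_def w(1))
qed

text \<open>The coefficient is z^k times the difference of two consecutive remainders, taken at one
  point z of modulus R + 1 in the sector.\<close>

lemma gevrey_coeff_bound:
  assumes g: "gevrey_on f \<theta> F \<epsilon> R B" and e: "0 < \<epsilon>" "R \<ge> 1" "B \<ge> 1"
  shows "cmod (fps_nth f k) \<le> 2 * B * B * (2 * B) ^ k * fact k"
proof -
  define r where "r = R + 1"
  define z where "z = of_real r * cis \<theta>"
  have r: "r \<ge> 1" "r > R" using e by (auto simp: r_def)
  have "z * cis (- \<theta>) = of_real r" by (simp add: z_def mult.assoc cis_mult)
  moreover have "Arg (of_real r) = 0" using r by (simp add: Arg_of_real)
  moreover have z0: "cmod z = r" "z \<noteq> 0" using r by (auto simp: z_def norm_mult)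
  ultimately have "z \<in> large_sector \<theta> \<epsilon>"
    using e(1) r pi_gt_zero unfolding large_sector_def mem_Collect_eq by (simp only: abs_zero) (simp add: add_pos_pos)
  note z = this z0
  define \<rho> where "\<rho> N = F (1 / z) - (\<Sum>k<N. fps_nth f k / z ^ k)" for N
  have \<rho>: "cmod (\<rho> N) \<le> B * B ^ N * fact N / r ^ N" for N
    using g z r unfolding gevrey_on_def \<rho>_def by auto
  have "fps_nth f k = z ^ k * (\<rho> k - \<rho> (Suc k))" using z by (simp add: \<rho>_def)
  hence "cmod (fps_nth f k) = r ^ k * cmod (\<rho> k - \<rho> (Suc k))" using z by (simp add: norm_mult norm_power)
  also have "cmod (\<rho> k - \<rho> (Suc k)) \<le> B * B ^ k * fact k / r ^ k + B * B ^ Suc k * fact (Suc k) / r ^ Suc k"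
    by (rule order_trans[OF norm_triangle_ineq4 add_mono[OF \<rho> \<rho>]])
  also have "B * B ^ Suc k * fact (Suc k) / r ^ Suc k \<le> B * B ^ Suc k * fact (Suc k) / r ^ k"
    using r e by (intro divide_left_mono power_increasing) auto
  also have "r ^ k * (B * B ^ k * fact k / r ^ k + B * B ^ Suc k * fact (Suc k) / r ^ k) = B * B ^ k * fact k * (1 + B * real (Suc k))"
    using r by (simp add: field_simps)
  also have "1 + B * real (Suc k) \<le> 2 * B * 2 ^ k"
  proof -
    have "Suc k \<le> 2 ^ k" using less_exp[of k] by (simp only: Suc_le_eq)
    hence "real (Suc k) \<le> 2 ^ k" by (metis of_nat_le_iff of_nat_numeral of_nat_power)
    hence "B * real (Suc k) \<le> B * 2 ^ k" using e by (intro mult_left_mono) auto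
    moreover have "1 \<le> B * 2 ^ k" using e by (metis mult_mono' one_le_numeral one_le_power mult_1 zero_le_one)
    ultimately show ?thesis by simp
  qed
  finally have "cmod (fps_nth f k) \<le> B * B ^ k * fact k * (2 * B * 2 ^ k)"
    using e r by (simp add: mult_left_mono)
  thus ?thesis by (simp add: power_mult_distrib mult_ac)
qed

section \<open>Sums, products and rescaling of 1-sums\<close>

lemma is_Ramis_sum_add:
  assumes "is_Ramis_sum f \<theta> F" "is_Ramis_sum g \<theta> G"
  shows "is_Ramis_sum (f + g) \<theta> (\<lambda>z. F z + G z)"
proof -
  obtain \<epsilon> R B where e: "0 < \<epsilon>" "\<epsilon> \<le> pi / 4" "R \<ge> 1" "B \<ge> 1" and gF: "gevrey_on f \<theta> F \<epsilon> R B"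
    and gG: "gevrey_on g \<theta> G \<epsilon> R B"
    using is_Ramis_sum_commonE[OF assms] by blast
  have "gevrey_on (f + g) \<theta> (\<lambda>z. F z + G z) \<epsilon> R (2 * B)"
    unfolding gevrey_on_def
  proof (intro conjI ballI impI allI)
    show "(\<lambda>z. F (1 / z) + G (1 / z)) holomorphic_on large_sector \<theta> \<epsilon>"
      using gF gG unfolding gevrey_on_def by (intro holomorphic_on_add) auto
    fix z N assume z: "z \<in> large_sector \<theta> \<epsilon>" "R < cmod z"
    have 1: "cmod (F (1 / z) - (\<Sum>k<N. fps_nth f k / z ^ k)) \<le> B * B ^ N * fact N / cmod z ^ N"
      using gF z unfolding gevrey_on_def by blast
    have 2: "cmod (G (1 / z) - (\<Sum>k<N. fps_nth g k / z ^ k)) \<le> B * B ^ N * fact N / cmod z ^ N"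
      using gG z unfolding gevrey_on_def by blast
    have "cmod (F (1 / z) + G (1 / z) - (\<Sum>k<N. fps_nth (f + g) k / z ^ k)) =
       cmod ((F (1 / z) - (\<Sum>k<N. fps_nth f k / z ^ k)) + (G (1 / z) - (\<Sum>k<N. fps_nth g k / z ^ k)))"
      by (simp add: add_divide_distrib sum.distrib algebra_simps)
    also have "\<dots> \<le> B * B ^ N * fact N / cmod z ^ N + B * B ^ N * fact N / cmod z ^ N"
      by (rule order_trans[OF norm_triangle_ineq add_mono[OF 1 2]])
    also have "\<dots> = 2 * B * B ^ N * fact N / cmod z ^ N" by simp
    also have "\<dots> \<le> 2 * B * (2 * B) ^ N * fact N / cmod z ^ N"
      using e by (intro divide_right_mono mult_right_mono mult_left_mono power_mono) auto
    finally show "cmod (F (1 / z) + G (1 / z) - (\<Sum>k<N. fps_nth (f + g) k / z ^ k)) \<le> 2 * B * (2 * B) ^ N * fact N / cmod z ^ N" .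
  qed
  thus ?thesis using e by (intro is_Ramis_sumI[of \<epsilon> R "2 * B"]) auto
qed

text \<open>The N-th remainder of the product is \<rho>f_N G plus the sum over i < N of f_i z^(-i)
  \<rho>g_(N - i). Each of the N terms carries i! (N - i)! \<le> N!, and the factor N is absorbed by
  2^N.\<close>

lemma is_Ramis_sum_mult:
  assumes "is_Ramis_sum f \<theta> F" "is_Ramis_sum g \<theta> G"
  shows "is_Ramis_sum (f * g) \<theta> (\<lambda>z. F z * G z)"
proof -
  obtain \<epsilon> R B where e: "0 < \<epsilon>" "\<epsilon> \<le> pi / 4" "R \<ge> 1" "B \<ge> 1" and gF: "gevrey_on f \<theta> F \<epsilon> R B"
    and gG: "gevrey_on g \<theta> G \<epsilon> R B"
    using is_Ramis_sum_commonE[OF assms] by blast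
  define A where "A = 4 * B * B * B"
  have BA: "4 * B \<le> A" "2 * B * B * B + B * B \<le> A"
  proof -
    have b2: "1 \<le> B * B" using mult_mono[of 1 B 1 B] e by simp
    show "4 * B \<le> A" unfolding A_def using mult_left_mono[OF b2, of "4 * B"] e by (simp add: mult_ac)
    have "B * B * 1 \<le> B * B * B" using e by (intro mult_left_mono) auto
    thus "2 * B * B * B + B * B \<le> A" unfolding A_def using e by simp
  qed
  have "gevrey_on (f * g) \<theta> (\<lambda>z. F z * G z) \<epsilon> R A"
    unfolding gevrey_on_def
  proof (intro conjI ballI impI allI)
    show "(\<lambda>z. F (1 / z) * G (1 / z)) holomorphic_on large_sector \<theta> \<epsilon>"
      using gF gG unfolding gevrey_on_def by (intro holomorphic_on_mult) auto
    fix z N assume z: "z \<in> large_sector \<theta> \<epsilon>" "R < cmod z"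
    have z0: "z \<noteq> 0" using z e by auto
    define r where "r = cmod z"
    have r: "r > 0" using z0 by (simp add: r_def)
    define \<rho>f \<rho>g where "\<rho>f N = F (1 / z) - (\<Sum>k<N. fps_nth f k / z ^ k)"
      and "\<rho>g N = G (1 / z) - (\<Sum>k<N. fps_nth g k / z ^ k)" for N
    have \<rho>f: "cmod (\<rho>f N) \<le> B * B ^ N * fact N / r ^ N" and \<rho>g: "cmod (\<rho>g N) \<le> B * B ^ N * fact N / r ^ N" for N
      using gF gG z unfolding gevrey_on_def \<rho>f_def \<rho>g_def r_def by auto
    have G0: "cmod (G (1 / z)) \<le> B" using \<rho>g[of 0] by (simp add: \<rho>g_def)
    have "(\<Sum>k<N. fps_nth (f * g) k / z ^ k) = (\<Sum>k<N. \<Sum>i\<le>k. (fps_nth f i / z ^ i) * (fps_nth g (k - i) / z ^ (k - i)))"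
    proof (rule sum.cong)
      fix k
      have "fps_nth (f * g) k / z ^ k = (\<Sum>i\<le>k. fps_nth f i * fps_nth g (k - i) / z ^ k)"
        by (simp add: fps_mult_nth atLeast0AtMost sum_divide_distrib)
      also have "\<dots> = (\<Sum>i\<le>k. (fps_nth f i / z ^ i) * (fps_nth g (k - i) / z ^ (k - i)))"
        by (intro sum.cong) (auto simp: power_add[symmetric])
      finally show "fps_nth (f * g) k / z ^ k = \<dots>" .
    qed simp
    also have "\<dots> = (\<Sum>(i, j)\<in>{(i, j). i + j < N}. (fps_nth f i / z ^ i) * (fps_nth g j / z ^ j))"
      by (rule sum.triangle_reindex[symmetric])
    also have "{(i, j). i + j < N} = Sigma {..<N} (\<lambda>i. {..<N - i})" by auto
    also have "(\<Sum>(i, j)\<in>Sigma {..<N} (\<lambda>i. {..<N - i}). (fps_nth f i / z ^ i) * (fps_nth g j / z ^ j)) =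
      (\<Sum>i<N. \<Sum>j<N - i. (fps_nth f i / z ^ i) * (fps_nth g j / z ^ j))"
      by (rule sum.Sigma[symmetric]) auto
    also have "\<dots> = (\<Sum>i<N. (fps_nth f i / z ^ i) * (G (1 / z) - \<rho>g (N - i)))"
      by (simp add: \<rho>g_def sum_distrib_left)
    also have "\<dots> = (F (1 / z) - \<rho>f N) * G (1 / z) - (\<Sum>i<N. (fps_nth f i / z ^ i) * \<rho>g (N - i))"
      by (simp add: \<rho>f_def right_diff_distrib sum_subtractf sum_distrib_right)
    finally have "F (1 / z) * G (1 / z) - (\<Sum>k<N. fps_nth (f * g) k / z ^ k) =
      \<rho>f N * G (1 / z) + (\<Sum>i<N. (fps_nth f i / z ^ i) * \<rho>g (N - i))" by (simp add: algebra_simps)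
    hence "cmod (F (1 / z) * G (1 / z) - (\<Sum>k<N. fps_nth (f * g) k / z ^ k)) \<le>
      cmod (\<rho>f N * G (1 / z)) + cmod (\<Sum>i<N. (fps_nth f i / z ^ i) * \<rho>g (N - i))"
      by (simp only: norm_triangle_ineq)
    also have "\<dots> \<le> cmod (\<rho>f N) * cmod (G (1 / z)) + (\<Sum>i<N. cmod (fps_nth f i) / r ^ i * cmod (\<rho>g (N - i)))"
    proof (rule add_mono)
      show "cmod (\<Sum>i<N. (fps_nth f i / z ^ i) * \<rho>g (N - i)) \<le> (\<Sum>i<N. cmod (fps_nth f i) / r ^ i * cmod (\<rho>g (N - i)))"
        by (rule order_trans[OF norm_sum]) (simp add: norm_mult norm_divide norm_power r_def)
    qed (simp add: norm_mult)
    also have "\<dots> \<le> B * B ^ N * fact N / r ^ N * B + (\<Sum>i<N. 2 * B * B * B * (2 * B) ^ N * fact N / r ^ N)"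
    proof (intro add_mono sum_mono mult_mono \<rho>f G0)
      fix i assume i: "i \<in> {..<N}"
      have "cmod (fps_nth f i) / r ^ i * cmod (\<rho>g (N - i)) \<le>
        (2 * B * B * (2 * B) ^ i * fact i) / r ^ i * (B * B ^ (N - i) * fact (N - i) / r ^ (N - i))"
        using r e by (intro mult_mono divide_right_mono gevrey_coeff_bound[OF gF] \<rho>g) auto
      also have "\<dots> = 2 * B * B * B * ((2 * B) ^ i * B ^ (N - i)) * (fact i * fact (N - i)) / r ^ N"
        using i by (simp add: power_add[symmetric])
      also have "\<dots> \<le> 2 * B * B * B * (2 * B) ^ N * fact N / r ^ N"
      proof -
        have "B ^ (N - i) \<le> (2 * B) ^ (N - i)" using e by (intro power_mono) auto
        hence "(2 * B) ^ i * B ^ (N - i) \<le> (2 * B) ^ i * (2 * B) ^ (N - i)" using e by (intro mult_left_mono) auto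
        also have "\<dots> = (2 * B) ^ N" using i by (simp only: power_add[symmetric]) simp
        finally have 1: "(2 * B) ^ i * B ^ (N - i) \<le> (2 * B) ^ N" .
        have "fact i * fact (N - i) dvd (fact (i + (N - i)) :: nat)" by (rule fact_fact_dvd_fact)
        hence "fact i * fact (N - i) \<le> (fact (i + (N - i)) :: nat)" by (rule dvd_imp_le) simp
        hence "real (fact i * fact (N - i)) \<le> real (fact (i + (N - i)))" by (rule of_nat_mono)
        moreover have "i + (N - i) = N" using i by simp
        ultimately have 2: "fact i * fact (N - i) \<le> (fact N :: real)" by (simp only: of_nat_mult of_nat_fact)
        show ?thesis using e r by (intro divide_right_mono mult_mono mult_left_mono 1 2) auto
      qed
      finally show "cmod (fps_nth f i) / r ^ i * cmod (\<rho>g (N - i)) \<le> 2 * B * B * B * (2 * B) ^ N * fact N / r ^ N" .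
    qed (use e r in auto)
    also have "\<dots> = (B * B * B ^ N + 2 * B * B * B * (real N * (2 * B) ^ N)) * fact N / r ^ N"
      by (simp add: add_divide_distrib algebra_simps)
    also have "\<dots> \<le> (B * B * (4 * B) ^ N + 2 * B * B * B * (4 * B) ^ N) * fact N / r ^ N"
    proof -
      have 1: "B ^ N \<le> (4 * B) ^ N" using e by (intro power_mono) auto
      have "N < 2 ^ N" by (rule less_exp)
      hence "real N \<le> real (2 ^ N)" by (intro of_nat_mono less_imp_le)
      hence "real N \<le> 2 ^ N" by simp
      hence "real N * (2 * B) ^ N \<le> 2 ^ N * (2 * B) ^ N" using e by (intro mult_right_mono) auto
      also have "\<dots> = (4 * B) ^ N" by (simp only: power_mult_distrib[symmetric]) simp
      finally have 2: "real N * (2 * B) ^ N \<le> (4 * B) ^ N" .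
      show ?thesis using e r by (intro divide_right_mono mult_right_mono add_mono mult_left_mono 1 2) auto
    qed
    also have "\<dots> = (2 * B * B * B + B * B) * (4 * B) ^ N * fact N / r ^ N" by (simp add: algebra_simps)
    also have "\<dots> \<le> A * A ^ N * fact N / r ^ N"
      using e r BA by (intro divide_right_mono mult_right_mono mult_mono power_mono) auto
    finally show "cmod (F (1 / z) * G (1 / z) - (\<Sum>k<N. fps_nth (f * g) k / z ^ k)) \<le> A * A ^ N * fact N / cmod z ^ N"
      by (simp add: r_def)
  qed
  moreover have "A > 0" using e by (simp add: A_def)
  ultimately show ?thesis using e by (intro is_Ramis_sumI[of \<epsilon> R A]) auto
qed

lemma is_Ramis_sum_const: "is_Ramis_sum (fps_const a) \<theta> (\<lambda>_. a)"
proof -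
  have s: "(\<Sum>k<N. fps_nth (fps_const a) k / z ^ k) = (if N = 0 then 0 else a)" for N and z :: complex
    by (induction N) auto
  have "gevrey_on (fps_const a) \<theta> (\<lambda>_. a) 1 1 (cmod a + 1)"
    unfolding gevrey_on_def s by auto
  thus ?thesis by (intro is_Ramis_sumI[of 1 1 "cmod a + 1"]) (auto intro: add_nonneg_pos)
qed

lemma is_Ramis_sum_X: "is_Ramis_sum fps_X \<theta> (\<lambda>z. z)"
proof -
  have s: "(\<Sum>k<N. fps_nth fps_X k / z ^ k) = (if N \<le> 1 then 0 else 1 / z)" for N and z :: complex
    by (induction N) (auto simp: fps_X_def le_Suc_eq)
  have "gevrey_on fps_X \<theta> (\<lambda>z. z) 1 1 1"
    unfolding gevrey_on_def s
  proof (intro conjI ballI impI allI)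
    show "(\<lambda>z. 1 / z) holomorphic_on large_sector \<theta> 1"
      by (intro holomorphic_intros) (auto simp: large_sector_def)
    fix z :: complex and N assume z: "1 < cmod z"
    show "cmod (1 / z - (if N \<le> 1 then 0 else 1 / z)) \<le> 1 * 1 ^ N * fact N / cmod z ^ N"
      using z by (cases N) (auto simp: norm_divide le_Suc_eq divide_le_eq_1)
  qed
  thus ?thesis by (intro is_Ramis_sumI[of 1 1 1]) auto
qed

lemma is_Ramis_sum_sum:
  "(\<And>i. i \<in> A \<Longrightarrow> is_Ramis_sum (f i) \<theta> (F i)) \<Longrightarrow> is_Ramis_sum (\<Sum>i\<in>A. f i) \<theta> (\<lambda>z. \<Sum>i\<in>A. F i z)"
  using is_Ramis_sum_const[of 0 \<theta>]
  by (induction A rule: infinite_finite_induct) (auto intro: is_Ramis_sum_add)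

lemma is_Ramis_sum_power:
  "is_Ramis_sum f \<theta> F \<Longrightarrow> is_Ramis_sum (f ^ n) \<theta> (\<lambda>z. F z ^ n)"
  using is_Ramis_sum_const[of 1 \<theta>] by (induction n) (auto intro: is_Ramis_sum_mult)

lemma is_Ramis_sum_prod:
  "(\<And>i. i \<in> A \<Longrightarrow> is_Ramis_sum (f i) \<theta> (F i)) \<Longrightarrow> is_Ramis_sum (\<Prod>i\<in>A. f i) \<theta> (\<lambda>z. \<Prod>i\<in>A. F i z)"
  using is_Ramis_sum_const[of 1 \<theta>]
  by (induction A rule: infinite_finite_induct) (auto intro: is_Ramis_sum_mult)

lemma is_Ramis_sum_poly: "is_Ramis_sum (fps_of_poly p) \<theta> (poly p)"
proof (induction p)
  case 0
  thus ?case using is_Ramis_sum_const[of 0 \<theta>] by simp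
next
  case (pCons a p)
  have "is_Ramis_sum (fps_const a + fps_of_poly p * fps_X) \<theta> (\<lambda>z. a + poly p z * z)"
    by (intro is_Ramis_sum_add is_Ramis_sum_mult is_Ramis_sum_const is_Ramis_sum_X pCons)
  moreover have "(\<lambda>z. a + poly p z * z) = poly (pCons a p)" by (rule ext) simp
  ultimately show ?case by (simp only: fps_of_poly_pCons)
qed

lemma Ramis_sum_is_Ramis_sum: "\<not> anti_Stokes f \<theta> \<Longrightarrow> is_Ramis_sum f \<theta> (Ramis_sum f \<theta>)"
  unfolding anti_Stokes_def Ramis_sum_def by (metis someI_ex)

lemma Ramis_sum_eq:
  assumes "is_Ramis_sum f \<theta> F" "z \<noteq> 0" "\<bar>Arg (z * cis (- \<theta>))\<bar> < pi / 2"
  shows "Ramis_sum f \<theta> (1 / z) = F (1 / z)"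
  using is_Ramis_sum_unique[OF _ assms] assms(1) by (metis Ramis_sum_def someI_ex)

lemma Arg_mult_cis:
  assumes "\<xi> \<noteq> 0" "z \<noteq> 0"
  shows "Arg (\<xi> * z * cis (- \<theta>)) = Arg (z * cis (- (\<theta> - Arg \<xi>)))"
proof -
  have "\<xi> = of_real (cmod \<xi>) * cis (Arg \<xi>)" by (metis rcis_cmod_Arg rcis_def)
  hence "\<xi> * z * cis (- \<theta>) = of_real (cmod \<xi>) * (z * (cis (Arg \<xi>) * cis (- \<theta>)))" by (metis mult.assoc mult.commute)
  also have "cis (Arg \<xi>) * cis (- \<theta>) = cis (- (\<theta> - Arg \<xi>))" by (simp add: cis_mult)
  finally have e: "\<xi> * z * cis (- \<theta>) = of_real (cmod \<xi>) * (z * cis (- (\<theta> - Arg \<xi>)))" .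
  show ?thesis unfolding e by (rule Arg_times_of_real) (use assms in simp)
qed

text \<open>Multiplication of z by \<xi> rotates sectors by Arg \<xi>, which is why \<theta> is only
  constrained relative to Arg \<xi>.\<close>

lemma is_Ramis_sum_rescale:
  assumes F: "is_Ramis_sum f \<theta> F" and \<xi>: "\<xi> \<noteq> 0"
  shows "is_Ramis_sum (Abs_fps (\<lambda>n. fps_nth f n / \<xi> ^ n)) (\<theta> - Arg \<xi>) (\<lambda>z. F (z / \<xi>))"
proof -
  obtain \<epsilon> R B where e: "0 < \<epsilon>" "\<epsilon> \<le> pi / 4" "R \<ge> 1" "B \<ge> 1" and g: "gevrey_on f \<theta> F \<epsilon> R B"
    using is_Ramis_sumE[OF F] by blast
  have sec: "\<xi> * z \<in> large_sector \<theta> \<epsilon>" if "z \<in> large_sector (\<theta> - Arg \<xi>) \<epsilon>" for z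
    using that \<xi> Arg_mult_cis[OF \<xi>, of z \<theta>] by (auto simp: large_sector_def)
  define R' where "R' = R / cmod \<xi>"
  define B' where "B' = max B (B / cmod \<xi>)"
  have "gevrey_on (Abs_fps (\<lambda>n. fps_nth f n / \<xi> ^ n)) (\<theta> - Arg \<xi>) (\<lambda>z. F (z / \<xi>)) \<epsilon> R' B'"
    unfolding gevrey_on_def
  proof (intro conjI ballI impI allI)
    have "(\<lambda>z. F (1 / (\<xi> * z))) holomorphic_on large_sector (\<theta> - Arg \<xi>) \<epsilon>"
    proof -
      have "(\<lambda>z. F (1 / z)) holomorphic_on large_sector \<theta> \<epsilon>" using g by (simp add: gevrey_on_def)
      from holomorphic_on_compose_gen[OF _ this, of "\<lambda>z. \<xi> * z" "large_sector (\<theta> - Arg \<xi>) \<epsilon>"] sec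
      show ?thesis by (auto simp: o_def intro!: holomorphic_intros)
    qed
    thus "(\<lambda>z. F (1 / z / \<xi>)) holomorphic_on large_sector (\<theta> - Arg \<xi>) \<epsilon>" by (simp add: mult.commute)
    fix z N assume z: "z \<in> large_sector (\<theta> - Arg \<xi>) \<epsilon>" "R' < cmod z"
    have "cmod (\<xi> * z) > R" using z(2) \<xi> by (simp add: R'_def norm_mult field_simps)
    hence "cmod (F (1 / (\<xi> * z)) - (\<Sum>k<N. fps_nth f k / (\<xi> * z) ^ k)) \<le> B * B ^ N * fact N / cmod (\<xi> * z) ^ N"
      using g sec[OF z(1)] unfolding gevrey_on_def by blast
    also have "\<dots> = B * (B / cmod \<xi>) ^ N * fact N / cmod z ^ N"
      by (simp add: norm_mult power_mult_distrib power_divide)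
    also have "\<dots> \<le> B' * B' ^ N * fact N / cmod z ^ N"
      using e by (intro divide_right_mono mult_right_mono mult_mono power_mono) (auto simp: B'_def)
    finally show "cmod (F (1 / z / \<xi>) - (\<Sum>k<N. fps_nth (Abs_fps (\<lambda>n. fps_nth f n / \<xi> ^ n)) k / z ^ k)) \<le> B' * B' ^ N * fact N / cmod z ^ N"
      by (simp add: power_mult_distrib mult.commute)
  qed
  thus ?thesis using e \<xi> by (intro is_Ramis_sumI[of \<epsilon> R' B']) (auto simp: R'_def B'_def)
qed

section \<open>Holonomic power series\<close>

definition holonomic :: "complex fps \<Rightarrow> bool" where
  "holonomic f \<longleftrightarrow> (\<exists>m c. (\<forall>i\<le>m. c i \<in> QP) \<and> (\<exists>i\<le>m. c i \<noteq> 0) \<and>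
     (\<Sum>i\<le>m. fps_of_poly (c i) * (fps_deriv ^^ i) f) = 0)"

text \<open>The falling factorial x (x - 1) ... (x - i + 1), which is the eigenvalue of X^i D^i on
  X^x for D = d/dX.\<close>

definition ffall :: "nat \<Rightarrow> nat \<Rightarrow> complex" where
  "ffall i x = (\<Prod>e<i. (of_nat x - of_nat e))"

lemma ffall_0 [simp]: "ffall 0 x = 1" by (simp add: ffall_def)

lemma ffall_Suc: "ffall (Suc i) x = ffall i x * (of_nat x - of_nat i)" by (simp add: ffall_def)

lemma ffall_eq_0: "x < i \<Longrightarrow> ffall i x = 0"
  unfolding ffall_def by (rule prod_zero) auto

lemma ffall_fact: "i \<le> x \<Longrightarrow> ffall i x * fact (x - i) = fact x"
proof (induction i)
  case (Suc i)
  have "fact (x - i) = of_nat (x - i) * (fact (x - Suc i) :: complex)"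
    using Suc.prems by (metis Suc_diff_Suc Suc_le_lessD fact_Suc)
  thus ?case using Suc by (simp add: ffall_Suc of_nat_diff mult_ac)
qed simp

lemma ffall_deriv: "fps_nth (fps_X ^ i * (fps_deriv ^^ i) f) x = ffall i x * fps_nth f x"
proof (cases "i \<le> x")
  case True
  have d: "fps_nth ((fps_deriv ^^ i) f) y * fact y = fact (y + i) * fps_nth f (y + i)" for y
  proof (induction i arbitrary: y)
    case (Suc i)
    have "fps_nth ((fps_deriv ^^ Suc i) f) y * fact y = fps_nth ((fps_deriv ^^ i) f) (Suc y) * fact (Suc y)"
      by (simp add: mult_ac)
    also have "\<dots> = fact (Suc y + i) * fps_nth f (Suc y + i)" by (rule Suc)
    finally show ?case by simp
  qed simp
  have "fps_nth (fps_X ^ i * (fps_deriv ^^ i) f) x = fps_nth ((fps_deriv ^^ i) f) (x - i)"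
    using True by (simp add: fps_X_power_mult_nth)
  moreover have "fps_nth ((fps_deriv ^^ i) f) (x - i) * fact (x - i) = ffall i x * fact (x - i) * fps_nth f x"
    using d[of "x - i"] True by (simp add: ffall_fact)
  ultimately show ?thesis by simp
qed (simp add: fps_X_power_mult_nth ffall_eq_0)

text \<open>The function \<phi> is a monic polynomial of degree D, written in falling factorials
  because these are the eigenvalues of the operators X^j D^j; being monic serves to exclude
  cancellation.\<close>

definition ff_monic :: "nat \<Rightarrow> (nat \<Rightarrow> complex) \<Rightarrow> (nat \<Rightarrow> complex) \<Rightarrow> bool" where
  "ff_monic D k \<phi> \<longleftrightarrow> (\<forall>j. k j \<in> Qbar) \<and> k D = 1 \<and> (\<forall>j>D. k j = 0) \<and> (\<forall>x. \<phi> x = (\<Sum>j\<le>D. k j * ffall j x))"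

text \<open>In the term with index j, write x - e = (x - j) + (j - e).\<close>

lemma ff_monic_step:
  assumes "ff_monic D k \<phi>"
  shows "\<exists>k'. ff_monic (Suc D) k' (\<lambda>x. \<phi> x * (of_nat x - of_nat e))"
proof -
  define k' where "k' j = (if j = 0 then 0 else k (j - 1)) + (of_nat j - of_nat e) * k j" for j
  have kQ: "k j \<in> Qbar" for j using assms by (simp add: ff_monic_def)
  have kz: "k j = 0" if "j > D" for j using assms that by (simp add: ff_monic_def)
  have "\<phi> x * (of_nat x - of_nat e) = (\<Sum>j\<le>Suc D. k' j * ffall j x)" for x
  proof -
    have "\<phi> x = (\<Sum>j\<le>D. k j * ffall j x)" using assms by (simp add: ff_monic_def)
    hence "\<phi> x * (of_nat x - of_nat e) = (\<Sum>j\<le>D. k j * ffall j x * (of_nat x - of_nat e))"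
      by (simp only: sum_distrib_right)
    also have "\<dots> = (\<Sum>j\<le>D. k j * ffall (Suc j) x + (of_nat j - of_nat e) * k j * ffall j x)"
      by (intro sum.cong refl) (simp add: ffall_Suc algebra_simps)
    also have "\<dots> = (\<Sum>j\<le>D. k j * ffall (Suc j) x) + (\<Sum>j\<le>D. (of_nat j - of_nat e) * k j * ffall j x)"
      by (rule sum.distrib)
    also have "(\<Sum>j\<le>D. k j * ffall (Suc j) x) = (\<Sum>j\<le>Suc D. (if j = 0 then 0 else k (j - 1)) * ffall j x)"
      by (subst sum.atMost_Suc_shift) simp
    also have "(\<Sum>j\<le>D. (of_nat j - of_nat e) * k j * ffall j x) = (\<Sum>j\<le>Suc D. (of_nat j - of_nat e) * k j * ffall j x)"
      by (simp add: kz)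
    finally show ?thesis by (simp add: k'_def sum.distrib[symmetric] distrib_right)
  qed
  moreover have "k' (Suc D) = 1" using assms kz by (simp add: k'_def ff_monic_def)
  moreover have "k' j = 0" if "j > Suc D" for j using kz[of j] kz[of "j - 1"] that by (simp add: k'_def)
  moreover have "k' j \<in> Qbar" for j unfolding k'_def using kQ by (cases j) (auto intro!: Qbar_add Qbar_mult Qbar_diff simp del: of_nat_Suc)
  ultimately show ?thesis unfolding ff_monic_def by (intro exI[of _ k']) auto
qed

lemma ff_monic_mult:
  assumes "ff_monic D k \<phi>"
  shows "\<exists>k'. ff_monic (D + t) k' (\<lambda>x. \<phi> x * ffall t x)"
proof (induction t)
  case 0
  thus ?case using assms by auto
next
  case (Suc t)
  then obtain k' where "ff_monic (D + t) k' (\<lambda>x. \<phi> x * ffall t x)" by blast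
  from ff_monic_step[OF this, of t] show ?case by (simp add: ffall_Suc mult.assoc)
qed

lemma ff_monic_ffall: "ff_monic i (\<lambda>j. if j = i then 1 else 0) (ffall i)"
proof -
  have "(\<Sum>j\<le>i. (if j = i then 1 else 0) * ffall j x) = (\<Sum>j\<le>i. if j = i then ffall j x else 0)" for x
    by (rule sum.cong) auto
  thus ?thesis unfolding ff_monic_def by (auto simp: sum.delta)
qed

text \<open>A recurrence for \<open>f\<^sub>n\<close> with polynomial coefficients turns into one for \<open>f\<^sub>n / n!\<close> after
  multiplication by a falling factorial.\<close>

lemma holonomic_divide_fact:
  assumes "holonomic f"
  shows "holonomic (Abs_fps (\<lambda>n. fps_nth f n / fact n))"
proof -
  obtain m c where cQ: "\<And>i. i \<le> m \<Longrightarrow> c i \<in> QP" and cnz: "\<exists>i\<le>m. c i \<noteq> 0"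
    and ode: "(\<Sum>i\<le>m. fps_of_poly (c i) * (fps_deriv ^^ i) f) = 0"
    using assms unfolding holonomic_def by blast
  define A where "A = (\<Sum>i\<le>m. degree (c i))"
  have Adeg: "degree (c i) \<le> A" if "i \<le> m" for i
    unfolding A_def using that by (intro member_le_sum) auto
  define g where "g = Abs_fps (\<lambda>n. fps_nth f n / fact n)"
  \<comment> \<open>Multiplication of the equation by X^m makes all shifts s = a + m - i of its
    terms z^a d^i/dz^i non-negative; \<open>S\<close> bounds them.\<close>
  define S where "S = A + m"
  define W where "W = {..m} \<times> {..A}"
  define s where "s w = snd w + m - fst w" for w :: "nat \<times> nat"
  define cc where "cc w = coeff (c (fst w)) (snd w)" for w
  have sS: "s w \<le> S" if "w \<in> W" for w using that by (auto simp: s_def S_def W_def)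
  have recf: "(\<Sum>w\<in>W. if s w \<le> N then cc w * (ffall (fst w) (N - s w) * fps_nth f (N - s w)) else 0) = 0" for N
  proof -
    have e: "fps_X ^ m * (fps_of_poly (c i) * (fps_deriv ^^ i) f) =
      (\<Sum>a\<le>A. fps_const (coeff (c i) a) * (fps_X ^ s (i, a) * (fps_X ^ i * (fps_deriv ^^ i) f)))" if i: "i \<le> m" for i
    proof -
      have "c i = (\<Sum>a\<le>A. monom (coeff (c i) a) a)"
        by (rule poly_eqI) (use Adeg[OF i] in \<open>auto simp: coeff_sum coeff_eq_0\<close>)
      hence "fps_of_poly (c i) = (\<Sum>a\<le>A. fps_of_poly (monom (coeff (c i) a) a))"
        by (metis fps_of_poly_sum)
      hence "fps_X ^ m * (fps_of_poly (c i) * (fps_deriv ^^ i) f) =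
        (\<Sum>a\<le>A. fps_const (coeff (c i) a) * (fps_X ^ (a + m) * (fps_deriv ^^ i) f))"
        by (simp add: fps_of_poly_monom sum_distrib_left sum_distrib_right power_add mult_ac)
      also have "\<dots> = (\<Sum>a\<le>A. fps_const (coeff (c i) a) * (fps_X ^ s (i, a) * (fps_X ^ i * (fps_deriv ^^ i) f)))"
      proof (rule sum.cong)
        fix a
        have "a + m = s (i, a) + i" using i by (simp add: s_def)
        thus "fps_const (coeff (c i) a) * (fps_X ^ (a + m) * (fps_deriv ^^ i) f) =
          fps_const (coeff (c i) a) * (fps_X ^ s (i, a) * (fps_X ^ i * (fps_deriv ^^ i) f))"
          by (simp add: power_add mult.assoc)
      qed simp
      finally show ?thesis .
    qed
    have "0 = fps_X ^ m * (\<Sum>i\<le>m. fps_of_poly (c i) * (fps_deriv ^^ i) f)" by (simp add: ode)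
    also have "\<dots> = (\<Sum>w\<in>W. fps_const (cc w) * (fps_X ^ s w * (fps_X ^ fst w * (fps_deriv ^^ fst w) f)))"
      by (simp add: sum_distrib_left e W_def sum.cartesian_product cc_def case_prod_beta)
    finally have "0 = fps_nth (\<Sum>w\<in>W. fps_const (cc w) * (fps_X ^ s w * (fps_X ^ fst w * (fps_deriv ^^ fst w) f))) N"
      by simp
    also have "\<dots> = (\<Sum>w\<in>W. if s w \<le> N then cc w * (ffall (fst w) (N - s w) * fps_nth f (N - s w)) else 0)"
      unfolding fps_sum_nth fps_mult_left_const_nth fps_X_power_mult_nth[of "s _"] ffall_deriv
      by (intro sum.cong) auto
    finally show ?thesis by simp
  qed
  \<comment> \<open>Insert f_(N - s) = (N - s)! g_(N - s) and divide by (N - S)!: what remains is a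
    falling factorial of length S - s. For N < S this factor vanishes, so the recurrence has no
    exceptional indices.\<close>
  have recg: "(\<Sum>w\<in>W. if s w \<le> N then cc w * (ffall (fst w) (N - s w) * ffall (S - s w) (N - s w) * fps_nth g (N - s w)) else 0) = 0" for N
  proof (cases "S \<le> N")
    case True
    have "(\<Sum>w\<in>W. if s w \<le> N then cc w * (ffall (fst w) (N - s w) * ffall (S - s w) (N - s w) * fps_nth g (N - s w)) else 0)
      = (\<Sum>w\<in>W. (if s w \<le> N then cc w * (ffall (fst w) (N - s w) * fps_nth f (N - s w)) else 0) / fact (N - S))"
    proof (rule sum.cong)
      fix w assume w: "w \<in> W"
      have "ffall (S - s w) (N - s w) * fact (N - s w - (S - s w)) = fact (N - s w)"
        using True sS[OF w] by (intro ffall_fact) auto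
      moreover have "N - s w - (S - s w) = N - S" using sS[OF w] True by simp
      ultimately have "ffall (S - s w) (N - s w) = fact (N - s w) / fact (N - S)" by (simp add: field_simps)
      thus "(if s w \<le> N then cc w * (ffall (fst w) (N - s w) * ffall (S - s w) (N - s w) * fps_nth g (N - s w)) else 0)
        = (if s w \<le> N then cc w * (ffall (fst w) (N - s w) * fps_nth f (N - s w)) else 0) / fact (N - S)"
        by (simp add: g_def)
    qed simp
    also have "\<dots> = 0" using recf[of N] by (simp add: sum_divide_distrib[symmetric])
    finally show ?thesis .
  next
    case False
    show ?thesis
      by (rule sum.neutral) (use False in \<open>auto simp: ffall_eq_0\<close>)
  qed
  define d where "d w = fst w + (S - s w)" for w
  have "\<exists>k. ff_monic (d w) k (\<lambda>x. ffall (fst w) x * ffall (S - s w) x)" for w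
    using ff_monic_mult[OF ff_monic_ffall, of "fst w" "S - s w"] by (simp add: d_def)
  then obtain k where k: "\<And>w. ff_monic (d w) (k w) (\<lambda>x. ffall (fst w) x * ffall (S - s w) x)" by metis
  have kz: "k w j = 0" if "j > d w" for w j using k[of w] that by (simp add: ff_monic_def)
  define J where "J = m + S"
  have dJ: "d w \<le> J" if "w \<in> W" for w using that by (auto simp: d_def J_def W_def)
  define C where "C j = (\<Sum>w\<in>W. monom (cc w * k w j) (s w + j))" for j
  have "C j \<in> QP" for j
    unfolding C_def using cQ k by (intro QP_sum) (auto simp: W_def cc_def ff_monic_def intro!: Qbar_mult QP_coeff)
  \<comment> \<open>Among the terms with the same shift s, the one with the largest order i of
    derivative has the largest degree d = i + S - s. Its monic top coefficient cannot be cancelled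
    by the others.\<close>
  moreover have "\<exists>j\<le>J. C j \<noteq> 0"
  proof -
    obtain i0 where i0: "i0 \<le> m" "c i0 \<noteq> 0" using cnz by blast
    define a0 where "a0 = degree (c i0)"
    define w0 where "w0 = (i0, a0)"
    define Q where "Q = {w\<in>W. cc w \<noteq> 0 \<and> s w = s w0}"
    have w0: "w0 \<in> Q" using i0 Adeg[OF i0(1)] by (simp add: Q_def W_def w0_def cc_def a0_def)
    have fQ: "finite (fst ` Q)" by (rule finite_imageI, rule finite_subset[of _ W]) (auto simp: Q_def W_def)
    have "Max (fst ` Q) \<in> fst ` Q" using w0 fQ by (intro Max_in) auto
    then obtain v where v: "v \<in> Q" "fst v = Max (fst ` Q)" by auto
    have vmax: "fst w \<le> fst v" if "w \<in> Q" for w using that fQ v(2) by (simp add: Max_ge)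
    have "coeff (C (d v)) (s v + d v) = (\<Sum>w\<in>W. if w = v then cc v else 0)"
      unfolding C_def coeff_sum
    proof (rule sum.cong)
      fix w assume w: "w \<in> W"
      have vW: "v \<in> W" using v(1) by (simp add: Q_def)
      show "coeff (monom (cc w * k w (d v)) (s w + d v)) (s v + d v) = (if w = v then cc v else 0)"
      proof (cases "w = v")
        case True
        thus ?thesis using k[of v] by (simp add: ff_monic_def)
      next
        case False
        have "cc w * k w (d v) = 0" if sw: "s w = s v"
        proof (cases "cc w = 0")
          case False
          hence "w \<in> Q" using w v(1) sw by (simp add: Q_def)
          hence "fst w \<le> fst v" by (rule vmax)
          moreover have "fst w \<noteq> fst v"
          proof
            assume e: "fst w = fst v"
            have "snd w = snd v" using sw e w vW by (auto simp: s_def W_def)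
            thus False using e \<open>w \<noteq> v\<close> by (simp add: prod_eq_iff)
          qed
          ultimately have "d w < d v" using sw by (simp add: d_def)
          thus ?thesis by (simp add: kz)
        qed simp
        thus ?thesis using False by auto
      qed
    qed simp
    also have "\<dots> = cc v" using v(1) by (simp add: Q_def W_def sum.delta)
    also have "\<dots> \<noteq> 0" using v(1) by (simp add: Q_def)
    finally have "C (d v) \<noteq> 0" by auto
    moreover have "d v \<le> J" using v(1) by (intro dJ) (simp add: Q_def)
    ultimately show ?thesis by blast
  qed
  moreover have "(\<Sum>j\<le>J. fps_of_poly (C j) * (fps_deriv ^^ j) g) = 0"
  proof (rule fps_ext)
    fix N
    have "(\<Sum>j\<le>J. fps_of_poly (C j) * (fps_deriv ^^ j) g) =
      (\<Sum>j\<le>J. \<Sum>w\<in>W. fps_const (cc w * k w j) * (fps_X ^ s w * (fps_X ^ j * (fps_deriv ^^ j) g)))"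
      by (simp add: C_def fps_of_poly_sum fps_of_poly_monom sum_distrib_right power_add mult.assoc)
    hence "fps_nth (\<Sum>j\<le>J. fps_of_poly (C j) * (fps_deriv ^^ j) g) N =
      (\<Sum>j\<le>J. \<Sum>w\<in>W. cc w * k w j * (if N < s w then 0 else ffall j (N - s w) * fps_nth g (N - s w)))"
      by (simp only: fps_sum_nth fps_mult_left_const_nth fps_X_power_mult_nth[of "s _"] ffall_deriv)
    also have "\<dots> = (\<Sum>w\<in>W. \<Sum>j\<le>J. cc w * k w j * (if N < s w then 0 else ffall j (N - s w) * fps_nth g (N - s w)))"
      by (rule sum.swap)
    also have "\<dots> = (\<Sum>w\<in>W. if s w \<le> N then cc w * (ffall (fst w) (N - s w) * ffall (S - s w) (N - s w) * fps_nth g (N - s w)) else 0)"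
    proof (rule sum.cong)
      fix w assume w: "w \<in> W"
      have "(\<Sum>j\<le>J. k w j * ffall j x) = (\<Sum>j\<le>d w. k w j * ffall j x)" for x
        by (rule sum.mono_neutral_right) (use dJ[OF w] kz in auto)
      hence *: "(\<Sum>j\<le>J. k w j * ffall j x) = ffall (fst w) x * ffall (S - s w) x" for x
        using k[of w] by (simp add: ff_monic_def)
      show "(\<Sum>j\<le>J. cc w * k w j * (if N < s w then 0 else ffall j (N - s w) * fps_nth g (N - s w))) =
        (if s w \<le> N then cc w * (ffall (fst w) (N - s w) * ffall (S - s w) (N - s w) * fps_nth g (N - s w)) else 0)"
        unfolding *[symmetric] by (auto simp: sum_distrib_left sum_distrib_right mult_ac)
    qed simp
    also have "\<dots> = 0" by (rule recg)
    finally show "fps_nth (\<Sum>j\<le>J. fps_of_poly (C j) * (fps_deriv ^^ j) g) N = fps_nth 0 N" by simp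
  qed
  ultimately show ?thesis unfolding holonomic_def g_def[symmetric] by blast
qed

text \<open>The m + 1 derived rows of the constant row l have m columns each, hence are linearly
  dependent over the polynomials.\<close>

lemma holonomic_combination:
  fixes u :: "'i \<Rightarrow> complex fps"
  assumes I: "finite I" and l: "\<And>i. i \<in> I \<Longrightarrow> l i \<in> Qbar" and T: "T \<in> QP" "T \<noteq> 0"
    and G: "\<And>i j. i \<in> I \<Longrightarrow> j \<in> I \<Longrightarrow> G i j \<in> QP"
    and sys: "\<And>i. i \<in> I \<Longrightarrow> fps_of_poly T * fps_deriv (u i) = (lincomb I (G i) u)"
  shows "holonomic (\<Sum>i\<in>I. fps_const (l i) * u i)"
proof -
  define b where "b j = [:l j:]" for j
  define m where "m = card I"
  have bQ: "b j \<in> QP" if "j \<in> I" for j using l[OF that] by (simp add: b_def)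
  have DQ: "Dit T G I i b j \<in> QP" if "j \<in> I" for i j
    using that by (intro QP_Dit T G bQ)
  have "\<exists>x. (\<forall>i. x i \<in> QP) \<and> (\<exists>i\<in>{..m}. x i \<noteq> 0) \<and> (\<forall>j\<in>I. (\<Sum>i\<in>{..m}. Dit T G I i b j * x i) = 0)"
    by (rule homogeneous_system_solution) (use I DQ in \<open>auto simp: m_def\<close>)
  then obtain x where x: "\<And>i. x i \<in> QP" "\<exists>i\<le>m. x i \<noteq> 0" "\<And>j. j \<in> I \<Longrightarrow> (\<Sum>i\<le>m. Dit T G I i b j * x i) = 0" by auto
  define h where "h = (lincomb I b u)"
  have "(\<Sum>i\<le>m. fps_of_poly (x i * T ^ i) * (fps_deriv ^^ i) h) =
    (\<Sum>i\<le>m. fps_of_poly (x i) * (lincomb I (Dit T G I i b) u))"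
    unfolding h_def
    by (intro sum.cong) (simp_all add: Dit_fps[OF I sys, symmetric] fps_of_poly_mult fps_of_poly_power mult.assoc)
  also have "\<dots> = (\<Sum>j\<in>I. fps_of_poly (\<Sum>i\<le>m. Dit T G I i b j * x i) * u j)"
    unfolding sum_distrib_left
    by (subst sum.swap) (simp add: fps_of_poly_sum fps_of_poly_mult sum_distrib_left sum_distrib_right mult_ac)
  also have "\<dots> = 0" using x(3) by simp
  finally have "(\<Sum>i\<le>m. fps_of_poly (x i * T ^ i) * (fps_deriv ^^ i) h) = 0" .
  moreover have "\<exists>i\<le>m. x i * T ^ i \<noteq> 0" using x(2) T(2) by auto
  moreover have "\<forall>i\<le>m. x i * T ^ i \<in> QP" using x(1) T(1) by auto
  ultimately have "holonomic h" unfolding holonomic_def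
    by (intro exI[of _ m] exI[of _ "\<lambda>i. x i * T ^ i"]) (intro conjI)
  thus ?thesis by (simp add: h_def b_def fps_of_poly_const)
qed

lemma fps_to_fls_sum: "fps_to_fls (\<Sum>i\<in>A. f i) = (\<Sum>i\<in>A. fps_to_fls (f i))"
  by (induction A rule: infinite_finite_induct) auto

lemma holonomic_imp_linear_ODE:
  assumes "holonomic f" shows "linear_ODE_over_Qbar_ratfuns f"
proof -
  obtain m c where c: "\<forall>i\<le>m. c i \<in> QP" "\<exists>i\<le>m. c i \<noteq> 0" "(\<Sum>i\<le>m. fps_of_poly (c i) * (fps_deriv ^^ i) f) = 0"
    using assms unfolding holonomic_def by blast
  have "fls_of_poly p \<in> Qbar_ratfuns" if "p \<in> QP" for p
    unfolding Qbar_ratfuns_def using that by (intro CollectI exI[of _ p] exI[of _ 1]) auto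
  moreover have "(\<Sum>i\<le>m. fls_of_poly (c i) * fps_to_fls ((fps_deriv ^^ i) f)) = 0"
    using arg_cong[OF c(3), of fps_to_fls] by (simp add: fls_times_fps_to_fls[symmetric] fps_to_fls_sum)
  moreover have "\<exists>i\<le>m. fls_of_poly (c i) \<noteq> 0" using c(2) by (auto simp: fps_to_fls_eq_0_iff)
  ultimately show ?thesis unfolding linear_ODE_over_Qbar_ratfuns_def using c(1)
    by (intro exI[of _ m] exI[of _ "\<lambda>i. fls_of_poly (c i)"]) auto
qed

lemma Eh_function_iff:
  "Eh_function f \<longleftrightarrow> tame f \<and> linear_ODE_over_Qbar_ratfuns (Abs_fps (\<lambda>n. fps_nth f n / fact n / fact n))"
  (is "_ \<longleftrightarrow> _ \<and> ?ode")
proof -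
  define a where "a n = fps_nth f n / fact n" for n
  define P where "P n d \<longleftrightarrow> d > 0 \<and> (\<forall>i\<le>n. algebraic_int (of_nat d * a i))" for n and d :: nat
  have cd: "common_denom a n = (LEAST d. P n d)" for n by (simp add: common_denom_def P_def)
  have E: "Eh_function f \<longleftrightarrow> (\<forall>n. a n \<in> Qbar) \<and> ?ode \<and>
     (\<exists>C::real. C > 0 \<and> (\<forall>n \<sigma>. Qbar_automorphism \<sigma> \<longrightarrow> cmod (\<sigma> (a n)) \<le> C ^ (n + 1)) \<and>
           (\<forall>n. real (common_denom a n) \<le> C ^ (n + 1)))"
    unfolding Eh_function_def G_function_def E_function_def Let_def by (simp add: a_def[abs_def])
  show ?thesis
  proof
    assume "Eh_function f"
    then obtain C :: real where C: "C > 0" "\<And>n \<sigma>. Qbar_automorphism \<sigma> \<Longrightarrow> cmod (\<sigma> (a n)) \<le> C ^ (n + 1)"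
      "\<And>n. real (common_denom a n) \<le> C ^ (n + 1)" and aQ: "\<And>n. a n \<in> Qbar"
      and ode: "?ode"
      unfolding E by blast
    \<comment> \<open>Some common denominator exists, so the \<open>LEAST\<close> in
      \<open>common_denom\<close> really is one.\<close>
    have "\<exists>d. P n d" for n
    proof -
      have "\<forall>i. \<exists>d::nat. d > 0 \<and> algebraic_int (of_nat d * a i)" using aQ by (simp add: Qbar_iff)
      then obtain d :: "nat \<Rightarrow> nat" where d: "\<And>i. d i > 0 \<and> algebraic_int (of_nat (d i) * a i)" by metis
      have "P n (\<Prod>i\<le>n. d i)" unfolding P_def
      proof (intro conjI allI impI)
        show "0 < (\<Prod>i\<le>n. d i)" using d by (simp add: prod_pos)
        fix i assume "i \<le> n"
        hence "(\<Prod>i\<le>n. d i) = d i * (\<Prod>i\<in>{..n} - {i}. d i)" by (intro prod.remove) auto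
        hence "of_nat (\<Prod>i\<le>n. d i) * a i = of_nat (\<Prod>i\<in>{..n} - {i}. d i) * (of_nat (d i) * a i)"
          by (simp add: mult_ac)
        thus "algebraic_int (of_nat (\<Prod>i\<le>n. d i) * a i)" using algebraic_int_scale_of_nat d by metis
      qed
      thus ?thesis by blast
    qed
    hence P: "P n (common_denom a n)" for n unfolding cd by (rule LeastI_ex)
    define C' where "C' = nat \<lceil>C\<rceil>"
    have C': "C \<le> real C'" by (simp add: C'_def real_nat_ceiling_ge)
    have pw: "C ^ (n + 1) \<le> real C' ^ (n + 1)" for n using C(1) C' by (intro power_mono) auto
    have "tame_bounds C' (common_denom a) f"
      unfolding tame_bounds_def
    proof (intro conjI allI impI)
      fix n
      show "0 < common_denom a n" using P by (simp add: P_def)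
      have "real (common_denom a n) \<le> real (C' ^ (n + 1))"
        unfolding of_nat_power by (rule order_trans[OF C(3) pw])
      thus "common_denom a n \<le> C' ^ (n + 1)" by (simp only: of_nat_le_iff)
      show "algebraic_int (of_nat (common_denom a n) * (fps_nth f i / fact i))" if "i \<le> n" for i
        using P[of n] that by (simp add: P_def a_def)
      show "conj_bound (real C' ^ (n + 1)) (fps_nth f n / fact n)"
        unfolding conj_bound_def using aQ C(2) pw order_trans by (simp only: a_def) blast
    qed
    thus "tame f \<and> ?ode"
      using ode unfolding tame_def by blast
  next
    assume *: "tame f \<and> ?ode"
    then obtain C D where tb: "tame_bounds C D f" unfolding tame_def by blast
    have C: "C > 0" using tb by (rule tame_bounds_pos)
    show "Eh_function f"
      unfolding E
    proof (intro conjI exI[of _ "real C"] allI impI)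
      show "a n \<in> Qbar" for n using tb by (simp add: a_def tame_bounds_def conj_bound_def)
      show "cmod (\<sigma> (a n)) \<le> real C ^ (n + 1)" if "Qbar_automorphism \<sigma>" for n \<sigma>
        using tb that by (simp add: a_def tame_bounds_def conj_bound_def)
      fix n
      have "P n (D n)" using tb by (simp add: P_def tame_bounds_def a_def)
      hence "common_denom a n \<le> D n" unfolding cd by (rule Least_le)
      also have "D n \<le> C ^ (n + 1)" using tb by (simp add: tame_bounds_def)
      finally have "real (common_denom a n) \<le> real (C ^ (n + 1))" by (rule of_nat_mono)
      thus "real (common_denom a n) \<le> real C ^ (n + 1)" by (simp only: of_nat_power)
    qed (use C * in auto)
  qed
qed

text \<open>The E-function behind f has the coefficients f_n / (n!)^2, so that the division by n! is
  carried out twice.\<close>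

lemma Eh_functionI:
  assumes "tame f" "holonomic f" shows "Eh_function f"
proof -
  have "holonomic (Abs_fps (\<lambda>n. fps_nth (Abs_fps (\<lambda>n. fps_nth f n / fact n)) n / fact n))"
    by (intro holonomic_divide_fact assms)
  thus ?thesis using assms(1) by (auto simp: Eh_function_iff intro: holonomic_imp_linear_ODE)
qed

section \<open>Transcendence degree and spaces of monomials\<close>

abbreviation "lookup \<equiv> Poly_Mapping.lookup"
abbreviation "keys \<equiv> Poly_Mapping.keys"
abbreviation "single \<equiv> Poly_Mapping.single"

definition mon :: "('v \<Rightarrow> 'b::comm_semiring_1) \<Rightarrow> ('v \<Rightarrow>\<^sub>0 nat) \<Rightarrow> 'b" where
  "mon x m = (\<Prod>v\<in>keys m. x v ^ lookup m v)"

definition mdeg :: "('v \<Rightarrow>\<^sub>0 nat) \<Rightarrow> nat" where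
  "mdeg m = (\<Sum>v\<in>keys m. lookup m v)"

definition Monos :: "'v set \<Rightarrow> nat \<Rightarrow> ('v \<Rightarrow>\<^sub>0 nat) set" where
  "Monos V d = {m. keys m \<subseteq> V \<and> mdeg m \<le> d}"

text \<open>Exponents are bounded one by one: this gives exactly (d + 1)^|V| monomials, and up to a
  constant factor in d the condition agrees with a bound on the total degree.\<close>

definition Box :: "'v set \<Rightarrow> nat \<Rightarrow> ('v \<Rightarrow>\<^sub>0 nat) set" where
  "Box V d = {m. keys m \<subseteq> V \<and> (\<forall>v. lookup m v \<le> d)}"

lemma mon_alt:
  "finite A \<Longrightarrow> keys m \<subseteq> A \<Longrightarrow> mon x m = (\<Prod>v\<in>A. x v ^ lookup m v)"
  unfolding mon_def by (rule prod.mono_neutral_left) (auto simp: in_keys_iff)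

lemma mdeg_alt:
  "finite A \<Longrightarrow> keys m \<subseteq> A \<Longrightarrow> mdeg m = (\<Sum>v\<in>A. lookup m v)"
  unfolding mdeg_def by (rule sum.mono_neutral_left) (auto simp: in_keys_iff)

lemma mon_0 [simp]: "mon x 0 = 1" and mdeg_0 [simp]: "mdeg 0 = 0"
  by (simp_all add: mon_def mdeg_def)

lemma mon_single [simp]: "mon x (single v k) = x v ^ k"
  and mdeg_single [simp]: "mdeg (single v k) = k"
  by (simp_all add: mon_alt[of "{v}"] mdeg_alt[of "{v}"])

lemma mon_add: "mon x (m + m') = mon x m * mon x m'"
  and mdeg_add: "mdeg (m + m') = mdeg m + mdeg m'"
proof -
  define A where "A = keys m \<union> keys m'"
  have A: "finite A" "keys m \<subseteq> A" "keys m' \<subseteq> A" "keys (m + m') \<subseteq> A"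
    using Poly_Mapping.keys_add[of m m'] by (auto simp: A_def)
  show "mon x (m + m') = mon x m * mon x m'"
    by (simp add: mon_alt[OF A(1)] A(2-4) lookup_add power_add prod.distrib)
  show "mdeg (m + m') = mdeg m + mdeg m'"
    by (simp add: mdeg_alt[OF A(1)] A(2-4) lookup_add sum.distrib)
qed

lemma monomial_cases:
  fixes m :: "'v \<Rightarrow>\<^sub>0 nat"
  assumes "m \<noteq> 0"
  obtains v m' where "v \<in> keys m" "keys m' \<subseteq> keys m"
    "m = m' + single v 1"
proof -
  obtain v where v: "v \<in> keys m" using assms by (metis all_not_in_conv keys_eq_empty)
  define m' where "m' = m - single v 1"
  have "m = m' + single v 1"
    using v by (intro poly_mapping_eqI) (auto simp: m'_def lookup_add lookup_minus lookup_single when_def in_keys_iff)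
  moreover have "keys m' \<subseteq> keys m"
    by (auto simp: m'_def lookup_minus in_keys_iff)
  ultimately show thesis using v by (intro that)
qed

lemma Monos_SucE:
  assumes "m \<in> Monos V (Suc d)"
  obtains "m \<in> Monos V d" | v m' where "v \<in> V" "m' \<in> Monos V d" "m = m' + single v 1"
proof (cases "m = 0")
  case True
  thus ?thesis using that(1) by (simp add: Monos_def)
next
  case False
  then obtain v m' where "v \<in> keys m" "keys m' \<subseteq> keys m"
    "m = m' + single v 1" by (rule monomial_cases)
  thus ?thesis using assms by (intro that(2)[of v m']) (auto simp: Monos_def mdeg_add)
qed

lemma Monos_0 [simp]: "Monos V 0 = {0}"
proof -
  have "m = 0" if "m \<in> Monos V 0" for m
  proof (rule ccontr)
    assume "m \<noteq> 0"
    then obtain v m' where "m = m' + single v 1" by (rule monomial_cases)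
    thus False using that by (simp add: Monos_def mdeg_add)
  qed
  thus ?thesis by (auto simp: Monos_def)
qed

lemma Monos_mono: "V \<subseteq> W \<Longrightarrow> d \<le> e \<Longrightarrow> Monos V d \<subseteq> Monos W e"
  by (auto simp: Monos_def)

lemma Monos_add: "m \<in> Monos V d \<Longrightarrow> m' \<in> Monos V e \<Longrightarrow> m + m' \<in> Monos V (d + e)"
  using Poly_Mapping.keys_add[of m m'] by (auto simp: Monos_def mdeg_add)

lemma Monos_single: "v \<in> V \<Longrightarrow> k \<le> d \<Longrightarrow> single v k \<in> Monos V d"
  by (auto simp: Monos_def)

lemma card_Box:
  assumes "finite V" shows "finite (Box V d)" "card (Box V d) = (d + 1) ^ card V"
proof -
  define \<rho> where "\<rho> m = restrict (lookup m) V" for m :: "'a \<Rightarrow>\<^sub>0 nat"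
  have inj: "inj_on \<rho> (Box V d)"
  proof
    fix m m' assume m: "m \<in> Box V d" "m' \<in> Box V d" "\<rho> m = \<rho> m'"
    show "m = m'"
    proof (rule poly_mapping_eqI)
      fix v show "lookup m v = lookup m' v"
      proof (cases "v \<in> V")
        case True
        thus ?thesis using fun_cong[OF m(3), of v] by (simp add: \<rho>_def)
      next
        case False
        hence "v \<notin> keys m" "v \<notin> keys m'" using m by (auto simp: Box_def)
        thus ?thesis by (simp add: in_keys_iff)
      qed
    qed
  qed
  have im: "\<rho> ` Box V d = (\<Pi>\<^sub>E v\<in>V. {..d})"
  proof
    show "\<rho> ` Box V d \<subseteq> (\<Pi>\<^sub>E v\<in>V. {..d})" by (auto simp: \<rho>_def Box_def)
    show "(\<Pi>\<^sub>E v\<in>V. {..d}) \<subseteq> \<rho> ` Box V d"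
    proof
      fix g assume g: "g \<in> (\<Pi>\<^sub>E v\<in>V. {..d})"
      define m where "m = Abs_poly_mapping (\<lambda>v. if v \<in> V then g v else 0)"
      have "finite {v. (if v \<in> V then g v else 0) \<noteq> 0}" using assms by (rule rev_finite_subset) auto
      hence lm: "lookup m v = (if v \<in> V then g v else 0)" for v by (simp add: m_def)
      have "m \<in> Box V d" using g by (auto simp: Box_def lm in_keys_iff PiE_def Pi_def split: if_splits)
      moreover have "\<rho> m = g" using g by (auto simp: \<rho>_def lm PiE_def extensional_def restrict_def)
      ultimately show "g \<in> \<rho> ` Box V d" by blast
    qed
  qed
  have "finite (\<Pi>\<^sub>E v\<in>V. {..d})" using assms by (intro finite_PiE) auto
  thus "finite (Box V d)" using inj im by (metis finite_imageD)
  show "card (Box V d) = (d + 1) ^ card V" using card_image[OF inj] assms by (simp add: im card_PiE)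
qed

lemma lookup_le_mdeg: "lookup m v \<le> mdeg m"
  unfolding mdeg_def by (cases "v \<in> keys m") (auto intro: member_le_sum simp: in_keys_iff)

lemma Monos_subset_Box: "Monos V d \<subseteq> Box V d"
  using order_trans[OF lookup_le_mdeg] by (auto simp: Monos_def Box_def)

lemma Box_subset_Monos:
  assumes "finite V" shows "Box V d \<subseteq> Monos V (card V * d)"
proof
  fix m assume m: "m \<in> Box V d"
  have "mdeg m = (\<Sum>v\<in>V. lookup m v)" using m assms by (intro mdeg_alt) (auto simp: Box_def)
  also have "\<dots> \<le> card V * d" using m sum_bounded_above[of V "lookup m" d] by (simp add: Box_def)
  finally show "m \<in> Monos V (card V * d)" using m by (simp add: Monos_def Box_def)
qed

lemma finite_Monos: "finite V \<Longrightarrow> finite (Monos V d)"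
  using card_Box(1) Monos_subset_Box by (metis finite_subset)

lemma card_Monos_le: "finite V \<Longrightarrow> card (Monos V d) \<le> (d + 1) ^ card V"
  by (rule order_trans[OF card_mono[OF card_Box(1) Monos_subset_Box]]) (simp_all add: card_Box(2))

section \<open>Spans over a subfield\<close>

inductive_set kspan :: "'a::field set \<Rightarrow> 'a set \<Rightarrow> 'a set" for K G where
  kspan_0: "0 \<in> kspan K G"
| kspan_step: "y \<in> kspan K G \<Longrightarrow> k \<in> K \<Longrightarrow> g \<in> G \<Longrightarrow> y + k * g \<in> kspan K G"

abbreviation poly_span :: "'a::field set \<Rightarrow> ('v \<Rightarrow> 'a) \<Rightarrow> 'v set \<Rightarrow> nat \<Rightarrow> 'a set" where
  "poly_span K x I d \<equiv> kspan K (mon x ` Monos I d)"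

abbreviation power_span :: "'a::field set \<Rightarrow> 'a set \<Rightarrow> nat \<Rightarrow> nat \<Rightarrow> 'a \<Rightarrow> 'a set" where
  "power_span K B s r v \<equiv> kspan K {mon id m * v ^ k | m k. m \<in> Monos B s \<and> k < r}"

lemma subfieldD:
  assumes "subfield_of_type K"
  shows "0 \<in> K" "1 \<in> K" "x \<in> K \<Longrightarrow> y \<in> K \<Longrightarrow> x - y \<in> K" "x \<in> K \<Longrightarrow> y \<in> K \<Longrightarrow> x * y \<in> K"
    "x \<in> K \<Longrightarrow> inverse x \<in> K" "x \<in> K \<Longrightarrow> - x \<in> K" "x \<in> K \<Longrightarrow> y \<in> K \<Longrightarrow> x + y \<in> K"
proof -
  show 1: "0 \<in> K" "1 \<in> K" "\<And>x y. x \<in> K \<Longrightarrow> y \<in> K \<Longrightarrow> x - y \<in> K" "x \<in> K \<Longrightarrow> y \<in> K \<Longrightarrow> x * y \<in> K"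
    "x \<in> K \<Longrightarrow> inverse x \<in> K"
    using assms by (auto simp: subfield_of_type_def)
  show 2: "- x \<in> K" if "x \<in> K" for x using 1(3)[of 0 x] 1(1) that by simp
  show "x \<in> K \<Longrightarrow> y \<in> K \<Longrightarrow> x + y \<in> K" using 1(3)[of x "- y"] 2[of y] by simp
qed

lemma kspan_add:
  assumes "y \<in> kspan K G" "z \<in> kspan K G" shows "y + z \<in> kspan K G"
  using assms(2,1)
proof (induction z rule: kspan.induct)
  case (kspan_step z k g)
  thus ?case using kspan.kspan_step[of "y + z" K G k g] by (simp add: add.assoc)
qed simp

lemma kspan_base: "k \<in> K \<Longrightarrow> g \<in> G \<Longrightarrow> k * g \<in> kspan K G"
  using kspan_step[OF kspan_0, of k K g G] by simp

lemma kspan_sum: "(\<And>i. i \<in> A \<Longrightarrow> f i \<in> kspan K G) \<Longrightarrow> (\<Sum>i\<in>A. f i) \<in> kspan K G"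
  by (induction A rule: infinite_finite_induct) (auto intro: kspan_0 kspan_add)

context
  fixes K :: "'a::field set"
  assumes K: "subfield_of_type K"
begin

lemma kspan_gen: "g \<in> G \<Longrightarrow> g \<in> kspan K G"
  using kspan_base[of 1 K g G] subfieldD(2)[OF K] by simp

lemma kspan_mult:
  assumes "y \<in> kspan K A" "z \<in> kspan K B" "\<And>a b. a \<in> A \<Longrightarrow> b \<in> B \<Longrightarrow> a * b \<in> kspan K C"
  shows "y * z \<in> kspan K C"
proof -
  have sc: "k * c \<in> kspan K C" if "k \<in> K" "c \<in> kspan K C" for k c
    using that(2)
  proof (induction c rule: kspan.induct)
    case (kspan_step c k' g)
    have "k * c + (k * k') * g \<in> kspan K C"
      using kspan_step that(1) subfieldD(4)[OF K] by (intro kspan.kspan_step) auto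
    thus ?case by (simp add: algebra_simps)
  qed (simp add: kspan_0)
  have 1: "a * z \<in> kspan K C" if "a \<in> A" for a
    using assms(2)
  proof (induction z rule: kspan.induct)
    case (kspan_step z k b)
    have "a * z + k * (a * b) \<in> kspan K C" using kspan_step.IH sc[OF kspan_step.hyps(2) assms(3)[OF that kspan_step.hyps(3)]] by (rule kspan_add)
    thus ?case by (simp add: algebra_simps)
  qed (simp add: kspan_0)
  show ?thesis using assms(1)
  proof (induction y rule: kspan.induct)
    case (kspan_step y k a)
    have "y * z + k * (a * z) \<in> kspan K C" using kspan_step.IH sc[OF kspan_step.hyps(2) 1[OF kspan_step.hyps(3)]] by (rule kspan_add)
    thus ?case by (simp add: algebra_simps)
  qed (simp add: kspan_0)
qed

lemma kspan_scale: "k \<in> K \<Longrightarrow> y \<in> kspan K G \<Longrightarrow> k * y \<in> kspan K G"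
  using kspan_mult[of k "{1}" y G G] kspan_base[of k K 1 "{1}"] by (auto intro: kspan_gen)

lemma kspan_diff: "y \<in> kspan K G \<Longrightarrow> z \<in> kspan K G \<Longrightarrow> y - z \<in> kspan K G"
  using kspan_add[of y K G "- 1 * z"] kspan_scale[of "- 1" z G] subfieldD(6)[OF K, of 1] subfieldD(2)[OF K] by simp

lemma kspan_trans: "y \<in> kspan K G \<Longrightarrow> G \<subseteq> kspan K H \<Longrightarrow> y \<in> kspan K H"
  using kspan_mult[of y G 1 "{1}" H] by (auto intro: kspan_gen)

lemma kspan_coefficients:
  assumes "finite N" "y \<in> kspan K (x ` N)"
  shows "\<exists>w. (\<forall>m. w m \<in> K) \<and> y = (\<Sum>m\<in>N. w m * x m)"
  using assms(2)
proof (induction y rule: kspan.induct)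
  case kspan_0
  show ?case using subfieldD(1)[OF K] by (intro exI[of _ "\<lambda>_. 0"]) simp
next
  case (kspan_step y k g)
  then obtain w where w: "\<And>m. w m \<in> K" "y = (\<Sum>m\<in>N. w m * x m)" by blast
  obtain m where m: "m \<in> N" "g = x m" using kspan_step(3) by blast
  have "(\<Sum>l\<in>N. (w(m := w m + k)) l * x l) = (\<Sum>l\<in>N. w l * x l + (if l = m then k * g else 0))"
    by (intro sum.cong) (auto simp: algebra_simps m)
  also have "\<dots> = y + k * g" using assms(1) m(1) by (simp add: sum.distrib w(2))
  finally show ?case using w(1) kspan_step subfieldD(7)[OF K]
    by (intro exI[of _ "w(m := w m + k)"]) auto
qed

lemma kspan_dependent:
  assumes "finite G" "finite L" "card G < card L" "\<And>l. l \<in> L \<Longrightarrow> y l \<in> kspan K G"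
  shows "\<exists>w. (\<forall>l. w l \<in> K) \<and> (\<exists>l\<in>L. w l \<noteq> 0) \<and> (\<Sum>l\<in>L. w l * y l) = 0"
proof -
  have "\<forall>l. \<exists>w. l \<in> L \<longrightarrow> (\<forall>g. w g \<in> K) \<and> y l = (\<Sum>g\<in>G. w g * g)"
    using kspan_coefficients[OF assms(1), of _ id] assms(4) by (simp add: image_id)
  then obtain a where a: "\<And>l g. l \<in> L \<Longrightarrow> a l g \<in> K" "\<And>l. l \<in> L \<Longrightarrow> y l = (\<Sum>g\<in>G. a l g * g)" by metis
  have "\<exists>w. (\<forall>l. w l \<in> K) \<and> (\<exists>l\<in>L. w l \<noteq> 0) \<and> (\<forall>g\<in>G. (\<Sum>l\<in>L. a l g * w l) = 0)"
    using assms(1-3) subfieldD[OF K] a(1) by (intro homogeneous_system_solution) auto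
  then obtain w where w: "\<forall>l. w l \<in> K" "\<exists>l\<in>L. w l \<noteq> 0" "\<And>g. g \<in> G \<Longrightarrow> (\<Sum>l\<in>L. a l g * w l) = 0" by blast
  have "(\<Sum>l\<in>L. w l * y l) = (\<Sum>l\<in>L. \<Sum>g\<in>G. a l g * w l * g)"
    by (intro sum.cong refl) (simp add: a(2) sum_distrib_left mult_ac)
  also have "\<dots> = (\<Sum>g\<in>G. (\<Sum>l\<in>L. a l g * w l) * g)"
    by (subst sum.swap) (simp add: sum_distrib_right)
  also have "\<dots> = 0" using w(3) by simp
  finally show ?thesis using w(1,2) by blast
qed

end

text \<open>Independence is a condition on exponents and not on the set of values, so that distinct
  monomials with equal values count as dependent, in particular when some x_v coincide.\<close>

definition mon_indep :: "'a::field set \<Rightarrow> ('v \<Rightarrow> 'a) \<Rightarrow> ('v \<Rightarrow>\<^sub>0 nat) set \<Rightarrow> bool" where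
  "mon_indep K x N \<longleftrightarrow> (\<forall>w. (\<forall>m\<in>N. w m \<in> K) \<longrightarrow> (\<Sum>m\<in>N. w m * mon x m) = 0 \<longrightarrow> (\<forall>m\<in>N. w m = 0))"

lemma mon_indepD:
  "mon_indep K x N \<Longrightarrow> (\<And>m. m \<in> N \<Longrightarrow> w m \<in> K) \<Longrightarrow> (\<Sum>m\<in>N. w m * mon x m) = 0 \<Longrightarrow> m \<in> N \<Longrightarrow> w m = 0"
  unfolding mon_indep_def by blast

lemma maximal_mon_indep:
  assumes K: "subfield_of_type K" and M: "finite M"
  shows "\<exists>N\<subseteq>M. mon_indep K x N \<and> mon x ` M \<subseteq> kspan K (mon x ` N)"
proof -
  define A where "A = {N. N \<subseteq> M \<and> mon_indep K x N}"
  have "finite A" by (rule finite_subset[of _ "Pow M"]) (use M in \<open>auto simp: A_def\<close>)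
  moreover have "{} \<in> A" by (simp add: A_def mon_indep_def)
  ultimately obtain N where N: "N \<in> A" "\<And>N'. N' \<in> A \<Longrightarrow> N \<subseteq> N' \<Longrightarrow> N = N'"
    using finite_has_maximal[of A] by (metis empty_iff)
  have fN: "finite N" using N(1) M finite_subset by (auto simp: A_def)
  have "mon x m \<in> kspan K (mon x ` N)" if m: "m \<in> M" for m
  proof (cases "m \<in> N")
    case True
    thus ?thesis by (intro kspan_gen[OF K]) auto
  next
    case False
    have "insert m N \<notin> A" using N(2)[of "insert m N"] False by blast
    hence "\<not> mon_indep K x (insert m N)" using N(1) m by (simp add: A_def)
    then obtain w where w: "\<And>m'. m' \<in> insert m N \<Longrightarrow> w m' \<in> K" "(\<Sum>m'\<in>insert m N. w m' * mon x m') = 0"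
      "\<exists>m'\<in>insert m N. w m' \<noteq> 0" unfolding mon_indep_def by blast
    have s: "w m * mon x m + (\<Sum>m'\<in>N. w m' * mon x m') = 0" using w(2) False fN by simp
    have wm: "w m \<noteq> 0"
    proof
      assume "w m = 0"
      hence "(\<Sum>m'\<in>N. w m' * mon x m') = 0" using s by simp
      hence "\<forall>m'\<in>N. w m' = 0" using N(1) w(1) mon_indepD[of K x N w] by (auto simp: A_def)
      thus False using w(3) \<open>w m = 0\<close> by blast
    qed
    have "w m * mon x m = (\<Sum>m'\<in>N. - w m' * mon x m')" using s by (simp add: sum_negf eq_neg_iff_add_eq_0)
    hence "mon x m = inverse (w m) * (\<Sum>m'\<in>N. - w m' * mon x m')" using wm by (metis left_inverse mult.assoc mult_1)
    also have "\<dots> \<in> kspan K (mon x ` N)"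
      using w(1) subfieldD[OF K] by (intro kspan_scale[OF K] kspan_sum kspan_base) auto
    finally show ?thesis .
  qed
  thus ?thesis using N(1) by (auto simp: A_def)
qed

lemma alg_indep_imp_mon_indep:
  assumes "alg_indep K S" "0 \<in> K" "finite N" "\<And>m. m \<in> N \<Longrightarrow> keys m \<subseteq> S"
  shows "mon_indep K id N"
  unfolding mon_indep_def
proof (intro allI impI)
  fix w assume w: "\<forall>m\<in>N. w m \<in> K" "(\<Sum>m\<in>N. w m * mon id m) = 0"
  define P where "P = Abs_poly_mapping (\<lambda>m. if m \<in> N then w m else 0)"
  have "finite {m. (if m \<in> N then w m else 0) \<noteq> 0}" using assms(3) by (rule rev_finite_subset) auto
  hence lP: "lookup P m = (if m \<in> N then w m else 0)" for m by (simp add: P_def)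
  have kP: "keys P \<subseteq> N" by (auto simp: lP in_keys_iff split: if_splits)
  have "P \<in> mpolys K S" using w(1) assms kP by (auto simp: mpolys_def lP)
  moreover have "mpoly_eval id id P = (\<Sum>m\<in>N. lookup P m * mon id m)"
    unfolding mpoly_eval_def mon_def id_apply
    using kP assms(3) by (intro sum.mono_neutral_left) (auto simp: in_keys_iff)
  ultimately have "P = 0" using assms(1) w(2) by (simp add: alg_indep_def lP)
  thus "\<forall>m\<in>N. w m = 0" using lP by (metis lookup_zero)
qed

context
  fixes K :: "'a::field set" and x :: "'v \<Rightarrow> 'a" and I :: "'v set"
  assumes K: "subfield_of_type K"
begin

lemma kspan_Monos_mult:
  assumes "y \<in> poly_span K x I d" "z \<in> poly_span K x I e"
  shows "y * z \<in> poly_span K x I (d + e)"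
  by (rule kspan_mult[OF K assms]) (auto intro!: kspan_gen[OF K] imageI Monos_add simp: mon_add[symmetric])

lemma kspan_Monos_1: "1 \<in> poly_span K x I d"
proof -
  have "mon x 0 \<in> poly_span K x I d" by (intro kspan_gen[OF K] imageI) (simp add: Monos_def)
  thus ?thesis by simp
qed

text \<open>The elements with such a fraction form a subfield that contains K and all x_i. The
  degree e is recorded to compare S with spaces of monomials.\<close>

lemma adjoin_fraction:
  assumes "y \<in> adjoin K (x ` I)"
  shows "\<exists>q e. q \<noteq> 0 \<and> q \<in> poly_span K x I e \<and> q * y \<in> poly_span K x I e"
proof -
  define P where "P e = poly_span K x I e" for e
  define F where "F = {y. \<exists>q e. q \<noteq> 0 \<and> q \<in> P e \<and> q * y \<in> P e}"
  have one: "1 \<in> P e" for e unfolding P_def by (rule kspan_Monos_1)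
  have Kin: "k \<in> P e" if "k \<in> K" for k e
    using kspan_scale[OF K that, of 1] one[of e] by (simp add: P_def)
  have Pm: "y * z \<in> P (d + e)" if "y \<in> P d" "z \<in> P e" for y z d e
    using that unfolding P_def by (rule kspan_Monos_mult)
  have "subfield_of_type F"
    unfolding subfield_of_type_def
  proof (intro conjI ballI)
    have "1 \<noteq> (0::'a) \<and> 1 \<in> P 0 \<and> 1 * 0 \<in> P 0" "1 \<noteq> (0::'a) \<and> 1 \<in> P 0 \<and> 1 * 1 \<in> P 0"
      using one[of 0] kspan_0 by (simp_all add: P_def)
    thus "0 \<in> F" "1 \<in> F" unfolding F_def by blast+
    fix y z assume "y \<in> F" "z \<in> F"
    then obtain q e p d where q: "q \<noteq> 0" "q \<in> P e" "q * y \<in> P e" and p: "p \<noteq> 0" "p \<in> P d" "p * z \<in> P d"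
      unfolding F_def by blast
    have "q * p * (y - z) = (q * y) * p - q * (p * z)" by (simp add: algebra_simps)
    also have "\<dots> \<in> P (e + d)" using kspan_diff[OF K] Pm q p unfolding P_def by blast
    finally show "y - z \<in> F" unfolding F_def using q p Pm by (auto intro!: exI[of _ "q * p"] exI[of _ "e + d"])
    have "q * p * (y * z) = (q * y) * (p * z)" by (simp add: algebra_simps)
    also have "\<dots> \<in> P (e + d)" using Pm q p by blast
    finally show "y * z \<in> F" unfolding F_def using q p Pm by (auto intro!: exI[of _ "q * p"] exI[of _ "e + d"])
  next
    fix y assume y: "y \<in> F"
    show "inverse y \<in> F"
    proof (cases "y = 0")
      case False
      obtain q e where q: "q \<noteq> 0" "q \<in> P e" "q * y \<in> P e" using y unfolding F_def by blast
      have e: "q * y * inverse y = q" using False by simp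
      have "q * y * inverse y \<in> P e" unfolding e by (rule q(2))
      thus ?thesis unfolding F_def using q False by (intro CollectI exI[of _ "q * y"] exI[of _ e] conjI) (simp, assumption+)
    qed (use y in simp)
  qed
  moreover have "K \<subseteq> F"
  proof
    fix k assume "k \<in> K"
    hence "1 \<noteq> (0::'a) \<and> 1 \<in> P 0 \<and> 1 * k \<in> P 0" using one[of 0] Kin by simp
    thus "k \<in> F" unfolding F_def by blast
  qed
  moreover have "x ` I \<subseteq> F"
  proof
    fix y assume "y \<in> x ` I"
    then obtain i where i: "i \<in> I" "y = x i" by blast
    have "mon x (single i 1) \<in> P 1"
      unfolding P_def using i(1) by (intro kspan_gen[OF K] imageI Monos_single) auto
    thus "y \<in> F" unfolding F_def using i one[of 1] by (intro CollectI exI[of _ 1]) auto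
  qed
  ultimately have "adjoin K (x ` I) \<subseteq> F" unfolding adjoin_def by blast
  thus ?thesis using assms by (auto simp: F_def P_def)
qed

lemma common_fraction:
  assumes "finite S" "S \<subseteq> adjoin K (x ` I)"
  shows "\<exists>q e. q \<noteq> 0 \<and> q \<in> poly_span K x I e \<and> (\<forall>y\<in>S. q * y \<in> poly_span K x I e)"
  using assms
proof (induction S rule: finite_induct)
  case empty
  have "1 \<noteq> (0::'a) \<and> 1 \<in> poly_span K x I 0 \<and> (\<forall>y\<in>{}. 1 * y \<in> poly_span K x I 0)"
    using kspan_Monos_1[of 0] by simp
  thus ?case by blast
next
  case (insert y S)
  then obtain q e where q: "q \<noteq> 0" "q \<in> poly_span K x I e" "\<forall>y\<in>S. q * y \<in> poly_span K x I e" by auto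
  obtain p d where p: "p \<noteq> 0" "p \<in> poly_span K x I d" "p * y \<in> poly_span K x I d"
    using adjoin_fraction[of y] insert.prems by auto
  have "q * p * z \<in> poly_span K x I (e + d)" if "z \<in> insert y S" for z
  proof (cases "z = y")
    case True
    thus ?thesis using kspan_Monos_mult[OF q(2) p(3)] by (simp add: mult.assoc)
  next
    case False
    hence "q * z \<in> poly_span K x I e" using q(3) that by blast
    from kspan_Monos_mult[OF this p(2)] show ?thesis by (simp add: mult_ac)
  qed
  thus ?case using q(1) p(1) kspan_Monos_mult[OF q(2) p(2)] by (intro exI[of _ "q * p"] exI[of _ "e + d"]) auto
qed

text \<open>A common denominator \<open>q\<close> of \<open>S\<close> embeds the monomials in \<open>S\<close> into the space of polynomials in the \<open>x\<^sub>i\<close>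
  of proportional degree.\<close>

lemma spanning_monomials_lower_bound:
  assumes I: "finite I" and S: "finite S" "S \<subseteq> adjoin K (x ` I)" "alg_indep K S"
  shows "\<exists>k. \<forall>d N. finite N \<longrightarrow> mon x ` Monos I (k * d) \<subseteq> kspan K (mon x ` N) \<longrightarrow> (d + 1) ^ card S \<le> card N"
proof -
  obtain q e where q: "q \<noteq> 0" "q \<in> poly_span K x I e" "\<And>y. y \<in> S \<Longrightarrow> q * y \<in> poly_span K x I e"
    using common_fraction[OF S(1,2)] by blast
  have qm: "q ^ d * mon id m \<in> poly_span K x I (e * d)" if "m \<in> Monos S d" for m d
    using that
  proof (induction d arbitrary: m)
    case 0
    thus ?case using kspan_Monos_1[of 0] by simp
  next
    case (Suc d)
    from Suc.prems show ?case
    proof (cases rule: Monos_SucE)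
      case 1
      thus ?thesis using kspan_Monos_mult[OF q(2) Suc.IH[OF 1]] by (simp add: mult_ac)
    next
      case (2 v m')
      have e: "q ^ Suc d * mon id m = (q * v) * (q ^ d * mon id m')" by (simp add: 2(3) mon_add mult_ac)
      show ?thesis unfolding e mult_Suc_right by (rule kspan_Monos_mult[OF q(3)[OF 2(1)] Suc.IH[OF 2(2)]])
    qed
  qed
  show ?thesis
  \<comment> \<open>Monomials in \<open>Box S d\<close> have degree at most d card S. Multiplied by
    q^(d card S), they become polynomials of degree e d card S in the x_i.\<close>
  proof (intro exI[of _ "e * card S"] allI impI)
    fix d N assume N: "finite N" "mon x ` Monos I (e * card S * d) \<subseteq> kspan K (mon x ` N)"
    show "(d + 1) ^ card S \<le> card N"
    proof (rule ccontr)
      assume "\<not> ?thesis"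
      hence "card (mon x ` N) < card (Box S d)" using card_image_le[OF N(1), of "mon x"] by (simp add: card_Box S(1))
      moreover have "q ^ (card S * d) * mon id m \<in> kspan K (mon x ` N)" if "m \<in> Box S d" for m
      proof (rule kspan_trans[OF K])
        show "q ^ (card S * d) * mon id m \<in> poly_span K x I (e * card S * d)"
          using qm[of m "card S * d"] Box_subset_Monos[OF S(1), of d] that by (auto simp: mult.assoc)
      qed (rule N(2))
      ultimately have "\<exists>w. (\<forall>m. w m \<in> K) \<and> (\<exists>m\<in>Box S d. w m \<noteq> 0) \<and> (\<Sum>m\<in>Box S d. w m * (q ^ (card S * d) * mon id m)) = 0"
        using N(1) card_Box(1)[OF S(1)] by (intro kspan_dependent[OF K]) auto
      then obtain w where w: "\<And>m. w m \<in> K" "\<exists>m\<in>Box S d. w m \<noteq> 0"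
        "(\<Sum>m\<in>Box S d. w m * (q ^ (card S * d) * mon id m)) = 0" by blast
      have "q ^ (card S * d) * (\<Sum>m\<in>Box S d. w m * mon id m) = 0"
        using w(3) by (simp add: sum_distrib_left mult_ac)
      hence "(\<Sum>m\<in>Box S d. w m * mon id m) = 0" using q(1) by simp
      moreover have "mon_indep K id (Box S d)"
        by (rule alg_indep_imp_mon_indep[OF S(3) subfieldD(1)[OF K] card_Box(1)[OF S(1)]]) (simp add: Box_def)
      ultimately show False using w(1,2) mon_indepD by blast
    qed
  qed
qed

end

section \<open>Upper bounds for the rank of monomials\<close>

lemma alg_indep_empty: "alg_indep K {}"
  unfolding alg_indep_def
proof (intro ballI impI)
  fix P assume P: "P \<in> mpolys K {}" "mpoly_eval id id P = 0"
  show "P = 0"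
  proof (rule ccontr)
    assume "P \<noteq> 0"
    moreover have "keys P \<subseteq> {0}" using P(1) by (auto simp: mpolys_def)
    ultimately have k: "keys P = {0}" by (metis keys_eq_empty subset_singletonD)
    hence "lookup P 0 = 0" using P(2) by (simp add: mpoly_eval_def)
    thus False using k by (metis in_keys_iff singletonI)
  qed
qed

lemma mon_split: "m = Poly_Mapping.update v 0 m + single v (lookup m v)"
  by (intro poly_mapping_eqI) (auto simp: lookup_add lookup_update lookup_single when_def)

lemma keys_update_0: "keys (Poly_Mapping.update v 0 m) = keys m - {v}"
  by (simp add: keys_update)

context
  fixes K :: "'a::field set"
  assumes K: "subfield_of_type K"
begin

text \<open>A non-trivial relation over B and v is arranged by powers of v: r is its degree in v and
  a its leading coefficient. The independence of B gives a \<noteq> 0, and r = 0 would be a relation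
  over B alone.\<close>

lemma algebraic_leading_coefficient:
  assumes B: "alg_indep K B" "finite B" and v: "v \<notin> B" "\<not> alg_indep K (insert v B)"
  shows "\<exists>a s r. a \<noteq> 0 \<and> r \<ge> 1 \<and> a \<in> poly_span K id B s \<and>
     a * v ^ r \<in> power_span K B s r v"
proof -
  obtain P where P: "P \<in> mpolys K (insert v B)" "mpoly_eval id id P = 0" "P \<noteq> 0"
    using v(2) unfolding alg_indep_def by blast
  define kP where "kP = keys P"
  define p where "p = lookup P"
  have kP: "finite kP" "kP \<noteq> {}" using P(3) by (simp_all add: kP_def)
  have pK: "p m \<in> K" for m using P(1) by (simp add: mpolys_def p_def)
  define \<rho> where "\<rho> = Poly_Mapping.update v (0::nat)"
  define r where "r = Max ((\<lambda>m. lookup m v) ` kP)"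
  define s where "s = (\<Sum>m\<in>kP. mdeg m)"
  have split: "m = \<rho> m + single v (lookup m v)" for m
    unfolding \<rho>_def by (rule mon_split)
  have \<rho>M: "\<rho> m \<in> Monos B s" if m: "m \<in> kP" for m
  proof -
    have "mdeg m = mdeg (\<rho> m) + lookup m v" using arg_cong[OF split, of mdeg m] by (simp add: mdeg_add)
    moreover have "mdeg m \<le> s" unfolding s_def using m kP by (intro member_le_sum) auto
    moreover have "keys (\<rho> m) \<subseteq> B"
      using P(1) m by (auto simp: mpolys_def \<rho>_def keys_update_0 kP_def)
    ultimately show ?thesis by (simp add: Monos_def)
  qed
  have monm: "mon id m = mon id (\<rho> m) * v ^ lookup m v" for m
    using arg_cong[OF split, of "mon id" m] by (simp add: mon_add)
  have ler: "lookup m v \<le> r" if "m \<in> kP" for m unfolding r_def using kP that by (intro Max_ge) auto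
  have "r \<in> (\<lambda>m. lookup m v) ` kP" unfolding r_def using kP by (intro Max_in) auto
  then obtain m0 where m0: "m0 \<in> kP" "lookup m0 v = r" by blast
  define L where "L = {m\<in>kP. lookup m v = r}"
  define c where "c = (\<Sum>m\<in>L. p m * mon id (\<rho> m))"
  define rest where "rest = (\<Sum>m\<in>kP - L. p m * mon id m)"
  have L: "L \<subseteq> kP" "finite L" using kP by (auto simp: L_def)
  have "(\<Sum>m\<in>kP. p m * mon id m) = 0"
    using P(2) by (simp add: mpoly_eval_def mon_def p_def kP_def)
  moreover have "(\<Sum>m\<in>kP. p m * mon id m) = rest + (\<Sum>m\<in>L. p m * mon id m)"
    unfolding rest_def using L kP by (intro sum.subset_diff)
  moreover have "(\<Sum>m\<in>L. p m * mon id m) = c * v ^ r"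
    unfolding c_def sum_distrib_right by (intro sum.cong refl) (subst monm, simp add: L_def mult.assoc)
  ultimately have eq: "c * v ^ r = - rest" by (simp add: eq_neg_iff_add_eq_0 add.commute)
  have c0: "c \<noteq> 0"
  proof
    assume c: "c = 0"
    have lm: "\<rho> m + single v r = m" if "m \<in> L" for m using split[of m] that by (simp add: L_def)
    have "c = (\<Sum>m'\<in>\<rho> ` L. p (m' + single v r) * mon id m')"
    proof (subst sum.reindex)
      show "inj_on \<rho> L" using lm by (metis inj_onI)
      show "c = sum ((\<lambda>m'. p (m' + single v r) * mon id m') \<circ> \<rho>) L"
        unfolding c_def by (intro sum.cong) (simp_all add: lm)
    qed
    moreover have "mon_indep K id (\<rho> ` L)"
      using \<rho>M L by (intro alg_indep_imp_mon_indep[OF B(1) subfieldD(1)[OF K]]) (auto simp: Monos_def)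
    moreover have "\<rho> m0 \<in> \<rho> ` L" using m0 by (auto simp: L_def)
    ultimately have "p (\<rho> m0 + single v r) = 0"
      using c pK mon_indepD[of K id "\<rho> ` L" "\<lambda>m'. p (m' + single v r)" "\<rho> m0"] by simp
    hence "p m0 = 0" using lm[of m0] m0 by (simp add: L_def)
    thus False using m0(1) by (simp add: p_def kP_def in_keys_iff)
  qed
  have "r \<noteq> 0"
  proof
    assume "r = 0"
    hence "kP - L = {}" using ler by (auto simp: L_def)
    hence "rest = 0" unfolding rest_def by (metis sum.empty)
    thus False using eq c0 \<open>r = 0\<close> by simp
  qed
  moreover have "c \<in> poly_span K id B s"
    unfolding c_def using \<rho>M pK L by (intro kspan_sum kspan_base imageI) auto
  moreover have "c * v ^ r \<in> power_span K B s r v"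
  proof -
    have "- rest = (\<Sum>m\<in>kP - L. - p m * (mon id (\<rho> m) * v ^ lookup m v))"
      unfolding rest_def monm[symmetric] by (simp add: sum_negf)
    also have "\<dots> \<in> power_span K B s r v"
    proof (intro kspan_sum kspan_base)
      fix m assume m: "m \<in> kP - L"
      show "- p m \<in> K" using pK subfieldD(6)[OF K] by blast
      have "lookup m v < r" using ler[of m] m by (auto simp: L_def)
      thus "mon id (\<rho> m) * v ^ lookup m v \<in> {mon id m * v ^ k | m k. m \<in> Monos B s \<and> k < r}"
        using \<rho>M m by blast
    qed
    finally show ?thesis by (simp only: eq)
  qed
  ultimately show ?thesis using c0 by (intro exI[of _ c] exI[of _ s] exI[of _ r]) auto
qed

text \<open>The equations of finitely many v are brought to the same leading coefficient and the
  same degree by multiplying them with each other's leading coefficient and with powers of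
  v.\<close>

lemma uniform_leading_coefficient:
  assumes B: "alg_indep K B" "finite B" and W: "finite W" "\<And>v. v \<in> W \<Longrightarrow> v \<notin> B \<Longrightarrow> \<not> alg_indep K (insert v B)"
  shows "\<exists>a s r. a \<noteq> 0 \<and> r \<ge> 1 \<and> a \<in> poly_span K id B s \<and>
     (\<forall>v\<in>W. a * v ^ r \<in> power_span K B s r v)"
  using W
proof (induction W rule: finite_induct)
  case empty
  have "1 \<noteq> (0::'a) \<and> (1::nat) \<ge> 1 \<and> 1 \<in> poly_span K id B 0" using kspan_Monos_1[OF K, of id B 0] by simp
  thus ?case by blast
next
  case (insert v W)
  obtain a s r where a: "a \<noteq> 0" "r \<ge> 1" "a \<in> poly_span K id B s"
    "\<forall>v\<in>W. a * v ^ r \<in> power_span K B s r v"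
    using insert.IH[OF insert.prems[OF insertI2]] by blast
  have "\<exists>b t q. b \<noteq> 0 \<and> q \<ge> 1 \<and> b \<in> poly_span K id B t \<and>
     b * v ^ q \<in> power_span K B t q v"
  proof (cases "v \<in> B")
    \<comment> \<open>An element of B satisfies the equation 1 v = v of degree 1, in which v on the
      right is a coefficient of degree 1 in B.\<close>
    case True
    have "mon id (single v 1) * v ^ 0 \<in> {mon id m * v ^ k | m k. m \<in> Monos B 1 \<and> k < 1}"
      using Monos_single[OF True, of 1 1] by blast
    hence "1 * v ^ 1 \<in> power_span K B 1 1 v"
      using kspan_gen[OF K] by simp
    thus ?thesis using kspan_Monos_1[OF K, of id B 1] by (intro exI[of _ 1]) auto
  next
    case False
    show ?thesis by (rule algebraic_leading_coefficient[OF B False]) (use insert.prems False in auto)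
  qed
  then obtain b t q where b: "b \<noteq> 0" "q \<ge> 1" "b \<in> poly_span K id B t"
     "b * v ^ q \<in> power_span K B t q v" by blast
  have raise: "y * z * w ^ i \<in> power_span K B (c + d) (e + i) w"
    if y: "y \<in> poly_span K id B c" and z: "z \<in> power_span K B d e w"
    for y z w c d e i
  proof -
    define Z where "Z = {mon id m * w ^ k | m k. m \<in> Monos B (c + d) \<and> k < e}"
    have "y * z \<in> kspan K Z"
    proof (rule kspan_mult[OF K y z])
      fix g h assume "g \<in> mon id ` Monos B c" "h \<in> {mon id m * w ^ k | m k. m \<in> Monos B d \<and> k < e}"
      then obtain m m' k where g: "m \<in> Monos B c" "g = mon id m" "m' \<in> Monos B d" "k < e" "h = mon id m' * w ^ k" by blast
      have "g * h = mon id (m + m') * w ^ k" by (simp add: g mon_add mult.assoc)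
      thus "g * h \<in> kspan K Z" unfolding Z_def using Monos_add[OF g(1,3)] g(4) by (intro kspan_gen[OF K]) blast
    qed
    moreover have "w ^ i \<in> kspan K {w ^ i}" by (intro kspan_gen[OF K]) simp
    ultimately show ?thesis
    proof (rule kspan_mult[OF K])
      fix g h assume "g \<in> Z" "h \<in> {w ^ i}"
      then obtain m k where g: "m \<in> Monos B (c + d)" "k < e" "g = mon id m * w ^ k" "h = w ^ i" unfolding Z_def by blast
      have "g * h = mon id m * w ^ (k + i)" by (simp add: g power_add)
      moreover have "k + i < e + i" using g by simp
      ultimately show "g * h \<in> power_span K B (c + d) (e + i) w"
        using g(1) by (intro kspan_gen[OF K]) blast
    qed
  qed
  have "a * b * w ^ (r + q) \<in> power_span K B (s + t) (r + q) w"
    if "w \<in> insert v W" for w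
  proof (cases "w = v")
    case True
    have e: "a * b * w ^ (r + q) = a * (b * v ^ q) * v ^ r" by (simp add: True power_add mult_ac)
    show ?thesis using raise[OF a(3) b(4), of r] unfolding e unfolding True by (simp only: add.commute[of q r])
  next
    case False
    hence w: "a * w ^ r \<in> power_span K B s r w" using a(4) that by blast
    have e: "a * b * w ^ (r + q) = b * (a * w ^ r) * w ^ q" by (simp add: power_add mult_ac)
    show ?thesis using raise[OF b(3) w, of q] unfolding e by (simp only: add.commute[of t s])
  qed
  moreover have "a * b \<noteq> 0" "r + q \<ge> 1" using a b by auto
  ultimately show ?case using kspan_Monos_mult[OF K a(3) b(3)]
    by (intro exI[of _ "a * b"] exI[of _ "s + t"] exI[of _ "r + q"] conjI ballI)
qed

text \<open>Relative to a maximal algebraically independent \<open>B \<subseteq> V\<close> with common leading coefficient \<open>a\<close>, every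
  monomial in \<open>V\<close> is, up to a power of \<open>a\<close>, a polynomial in \<open>B\<close> times one of finitely many monomials.\<close>

lemma spanning_monomials_upper_bound:
  assumes V: "finite V"
  shows "\<exists>B\<subseteq>V. alg_indep K B \<and> (\<exists>C s. \<forall>d. \<exists>G a. finite G \<and> card G \<le> C * (s * d + 1) ^ card B \<and>
     a \<noteq> 0 \<and> (\<forall>m\<in>Monos V d. a * mon id m \<in> kspan K G))"
proof -
  define A where "A = {B. B \<subseteq> V \<and> alg_indep K B}"
  have "finite A" by (rule finite_subset[of _ "Pow V"]) (use V in \<open>auto simp: A_def\<close>)
  moreover have "{} \<in> A" by (simp add: A_def alg_indep_empty)
  ultimately obtain B where B: "B \<in> A" "\<And>B'. B' \<in> A \<Longrightarrow> B \<subseteq> B' \<Longrightarrow> B = B'"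
    using finite_has_maximal[of A] by (metis empty_iff)
  have B': "B \<subseteq> V" "alg_indep K B" "finite B" using B(1) V finite_subset by (auto simp: A_def)
  have "\<not> alg_indep K (insert v B)" if "v \<in> V" "v \<notin> B" for v
    using B(2)[of "insert v B"] that B'(1) by (auto simp: A_def)
  then obtain a s r where a: "a \<noteq> 0" "r \<ge> 1" "a \<in> poly_span K id B s"
     "\<And>v. v \<in> V \<Longrightarrow> a * v ^ r \<in> power_span K B s r v"
    using uniform_leading_coefficient[OF B'(2,3) V] by blast
  \<comment> \<open>Only the first factor, the monomials in B, grows with d; the second one ranges
    over the finitely many monomials in V with exponents below r.\<close>
  define G where "G d = (\<lambda>(m, e). mon id m * mon id e) ` (Monos B d \<times> Box V (r - 1))" for d
  have GI: "mon id m * mon id e \<in> kspan K (G d)" if "m \<in> Monos B d" "e \<in> Box V (r - 1)" for m e d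
    unfolding G_def using that by (intro kspan_gen[OF K]) force
  have step0: "a * y \<in> kspan K (G (s + d))" if "y \<in> kspan K (G d)" for y d
  proof (rule kspan_mult[OF K a(3) that])
    fix g h assume "g \<in> mon id ` Monos B s" "h \<in> G d"
    then obtain m m' e where g: "m \<in> Monos B s" "g = mon id m" "m' \<in> Monos B d" "e \<in> Box V (r - 1)"
      "h = mon id m' * mon id e" unfolding G_def by force
    show "g * h \<in> kspan K (G (s + d))" using GI[OF Monos_add[OF g(1,3)] g(4)] by (simp add: g mon_add mult.assoc)
  qed
  have step1: "(a * v) * y \<in> kspan K (G (s + d))" if v: "v \<in> V" and y: "y \<in> kspan K (G d)" for v y d
  proof -
    have "(a * v) * h \<in> kspan K (G (s + d))" if "h \<in> G d" for h
    proof -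
      obtain m e where h: "m \<in> Monos B d" "e \<in> Box V (r - 1)" "h = mon id m * mon id e"
        using \<open>h \<in> G d\<close> unfolding G_def by force
      show ?thesis
      \<comment> \<open>Multiplication by v either keeps the exponent of v below r or produces v^r.
        The latter is rewritten by the equation of v, at the cost of a factor a and of s in the
        degree in B.\<close>
      proof (cases "lookup e v + 1 < r")
        case True
        have "keys (e + single v 1) \<subseteq> V"
          using Poly_Mapping.keys_add[of e "single v 1"] h(2) v by (auto simp: Box_def split: if_splits)
        hence e': "e + single v 1 \<in> Box V (r - 1)"
          using h(2) True by (auto simp: Box_def lookup_add lookup_single when_def)
        have "mon id m * mon id (e + single v 1) \<in> kspan K (G d)" by (rule GI[OF h(1) e'])
        from step0[OF this] show ?thesis by (simp add: h(3) mon_add mult_ac)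
      next
        case False
        hence ev: "lookup e v + 1 = r" using h(2) a(2) by (simp add: Box_def) (metis Suc_pred' diff_Suc_1 le_antisym not_less not_less_eq_eq One_nat_def Suc_le_eq)
        define e' where "e' = Poly_Mapping.update v 0 e"
        have "mon id e = mon id e' * v ^ lookup e v"
          using arg_cong[OF mon_split, of "mon id" e v] by (simp add: mon_add e'_def)
        hence eq: "(a * v) * h = (a * v ^ r) * (mon id m * mon id e')"
          using ev by (simp add: h(3) mult_ac flip: power_Suc)
        have "mon id m * mon id e' \<in> kspan K {mon id m * mon id e'}" by (intro kspan_gen[OF K]) simp
        show ?thesis unfolding eq
        proof (rule kspan_mult[OF K a(4)[OF v] \<open>mon id m * mon id e' \<in> _\<close>])
          fix g g' assume "g \<in> {mon id m * v ^ k | m k. m \<in> Monos B s \<and> k < r}" "g' \<in> {mon id m * mon id e'}"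
          then obtain m' k where g: "m' \<in> Monos B s" "k < r" "g = mon id m' * v ^ k" "g' = mon id m * mon id e'" by blast
          have "keys (e' + single v k) \<subseteq> V"
            using Poly_Mapping.keys_add[of e' "single v k"] h(2) v
            by (auto simp: Box_def e'_def keys_update_0 split: if_splits)
          hence "e' + single v k \<in> Box V (r - 1)"
            using h(2) g(2) by (auto simp: Box_def e'_def lookup_add lookup_single lookup_update when_def)
          from GI[OF Monos_add[OF g(1) h(1)] this]
          show "g * g' \<in> kspan K (G (s + d))" by (simp add: g mon_add mult_ac)
        qed
      qed
    qed
    moreover have "a * v \<in> kspan K {a * v}" by (intro kspan_gen[OF K]) simp
    ultimately show ?thesis using kspan_mult[OF K _ y, of "a * v" "{a * v}"] by blast
  qed
  have main: "a ^ d * mon id m \<in> kspan K (G (s * d))" if "m \<in> Monos V d" for m d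
    using that
  proof (induction d arbitrary: m)
    case 0
    have "0 \<in> Monos B (s * 0)" "0 \<in> Box V (r - 1)" by (simp_all add: Box_def)
    from GI[OF this] show ?case using 0 by simp
  next
    case (Suc d)
    from Suc.prems show ?case
    proof (cases rule: Monos_SucE)
      case 1
      from step0[OF Suc.IH[OF 1]] show ?thesis by (simp add: mult_ac)
    next
      case (2 v m')
      have e: "a ^ Suc d * mon id m = (a * v) * (a ^ d * mon id m')" by (simp add: 2(3) mon_add mult_ac)
      show ?thesis unfolding e mult_Suc_right by (rule step1[OF 2(1) Suc.IH[OF 2(2)]])
    qed
  qed
  have fin: "finite (Monos B d \<times> Box V (r - 1))" for d using finite_Monos[OF B'(3)] card_Box(1)[OF V] by blast
  have "card (G (s * d)) \<le> r ^ card V * (s * d + 1) ^ card B" for d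
  proof -
    have "card (G (s * d)) \<le> card (Monos B (s * d)) * card (Box V (r - 1))"
      unfolding G_def card_cartesian_product[symmetric] by (rule card_image_le[OF fin])
    also have "\<dots> \<le> (s * d + 1) ^ card B * r ^ card V"
      using card_Monos_le[OF B'(3), of "s * d"] a(2) by (intro mult_le_mono) (auto simp: card_Box(2)[OF V])
    finally show ?thesis by (simp add: mult.commute)
  qed
  moreover have "finite (G d)" for d unfolding G_def by (intro finite_imageI fin)
  ultimately have "\<exists>G' a'. finite G' \<and> card G' \<le> r ^ card V * (s * d + 1) ^ card B \<and> a' \<noteq> 0 \<and>
      (\<forall>m\<in>Monos V d. a' * mon id m \<in> kspan K G')" for d
    using main a(1) by (intro exI[of _ "G (s * d)"] exI[of _ "a ^ d"]) auto
  thus ?thesis using B'(1,2) by blast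
qed

end

lemma Monos_image:
  "m \<in> Monos I d \<Longrightarrow> \<exists>m'\<in>Monos (x ` I) d. mon id m' = mon x m"
proof (induction d arbitrary: m)
  case (Suc d)
  from Suc.prems show ?case
  proof (cases rule: Monos_SucE)
    case 1
    then obtain m' where "m' \<in> Monos (x ` I) d" "mon id m' = mon x m" using Suc.IH by blast
    thus ?thesis using Monos_mono[of "x ` I" "x ` I" d "Suc d", OF subset_refl le_SucI[OF le_refl]] by blast
  next
    case (2 v m')
    then obtain m'' where m'': "m'' \<in> Monos (x ` I) d" "mon id m'' = mon x m'" using Suc.IH by blast
    have "m'' + single (x v) 1 \<in> Monos (x ` I) (d + 1)"
      by (intro Monos_add m'' Monos_single) (use 2 in auto)
    moreover have "mon id (m'' + single (x v) 1) = mon x m"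
      unfolding 2(3) mon_add m''(2) by simp
    ultimately show ?thesis by (intro bexI[of _ "m'' + single (x v) 1"]) (assumption, simp)
  qed
qed (simp add: exI[of _ 0])

text \<open>If t > b, the inequality already fails at d = C (k + 1)^b.\<close>

lemma power_growth:
  assumes "\<And>d::nat. (d + 1) ^ t \<le> C * (k * d + 1) ^ b" shows "t \<le> b"
proof (rule ccontr)
  assume "\<not> t \<le> b"
  define D where "D = C * (k + 1) ^ b"
  have "(D + 1) ^ (b + 1) \<le> (D + 1) ^ t" using \<open>\<not> t \<le> b\<close> by (intro power_increasing) auto
  also have "\<dots> \<le> C * (k * D + 1) ^ b" by (rule assms)
  also have "\<dots> \<le> C * ((k + 1) * (D + 1)) ^ b" by (intro mult_le_mono power_mono) auto
  also have "\<dots> = D * (D + 1) ^ b" by (simp only: D_def power_mult_distrib mult.assoc)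
  finally have "(D + 1) * (D + 1) ^ b \<le> D * (D + 1) ^ b" by (simp only: power_add power_one_right mult.commute)
  thus False by simp
qed

text \<open>For S independent over K, the monomials of degree at most k d in the x_i have rank at
  least (d + 1)^|S|; for a maximal independent B among the y_i, those in the y_i have rank O(d^|B|).
  Only ranks are transferred; there is no map between the two fields.\<close>

lemma trdeg_le:
  fixes x :: "'v \<Rightarrow> 'a::field" and y :: "'v \<Rightarrow> 'b::field"
  assumes K: "subfield_of_type K" and L: "subfield_of_type L" and I: "finite I"
    and transfer: "\<And>d N. N \<subseteq> Monos I d \<Longrightarrow> mon_indep K x N \<Longrightarrow>
      \<exists>N'\<subseteq>Monos I d. mon_indep L y N' \<and> card N \<le> card N'"
  shows "trdeg K (x ` I) \<le> trdeg L (y ` I)"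
  unfolding trdeg_def[of K]
proof (rule SUP_least)
  fix S assume "S \<in> {S. finite S \<and> S \<subseteq> adjoin K (x ` I) \<and> alg_indep K S}"
  hence S: "finite S" "S \<subseteq> adjoin K (x ` I)" "alg_indep K S" by auto
  obtain k where k: "\<And>d N. finite N \<Longrightarrow> mon x ` Monos I (k * d) \<subseteq> kspan K (mon x ` N) \<Longrightarrow> (d + 1) ^ card S \<le> card N"
    using spanning_monomials_lower_bound[OF K I S] by blast
  obtain B C s where B: "B \<subseteq> y ` I" "alg_indep L B"
    and ub: "\<And>d. \<exists>G a. finite G \<and> card G \<le> C * (s * d + 1) ^ card B \<and> a \<noteq> 0 \<and> (\<forall>m\<in>Monos (y ` I) d. a * mon id m \<in> kspan L G)"
    using spanning_monomials_upper_bound[OF L finite_imageI[OF I], of y] by blast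
  have "(d + 1) ^ card S \<le> C * (s * k * d + 1) ^ card B" for d
  proof -
    obtain N where N: "N \<subseteq> Monos I (k * d)" "mon_indep K x N" "mon x ` Monos I (k * d) \<subseteq> kspan K (mon x ` N)"
      using maximal_mon_indep[OF K finite_Monos[OF I]] by blast
    obtain N' where N': "N' \<subseteq> Monos I (k * d)" "mon_indep L y N'" "card N \<le> card N'" using transfer[OF N(1,2)] by blast
    obtain G a where G: "finite G" "card G \<le> C * (s * (k * d) + 1) ^ card B" "a \<noteq> 0"
      "\<And>m. m \<in> Monos (y ` I) (k * d) \<Longrightarrow> a * mon id m \<in> kspan L G" using ub[of "k * d"] by blast
    have fN: "finite N" "finite N'" using N(1) N'(1) finite_Monos[OF I] by (metis finite_subset)+
    have "card N' \<le> card G"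
    proof (rule ccontr)
      assume "\<not> ?thesis"
      moreover have "a * mon y m \<in> kspan L G" if "m \<in> N'" for m
        using Monos_image[of m I "k * d" y] N'(1) G(4) that by force
      ultimately have "\<exists>w. (\<forall>l. w l \<in> L) \<and> (\<exists>l\<in>N'. w l \<noteq> 0) \<and> (\<Sum>l\<in>N'. w l * (a * mon y l)) = 0"
        using G(1) fN(2) by (intro kspan_dependent[OF L]) auto
      then obtain w where w: "\<And>l. w l \<in> L" "\<exists>l\<in>N'. w l \<noteq> 0" "(\<Sum>l\<in>N'. w l * (a * mon y l)) = 0" by blast
      have "a * (\<Sum>l\<in>N'. w l * mon y l) = 0" using w(3) by (simp add: sum_distrib_left mult_ac)
      hence "(\<Sum>l\<in>N'. w l * mon y l) = 0" using G(3) by simp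
      thus False using w(1,2) mon_indepD[OF N'(2)] by blast
    qed
    thus ?thesis using k[OF fN(1) N(3)] N'(3) G(2) by (simp add: mult.assoc)
  qed
  hence "card S \<le> card B" by (rule power_growth)
  hence "enat (card S) \<le> enat (card B)" by simp
  also have "\<dots> \<le> trdeg L (y ` I)" unfolding trdeg_def
  proof (rule SUP_upper)
    have "B \<subseteq> adjoin L (y ` I)" using B(1) unfolding adjoin_def by blast
    moreover have "finite B" using B(1) I finite_subset by blast
    ultimately show "B \<in> {S. finite S \<and> S \<subseteq> adjoin L (y ` I) \<and> alg_indep L S}" using B(2) by simp
  qed
  finally show "enat (card S) \<le> trdeg L (y ` I)" .
qed

section \<open>Relations between values\<close>

lemma tame_rescale:
  assumes f: "tame f" and a: "a \<in> Qbar"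
  shows "tame (Abs_fps (\<lambda>n. a ^ n * fps_nth f n))"
proof -
  obtain C D where tb: "tame_bounds C D f" using f unfolding tame_def by blast
  obtain d :: nat where d: "d > 0" "algebraic_int (of_nat d * a)" using a by (auto simp: Qbar_iff)
  obtain R where R: "R > 0" "conj_bound R a" using Qbar_conj_bound[OF a] by blast
  define B where "B = d + nat \<lceil>R\<rceil>"
  have RB: "conj_bound (real B) a" using conj_bound_mono[OF R(2), of "real B"] R(1) unfolding B_def by linarith
  have B: "d \<le> B" "B \<ge> 1" using d by (simp_all add: B_def)
  have "conj_bound (real B ^ n) (a ^ n)" for n
  proof (induction n)
    case 0
    show ?case using conj_bound_of_nat[of 1] by simp
  next
    case (Suc n)
    show ?case using conj_bound_mult[OF RB Suc] by simp
  qed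
  hence pw: "conj_bound (real B ^ (n + 1)) (a ^ n)" for n
    by (rule conj_bound_mono) (use B in \<open>auto intro: power_increasing\<close>)
  have "tame_bounds (C * B) (\<lambda>n. D n * d ^ n) (Abs_fps (\<lambda>n. a ^ n * fps_nth f n))"
    unfolding tame_bounds_def
  proof (intro conjI allI impI)
    fix n
    show "0 < D n * d ^ n" using tb d by (simp add: tame_bounds_def)
    have "d ^ n \<le> B ^ n" using B by (intro power_mono) auto
    also have "\<dots> \<le> B ^ (n + 1)" using B by (intro power_increasing) auto
    finally show "D n * d ^ n \<le> (C * B) ^ (n + 1)"
      unfolding power_mult_distrib using tb by (intro mult_le_mono) (auto simp: tame_bounds_def)
    show "algebraic_int (of_nat (D n * d ^ n) * (fps_nth (Abs_fps (\<lambda>n. a ^ n * fps_nth f n)) i / fact i))" if "i \<le> n" for i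
    proof -
      have "d ^ n = d ^ (n - i) * d ^ i" using that by (simp add: power_add[symmetric])
      hence "of_nat (D n * d ^ n) * (fps_nth (Abs_fps (\<lambda>n. a ^ n * fps_nth f n)) i / fact i) =
        of_nat (d ^ (n - i)) * ((of_nat d * a) ^ i * (of_nat (D n) * (fps_nth f i / fact i)))"
        by (simp add: power_mult_distrib mult_ac)
      moreover have "algebraic_int (of_nat (D n) * (fps_nth f i / fact i))" using tb that by (simp add: tame_bounds_def)
      ultimately show ?thesis
        using algebraic_int_scale_of_nat[OF algebraic_int_add_mult(2)[OF algebraic_int_power[OF d(2)]]] by metis
    qed
    have "conj_bound (real C ^ (n + 1)) (fps_nth f n / fact n)" using tb by (simp add: tame_bounds_def)
    from conj_bound_mult[OF this pw, of n]
    show "conj_bound (real (C * B) ^ (n + 1)) (fps_nth (Abs_fps (\<lambda>n. a ^ n * fps_nth f n)) n / fact n)"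
      by (simp add: power_mult_distrib mult_ac)
  qed
  thus ?thesis unfolding tame_def by blast
qed

section \<open>Polynomial systems for functions and their monomials\<close>

lemma fls_of_poly_mult: "fls_of_poly (p * q) = fls_of_poly p * fls_of_poly q"
  by (simp add: fps_of_poly_mult fls_times_fps_to_fls)

lemma fls_of_poly_eq_iff: "fls_of_poly p = fls_of_poly q \<longleftrightarrow> p = q"
  by (simp add: fps_of_poly_eq_iff)

lemma fls_of_poly_eq_0_iff: "fls_of_poly p = 0 \<longleftrightarrow> p = 0"
  using fls_of_poly_eq_iff[of p 0] by simp

text \<open>Membership in \<open>Qbar_ratfuns\<close> gives a fraction with algebraic coefficients,
  absence of a pole one with complex coefficients and denominator non-zero at c. Cancelling the
  common power of z - c from the first gives it the second property as well.\<close>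

lemma regular_fraction:
  assumes r: "r \<in> Qbar_ratfuns" "\<not> ratfun_pole r c" and c: "c \<in> Qbar" "c \<noteq> 0"
  shows "\<exists>p q. p \<in> QP \<and> q \<in> QP \<and> poly q c \<noteq> 0 \<and> fls_of_poly q * r = fls_of_poly p"
proof -
  obtain p' q' where 1: "r = fls_of_poly p' / fls_of_poly q'" "p' \<in> QP" "q' \<in> QP" "q' \<noteq> 0"
    using r(1) unfolding Qbar_ratfuns_def by blast
  obtain p q where 2: "poly q c \<noteq> 0" "r = fls_of_poly p / fls_of_poly q"
    using r(2) unfolding ratfun_pole_def by blast
  have nz: "fls_of_poly q \<noteq> 0" "fls_of_poly q' \<noteq> 0" using 1(4) 2(1) by (auto simp: fls_of_poly_eq_0_iff)
  have "fls_of_poly (p' * q) = fls_of_poly (p * q')"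
    using 1(1) 2(2) nz by (simp add: fls_of_poly_mult frac_eq_eq)
  hence pq: "p' * q = p * q'" by (simp only: fls_of_poly_eq_iff)
  define w where "w b = (if b then p' else q')" for b
  have "\<exists>t w'. (\<forall>b\<in>UNIV. w b = [:-c, 1:] ^ t * w' b \<and> w' b \<in> QP) \<and> (\<exists>b\<in>UNIV. poly (w' b) c \<noteq> 0)"
    by (rule strip_linear_factor) (use 1 c in \<open>auto simp: w_def intro!: exI[of _ False]\<close>)
  then obtain t w' where w': "\<And>b. w b = [:-c, 1:] ^ t * w' b" "\<And>b. w' b \<in> QP" "\<exists>b. poly (w' b) c \<noteq> 0" by auto
  have l0: "[:-c, 1:] ^ t \<noteq> 0" by simp
  have "[:-c, 1:] ^ t * (w' True * q) = [:-c, 1:] ^ t * (p * w' False)"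
    using pq w'(1)[of True] w'(1)[of False] by (simp only: w_def if_True if_False mult_ac)
  hence e: "w' True * q = p * w' False" by (simp only: mult_left_cancel[OF l0])
  have "poly (w' False) c \<noteq> 0"
  proof
    assume 0: "poly (w' False) c = 0"
    hence "poly (w' True) c = 0" using arg_cong[OF e, of "\<lambda>p. poly p c"] 2(1) by simp
    thus False using w'(3) 0 by (metis (full_types))
  qed
  moreover have "fls_of_poly (w' False) * r = fls_of_poly (w' True)"
  proof -
    have "r * fls_of_poly q = fls_of_poly p" using 2(2) nz by simp
    have "fls_of_poly (w' False) * r * fls_of_poly q = (r * fls_of_poly q) * fls_of_poly (w' False)"
      by (simp only: mult_ac)
    also have "\<dots> = fls_of_poly (p * w' False)"
      by (simp only: \<open>r * fls_of_poly q = fls_of_poly p\<close> fls_of_poly_mult)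
    also have "\<dots> = fls_of_poly (w' True) * fls_of_poly q" by (simp only: e[symmetric] fls_of_poly_mult)
    finally have "fls_of_poly (w' False) * r * fls_of_poly q = fls_of_poly (w' True) * fls_of_poly q" .
    thus ?thesis using nz by simp
  qed
  ultimately show ?thesis using w'(2) by blast
qed

lemma polynomial_system:
  fixes f :: "nat \<Rightarrow> complex fps"
  assumes A: "\<And>i j. i < n \<Longrightarrow> j < n \<Longrightarrow> A i j \<in> Qbar_ratfuns" "\<And>i j. i < n \<Longrightarrow> j < n \<Longrightarrow> \<not> ratfun_pole (A i j) c"
    and c: "c \<in> Qbar" "c \<noteq> 0"
    and sys: "\<And>i. i < n \<Longrightarrow> fps_to_fls (fps_deriv (f i)) = (\<Sum>j<n. A i j * fps_to_fls (f j))"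
  shows "\<exists>T G. T \<in> QP \<and> poly T c \<noteq> 0 \<and> (\<forall>i<n. \<forall>j<n. G i j \<in> QP) \<and>
    (\<forall>i<n. fps_of_poly T * fps_deriv (f i) = (\<Sum>j<n. fps_of_poly (G i j) * f j))"
proof -
  define R where "R i j x \<longleftrightarrow> fst x \<in> QP \<and> snd x \<in> QP \<and> poly (snd x) c \<noteq> 0 \<and>
    fls_of_poly (snd x) * A i j = fls_of_poly (fst x)" for i j and x :: "complex poly \<times> complex poly"
  define p where "p i j = fst (SOME x. R i j x)" for i j
  define q where "q i j = snd (SOME x. R i j x)" for i j
  have pq: "p i j \<in> QP \<and> q i j \<in> QP \<and> poly (q i j) c \<noteq> 0 \<and> fls_of_poly (q i j) * A i j = fls_of_poly (p i j)"
    if ij: "i < n" "j < n" for i j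
  proof -
    have "\<exists>x. R i j x" using regular_fraction[OF A[OF ij] c] by (force simp: R_def)
    hence "R i j (SOME x. R i j x)" by (rule someI_ex)
    thus ?thesis by (simp add: R_def p_def q_def)
  qed
  define W where "W = {..<n} \<times> {..<n}"
  define q' where "q' w = q (fst w) (snd w)" for w
  define T where "T = (\<Prod>w\<in>W. q' w)"
  define G where "G i j = p i j * (\<Prod>w\<in>W - {(i, j)}. q' w)" for i j
  have "T \<in> QP" unfolding T_def using pq by (intro QP_prod) (auto simp: W_def q'_def)
  moreover have "poly T c \<noteq> 0" unfolding T_def poly_prod using pq by (auto simp: W_def q'_def)
  moreover have "G i j \<in> QP" if "i < n" "j < n" for i j
    unfolding G_def using pq that by (intro QP_mult QP_prod) (auto simp: W_def q'_def)
  moreover have "fps_of_poly T * fps_deriv (f i) = (\<Sum>j<n. fps_of_poly (G i j) * f j)" if i: "i < n" for i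
  proof -
    have TA: "fls_of_poly T * A i j = fls_of_poly (G i j)" if j: "j < n" for j
    proof -
      have "T = q i j * (\<Prod>w\<in>W - {(i, j)}. q' w)"
        unfolding T_def using i j by (subst prod.remove[of _ "(i, j)"]) (auto simp: W_def q'_def)
      hence "fls_of_poly T * A i j = (fls_of_poly (q i j) * A i j) * fls_of_poly (\<Prod>w\<in>W - {(i, j)}. q' w)"
        by (simp only: fls_of_poly_mult mult_ac)
      thus ?thesis using pq[OF i j] by (simp only: G_def fls_of_poly_mult)
    qed
    have "fps_to_fls (fps_of_poly T * fps_deriv (f i)) = (\<Sum>j<n. (fls_of_poly T * A i j) * fps_to_fls (f j))"
      by (simp only: fls_times_fps_to_fls sys[OF i] sum_distrib_left mult.assoc)
    also have "\<dots> = (\<Sum>j<n. fls_of_poly (G i j) * fps_to_fls (f j))" by (intro sum.cong refl) (simp add: TA)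
    also have "\<dots> = fps_to_fls (\<Sum>j<n. fps_of_poly (G i j) * f j)" by (simp only: fps_to_fls_sum fls_times_fps_to_fls)
    finally show ?thesis by (simp only: fps_to_fls_eq_iff)
  qed
  ultimately show ?thesis by (intro exI[of _ T] exI[of _ G]) auto
qed

text \<open>Two cases occur: D = {d} for homogeneous relations and D = {0..d} for transcendence
  degrees.\<close>

definition degree_class :: "'v set \<Rightarrow> nat set \<Rightarrow> ('v \<Rightarrow>\<^sub>0 nat) set" where
  "degree_class V D = {m. keys m \<subseteq> V \<and> mdeg m \<in> D}"

lemma Monos_degree_class: "Monos V d = degree_class V {..d}"
  by (auto simp: Monos_def degree_class_def)

lemma finite_degree_class:
  assumes "finite V" "finite D" shows "finite (degree_class V D)"
proof -
  have "degree_class V D \<subseteq> Monos V (\<Sum>D)"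
    using member_le_sum[of _ D id] assms(2) by (auto simp: degree_class_def Monos_def)
  thus ?thesis using finite_Monos[OF assms(1)] finite_subset by blast
qed

text \<open>Differentiation along the system preserves the degree of monomials in the f_i, and by
  the product rule the denominator T does not change; so regularity at the point is
  inherited.\<close>

lemma monomial_system:
  fixes f :: "'v \<Rightarrow> complex fps"
  assumes I: "finite I" and G: "\<And>i j. i \<in> I \<Longrightarrow> j \<in> I \<Longrightarrow> G i j \<in> QP" and D: "finite D"
    and sys: "\<And>i. i \<in> I \<Longrightarrow> fps_of_poly T * fps_deriv (f i) = (lincomb I (G i) f)"
  shows "\<exists>G'. (\<forall>m m'. G' m m' \<in> QP) \<and> (\<forall>m\<in>degree_class I D. fps_of_poly T * fps_deriv (mon f m) =
    (lincomb (degree_class I D) (G' m) (mon f)))"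
proof -
  define M where "M d = degree_class I {d}" for d
  have fM: "finite (M d)" for d unfolding M_def by (intro finite_degree_class I) simp
  define sp where "sp d = {h. \<exists>w. (\<forall>m. w m \<in> QP) \<and> h = (lincomb (M d) w (mon f))}" for d
  have sp0: "0 \<in> sp d" for d unfolding sp_def by (intro CollectI exI[of _ "\<lambda>_. 0"]) auto
  have sp_add: "g + h \<in> sp d" if gh: "g \<in> sp d" "h \<in> sp d" for g h d
  proof -
    obtain w w' where "\<And>m. w m \<in> QP" "g = (lincomb (M d) w (mon f))"
      "\<And>m. w' m \<in> QP" "h = (lincomb (M d) w' (mon f))" using gh unfolding sp_def by blast
    thus ?thesis unfolding sp_def
      by (intro CollectI exI[of _ "\<lambda>m. w m + w' m"]) (auto simp: fps_of_poly_add distrib_right sum.distrib)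
  qed
  have sp_sum: "(\<Sum>i\<in>A. g i) \<in> sp d" if "\<And>i. i \<in> A \<Longrightarrow> g i \<in> sp d" for A :: "'x set" and g d
    using that by (induction A rule: infinite_finite_induct) (auto intro: sp0 sp_add)
  have sp_gen: "fps_of_poly p * mon f m \<in> sp d" if p: "p \<in> QP" "m \<in> M d" for p m d
  proof -
    have "(\<Sum>l\<in>M d. fps_of_poly (if l = m then p else 0) * mon f l) = (\<Sum>l\<in>M d. if l = m then fps_of_poly p * mon f l else 0)"
      by (intro sum.cong) auto
    also have "\<dots> = fps_of_poly p * mon f m" using fM p by (simp add: sum.delta)
    finally show ?thesis unfolding sp_def using p(1)
      by (intro CollectI exI[of _ "\<lambda>l. if l = m then p else 0"]) auto
  qed
  have M_Suc: "m + single v 1 \<in> M (Suc d)" if "m \<in> M d" "v \<in> I" for m v d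
    using that Poly_Mapping.keys_add[of m "Poly_Mapping.single v 1"] by (auto simp: M_def degree_class_def mdeg_add split: if_splits)
  have mon_Suc: "mon f (m + single v 1) = mon f m * f v" for m v by (simp add: mon_add)
  have sp_times: "h * f v \<in> sp (Suc d)" if h: "h \<in> sp d" "v \<in> I" for h v d
  proof -
    obtain w where w: "\<And>m. w m \<in> QP" "h = (lincomb (M d) w (mon f))" using h unfolding sp_def by blast
    have "h * f v = (\<Sum>m\<in>M d. fps_of_poly (w m) * mon f (m + single v 1))"
      unfolding w(2) sum_distrib_right mon_Suc by (simp only: mult.assoc)
    also have "\<dots> \<in> sp (Suc d)" using w(1) h(2) by (intro sp_sum sp_gen M_Suc)
    finally show ?thesis .
  qed
  have der: "fps_of_poly T * fps_deriv (mon f m) \<in> sp d" if "m \<in> M d" for m d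
    using that
  proof (induction d arbitrary: m)
    case 0
    hence "m \<in> Monos I 0" by (simp add: M_def degree_class_def Monos_def)
    thus ?case using sp0 by simp
  next
    case (Suc d)
    hence "m \<noteq> 0" by (auto simp: M_def degree_class_def)
    then obtain v m' where v: "v \<in> keys m" "Poly_Mapping.keys m' \<subseteq> keys m"
      "m = m' + single v 1" by (rule monomial_cases)
    have m': "m' \<in> M d" and vI: "v \<in> I" using Suc.prems v by (auto simp: M_def degree_class_def mdeg_add)
    have "fps_of_poly T * fps_deriv (mon f m) = (fps_of_poly T * fps_deriv (mon f m')) * f v + mon f m' * (fps_of_poly T * fps_deriv (f v))"
      unfolding v(3) mon_Suc by (simp add: algebra_simps)
    also have "mon f m' * (fps_of_poly T * fps_deriv (f v)) = (\<Sum>j\<in>I. fps_of_poly (G v j) * mon f (m' + single j 1))"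
      unfolding sys[OF vI] mon_Suc sum_distrib_left by (simp only: mult_ac)
    also have "(fps_of_poly T * fps_deriv (mon f m')) * f v + \<dots> \<in> sp (Suc d)"
      using G vI by (intro sp_add sp_times Suc.IH m' sp_sum sp_gen M_Suc)
    finally show ?case .
  qed
  have "\<forall>m. \<exists>w. (\<forall>m'. w m' \<in> QP) \<and> (m \<in> degree_class I D \<longrightarrow> fps_of_poly T * fps_deriv (mon f m) =
      (lincomb (M (mdeg m)) w (mon f)))"
  proof
    fix m show "\<exists>w. (\<forall>m'. w m' \<in> QP) \<and> (m \<in> degree_class I D \<longrightarrow> fps_of_poly T * fps_deriv (mon f m) =
      (lincomb (M (mdeg m)) w (mon f)))"
    proof (cases "m \<in> degree_class I D")
      case True
      hence "m \<in> M (mdeg m)" by (simp add: M_def degree_class_def)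
      from der[OF this] show ?thesis unfolding sp_def by blast
    next
      case False
      thus ?thesis by (intro exI[of _ "\<lambda>_. 0"]) simp
    qed
  qed
  from choice[OF this] obtain w where w': "\<forall>m. (\<forall>m'. w m m' \<in> QP) \<and> (m \<in> degree_class I D \<longrightarrow>
      fps_of_poly T * fps_deriv (mon f m) = (lincomb (M (mdeg m)) (w m) (mon f)))" by (elim exE)
  have w: "w m m' \<in> QP" "m \<in> degree_class I D \<Longrightarrow> fps_of_poly T * fps_deriv (mon f m) =
      (lincomb (M (mdeg m)) (w m) (mon f))" for m m' using w' by simp_all
  define G' where "G' m m' = (if m' \<in> M (mdeg m) then w m m' else 0)" for m m'
  have "(lincomb (degree_class I D) (G' m) (mon f)) = (lincomb (M (mdeg m)) (w m) (mon f))"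
    if m: "m \<in> degree_class I D" for m
  proof -
    have "M (mdeg m) \<subseteq> degree_class I D" using m by (auto simp: M_def degree_class_def)
    hence "(lincomb (degree_class I D) (G' m) (mon f)) = (lincomb (M (mdeg m)) (G' m) (mon f))"
      using finite_degree_class[OF I D] by (intro sum.mono_neutral_right) (auto simp: G'_def)
    thus ?thesis by (simp add: G'_def)
  qed
  moreover have "G' m m' \<in> QP" for m m' using w(1) by (simp add: G'_def)
  ultimately show ?thesis using w(2) by (intro exI[of _ G']) auto
qed

lemma mon_compose:
  fixes f :: "'v \<Rightarrow> complex fps"
  assumes "fps_nth s 0 = 0"
  shows "fps_compose (mon f m) s = mon (\<lambda>i. fps_compose (f i) s) m"
  unfolding mon_def fps_compose_prod_distrib[OF assms] by (intro prod.cong refl) (simp add: fps_compose_power[OF assms])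

lemma is_Ramis_sum_mon:
  "(\<And>i. i \<in> keys m \<Longrightarrow> is_Ramis_sum (f i) \<theta> (F i)) \<Longrightarrow> is_Ramis_sum (mon f m) \<theta> (\<lambda>z. mon (\<lambda>i. F i z) m)"
  unfolding mon_def by (intro is_Ramis_sum_prod is_Ramis_sum_power)

lemma tame_mon: "(\<And>i. i \<in> keys m \<Longrightarrow> tame (f i)) \<Longrightarrow> tame (mon f m)"
proof -
  assume f: "\<And>i. i \<in> keys m \<Longrightarrow> tame (f i)"
  have one: "tame 1" using tame_const[OF Qbar_1] by simp
  have pw: "tame (g ^ k)" if "tame g" for g k
    by (induction k) (use that one in \<open>auto intro: tame_mult\<close>)
  have "tame (\<Prod>v\<in>A. f v ^ lookup m v)" if "A \<subseteq> keys m" for A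
    using that by (induction A rule: infinite_finite_induct) (use one f pw in \<open>auto intro: tame_mult\<close>)
  thus ?thesis unfolding mon_def by blast
qed

locale regular_values =
  fixes I :: "'v set" and f :: "'v \<Rightarrow> complex fps" and T G and \<xi> :: complex and \<theta> :: real
  assumes H: "\<And>(h :: complex fps) (\<phi> :: real).
      \<lbrakk>Eh_function h; - pi / 2 < \<phi>; \<phi> < pi / 2; \<not> anti_Stokes h \<phi>; Ramis_sum h \<phi> 1 = 0\<rbrakk>
        \<Longrightarrow> Eh_function (h / (fps_X - 1))"
    and I: "finite I"
    and tame_f: "\<And>i. i \<in> I \<Longrightarrow> tame (f i)"
    and T: "T \<in> QP" "poly T (1 / \<xi>) \<noteq> 0"
    and G: "\<And>i j. i \<in> I \<Longrightarrow> j \<in> I \<Longrightarrow> G i j \<in> QP"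
    and sys: "\<And>i. i \<in> I \<Longrightarrow> fps_of_poly T * fps_deriv (f i) = (lincomb I (G i) f)"
    and xi: "\<xi> \<in> Qbar" "\<xi> \<noteq> 0"
    and theta: "Arg \<xi> - pi / 2 < \<theta>" "\<theta> < Arg \<xi> + pi / 2"
    and not_anti_Stokes: "\<And>i. i \<in> I \<Longrightarrow> \<not> anti_Stokes (f i) \<theta>"
begin

definition val :: "'v \<Rightarrow> complex" where "val i = Ramis_sum (f i) \<theta> (1 / \<xi>)"

lemma f_sum: "i \<in> I \<Longrightarrow> is_Ramis_sum (f i) \<theta> (Ramis_sum (f i) \<theta>)"
  by (intro Ramis_sum_is_Ramis_sum not_anti_Stokes)

lemma Arg_direction: "Arg (cis (- (\<theta> - Arg \<xi>))) = - (\<theta> - Arg \<xi>)"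
  using theta pi_gt_zero by (intro Arg_cis) auto

text \<open>Summation respects sums and products, and by uniqueness the zero series has the sum
  0.\<close>

lemma specialise:
  assumes M: "finite M" "\<And>m. m \<in> M \<Longrightarrow> keys m \<subseteq> I"
    and rel: "(lincomb M b (mon f)) = 0"
  shows "(\<Sum>m\<in>M. poly (b m) (1 / \<xi>) * mon val m) = 0"
proof -
  define F where "F z = (\<Sum>m\<in>M. poly (b m) z * mon (\<lambda>i. Ramis_sum (f i) \<theta> z) m)" for z
  have "is_Ramis_sum (lincomb M b (mon f)) \<theta> F"
    unfolding F_def using M(2) by (intro is_Ramis_sum_sum is_Ramis_sum_mult is_Ramis_sum_poly is_Ramis_sum_mon f_sum) blast
  hence "is_Ramis_sum 0 \<theta> F" by (simp only: rel)
  moreover have "is_Ramis_sum 0 \<theta> (\<lambda>_. 0)" using is_Ramis_sum_const[of 0] by simp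
  moreover have "Arg (\<xi> * cis (- \<theta>)) = Arg \<xi> - \<theta>"
    using Arg_mult_cis[OF xi(2), of 1 \<theta>] by (simp add: Arg_direction[simplified])
  hence "\<bar>Arg (\<xi> * cis (- \<theta>))\<bar> < pi / 2" using theta by linarith
  ultimately have "F (1 / \<xi>) = 0" using is_Ramis_sum_unique[of 0 \<theta> F "\<lambda>_. 0" \<xi>] xi(2) by simp
  thus ?thesis by (simp add: F_def val_def[abs_def])
qed

text \<open>The place where H is used. The combination h of monomials, in the variable rescaled by
  1/\<xi>, has 1-sum 0 at 1 in the direction \<theta> - Arg \<xi>; the differential equation
  inherited from the monomial system brings it into the scope of H.\<close>

lemma relation_lifts_to_functions:
  assumes D: "finite D" and l: "\<And>m. m \<in> degree_class I D \<Longrightarrow> l m \<in> Qbar"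
    and rel: "(\<Sum>m\<in>degree_class I D. l m * mon val m) = 0"
  shows "\<exists>b. (\<forall>m\<in>degree_class I D. b m \<in> QP \<and> poly (b m) (1 / \<xi>) = l m) \<and>
    (lincomb (degree_class I D) b (mon f)) = 0"
proof -
  define M where "M = degree_class I D"
  have M: "finite M" "\<And>m. m \<in> M \<Longrightarrow> keys m \<subseteq> I"
    using finite_degree_class[OF I D] by (auto simp: M_def degree_class_def)
  define c where "c = 1 / \<xi>"
  have c: "c \<in> Qbar" "c \<noteq> 0" using xi by (auto simp: c_def)
  define s where "s = fps_const c * fps_X"
  have s: "fps_nth s 0 = 0" "fps_deriv s = fps_const c" "fps_of_poly [:0, c:] = s"
    by (simp_all add: s_def fps_of_poly_pCons)
  define g where "g i = fps_compose (f i) s" for i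
  have g_nth: "g i = Abs_fps (\<lambda>n. c ^ n * fps_nth (f i) n)" for i
    unfolding g_def s_def by (rule fps_compose_linear)
  have g_tame: "tame (g i)" if "i \<in> I" for i unfolding g_nth by (intro tame_rescale tame_f that c)
  define T' where "T' = pcompose T [:0, c:]"
  \<comment> \<open>The factor c is the inner derivative of f_i(c z).\<close>
  define G' where "G' i j = [:c:] * pcompose (G i j) [:0, c:]" for i j
  have T': "T' \<in> QP" "poly T' 1 \<noteq> 0" using T c by (auto simp: T'_def poly_pcompose c_def intro!: QP_pcompose QP_linear)
  have G': "G' i j \<in> QP" if "i \<in> I" "j \<in> I" for i j
    unfolding G'_def using G[OF that] c by (intro QP_mult QP_pcompose QP_linear) auto
  have sys': "fps_of_poly T' * fps_deriv (g i) = (lincomb I (G' i) g)" if i: "i \<in> I" for i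
  proof -
    have "fps_of_poly T' * fps_deriv (g i) = fps_const c * fps_compose (fps_of_poly T * fps_deriv (f i)) s"
      unfolding g_def T'_def
      by (simp add: fps_compose_deriv[OF s(1)] s fps_of_poly_pcompose fps_compose_mult_distrib mult_ac)
    also have "\<dots> = (\<Sum>j\<in>I. fps_const c * fps_compose (fps_of_poly (G i j)) s * g j)"
      unfolding sys[OF i] g_def
      by (simp add: fps_compose_sum_distrib fps_compose_mult_distrib[OF s(1)] sum_distrib_left mult.assoc)
    also have "\<dots> = (lincomb I (G' i) g)"
      unfolding G'_def fps_of_poly_mult fps_of_poly_const by (simp add: fps_of_poly_pcompose s)
    finally show ?thesis .
  qed
  obtain GM where GM: "\<And>m m'. GM m m' \<in> QP"
    "\<And>m. m \<in> M \<Longrightarrow> fps_of_poly T' * fps_deriv (mon g m) = (lincomb M (GM m) (mon g))"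
    using monomial_system[OF I G' D sys'] unfolding M_def by blast
  define h where "h = (\<Sum>m\<in>M. fps_const (l m) * mon g m)"
  have l': "l m \<in> Qbar" if "m \<in> M" for m using l that by (simp add: M_def)
  define \<phi> where "\<phi> = \<theta> - Arg \<xi>"
  define F where "F z = (\<Sum>m\<in>M. l m * mon (\<lambda>i. Ramis_sum (f i) \<theta> (z / \<xi>)) m)" for z
  have "is_Ramis_sum (g i) \<phi> (\<lambda>z. Ramis_sum (f i) \<theta> (z / \<xi>))" if "i \<in> I" for i
    using is_Ramis_sum_rescale[OF f_sum[OF that] xi(2)] by (simp add: g_nth \<phi>_def c_def power_one_over)
  hence hF: "is_Ramis_sum h \<phi> F"
    unfolding h_def F_def using M(2) by (intro is_Ramis_sum_sum is_Ramis_sum_mult is_Ramis_sum_const is_Ramis_sum_mon) blast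
  have \<phi>: "- pi / 2 < \<phi>" "\<phi> < pi / 2" using theta by (auto simp: \<phi>_def)
  have "\<bar>Arg (1 * cis (- \<phi>))\<bar> < pi / 2" unfolding \<phi>_def mult_1 Arg_direction using theta by linarith
  hence "Ramis_sum h \<phi> (1 / 1) = F (1 / 1)" by (rule Ramis_sum_eq[OF hF one_neq_zero])
  moreover have "F 1 = 0" using rel by (simp add: F_def M_def val_def[abs_def])
  ultimately have h0: "Ramis_sum h \<phi> 1 = 0" by simp
  have ht: "tame h" unfolding h_def using M(2) l' g_tame by (intro tame_sum tame_mult tame_const tame_mon) auto
  have "T' \<noteq> 0" using T' by auto
  hence "holonomic h"
    unfolding h_def using M(1) l' T' GM by (intro holonomic_combination[of M l T' GM]) auto
  hence "Eh_function h" by (intro Eh_functionI ht)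
  moreover have "\<not> anti_Stokes h \<phi>" using hF unfolding anti_Stokes_def by blast
  ultimately have "Eh_function (h / (fps_X - 1))" using H \<phi> h0 by blast
  hence y: "tame (h / (fps_X - 1))" by (simp add: Eh_function_iff)
  \<comment> \<open>X - 1 is a unit among power series, so this divisibility has no content; the
    content of H lies in the arithmetic of the quotient.\<close>
  have "(fps_X - 1 :: complex fps) dvd h" by (rule unit_imp_dvd) (simp add: fps_is_unit_iff)
  hence hy: "(fps_X - 1) * (h / (fps_X - 1)) = (\<Sum>m\<in>M. fps_const (l m) * mon g m)" by (simp add: h_def)
  have mt: "tame (mon g m)" if "m \<in> M" for m using M(2)[OF that] g_tame by (intro tame_mon) blast
  have "\<exists>b. (\<forall>m\<in>M. b m \<in> QP \<and> poly (b m) 1 = l m) \<and> (lincomb M b (mon g)) = 0"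
    by (rule relation_liftsD[where u = "mon g" and G = GM, OF linear_relation_lifts[OF M(1)] _ y l' hy T'])
      (use GM mt in simp_all)
  then obtain b where b: "\<And>m. m \<in> M \<Longrightarrow> b m \<in> QP \<and> poly (b m) 1 = l m" "(lincomb M b (mon g)) = 0" by blast
  define s' where "s' = fps_const \<xi> * fps_X"
  have s': "fps_nth s' 0 = 0" "fps_of_poly [:0, \<xi>:] = s'" by (simp_all add: s'_def fps_of_poly_pCons)
  have gf: "fps_compose (g i) s' = f i" for i
    unfolding s'_def fps_compose_linear g_nth using xi(2)
    by (intro fps_ext) (simp add: c_def power_one_over)
  define b' where "b' m = pcompose (b m) [:0, \<xi>:]" for m
  have "(lincomb M b' (mon f)) = fps_compose (lincomb M b (mon g)) s'"
    by (simp add: fps_compose_sum_distrib fps_compose_mult_distrib[OF s'(1)] mon_compose[OF s'(1)] gf b'_def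
        fps_of_poly_pcompose s')
  also have "\<dots> = 0" by (simp add: b(2))
  finally have "(lincomb M b' (mon f)) = 0" .
  moreover have "b' m \<in> QP \<and> poly (b' m) (1 / \<xi>) = l m" if "m \<in> M" for m
    using b(1)[OF that] xi by (auto simp: b'_def poly_pcompose intro!: QP_pcompose QP_linear)
  ultimately show ?thesis unfolding M_def by blast
qed

end

section \<open>Comparison of the transcendence degrees\<close>

lemma subfield_Qbar: "subfield_of_type Qbar"
  unfolding subfield_of_type_def by auto

lemma Qbar_ratfunsI: "p \<in> QP \<Longrightarrow> q \<in> QP \<Longrightarrow> q \<noteq> 0 \<Longrightarrow> fls_of_poly p / fls_of_poly q \<in> Qbar_ratfuns"
  unfolding Qbar_ratfuns_def by blast

lemma fls_of_poly_Qbar_ratfuns: "p \<in> QP \<Longrightarrow> fls_of_poly p \<in> Qbar_ratfuns"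
  using Qbar_ratfunsI[of p 1] by simp

lemma subfield_Qbar_ratfuns: "subfield_of_type Qbar_ratfuns"
  unfolding subfield_of_type_def
proof (intro conjI ballI)
  show "0 \<in> Qbar_ratfuns" "1 \<in> Qbar_ratfuns"
    using fls_of_poly_Qbar_ratfuns[of 0] fls_of_poly_Qbar_ratfuns[of 1] by simp_all
  fix x y assume "x \<in> Qbar_ratfuns" "y \<in> Qbar_ratfuns"
  then obtain p q p' q' where x: "x = fls_of_poly p / fls_of_poly q" "p \<in> QP" "q \<in> QP" "q \<noteq> 0"
    and y: "y = fls_of_poly p' / fls_of_poly q'" "p' \<in> QP" "q' \<in> QP" "q' \<noteq> 0"
    unfolding Qbar_ratfuns_def by blast
  have nz: "fls_of_poly q \<noteq> 0" "fls_of_poly q' \<noteq> 0" using x(4) y(4) by (simp_all add: fls_of_poly_eq_0_iff)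
  have d: "fls_of_poly (a - b) = fls_of_poly a - fls_of_poly b" for a b by (simp add: fps_of_poly_diff)
  have "x - y = fls_of_poly (p * q' - p' * q) / fls_of_poly (q * q')"
    unfolding x(1) y(1) d fls_of_poly_mult by (rule diff_frac_eq[OF nz])
  thus "x - y \<in> Qbar_ratfuns" using x y by (auto intro!: Qbar_ratfunsI QP_diff QP_mult)
  have "x * y = fls_of_poly (p * p') / fls_of_poly (q * q')"
    unfolding x(1) y(1) fls_of_poly_mult by (rule times_divide_times_eq)
  thus "x * y \<in> Qbar_ratfuns" using x y by (auto intro!: Qbar_ratfunsI QP_mult)
next
  fix x assume x: "x \<in> Qbar_ratfuns"
  then obtain p q where p: "x = fls_of_poly p / fls_of_poly q" "p \<in> QP" "q \<in> QP" "q \<noteq> 0"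
    unfolding Qbar_ratfuns_def by blast
  show "inverse x \<in> Qbar_ratfuns"
  proof (cases "p = 0")
    case True
    thus ?thesis using x p(1) by simp
  next
    case False
    have "inverse x = fls_of_poly q / fls_of_poly p" unfolding p(1) by (rule inverse_divide)
    thus ?thesis using p False by (auto intro!: Qbar_ratfunsI)
  qed
qed

lemma fps_to_fls_mon: "fps_to_fls (mon f m) = mon (\<lambda>i. fps_to_fls (f i)) m"
  for f :: "'v \<Rightarrow> complex fps" and m :: "'v \<Rightarrow>\<^sub>0 nat"
proof -
  have "fps_to_fls (g ^ k) = fps_to_fls g ^ k" for g :: "complex fps" and k
    by (induction k) (simp_all add: fls_times_fps_to_fls)
  moreover have "fps_to_fls (\<Prod>v\<in>A. h v) = (\<Prod>v\<in>A. fps_to_fls (h v))" for A and h :: "'v \<Rightarrow> complex fps"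
    by (induction A rule: infinite_finite_induct) (simp_all add: fls_times_fps_to_fls)
  ultimately show ?thesis by (simp add: mon_def)
qed

lemma ratfun_relation_imp_poly_relation:
  fixes f :: "'v \<Rightarrow> complex fps"
  assumes N: "finite N" and w: "\<And>m. m \<in> N \<Longrightarrow> w m \<in> Qbar_ratfuns" "\<exists>m\<in>N. w m \<noteq> 0"
    and rel: "(\<Sum>m\<in>N. w m * mon (\<lambda>i. fps_to_fls (f i)) m) = 0"
  shows "\<exists>b. (\<forall>m\<in>N. b m \<in> QP) \<and> (\<exists>m\<in>N. b m \<noteq> 0) \<and> (lincomb N b (mon f)) = 0"
proof -
  define R where "R m x \<longleftrightarrow> fst x \<in> QP \<and> snd x \<in> QP \<and> snd x \<noteq> 0 \<and> w m = fls_of_poly (fst x) / fls_of_poly (snd x)"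
    for m and x :: "complex poly \<times> complex poly"
  define p where "p m = fst (SOME x. R m x)" for m
  define q where "q m = snd (SOME x. R m x)" for m
  have pq: "p m \<in> QP \<and> q m \<in> QP \<and> q m \<noteq> 0 \<and> w m = fls_of_poly (p m) / fls_of_poly (q m)" if m: "m \<in> N" for m
  proof -
    have "\<exists>x. R m x" using w(1)[OF m] unfolding Qbar_ratfuns_def by (force simp: R_def)
    hence "R m (SOME x. R m x)" by (rule someI_ex)
    thus ?thesis by (simp add: R_def p_def q_def)
  qed
  define T where "T = (\<Prod>m\<in>N. q m)"
  define b where "b m = p m * (\<Prod>m'\<in>N - {m}. q m')" for m
  have T: "fls_of_poly T \<noteq> 0" using pq N by (simp add: T_def fls_of_poly_eq_0_iff)
  have bw: "fls_of_poly (b m) = fls_of_poly T * w m" if m: "m \<in> N" for m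
  proof -
    have "T = q m * (\<Prod>m'\<in>N - {m}. q m')" unfolding T_def by (rule prod.remove[OF N m])
    hence "fls_of_poly T * w m = (fls_of_poly (q m) * w m) * fls_of_poly (\<Prod>m'\<in>N - {m}. q m')"
      by (simp only: fls_of_poly_mult mult_ac)
    also have "fls_of_poly (q m) * w m = fls_of_poly (p m)" using pq[OF m] by (simp add: fls_of_poly_eq_0_iff)
    finally show ?thesis by (simp only: b_def fls_of_poly_mult)
  qed
  have "fps_to_fls (lincomb N b (mon f)) = (\<Sum>m\<in>N. fls_of_poly (b m) * mon (\<lambda>i. fps_to_fls (f i)) m)"
    by (simp only: fps_to_fls_sum fls_times_fps_to_fls fps_to_fls_mon)
  also have "\<dots> = fls_of_poly T * (\<Sum>m\<in>N. w m * mon (\<lambda>i. fps_to_fls (f i)) m)"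
    unfolding sum_distrib_left by (intro sum.cong refl) (simp only: bw mult.assoc)
  finally have "(lincomb N b (mon f)) = 0" by (simp add: rel)
  moreover have "\<exists>m\<in>N. b m \<noteq> 0" using w(2) bw T by (metis fls_of_poly_eq_0_iff mult_eq_0_iff)
  moreover have "b m \<in> QP" if "m \<in> N" for m unfolding b_def using pq that by (intro QP_mult QP_prod) auto
  ultimately show ?thesis by blast
qed

context regular_values
begin

abbreviation fl :: "'v \<Rightarrow> complex fls" where "fl i \<equiv> fps_to_fls (f i)"

text \<open>A relation between the functions, divided by its power of z - 1/\<xi>, specialises to a
  non-trivial relation between the values.\<close>

lemma independence_of_values_transfers:
  assumes N: "N \<subseteq> Monos I d" and ind: "mon_indep Qbar val N"
  shows "mon_indep Qbar_ratfuns fl N"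
proof (rule ccontr)
  assume "\<not> ?thesis"
  then obtain w where w: "\<And>m. m \<in> N \<Longrightarrow> w m \<in> Qbar_ratfuns" "\<exists>m\<in>N. w m \<noteq> 0" "(\<Sum>m\<in>N. w m * mon fl m) = 0"
    unfolding mon_indep_def by blast
  have fN: "finite N" using N finite_Monos[OF I] finite_subset by blast
  obtain b where b: "\<And>m. m \<in> N \<Longrightarrow> b m \<in> QP" "\<exists>m\<in>N. b m \<noteq> 0" "(lincomb N b (mon f)) = 0"
    using ratfun_relation_imp_poly_relation[OF fN w] by blast
  have c: "1 / \<xi> \<in> Qbar" "1 / \<xi> \<noteq> 0" using xi by auto
  obtain t b' where b': "\<And>m. m \<in> N \<Longrightarrow> b m = [:-(1 / \<xi>), 1:] ^ t * b' m" "\<And>m. m \<in> N \<Longrightarrow> b' m \<in> QP"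
    "\<exists>m\<in>N. poly (b' m) (1 / \<xi>) \<noteq> 0"
    using strip_linear_factor[OF fN b(2,1) c] by blast
  have "(lincomb N b (mon f)) = fps_of_poly ([:-(1 / \<xi>), 1:] ^ t) * (lincomb N b' (mon f))"
    unfolding sum_distrib_left by (intro sum.cong refl) (simp only: b'(1) fps_of_poly_mult mult.assoc)
  moreover have "fps_of_poly ([:-(1 / \<xi>), 1:] ^ t) \<noteq> 0" using fps_of_poly_eq_iff[of "[:-(1 / \<xi>), 1:] ^ t" 0] by simp
  ultimately have "(lincomb N b' (mon f)) = 0" using b(3) by simp
  hence "(\<Sum>m\<in>N. poly (b' m) (1 / \<xi>) * mon val m) = 0"
    using N by (intro specialise fN) (auto simp: Monos_def)
  hence "poly (b' m) (1 / \<xi>) = 0" if "m \<in> N" for m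
    using that by (intro mon_indepD[OF ind, of "\<lambda>m. poly (b' m) (1 / \<xi>)"]) (rule QP_poly[OF b'(2) c(1)])
  thus False using b'(3) by blast
qed

text \<open>Combining the lifted relations so as to leave only monomials in \<open>N\<close> is possible when \<open>N\<close> has more elements than a basis of the values.\<close>

lemma independence_of_functions_transfers:
  assumes N: "N \<subseteq> Monos I d" and ind: "mon_indep Qbar_ratfuns fl N"
  shows "\<exists>N'\<subseteq>Monos I d. mon_indep Qbar val N' \<and> card N \<le> card N'"
proof -
  define M where "M = Monos I d"
  have M: "finite M" "\<And>m. m \<in> M \<Longrightarrow> keys m \<subseteq> I" "M = degree_class I {..d}"
    unfolding M_def using finite_Monos[OF I] by (simp_all only: Monos_degree_class) (simp add: degree_class_def)
  obtain N' where N': "N' \<subseteq> M" "mon_indep Qbar val N'" "mon val ` M \<subseteq> kspan Qbar (mon val ` N')"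
    using maximal_mon_indep[OF subfield_Qbar M(1)] by blast
  have fN': "finite N'" using N'(1) M(1) finite_subset by blast
  have "card N \<le> card N'"
  proof (rule ccontr)
    assume "\<not> ?thesis"
    moreover have "card (M - N) = card M - card N" "card (M - N') = card M - card N'"
      using N N'(1) M(1) by (auto simp: M_def[symmetric] intro!: card_Diff_subset intro: finite_subset)
    moreover have "card N \<le> card M" unfolding M_def using N M(1) by (intro card_mono) (auto simp: M_def)
    ultimately have card: "card (M - N) < card (M - N')" by linarith
    \<comment> \<open>For each m outside \<open>N'\<close>, the expression of its value through
      \<open>N'\<close> is a relation that lifts. On the columns outside \<open>N'\<close>, the
      matrix of the lifted relations is the identity at 1/\<xi>.\<close>
    have "\<forall>m. \<exists>b. m \<in> M - N' \<longrightarrow> (\<forall>m'\<in>M. b m' \<in> QP) \<and> (\<forall>m'\<in>M - N'. poly (b m') (1 / \<xi>) = (if m' = m then 1 else 0)) \<and>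
       (lincomb M b (mon f)) = 0"
    proof (intro allI)
      fix m show "\<exists>b. m \<in> M - N' \<longrightarrow> (\<forall>m'\<in>M. b m' \<in> QP) \<and> (\<forall>m'\<in>M - N'. poly (b m') (1 / \<xi>) = (if m' = m then 1 else 0)) \<and>
       (lincomb M b (mon f)) = 0"
      proof (cases "m \<in> M - N'")
        case True
        hence "mon val m \<in> kspan Qbar (mon val ` N')" using N'(3) by blast
        then obtain w where w: "\<And>m. w m \<in> Qbar" "mon val m = (\<Sum>m'\<in>N'. w m' * mon val m')"
          using kspan_coefficients[OF subfield_Qbar fN'] by blast
        define l where "l m' = (if m' \<in> N' then - w m' else if m' = m then 1 else 0)" for m'
        have "(\<Sum>m'\<in>M. l m' * mon val m') = (\<Sum>m'\<in>insert m N'. l m' * mon val m')"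
          using M(1) N'(1) True by (intro sum.mono_neutral_right) (auto simp: l_def)
        also have "\<dots> = l m * mon val m + (\<Sum>m'\<in>N'. l m' * mon val m')" using True fN' by simp
        also have "\<dots> = mon val m - (\<Sum>m'\<in>N'. w m' * mon val m')" using True by (simp add: l_def sum_negf)
        also have "\<dots> = 0" by (simp add: w(2))
        finally have "\<exists>b. (\<forall>m\<in>M. b m \<in> QP \<and> poly (b m) (1 / \<xi>) = l m) \<and> (lincomb M b (mon f)) = 0"
          unfolding M(3) using w(1) by (intro relation_lifts_to_functions) (auto simp: l_def)
        then obtain b where b: "\<forall>m\<in>M. b m \<in> QP \<and> poly (b m) (1 / \<xi>) = l m" "(lincomb M b (mon f)) = 0" by blast
        show ?thesis using b by (intro exI[of _ b]) (simp add: l_def)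
      qed blast
    qed
    from choice[OF this] obtain b where b': "\<forall>m. m \<in> M - N' \<longrightarrow> (\<forall>m'\<in>M. b m m' \<in> QP) \<and>
      (\<forall>m'\<in>M - N'. poly (b m m') (1 / \<xi>) = (if m' = m then 1 else 0)) \<and> (lincomb M (b m) (mon f)) = 0"
      by (elim exE)
    have b: "m' \<in> M \<Longrightarrow> b m m' \<in> QP"
      "m' \<in> M - N' \<Longrightarrow> poly (b m m') (1 / \<xi>) = (if m' = m then 1 else 0)"
      "(lincomb M (b m) (mon f)) = 0" if "m \<in> M - N'" for m m'
      using b'[THEN spec[of _ m], THEN mp, OF that] by simp_all
    \<comment> \<open>There are more lifted relations than monomials outside \<open>N\<close>, so a
      non-trivial combination of them involves only monomials in \<open>N\<close>; by the
      independence of \<open>N\<close> all its coefficients vanish.\<close>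
    have "\<exists>x. (\<forall>u. x u \<in> QP) \<and> (\<exists>u\<in>M - N'. x u \<noteq> 0) \<and> (\<forall>r\<in>M - N. (\<Sum>u\<in>M - N'. b u r * x u) = 0)"
      by (rule homogeneous_system_solution) (use M(1) card b(1) in \<open>auto intro: QP_diff QP_mult\<close>)
    then obtain x where x: "\<And>u. x u \<in> QP" "\<exists>u\<in>M - N'. x u \<noteq> 0"
      "\<And>r. r \<in> M - N \<Longrightarrow> (\<Sum>u\<in>M - N'. b u r * x u) = 0" by blast
    define y where "y r = (\<Sum>u\<in>M - N'. b u r * x u)" for r
    have yQ: "y r \<in> QP" if "r \<in> M" for r unfolding y_def using b(1) x(1) that by (intro QP_sum QP_mult) auto
    have "(lincomb M y (mon f)) = (\<Sum>r\<in>M. \<Sum>u\<in>M - N'. fps_of_poly (x u) * (fps_of_poly (b u r) * mon f r))"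
      unfolding y_def fps_of_poly_sum sum_distrib_right by (intro sum.cong refl) (simp add: fps_of_poly_mult mult_ac)
    also have "\<dots> = (\<Sum>u\<in>M - N'. fps_of_poly (x u) * (lincomb M (b u) (mon f)))"
      by (subst sum.swap) (simp add: sum_distrib_left)
    also have "\<dots> = 0" by (simp add: b(3))
    finally have "(lincomb M y (mon f)) = 0" .
    moreover have "(lincomb M y (mon f)) = (lincomb N y (mon f))"
      using M(1) N x(3) by (intro sum.mono_neutral_right) (auto simp: M_def y_def)
    ultimately have "fps_to_fls (lincomb N y (mon f)) = 0" by simp
    hence "(\<Sum>r\<in>N. fls_of_poly (y r) * mon fl r) = 0"
      by (simp only: fps_to_fls_sum fls_times_fps_to_fls fps_to_fls_mon)
    hence "y r = 0" if "r \<in> N" for r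
      using mon_indepD[OF ind, of "\<lambda>r. fls_of_poly (y r)" r] yQ N that fls_of_poly_Qbar_ratfuns
      by (auto simp: fls_of_poly_eq_0_iff M_def)
    hence y0: "y r = 0" if "r \<in> M" for r using x(3)[of r] that by (cases "r \<in> N") (auto simp: y_def)
    have c: "1 / \<xi> \<in> Qbar" "1 / \<xi> \<noteq> 0" using xi by auto
    have fM: "finite (M - N')" using M(1) by simp
    obtain t x' where x': "\<And>u. u \<in> M - N' \<Longrightarrow> x u = [:-(1 / \<xi>), 1:] ^ t * x' u" "\<exists>u\<in>M - N'. poly (x' u) (1 / \<xi>) \<noteq> 0"
      using strip_linear_factor[OF fM x(2,1) c] by blast
    \<comment> \<open>As the matrix is the identity at 1/\<xi>, a combination that is zero in every
      column has multipliers vanishing there, although they were freed of common factors z -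
      1/\<xi>.\<close>
    have "poly (x' r) (1 / \<xi>) = 0" if r: "r \<in> M - N'" for r
    proof -
      have "[:-(1 / \<xi>), 1:] ^ t * (\<Sum>u\<in>M - N'. b u r * x' u) = y r"
        unfolding y_def sum_distrib_left by (intro sum.cong refl) (simp only: x'(1) mult_ac)
      moreover have "[:-(1 / \<xi>), 1:] ^ t \<noteq> 0" by simp
      ultimately have "(\<Sum>u\<in>M - N'. b u r * x' u) = 0" using y0[of r] r by (metis DiffD1 mult_eq_0_iff)
      hence "poly (\<Sum>u\<in>M - N'. b u r * x' u) (1 / \<xi>) = 0" by simp
      hence "(\<Sum>u\<in>M - N'. poly (b u r) (1 / \<xi>) * poly (x' u) (1 / \<xi>)) = 0" by (simp add: poly_sum)
      moreover have "(\<Sum>u\<in>M - N'. poly (b u r) (1 / \<xi>) * poly (x' u) (1 / \<xi>)) =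
        (\<Sum>u\<in>M - N'. if u = r then poly (x' u) (1 / \<xi>) else 0)"
        using b(2) r by (intro sum.cong) auto
      ultimately show ?thesis using fM r by (simp add: sum.delta)
    qed
    thus False using x'(2) by blast
  qed
  thus ?thesis using N'(1,2) by (auto simp: M_def)
qed

lemma trdeg_values: "trdeg Qbar (val ` I) = trdeg Qbar_ratfuns (fl ` I)"
proof (rule antisym)
  show "trdeg Qbar (val ` I) \<le> trdeg Qbar_ratfuns (fl ` I)"
    using independence_of_values_transfers by (intro trdeg_le subfield_Qbar subfield_Qbar_ratfuns I) blast
  show "trdeg Qbar_ratfuns (fl ` I) \<le> trdeg Qbar (val ` I)"
    by (intro trdeg_le subfield_Qbar subfield_Qbar_ratfuns I independence_of_functions_transfers)
qed

lemma homogeneous_relation_lifts: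
  fixes P :: "('v, complex) mpoly"
  assumes P: "P \<in> mpolys Qbar I" "homogeneous P" "mpoly_eval id val P = 0"
  shows "\<exists>Q. Q \<in> mpolys QP I \<and> homogeneous Q \<and> mpoly_eval fps_of_poly f Q = 0 \<and>
    P = Poly_Mapping.map (\<lambda>c. poly c (1 / \<xi>)) Q"
proof -
  obtain d where d: "\<And>m. m \<in> keys P \<Longrightarrow> mdeg m = d"
    using P(2) unfolding homogeneous_def mdeg_def by blast
  define M where "M = degree_class I {d}"
  have fM: "finite M" unfolding M_def by (intro finite_degree_class I) simp
  have kP: "Poly_Mapping.keys P \<subseteq> M" using P(1) d by (auto simp: M_def degree_class_def mpolys_def)
  have "(\<Sum>m\<in>M. lookup P m * mon val m) = (\<Sum>m\<in>keys P. lookup P m * mon val m)"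
    using fM kP by (intro sum.mono_neutral_right) (auto simp: in_keys_iff)
  also have "\<dots> = 0" using P(3) by (simp add: mpoly_eval_def mon_def)
  finally have "\<exists>b. (\<forall>m\<in>M. b m \<in> QP \<and> poly (b m) (1 / \<xi>) = lookup P m) \<and> (lincomb M b (mon f)) = 0"
    unfolding M_def using P(1) by (intro relation_lifts_to_functions) (auto simp: mpolys_def)
  then obtain b where b: "\<And>m. m \<in> M \<Longrightarrow> b m \<in> QP" "\<And>m. m \<in> M \<Longrightarrow> poly (b m) (1 / \<xi>) = lookup P m"
    "(lincomb M b (mon f)) = 0" by blast
  define Q where "Q = Abs_poly_mapping (\<lambda>m. if m \<in> M then b m else 0)"
  have "finite {m. (if m \<in> M then b m else 0) \<noteq> 0}" using fM by (rule rev_finite_subset) auto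
  hence lQ: "Poly_Mapping.lookup Q m = (if m \<in> M then b m else 0)" for m by (simp add: Q_def)
  have kQ: "Poly_Mapping.keys Q \<subseteq> M" by (auto simp: lQ in_keys_iff split: if_splits)
  have "Q \<in> mpolys QP I" using b(1) kQ by (auto simp: mpolys_def lQ M_def degree_class_def)
  moreover have "homogeneous Q"
    unfolding homogeneous_def mdeg_def[symmetric] using kQ by (intro exI[of _ d]) (auto simp: M_def degree_class_def)
  moreover have "mpoly_eval fps_of_poly f Q = 0"
  proof -
    have "(\<Sum>m\<in>keys Q. fps_of_poly (lookup Q m) * mon f m) = (\<Sum>m\<in>M. fps_of_poly (lookup Q m) * mon f m)"
      using fM kQ by (intro sum.mono_neutral_left) (auto simp: in_keys_iff)
    thus ?thesis using b(3) by (simp add: mpoly_eval_def mon_def lQ)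
  qed
  moreover have "P = Poly_Mapping.map (\<lambda>c. poly c (1 / \<xi>)) Q"
  proof (rule poly_mapping_eqI)
    fix m
    show "Poly_Mapping.lookup P m = lookup (Poly_Mapping.map (\<lambda>c. poly c (1 / \<xi>)) Q) m"
    proof (cases "m \<in> M")
      case True
      thus ?thesis using b(2)[OF True] by (auto simp: Poly_Mapping.map.rep_eq lQ when_def)
    next
      case False
      hence "Poly_Mapping.lookup P m = 0" using kP by (auto simp: in_keys_iff)
      thus ?thesis using False by (simp add: Poly_Mapping.map.rep_eq lQ when_def)
    qed
  qed
  ultimately show ?thesis by blast
qed

end

theorem theorem3:
  fixes n :: nat
    and f :: "nat \<Rightarrow> complex fps"
    and A :: "nat \<Rightarrow> nat \<Rightarrow> complex fls"
    and \<xi> :: complex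
    and \<theta> :: real
  assumes H: "\<And>(h :: complex fps) (\<phi> :: real).
      \<lbrakk>Eh_function h; - pi / 2 < \<phi>; \<phi> < pi / 2; \<not> anti_Stokes h \<phi>; Ramis_sum h \<phi> 1 = 0\<rbrakk>
        \<Longrightarrow> Eh_function (h / (fps_X - 1))"
    and f_Eh: "\<And>i. i < n \<Longrightarrow> Eh_function (f i)"
    and A_rat: "\<And>i j. \<lbrakk>i < n; j < n\<rbrakk> \<Longrightarrow> A i j \<in> Qbar_ratfuns"
    and system: "\<And>i. i < n \<Longrightarrow>
      fps_to_fls (fps_deriv (f i)) = (\<Sum>j<n. A i j * fps_to_fls (f j))"
    and xi: "\<xi> \<in> Qbar" "\<xi> \<noteq> 0"
    and theta: "Arg \<xi> - pi / 2 < \<theta>" "\<theta> < Arg \<xi> + pi / 2"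
    and no_pole: "\<And>i j. \<lbrakk>i < n; j < n\<rbrakk> \<Longrightarrow> \<not> ratfun_pole (A i j) (1 / \<xi>)"
    and not_anti_Stokes: "\<And>i. i < n \<Longrightarrow> \<not> anti_Stokes (f i) \<theta>"
  shows "(\<forall>P :: (nat, complex) mpoly.
            P \<in> mpolys Qbar {..<n} \<and> homogeneous P \<and>
            mpoly_eval id (\<lambda>i. Ramis_sum (f i) \<theta> (1 / \<xi>)) P = 0 \<longrightarrow>
            (\<exists>Q :: (nat, complex poly) mpoly.
               Q \<in> mpolys (polys_over Qbar) {..<n} \<and> homogeneous Q \<and>
               mpoly_eval fps_of_poly f Q = 0 \<and>
               P = Poly_Mapping.map (\<lambda>c. poly c (1 / \<xi>)) Q))
       \<and> trdeg Qbar ((\<lambda>i. Ramis_sum (f i) \<theta> (1 / \<xi>)) ` {..<n})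
           = trdeg Qbar_ratfuns ((\<lambda>i. fps_to_fls (f i)) ` {..<n})"
proof -
  have c: "1 / \<xi> \<in> Qbar" "1 / \<xi> \<noteq> 0" using xi by auto
  obtain T G where TG: "T \<in> QP" "poly T (1 / \<xi>) \<noteq> 0" "\<forall>i<n. \<forall>j<n. G i j \<in> QP"
    "\<forall>i<n. fps_of_poly T * fps_deriv (f i) = (\<Sum>j<n. fps_of_poly (G i j) * f j)"
    using polynomial_system[OF A_rat no_pole c system] by blast
  interpret regular_values "{..<n}" f T G \<xi> \<theta>
  proof
    show "Eh_function (h / (fps_X - 1))" if "Eh_function h" "- pi / 2 < \<phi>" "\<phi> < pi / 2" "\<not> anti_Stokes h \<phi>"
      "Ramis_sum h \<phi> 1 = 0" for h \<phi> using that by (rule H)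
    show "tame (f i)" if "i \<in> {..<n}" for i using f_Eh that by (simp add: Eh_function_iff)
    show "\<not> anti_Stokes (f i) \<theta>" if "i \<in> {..<n}" for i using not_anti_Stokes that by simp
  qed (use TG xi theta in auto)
  show ?thesis
    using homogeneous_relation_lifts trdeg_values unfolding val_def[abs_def] by blast
qed

end
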